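(* Let $\mathbf{k}$ be an algebraically closed field, $\Lambda=\mathbf{k}Q/I$ a gentle algebra, $(c,\lambda)$ a band with $\lambda\in\mathbf{k}^*$ and $w$ a string. Suppose that ${}^\infty c^\infty$ and $w$ admit decompositions $${}^\infty c^\infty={}^\infty c\, c_L\bar B m A c_R\, c^\infty\quad\text{and}\quad w=w_LDm\bar Cw_R,$$ where $A,B,C,D\in Q_1$ ($C$, $D$ possibly absent) with $A\neq\emptyset\neq B$, and $c_L,c_R,m,w_L,w_R$ are (possibly trivial) strings satisfying the overlap conditions (i)--(iii) of the context. (a) If, after suitable rotation of $c$, $m$ is a proper subword of $c$, then there is a non-split overlap extension $$0\to M(w)\to M(u)\to B(c,\lambda)\to0,$$ where $u=w_LDmAc_Rc_L\bar Bm\bar Cw_R$ is a string. (b) If $c$ is a subword of $m$, then after suitable rotation of $c$ there is a decomposition $c=c_2c_1$ such that $m=c^\ell c_2$ for some $\ell\ge1$, and there is a non-split overlap extension $$0\to M(w)\to M(u)\to B(c,\lambda)\to0,$$ where $u=w_LDc^{\ell+1}c_2\bar Cw_R$ is a string. Moreover, the collection of such extensions forms a basis of $\operatorname{Ext}^1_\Lambda(B(c,\lambda),M(w))$.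
   Context: Gentle algebra: $\Lambda=\mathbf{k}Q/I$ is finite-dimensional, $Q$ a finite quiver, $I$ an admissible ideal, such that (1) at each vertex at most two arrows start and at most two arrows end; (2) for each arrow $a$ there is at most one arrow $b$ with $e(a)=s(b)$ and $ba\notin I$, and at most one arrow $c$ with $e(c)=s(a)$ and $ac\notin I$; (3) for each arrow $a$ there is at most one arrow $b$ with $e(a)=s(b)$ and $ba\in I$, and at most one arrow $c$ with $e(c)=s(a)$ and $ac\in I$; (4) $I$ is generated by paths of length two. Modules are finitely generated left modules and paths are read from right to left; $s,e$ denote start and end. Strings and bands: each arrow $a$ has a formal inverse $\bar a$ with $s(\bar a)=e(a)$, $e(\bar a)=s(a)$. A walk is a sequence $w=w_l\cdots w_1$ of letters (arrows, called direct, or inverse arrows) with $s(w_{i+1})=e(w_i)$ and no subsequence $a\bar a$ or $\bar aa$; its inverse is $\bar w=\bar w_1\cdots\bar w_l$. A string is a walk with no subwalk $u$ with $u\in I$ or $\bar u\in I$, or a trivial string $1_x$ for a vertex $x$. A band is a string $b=b_n\cdots b_1$ with $e(b_n)=s(b_1)$, $b_1\ne\bar b_n$, $b_1b_n$ a string, and $b\ne y^r$ for every substring $y$ and $r>1$. Strings are taken modulo inversion, bands modulo inversion and cyclic permutation (rotation). $M(w)$, for $w=w_l\cdots w_1$, has basis $z_0,\dots,z_l$ ($z_0$ at $s(w_1)$, $z_i$ at $e(w_i)$); an arrow $w_i$ sends $z_{i-1}$ to $z_i$, for $w_i=\bar a$ the arrow $a$ sends $z_i$ to $z_{i-1}$,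 all other actions are zero. The (quasi-simple) band module $B(b,\mu)$ is defined in the same way with basis indexed by $\mathbb{Z}/n$, the letters read cyclically, except that one chosen direct letter $b_i$ acts by $z_{i-1}\mapsto\mu z_i$. The infinite words ${}^\infty b^\infty=\cdots bbb\cdots$, ${}^\infty b=\cdots bb$, $b^\infty=bb\cdots$ are obtained by repeated concatenation (in both directions, to the left, to the right). Overlap conditions: an absent arrow is written $\emptyset$ (then the adjacent outer word is absent too). (i) If $A=\emptyset$ then $C\neq\emptyset$; (ii) if $B=\emptyset$ then $D\ne\emptyset$; (iii) if $m=1_x$ is a trivial string, then $CA\in I$ and $DB\in I$ whenever the arrows involved exist. Conventions: in (a), after rotation $c=c_L\bar BmAc_R$. In both cases $u=w_LD\,y\,\bar Cw_R$, where $y$ is a subword of ${}^\infty c^\infty$ beginning and ending in the given overlap $m$, of length $|m|+|c|$; the map $M(u)\to B(c,\lambda)$ is the canonical one, $M(u)\twoheadrightarrow M(y)\to B(c,\lambda)$, sending each basis vector of $M(y)$ to the basis vector of $B(c,\lambda)$ below it, weighted by the appropriate power of $\lambda$. "The collection of such extensions" has one extension for each pair of decompositions ${}^\infty c^\infty={}^\infty c\, c_L\bar B m A c_R\, c^\infty$ and $w=w_LDm\bar Cw_R$ with $A,B,C,D\in Q_1$ ($C$, $D$ possibly absent), $A\neq\emptyset\neq B$, and $c_L,c_R,m,w_L,w_R$ (possibly trivial) strings satisfying the overlap conditions (i)--(iii), for all choices of representatives modulo inversion; decompositions of ${}^\infty c^\infty$ are taken up to translation by the period, and data differing by simultaneous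 inversion are identified. *)

theory Defs
  imports
    "HOL-Algebra.QuotRing"
    "HOL-Computational_Algebra.Polynomial"
    "HOL-Library.Sublist"
    "Graph_Theory.Arc_Walk"
    "Jordan_Normal_Form.VS_Connect"
begin

section \<open>Path algebras and gentle algebras\<close>

text \<open>
  A quiver is a \<^typ>\<open>('v, 'a) pre_digraph\<close> (loops and parallel arrows allowed); \<^const>\<open>tail\<close> and
  \<^const>\<open>head\<close> are the start and end maps. A path is its start vertex together with the list of its
  arrows in the order in which they are traversed, so that the path written \<open>a\<^sub>r \<cdots> a\<^sub>1\<close> from right
  to left is the list \<open>[a\<^sub>1, \<dots>, a\<^sub>r]\<close>. The same convention is used for walks below.
\<close>

type_synonym ('v, 'a) path = "'v \<times> 'a list"

definition paths :: "('v, 'a) pre_digraph \<Rightarrow> ('v, 'a) path set" where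
  "paths Q = {(x, p). \<exists>y. pre_digraph.awalk Q x p y}"

text \<open>In \<open>f \<otimes> g\<close> the paths of \<open>g\<close> are traversed first.\<close>

definition path_algebra ::
    "('v, 'a) pre_digraph \<Rightarrow> (('v, 'a) path \<Rightarrow> 'k::field) ring" where
  "path_algebra Q =
    \<lparr>carrier = {f. finite {p. f p \<noteq> 0} \<and> {p. f p \<noteq> 0} \<subseteq> paths Q},
     monoid.mult = (\<lambda>f g (x, p). \<Sum>i\<le>length p.
        f (last (pre_digraph.awalk_verts Q x (take i p)), drop i p) * g (x, take i p)),
     one = (\<lambda>(x, p). if x \<in> verts Q \<and> p = [] then 1 else 0),
     zero = (\<lambda>_. 0),
     add = (\<lambda>f g p. f p + g p)\<rparr>"

definition path_elt :: "('v, 'a) path \<Rightarrow> ('v, 'a) path \<Rightarrow> 'k::field" where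
  "path_elt p = (\<lambda>q. if q = p then 1 else 0)"

text \<open>
  The \<open>m\<close>-th power of the arrow ideal is spanned by the paths of length at least \<open>m\<close>. Over a finite
  quiver an admissible ideal has finite codimension.
\<close>

definition admissible ::
    "('v, 'a) pre_digraph \<Rightarrow> (('v, 'a) path \<Rightarrow> 'k::field) set \<Rightarrow> bool" where
  "admissible Q I \<longleftrightarrow> ideal I (path_algebra Q) \<and>
     (\<forall>f\<in>I. \<forall>p. f p \<noteq> 0 \<longrightarrow> 2 \<le> length (snd p)) \<and>
     (\<exists>m\<ge>2. \<forall>p\<in>paths Q. m \<le> length (snd p) \<longrightarrow> path_elt p \<in> I)"

text \<open>\<open>zero_comp Q I b a\<close>: the length-two path \<open>ba\<close> (first \<open>a\<close>, then \<open>b\<close>) lies in \<open>I\<close>.\<close>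

definition zero_comp ::
    "('v, 'a) pre_digraph \<Rightarrow> (('v, 'a) path \<Rightarrow> 'k::field) set \<Rightarrow> 'a \<Rightarrow> 'a \<Rightarrow> bool" where
  "zero_comp Q I b a \<longleftrightarrow> path_elt (tail Q a, [a, b]) \<in> I"

definition gentle ::
    "('v, 'a) pre_digraph \<Rightarrow> (('v, 'a) path \<Rightarrow> 'k::field) set \<Rightarrow> bool" where
  "gentle Q I \<longleftrightarrow> fin_digraph Q \<and> admissible Q I \<and>
     (\<forall>x\<in>verts Q. card {a\<in>arcs Q. tail Q a = x} \<le> 2 \<and> card {a\<in>arcs Q. head Q a = x} \<le> 2) \<and>
     (\<forall>a\<in>arcs Q.
        card {b\<in>arcs Q. head Q a = tail Q b \<and> \<not> zero_comp Q I b a} \<le> 1 \<and>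
        card {b\<in>arcs Q. head Q b = tail Q a \<and> \<not> zero_comp Q I a b} \<le> 1 \<and>
        card {b\<in>arcs Q. head Q a = tail Q b \<and> zero_comp Q I b a} \<le> 1 \<and>
        card {b\<in>arcs Q. head Q b = tail Q a \<and> zero_comp Q I a b} \<le> 1) \<and>
     (\<exists>S \<subseteq> {p\<in>paths Q. length (snd p) = 2}. I = genideal (path_algebra Q) (path_elt ` S))"

abbreviation bound_quiver_algebra ::
    "('v, 'a) pre_digraph \<Rightarrow> (('v, 'a) path \<Rightarrow> 'k::field) set \<Rightarrow>
     (('v, 'a) path \<Rightarrow> 'k) set ring" where
  "bound_quiver_algebra Q I \<equiv> path_algebra Q Quot I"

definition scalar ::
    "('v, 'a) pre_digraph \<Rightarrow> (('v, 'a) path \<Rightarrow> 'k::field) set \<Rightarrow> 'k \<Rightarrow>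
     (('v, 'a) path \<Rightarrow> 'k) set" where
  "scalar Q I \<kappa> = I +>\<^bsub>path_algebra Q\<^esub> (\<lambda>p. \<kappa> * \<one>\<^bsub>path_algebra Q\<^esub> p)"


section \<open>Left modules, short exact sequences and the first extension group\<close>

text \<open>The locale \<^locale>\<open>module\<close> requires a commutative base ring.\<close>

locale left_module = R?: ring R + M?: abelian_group M
  for R :: "('r, 'b) ring_scheme" (structure) and M :: "('r, 'm, 'c) module_scheme" (structure) +
  assumes smult_closed: "r \<in> carrier R \<Longrightarrow> x \<in> carrier M \<Longrightarrow> r \<odot>\<^bsub>M\<^esub> x \<in> carrier M"
    and smult_l_distr: "r \<in> carrier R \<Longrightarrow> s \<in> carrier R \<Longrightarrow> x \<in> carrier M \<Longrightarrow>
      (r \<oplus>\<^bsub>R\<^esub> s) \<odot>\<^bsub>M\<^esub> x = r \<odot>\<^bsub>M\<^esub> x \<oplus>\<^bsub>M\<^esub> s \<odot>\<^bsub>M\<^esub> x"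
    and smult_r_distr: "r \<in> carrier R \<Longrightarrow> x \<in> carrier M \<Longrightarrow> y \<in> carrier M \<Longrightarrow>
      r \<odot>\<^bsub>M\<^esub> (x \<oplus>\<^bsub>M\<^esub> y) = r \<odot>\<^bsub>M\<^esub> x \<oplus>\<^bsub>M\<^esub> r \<odot>\<^bsub>M\<^esub> y"
    and smult_assoc: "r \<in> carrier R \<Longrightarrow> s \<in> carrier R \<Longrightarrow> x \<in> carrier M \<Longrightarrow>
      (r \<otimes>\<^bsub>R\<^esub> s) \<odot>\<^bsub>M\<^esub> x = r \<odot>\<^bsub>M\<^esub> (s \<odot>\<^bsub>M\<^esub> x)"
    and smult_one: "x \<in> carrier M \<Longrightarrow> \<one>\<^bsub>R\<^esub> \<odot>\<^bsub>M\<^esub> x = x"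

text \<open>\<open>(E, f, g)\<close> stands for \<open>0 \<rightarrow> Y \<rightarrow> E \<rightarrow> X \<rightarrow> 0\<close> with \<open>f : Y \<rightarrow> E\<close> and \<open>g : E \<rightarrow> X\<close>.\<close>

type_synonym ('r, 'y, 'e, 'x) ses = "('r, 'e) module \<times> ('y \<Rightarrow> 'e) \<times> ('e \<Rightarrow> 'x)"

fun is_extension ::
    "'r ring \<Rightarrow> ('r, 'x) module \<Rightarrow> ('r, 'y) module \<Rightarrow> ('r, 'y, 'e, 'x) ses \<Rightarrow> bool" where
  "is_extension R X Y (E, f, g) \<longleftrightarrow>
     left_module R X \<and> left_module R Y \<and> left_module R E \<and>
     f \<in> module_hom R Y E \<and> g \<in> module_hom R E X \<and>
     inj_on f (carrier Y) \<and> g ` carrier E = carrier X \<and>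
     f ` carrier Y = {e \<in> carrier E. g e = \<zero>\<^bsub>X\<^esub>}"

fun split_extension ::
    "'r ring \<Rightarrow> ('r, 'x) module \<Rightarrow> ('r, 'y, 'e, 'x) ses \<Rightarrow> bool" where
  "split_extension R X (E, f, g) \<longleftrightarrow> (\<exists>s \<in> module_hom R X E. \<forall>x\<in>carrier X. g (s x) = x)"

text \<open>
  A morphism of short exact sequences which is \<open>\<beta>\<close> on the left-hand terms and the identity on the
  right-hand terms. For extensions \<open>\<xi>\<close> of \<open>X\<close> by \<open>Y\<close> and \<open>\<xi>'\<close> of \<open>X\<close> by \<open>Y'\<close>, such a morphism exists
  iff \<open>\<xi>'\<close> is (equivalent to) the pushout of \<open>\<xi>\<close> along \<open>\<beta> : Y \<rightarrow> Y'\<close>.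
\<close>

fun ext_morphism ::
    "'r ring \<Rightarrow> ('r, 'y) module \<Rightarrow> ('y \<Rightarrow> 'z) \<Rightarrow>
     ('r, 'y, 'e, 'x) ses \<Rightarrow> ('r, 'z, 'd, 'x) ses \<Rightarrow> bool" where
  "ext_morphism R Y \<beta> (E, f, g) (E', f', g') \<longleftrightarrow>
     (\<exists>\<phi> \<in> module_hom R E E'.
        (\<forall>y\<in>carrier Y. \<phi> (f y) = f' (\<beta> y)) \<and> (\<forall>e\<in>carrier E. g' (\<phi> e) = g e))"

text \<open>The pullback of \<open>\<xi> \<oplus> \<xi>'\<close> along the diagonal of \<open>X\<close>, an extension of \<open>X\<close> by \<open>Y \<oplus> Y\<close>.\<close>

fun fibre_ext ::
    "('r, 'y, 'e, 'x) ses \<Rightarrow> ('r, 'y, 'd, 'x) ses \<Rightarrow> ('r, 'y \<times> 'y, 'e \<times> 'd, 'x) ses" where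
  "fibre_ext (E, f, g) (E', f', g') =
     ((direct_sum E E')\<lparr>carrier := {(e, e'). e \<in> carrier E \<and> e' \<in> carrier E' \<and> g e = g' e'}\<rparr>,
      (\<lambda>(y, y'). (f y, f' y')), (\<lambda>(e, e'). g e))"

text \<open>
  Yoneda's \<open>Ext\<^sup>1(X, Y)\<close> with the Baer sum (pullback along the diagonal of \<open>X\<close> followed by pushout
  along the codiagonal of \<open>Y\<close>); \<open>\<iota>\<close> embeds the field into the centre of \<open>R\<close>. The middle terms have
  their elements in the type \<open>'m\<close> which also carries \<open>X\<close> and \<open>Y\<close>. For finite-dimensional \<open>X\<close>, \<open>Y\<close>
  over \<open>'k\<close> and \<open>'m = nat \<Rightarrow> 'k\<close> this is no restriction: every middle term is then
  finite-dimensional, so it is isomorphic to a module with elements in \<open>nat \<Rightarrow> 'k\<close>.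
  The fields \<^const>\<open>monoid.mult\<close> and \<^const>\<open>one\<close> of a module record have no meaning.
\<close>

definition extensions ::
    "'r ring \<Rightarrow> ('r, 'm) module \<Rightarrow> ('r, 'm) module \<Rightarrow> ('r, 'm, 'm, 'm) ses set" where
  "extensions R X Y = {\<xi>. is_extension R X Y \<xi>}"

definition ext_equiv ::
    "'r ring \<Rightarrow> ('r, 'm) module \<Rightarrow> ('r, 'm) module \<Rightarrow>
     (('r, 'm, 'm, 'm) ses \<times> ('r, 'm, 'm, 'm) ses) set" where
  "ext_equiv R X Y = {(\<xi>, \<xi>'). \<xi> \<in> extensions R X Y \<and> \<xi>' \<in> extensions R X Y \<and>
     ext_morphism R Y (\<lambda>y. y) \<xi> \<xi>'}"

definition Ext1 ::
    "'r ring \<Rightarrow> ('k \<Rightarrow> 'r) \<Rightarrow> ('r, 'm) module \<Rightarrow> ('r, 'm) module \<Rightarrow>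
     ('k, ('r, 'm, 'm, 'm) ses set) module" where
  "Ext1 R \<iota> X Y =
    \<lparr>carrier = extensions R X Y // ext_equiv R X Y,
     monoid.mult = undefined,
     one = undefined,
     zero = {\<xi> \<in> extensions R X Y. split_extension R X \<xi>},
     add = (\<lambda>\<Xi> \<Xi>'. {\<zeta> \<in> extensions R X Y. \<exists>\<xi>\<in>\<Xi>. \<exists>\<xi>'\<in>\<Xi>'.
        ext_morphism R (direct_sum Y Y) (\<lambda>(y, y'). y \<oplus>\<^bsub>Y\<^esub> y') (fibre_ext \<xi> \<xi>') \<zeta>}),
     smult = (\<lambda>\<kappa> \<Xi>. {\<zeta> \<in> extensions R X Y. \<exists>\<xi>\<in>\<Xi>.
        ext_morphism R Y (\<lambda>y. \<iota> \<kappa> \<odot>\<^bsub>Y\<^esub> y) \<xi> \<zeta>})\<rparr>"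


section \<open>Strings and bands\<close>

datatype 'a letter = Dir 'a | Inv 'a

fun letter_inv :: "'a letter \<Rightarrow> 'a letter" where
  "letter_inv (Dir a) = Inv a"
| "letter_inv (Inv a) = Dir a"

fun letter_arrow :: "'a letter \<Rightarrow> 'a" where
  "letter_arrow (Dir a) = a"
| "letter_arrow (Inv a) = a"

fun letter_start :: "('v, 'a) pre_digraph \<Rightarrow> 'a letter \<Rightarrow> 'v" where
  "letter_start Q (Dir a) = tail Q a"
| "letter_start Q (Inv a) = head Q a"

fun letter_end :: "('v, 'a) pre_digraph \<Rightarrow> 'a letter \<Rightarrow> 'v" where
  "letter_end Q (Dir a) = head Q a"
| "letter_end Q (Inv a) = tail Q a"

text \<open>
  A walk \<open>w\<^sub>l \<cdots> w\<^sub>1\<close> is its start vertex together with \<open>[w\<^sub>1, \<dots>, w\<^sub>l]\<close>; the trivial string \<open>1\<^sub>x\<close>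
  is \<open>(x, [])\<close>. Hence the right-most factor of a product of words comes first in the list.
\<close>

type_synonym ('v, 'a) qword = "'v \<times> 'a letter list"

fun word_end :: "('v, 'a) pre_digraph \<Rightarrow> ('v, 'a) qword \<Rightarrow> 'v" where
  "word_end Q (x, ls) = (if ls = [] then x else letter_end Q (last ls))"

fun word_inv :: "('v, 'a) pre_digraph \<Rightarrow> ('v, 'a) qword \<Rightarrow> ('v, 'a) qword" where
  "word_inv Q (x, ls) = (word_end Q (x, ls), rev (map letter_inv ls))"

fun is_walk :: "('v, 'a) pre_digraph \<Rightarrow> ('v, 'a) qword \<Rightarrow> bool" where
  "is_walk Q (x, ls) \<longleftrightarrow> x \<in> verts Q \<and> letter_arrow ` set ls \<subseteq> arcs Q \<and>
     (ls \<noteq> [] \<longrightarrow> letter_start Q (hd ls) = x) \<and>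
     (\<forall>i. Suc i < length ls \<longrightarrow>
        letter_start Q (ls ! Suc i) = letter_end Q (ls ! i) \<and> ls ! Suc i \<noteq> letter_inv (ls ! i))"

definition is_string ::
    "('v, 'a) pre_digraph \<Rightarrow> (('v, 'a) path \<Rightarrow> 'k::field) set \<Rightarrow> ('v, 'a) qword \<Rightarrow> bool" where
  "is_string Q I w \<longleftrightarrow> is_walk Q w \<and>
     (\<forall>p. p \<noteq> [] \<and> (sublist (map Dir p) (snd w) \<or> sublist (rev (map Inv p)) (snd w)) \<longrightarrow>
        path_elt (tail Q (hd p), p) \<notin> I)"

definition list_power :: "'b list \<Rightarrow> nat \<Rightarrow> 'b list" where
  "list_power y r = concat (replicate r y)"

text \<open>A band is nontrivial, so its start vertex is determined by its letters \<open>[b\<^sub>1, \<dots>, b\<^sub>n]\<close>.\<close>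

definition is_band ::
    "('v, 'a) pre_digraph \<Rightarrow> (('v, 'a) path \<Rightarrow> 'k::field) set \<Rightarrow> 'a letter list \<Rightarrow> bool" where
  "is_band Q I b \<longleftrightarrow> b \<noteq> [] \<and> is_string Q I (letter_start Q (hd b), b) \<and>
     letter_end Q (last b) = letter_start Q (hd b) \<and> hd b \<noteq> letter_inv (last b) \<and>
     is_string Q I (letter_start Q (last b), [last b, hd b]) \<and>
     (\<forall>y r. sublist y b \<and> 1 < r \<longrightarrow> b \<noteq> list_power y r)"


section \<open>String and band modules\<close>

text \<open>
  Basis vectors \<open>z\<^sub>0, \<dots>, z\<^sub>N\<^sub>-\<^sub>1\<close>, with \<open>z\<^sub>j\<close> at the vertex \<open>lab j\<close>; vectors are coordinate functions.
  The \<open>k\<close>-th letter (counted from 0) joins \<open>z\<^sub>k\<close> to \<open>z\<^bsub>nx k\<^esub>\<close>: a direct letter \<open>a\<close> makes \<open>a\<close> send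
  \<open>z\<^sub>k\<close> to \<open>wt k\<close> times \<open>z\<^bsub>nx k\<^esub>\<close>, an inverse letter makes \<open>a\<close> send \<open>z\<^bsub>nx k\<^esub>\<close> to \<open>z\<^sub>k\<close>.
\<close>

definition vertex_act :: "nat \<Rightarrow> (nat \<Rightarrow> 'v) \<Rightarrow> 'v \<Rightarrow> (nat \<Rightarrow> 'k::field) \<Rightarrow> nat \<Rightarrow> 'k" where
  "vertex_act N lab x z = (\<lambda>j. if j < N \<and> lab j = x then z j else 0)"

definition arrow_act ::
    "'a letter list \<Rightarrow> (nat \<Rightarrow> nat) \<Rightarrow> (nat \<Rightarrow> 'k::field) \<Rightarrow> 'a \<Rightarrow> (nat \<Rightarrow> 'k) \<Rightarrow> nat \<Rightarrow> 'k" where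
  "arrow_act ls nx wt a z = (\<lambda>j. \<Sum>k<length ls.
     case ls ! k of
       Dir b \<Rightarrow> if b = a \<and> j = nx k then wt k * z k else 0
     | Inv b \<Rightarrow> if b = a \<and> j = k then z (nx k) else 0)"

fun path_act ::
    "nat \<Rightarrow> (nat \<Rightarrow> 'v) \<Rightarrow> 'a letter list \<Rightarrow> (nat \<Rightarrow> nat) \<Rightarrow> (nat \<Rightarrow> 'k::field) \<Rightarrow>
     ('v, 'a) path \<Rightarrow> (nat \<Rightarrow> 'k) \<Rightarrow> nat \<Rightarrow> 'k" where
  "path_act N lab ls nx wt (x, p) z = fold (arrow_act ls nx wt) p (vertex_act N lab x z)"

definition path_algebra_act ::
    "nat \<Rightarrow> (nat \<Rightarrow> 'v) \<Rightarrow> 'a letter list \<Rightarrow> (nat \<Rightarrow> nat) \<Rightarrow> (nat \<Rightarrow> 'k::field) \<Rightarrow>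
     (('v, 'a) path \<Rightarrow> 'k) \<Rightarrow> (nat \<Rightarrow> 'k) \<Rightarrow> nat \<Rightarrow> 'k" where
  "path_algebra_act N lab ls nx wt f z =
     (\<lambda>j. \<Sum>p | f p \<noteq> 0. f p * path_act N lab ls nx wt p z j)"

text \<open>A coset of \<open>I\<close> acts by the common action of its elements.\<close>

definition diagram_module ::
    "nat \<Rightarrow> (nat \<Rightarrow> 'v) \<Rightarrow> 'a letter list \<Rightarrow> (nat \<Rightarrow> nat) \<Rightarrow> (nat \<Rightarrow> 'k::field) \<Rightarrow>
     ((('v, 'a) path \<Rightarrow> 'k) set, nat \<Rightarrow> 'k) module" where
  "diagram_module N lab ls nx wt =
    \<lparr>carrier = {z. \<forall>j\<ge>N. z j = 0},
     monoid.mult = undefined,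
     one = undefined,
     zero = (\<lambda>_. 0),
     add = (\<lambda>y z j. y j + z j),
     smult = (\<lambda>F z. the_elem ((\<lambda>f. path_algebra_act N lab ls nx wt f z) ` F))\<rparr>"

fun string_module ::
    "('v, 'a) pre_digraph \<Rightarrow> ('v, 'a) qword \<Rightarrow>
     ((('v, 'a) path \<Rightarrow> 'k::field) set, nat \<Rightarrow> 'k) module" where
  "string_module Q (x, ls) =
     diagram_module (Suc (length ls)) (\<lambda>j. word_end Q (x, take j ls)) ls Suc (\<lambda>_. 1)"

text \<open>\<open>t\<close> is the position (counted from 0) of the direct letter that carries the scalar \<open>\<mu>\<close>.\<close>

definition band_module ::
    "('v, 'a) pre_digraph \<Rightarrow> 'a letter list \<Rightarrow> nat \<Rightarrow> 'k::field \<Rightarrow>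
     ((('v, 'a) path \<Rightarrow> 'k) set, nat \<Rightarrow> 'k) module" where
  "band_module Q b t \<mu> =
     diagram_module (length b) (\<lambda>j. letter_start Q (b ! j)) b
       (\<lambda>k. Suc k mod length b) (\<lambda>k. if k = t then \<mu> else 1)"


section \<open>Overlaps of a band with a string\<close>

text \<open>
  The bi-infinite word \<open>\<^sup>\<infinity>c\<^sup>\<infinity>\<close>; its \<open>i\<close>-th letter joins the \<open>i\<close>-th vertex to the \<open>i+1\<close>-st, and the
  \<open>i\<close>-th vertex lies above the basis vector of index \<open>i mod |c|\<close> of the band module.
\<close>

definition biinf :: "'b list \<Rightarrow> int \<Rightarrow> 'b" where
  "biinf c i = c ! nat (i mod int (length c))"

definition biinf_segment :: "'b list \<Rightarrow> int \<Rightarrow> nat \<Rightarrow> 'b list" where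
  "biinf_segment c i k = map (\<lambda>j. biinf c (i + int j)) [0..<k]"

text \<open>
  A pair of decompositions \<open>\<^sup>\<infinity>c\<^sup>\<infinity> = \<^sup>\<infinity>c c\<^sub>L B\<^sup>-\<^sup>1 m A c\<^sub>R c\<^sup>\<infinity>\<close> and \<open>w = w\<^sub>L D m C\<^sup>-\<^sup>1 w\<^sub>R\<close>. The former is
  given by the place \<open>ov_pos\<close> at which \<open>m\<close> starts (the parts of \<open>\<^sup>\<infinity>c\<^sup>\<infinity>\<close> to the right of \<open>A\<close> and to the
  left of \<open>B\<^sup>-\<^sup>1\<close> are then determined, only their division into \<open>c\<^sub>R\<close>, \<open>c\<^sup>\<infinity>\<close> and \<open>\<^sup>\<infinity>c\<close>, \<open>c\<^sub>L\<close> is not).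
  An absent arrow is \<^const>\<open>None\<close>.
\<close>

record ('v, 'a) overlap =
  ov_pos :: int
  ov_word :: "('v, 'a) qword"
  ov_m :: "('v, 'a) qword"
  ov_A :: 'a
  ov_B :: 'a
  ov_C :: "'a option"
  ov_D :: "'a option"
  ov_wL :: "'a letter list"
  ov_wR :: "'a letter list"

definition ov_right :: "('v, 'a) overlap \<Rightarrow> 'a letter list" where
  "ov_right d = ov_wR d @ (case ov_C d of None \<Rightarrow> [] | Some a \<Rightarrow> [Inv a])"

definition ov_left :: "('v, 'a) overlap \<Rightarrow> 'a letter list" where
  "ov_left d = (case ov_D d of None \<Rightarrow> [] | Some a \<Rightarrow> [Dir a]) @ ov_wL d"

definition ov_len :: "('v, 'a) overlap \<Rightarrow> nat" where
  "ov_len d = length (snd (ov_m d))"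

text \<open>
  Since \<open>A\<close> and \<open>B\<close> are present, only the third overlap condition (on trivial \<open>m\<close>) is not vacuous.
  The two conditions on \<open>fst (ov_m d)\<close> matter only for trivial \<open>m\<close>; they say that its vertex is the
  one at the given place of \<open>\<^sup>\<infinity>c\<^sup>\<infinity>\<close> and of \<open>w\<close>.
\<close>

definition is_overlap ::
    "('v, 'a) pre_digraph \<Rightarrow> (('v, 'a) path \<Rightarrow> 'k::field) set \<Rightarrow> 'a letter list \<Rightarrow>
     ('v, 'a) overlap \<Rightarrow> bool" where
  "is_overlap Q I c d \<longleftrightarrow>
     biinf c (ov_pos d - 1) = Dir (ov_A d) \<and>
     biinf_segment c (ov_pos d) (ov_len d) = snd (ov_m d) \<and>
     biinf c (ov_pos d + int (ov_len d)) = Inv (ov_B d) \<and>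
     snd (ov_word d) = ov_right d @ snd (ov_m d) @ ov_left d \<and>
     fst (ov_m d) = head Q (ov_A d) \<and>
     fst (ov_m d) = word_end Q (fst (ov_word d), ov_right d) \<and>
     (ov_C d = None \<longrightarrow> ov_wR d = []) \<and> (ov_D d = None \<longrightarrow> ov_wL d = []) \<and>
     (snd (ov_m d) = [] \<longrightarrow>
        (\<forall>C. ov_C d = Some C \<longrightarrow> zero_comp Q I C (ov_A d)) \<and>
        (\<forall>D. ov_D d = Some D \<longrightarrow> zero_comp Q I D (ov_B d)))"

text \<open>The index set of the collection of extensions: by simultaneous inversion \<open>c\<close> can be kept in its
  given orientation, and by translation \<open>m\<close> starts within one fixed period.\<close>

definition overlaps ::
    "('v, 'a) pre_digraph \<Rightarrow> (('v, 'a) path \<Rightarrow> 'k::field) set \<Rightarrow> 'a letter list \<Rightarrow>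
     ('v, 'a) qword \<Rightarrow> ('v, 'a) overlap set" where
  "overlaps Q I c w = {d. is_overlap Q I c d \<and> ov_word d \<in> {w, word_inv Q w} \<and>
     0 \<le> ov_pos d \<and> ov_pos d < int (length c)}"

text \<open>The word \<open>u = w\<^sub>L D y C\<^sup>-\<^sup>1 w\<^sub>R\<close>.\<close>

definition ov_middle :: "'a letter list \<Rightarrow> ('v, 'a) overlap \<Rightarrow> ('v, 'a) qword" where
  "ov_middle c d =
     (fst (ov_word d),
      ov_right d @ biinf_segment c (ov_pos d) (ov_len d + length c) @ ov_left d)"

text \<open>
  The canonical map \<open>M(u) \<rightarrow> M(y) \<rightarrow> B(c, \<lambda>)\<close>: the \<open>s\<close>-th basis vector of \<open>M(y)\<close> goes to
  \<open>\<lambda>\<^sup>e\<close> times the basis vector below it, where \<open>e\<close> counts the occurrences of the letter carrying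
  \<open>\<lambda>\<close> among the first \<open>s\<close> letters of \<open>y\<close>.
\<close>

definition ov_proj ::
    "'a letter list \<Rightarrow> nat \<Rightarrow> 'k::field \<Rightarrow> ('v, 'a) overlap \<Rightarrow> (nat \<Rightarrow> 'k) \<Rightarrow> nat \<Rightarrow> 'k" where
  "ov_proj c t lam d z = (\<lambda>j. \<Sum>s\<le>ov_len d + length c.
     if int j = (ov_pos d + int s) mod int (length c)
     then lam ^ card {i. i < s \<and> (ov_pos d + int i) mod int (length c) = int t} *
       z (length (ov_right d) + s)
     else 0)"

text \<open>
  The embedding of \<open>M(w)\<close> as the kernel of \<^const>\<open>ov_proj\<close>. It is the identity on \<open>w\<^sub>R\<close>; it sends a
  basis vector of \<open>m\<close> to its copy in the first \<open>m\<close> of \<open>u\<close> (adjacent to \<open>w\<^sub>R\<close>) minus \<open>\<lambda>\<^sup>-\<^sup>1\<close> times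
  its copy in the last one, \<open>|c|\<close> places further on; and it is \<open>-\<lambda>\<^sup>-\<^sup>1\<close> times the identity on \<open>w\<^sub>L\<close>.
  If the overlap uses the inverse of \<open>w\<close>, the isomorphism reversing the basis is applied first.
\<close>

definition ov_incl ::
    "'a letter list \<Rightarrow> 'k::field \<Rightarrow> ('v, 'a) qword \<Rightarrow> ('v, 'a) overlap \<Rightarrow> (nat \<Rightarrow> 'k) \<Rightarrow> nat \<Rightarrow> 'k"
  where
  "ov_incl c lam w d z =
     (let l = length (snd w); r = length (ov_right d); n = length c;
          z' = (if ov_word d = w then z else (\<lambda>j. if j \<le> l then z (l - j) else 0))
      in (\<lambda>j. (if j \<le> r + ov_len d then z' j else 0) -
              (if r + n \<le> j then inverse lam * z' (j - n) else 0)))"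

definition ov_ext ::
    "('v, 'a) pre_digraph \<Rightarrow> 'a letter list \<Rightarrow> nat \<Rightarrow> 'k::field \<Rightarrow> ('v, 'a) qword \<Rightarrow>
     ('v, 'a) overlap \<Rightarrow>
     ((('v, 'a) path \<Rightarrow> 'k) set, nat \<Rightarrow> 'k, nat \<Rightarrow> 'k, nat \<Rightarrow> 'k) ses" where
  "ov_ext Q c t lam w d =
     (string_module Q (ov_middle c d), ov_incl c lam w d, ov_proj c t lam d)"

definition nonsplit_extension ::
    "'r ring \<Rightarrow> ('r, 'x) module \<Rightarrow> ('r, 'y) module \<Rightarrow> ('r, 'y, 'e, 'x) ses \<Rightarrow> bool" where
  "nonsplit_extension R X Y \<xi> \<longleftrightarrow> is_extension R X Y \<xi> \<and> \<not> split_extension R X \<xi>"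

end

theory Submission
  imports Defs
begin

text \<open>
  Let \<open>B\<close> be the band module and \<open>Y = M(w)\<close>. In the middle term \<open>E\<close> of an extension of \<open>B\<close> by \<open>Y\<close>
  one chooses lifts \<open>e\<^sub>i\<close> of the basis vectors of \<open>B\<close>, each at its vertex. The \<open>i\<close>-th letter of the
  band acts on the lifts as it does in \<open>B\<close>, up to an error \<open>\<eta>\<^sub>i \<in> Y\<close>. In a gentle algebra every other
  arrow starting at the vertex of \<open>e\<^sub>i\<close> forms a zero relation with a neighbouring letter of the band,
  so its action on \<open>e\<^sub>i\<close> is determined by the errors (\<open>defect_exists\<close>, \<open>defect_lift\<close>). Hence the errors
  determine the extension up to equivalence, and a change of the lifts changes them by a boundary
  (\<open>morphism_iff\<close>). The group \<open>Ext\<^sup>1(B, Y)\<close> is therefore the space of the families of errors that occur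
  (\<open>realised\<close>) modulo boundaries, with Baer sum given by addition (\<open>Ext_add\<close>, \<open>Ext_smult\<close>).

  The extension of an overlap has a single nonzero error. It belongs to the letter \<open>A\<close> and is a
  multiple of the basis vector of \<open>Y\<close> at which \<open>m\<close> starts (\<open>overlap_lift\<close>).

  Independence comes from a pairing with homomorphisms \<open>Y \<rightarrow> B\<close>. In \<open>w\<close> the arrows \<open>C\<close> and \<open>D\<close> point out
  of \<open>m\<close>, and in the band \<open>A\<close> and \<open>B\<close> point into it, so an overlap gives a homomorphism
  \<open>Y \<rightarrow> M(m) \<rightarrow> B\<close>. Pushing an extension forward along it yields a self-extension of \<open>B\<close>, and the
  weighted sum of its errors around the cycle vanishes on boundaries (\<open>pairing_boundary\<close>). The pairing
  of the overlap extensions with the homomorphisms of the overlaps is a diagonal matrix with nonzero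
  entries on the diagonal (\<open>pairing_overlap_coords_self\<close>, \<open>pairing_overlap_coords_other\<close>). In
  particular no overlap extension splits. Behind this is the Auslander-Reiten duality between
  \<open>Ext\<^sup>1(B, Y)\<close> and \<open>Hom(Y, B)\<close>, where \<open>B\<close> is its own translate.

  For spanning, consider errors concentrated in one letter and one basis vector of \<open>Y\<close>. Changing a
  single lift by a basis vector shows that modulo boundaries such an error may be moved by one step
  along a common subword of \<open>w\<close> and the band (\<open>move\<close>). At an end of a maximal common subword it
  becomes zero, unless the subword is an overlap, and then it is the error of the overlap extension
  (\<open>left_end\<close>). So boundaries and overlap extensions span everything (\<open>realised_W\<close>).
\<close>

section \<open>The path algebra and its quotient\<close>

definition path_end :: "('v, 'a) pre_digraph \<Rightarrow> ('v, 'a) path \<Rightarrow> 'v" where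
  "path_end Q p = (if snd p = [] then fst p else head Q (last (snd p)))"

definition monomial :: "'k::field \<Rightarrow> ('v, 'a) path \<Rightarrow> ('v, 'a) path \<Rightarrow> 'k" where
  "monomial \<kappa> p = (\<lambda>q. if q = p then \<kappa> else 0)"

lemma path_elt_monomial: "path_elt p = monomial 1 p"
  by (simp add: path_elt_def monomial_def)

lemma awlast_path_end: "last (pre_digraph.awalk_verts Q x p) = path_end Q (x, p)"
  by (simp add: pre_digraph.awalk_verts_conv path_end_def)

lemma path_algebra_simps:
  "f \<in> carrier (path_algebra Q) \<longleftrightarrow> finite {p. f p \<noteq> 0} \<and> {p. f p \<noteq> 0} \<subseteq> paths Q"
  "f \<oplus>\<^bsub>path_algebra Q\<^esub> g = (\<lambda>p. f p + g p)"
  "\<zero>\<^bsub>path_algebra Q\<^esub> = (\<lambda>_. 0)"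
  "\<one>\<^bsub>path_algebra Q\<^esub> = (\<lambda>(x, p). if x \<in> verts Q \<and> p = [] then 1 else 0)"
  by (auto simp: path_algebra_def)

lemma path_algebra_mult:
  "(f \<otimes>\<^bsub>path_algebra Q\<^esub> g) (x, p) =
     (\<Sum>i\<le>length p. f (path_end Q (x, take i p), drop i p) * g (x, take i p))"
  by (simp add: path_algebra_def awlast_path_end)

lemma monomial_mult:
  "monomial \<kappa> (y, q) \<otimes>\<^bsub>path_algebra Q\<^esub> monomial \<mu> (x, p) =
     (if y = path_end Q (x, p) then monomial (\<kappa> * \<mu>) (x, p @ q) else (\<lambda>_. 0))"
proof (rule ext)
  fix z :: "('a, 'b) path"
  obtain x' r where z: "z = (x', r)" by (cases z)
  let ?t = "\<lambda>i. monomial \<kappa> (y, q) (path_end Q (x', take i r), drop i r) * monomial \<mu> (x, p) (x', take i r)"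
  have "(\<Sum>i\<le>length r. ?t i) = (\<Sum>i\<in>{..length r} \<inter> {length p}. ?t i)"
    by (rule sum.mono_neutral_right) (auto simp: monomial_def)
  also have "\<dots> = (if y = path_end Q (x, p) then monomial (\<kappa> * \<mu>) (x, p @ q) z else 0)"
  proof (cases "length p \<le> length r")
    case True
    have "(take (length p) r = p \<and> drop (length p) r = q) \<longleftrightarrow> r = p @ q"
      by (metis append_eq_conv_conj)
    moreover have "{..length r} \<inter> {length p} = {length p}" using True by auto
    ultimately show ?thesis by (auto simp: z monomial_def)
  next
    case False
    then have "{..length r} \<inter> {length p} = {}" by auto
    then show ?thesis using False by (auto simp: z monomial_def)
  qed
  finally show "(monomial \<kappa> (y, q) \<otimes>\<^bsub>path_algebra Q\<^esub> monomial \<mu> (x, p)) z =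
     (if y = path_end Q (x, p) then monomial (\<kappa> * \<mu>) (x, p @ q) else (\<lambda>_. 0)) z"
    by (simp add: z path_algebra_mult)
qed

lemma monomial_carrier: "p \<in> paths Q \<Longrightarrow> monomial \<kappa> p \<in> carrier (path_algebra Q)"
proof -
  assume "p \<in> paths Q"
  moreover have "{q. monomial \<kappa> p q \<noteq> 0} \<subseteq> {p}" by (auto simp: monomial_def)
  ultimately show ?thesis by (auto simp: path_algebra_simps intro: finite_subset)
qed

lemma path_algebra_induct [consumes 1, case_names zero monomial add]:
  assumes "f \<in> carrier (path_algebra Q)"
    and "P (\<lambda>_. 0)"
    and "\<And>\<kappa> p. p \<in> paths Q \<Longrightarrow> P (monomial \<kappa> p)"
    and "\<And>f g. f \<in> carrier (path_algebra Q) \<Longrightarrow> g \<in> carrier (path_algebra Q) \<Longrightarrow>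
           P f \<Longrightarrow> P g \<Longrightarrow> P (f \<oplus>\<^bsub>path_algebra Q\<^esub> g)"
  shows "P (f :: ('v, 'a) path \<Rightarrow> 'k::field)"
proof -
  define S where "S = {p. f p \<noteq> 0}"
  have fin: "finite S" and sub: "S \<subseteq> paths Q"
    using assms(1) by (auto simp: path_algebra_simps S_def)
  have "\<forall>f. {p. f p \<noteq> 0} \<subseteq> S \<longrightarrow> P f" using fin sub
  proof (induction S rule: finite_induct)
    case empty
    have "f = (\<lambda>_. 0)" if "{p. f p \<noteq> 0} \<subseteq> {}" for f :: "('v, 'a) path \<Rightarrow> 'k"
      using that by auto
    then show ?case using assms(2) by metis
  next
    case (insert s S)
    show ?case
    proof (intro allI impI)
      fix f :: "('v, 'a) path \<Rightarrow> 'k" assume f: "{p. f p \<noteq> 0} \<subseteq> insert s S"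
      define g where "g = f(s := 0)"
      have g: "{p. g p \<noteq> 0} \<subseteq> S" using f by (auto simp: g_def split: if_splits)
      then have "P g" using insert by auto
      moreover have "g \<in> carrier (path_algebra Q)"
        using g insert by (auto simp: path_algebra_simps intro: finite_subset)
      moreover have "f = monomial (f s) s \<oplus>\<^bsub>path_algebra Q\<^esub> g"
        by (auto simp: path_algebra_simps monomial_def g_def)
      ultimately show "P f" using assms(3,4) monomial_carrier insert
        by (metis insert_subset)
    qed
  qed
  then show ?thesis by (simp add: S_def)
qed

lemma cas_path_end: "pre_digraph.cas Q x p y \<Longrightarrow> y = path_end Q (x, p)"
  by (induction p arbitrary: x) (auto simp: path_end_def pre_digraph.cas.simps)

lemma cas_append:
  "pre_digraph.cas Q x (p @ q) z \<longleftrightarrow> pre_digraph.cas Q x p (path_end Q (x, p)) \<and>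
     pre_digraph.cas Q (path_end Q (x, p)) q z"
proof (induction p arbitrary: x)
  case (Cons a p)
  have "path_end Q (x, a # p) = path_end Q (head Q a, p)" by (simp add: path_end_def)
  with Cons[of "head Q a"] show ?case by (simp add: pre_digraph.cas.simps)
qed (simp add: path_end_def pre_digraph.cas.simps)

lemma paths_altdef: "(x, p) \<in> paths Q \<longleftrightarrow> x \<in> verts Q \<and> set p \<subseteq> arcs Q \<and>
    pre_digraph.cas Q x p (path_end Q (x, p))"
  by (auto simp: paths_def pre_digraph.awalk_def dest: cas_path_end)

lemma paths_Nil [simp]: "(x, []) \<in> paths Q \<longleftrightarrow> x \<in> verts Q"
  by (simp add: paths_altdef path_end_def pre_digraph.cas.simps)

lemma path_end_snoc [simp]: "path_end Q (x, p @ [a]) = head Q a"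
  and path_end_Nil [simp]: "path_end Q (x, []) = x"
  by (auto simp: path_end_def)

lemma paths_snoc:
  "(x, p @ [a]) \<in> paths Q \<longleftrightarrow> (x, p) \<in> paths Q \<and> a \<in> arcs Q \<and> tail Q a = path_end Q (x, p)"
  by (auto simp: paths_altdef cas_append pre_digraph.cas.simps)

lemma paths_single:
  assumes "wf_digraph Q"
  shows "(x, [a]) \<in> paths Q \<longleftrightarrow> a \<in> arcs Q \<and> tail Q a = x"
  using paths_snoc[of x "[]" a Q] assms by (auto simp: wf_digraph_def)

locale gentle_quiver =
  fixes Q :: "('v, 'a) pre_digraph"
    and I :: "(('v, 'a) path \<Rightarrow> 'k::field) set"
  assumes gentle: "gentle Q I"
begin

lemma fin_digraph: "fin_digraph Q" and admissible: "admissible Q I"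
  using gentle by (auto simp: gentle_def)

lemma wf_digraph: "wf_digraph Q"
  using fin_digraph by (simp add: fin_digraph_def)

lemma tail_verts: "a \<in> arcs Q \<Longrightarrow> tail Q a \<in> verts Q"
  and head_verts: "a \<in> arcs Q \<Longrightarrow> head Q a \<in> verts Q"
  using wf_digraph by (auto simp: wf_digraph_def)

lemma finite_arcs: "finite (arcs Q)" and finite_verts: "finite (verts Q)"
  using fin_digraph by (auto simp: fin_digraph_def fin_digraph_axioms_def)

abbreviation R0 :: "(('v, 'a) path \<Rightarrow> 'k) ring" where "R0 \<equiv> path_algebra Q"
abbreviation R :: "(('v, 'a) path \<Rightarrow> 'k) set ring" where "R \<equiv> bound_quiver_algebra Q I"

lemma ideal: "ideal I R0"
  using admissible by (simp add: admissible_def)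

lemma ring_R0: "ring R0" using ideal by (simp add: ideal_def)
lemma ring_R: "ring R" using ideal by (rule ideal.quotient_is_ring)

definition quot :: "(('v, 'a) path \<Rightarrow> 'k) \<Rightarrow> (('v, 'a) path \<Rightarrow> 'k) set" where
  "quot f = I +>\<^bsub>R0\<^esub> f"

definition vtx :: "'v \<Rightarrow> (('v, 'a) path \<Rightarrow> 'k) set" where
  "vtx x = quot (monomial 1 (x, []))"

definition arr :: "'a \<Rightarrow> (('v, 'a) path \<Rightarrow> 'k) set" where
  "arr a = quot (monomial 1 (tail Q a, [a]))"

abbreviation sc :: "'k \<Rightarrow> (('v, 'a) path \<Rightarrow> 'k) set" where
  "sc \<equiv> scalar Q I"

text \<open>The element of the path algebra whose coset is the scalar \<open>\<kappa>\<close>.\<close>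
definition scl :: "'k \<Rightarrow> ('v, 'a) path \<Rightarrow> 'k" where
  "scl \<kappa> = (\<lambda>p. \<kappa> * \<one>\<^bsub>R0\<^esub> p)"

lemma sc_quot: "sc \<kappa> = quot (scl \<kappa>)"
  by (simp add: scalar_def quot_def scl_def)

lemma quot_hom: "quot \<in> Ring.ring_hom R0 R"
  using ideal.rcos_ring_hom[OF ideal] by (simp add: quot_def[abs_def])

lemma quot_closed: "f \<in> carrier R0 \<Longrightarrow> quot f \<in> carrier R"
  and quot_add: "f \<in> carrier R0 \<Longrightarrow> g \<in> carrier R0 \<Longrightarrow> quot (f \<oplus>\<^bsub>R0\<^esub> g) = quot f \<oplus>\<^bsub>R\<^esub> quot g"
  and quot_mult: "f \<in> carrier R0 \<Longrightarrow> g \<in> carrier R0 \<Longrightarrow> quot (f \<otimes>\<^bsub>R0\<^esub> g) = quot f \<otimes>\<^bsub>R\<^esub> quot g"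
  and quot_one: "quot \<one>\<^bsub>R0\<^esub> = \<one>\<^bsub>R\<^esub>"
  using quot_hom by (auto simp: Ring.ring_hom_def)

lemma quot_surj: "F \<in> carrier R \<Longrightarrow> \<exists>f\<in>carrier R0. F = quot f"
  by (auto simp: FactRing_def A_RCOSETS_def' quot_def)

lemma quot_eq_zero: "f \<in> I \<Longrightarrow> quot f = \<zero>\<^bsub>R\<^esub>"
  unfolding quot_def using ideal.rcos_ring_hom_ring[OF ideal]
  by (metis FactRing_def ring.simps(1) abelian_group.a_coset_join2 additive_subgroup.a_subgroup ideal
      ideal.axioms(1) ideal.Icarr ring.is_abelian_group ring_R0)

lemma quot_zero: "quot (\<lambda>_. 0) = \<zero>\<^bsub>R\<^esub>"
  using quot_eq_zero[of "\<zero>\<^bsub>R0\<^esub>"] additive_subgroup.zero_closed[OF ideal.axioms(1)[OF ideal]]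
  by (simp add: path_algebra_simps(3))

lemma scl_carrier: "scl \<kappa> \<in> carrier R0"
proof -
  have "{p. scl \<kappa> p \<noteq> 0} \<subseteq> (\<lambda>x. (x, [])) ` verts Q"
    by (auto simp: scl_def path_algebra_simps split: if_splits)
  then show ?thesis using finite_verts by (auto simp: path_algebra_simps(1) intro: finite_subset)
qed

lemma path_end_verts: "(x, p) \<in> paths Q \<Longrightarrow> path_end Q (x, p) \<in> verts Q"
  using wf_digraph by (cases p rule: rev_cases) (auto simp: paths_altdef wf_digraph_def)

lemma scl_mult_left:
  assumes f: "f \<in> carrier R0"
  shows "scl \<kappa> \<otimes>\<^bsub>R0\<^esub> f = (\<lambda>p. \<kappa> * f p)"
proof (rule ext)
  fix z :: "('v, 'a) path"
  obtain x p where z: "z = (x, p)" by (cases z)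
  have "(scl \<kappa> \<otimes>\<^bsub>R0\<^esub> f) z = (\<Sum>i\<le>length p. if i = length p then \<kappa> * f z else 0)"
    unfolding z path_algebra_mult
  proof (rule sum.cong[OF refl])
    fix i assume "i \<in> {..length p}"
    moreover have "path_end Q (x, p) \<in> verts Q \<or> f (x, p) = 0"
      using f path_end_verts by (auto simp: path_algebra_simps)
    ultimately show "scl \<kappa> (path_end Q (x, take i p), drop i p) * f (x, take i p) =
        (if i = length p then \<kappa> * f (x, p) else 0)"
      by (auto simp: scl_def path_algebra_simps)
  qed
  then show "(scl \<kappa> \<otimes>\<^bsub>R0\<^esub> f) z = \<kappa> * f z" by simp
qed

lemma scl_mult_right:
  assumes f: "f \<in> carrier R0"
  shows "f \<otimes>\<^bsub>R0\<^esub> scl \<kappa> = (\<lambda>p. \<kappa> * f p)"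
proof (rule ext)
  fix z :: "('v, 'a) path"
  obtain x p where z: "z = (x, p)" by (cases z)
  have "(f \<otimes>\<^bsub>R0\<^esub> scl \<kappa>) z = (\<Sum>i\<le>length p. if i = 0 then \<kappa> * f z else 0)"
    unfolding z path_algebra_mult
  proof (rule sum.cong[OF refl])
    fix i assume "i \<in> {..length p}"
    moreover have "x \<in> verts Q \<or> f (x, p) = 0"
      using f by (auto simp: path_algebra_simps paths_altdef)
    ultimately show "f (path_end Q (x, take i p), drop i p) * scl \<kappa> (x, take i p) =
        (if i = 0 then \<kappa> * f (x, p) else 0)"
      by (cases "p = []") (auto simp: scl_def path_algebra_simps)
  qed
  then show "(f \<otimes>\<^bsub>R0\<^esub> scl \<kappa>) z = \<kappa> * f z" by simp
qed

lemma sc_closed [simp]: "sc \<kappa> \<in> carrier R"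
  by (simp add: sc_quot quot_closed scl_carrier)

lemma sc_add: "sc (\<kappa> + \<mu>) = sc \<kappa> \<oplus>\<^bsub>R\<^esub> sc \<mu>"
  unfolding sc_quot quot_add[symmetric, OF scl_carrier scl_carrier]
  by (simp add: path_algebra_simps scl_def ring_distribs)

lemma sc_mult: "sc (\<kappa> * \<mu>) = sc \<kappa> \<otimes>\<^bsub>R\<^esub> sc \<mu>"
  unfolding sc_quot quot_mult[symmetric, OF scl_carrier scl_carrier] scl_mult_left[OF scl_carrier]
  by (simp add: scl_def mult.assoc)

lemma sc_one: "sc 1 = \<one>\<^bsub>R\<^esub>"
  by (simp add: sc_quot scl_def quot_one)

lemma sc_zero: "sc 0 = \<zero>\<^bsub>R\<^esub>"
  by (simp add: sc_quot scl_def quot_zero)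

lemma sc_central: "F \<in> carrier R \<Longrightarrow> sc \<kappa> \<otimes>\<^bsub>R\<^esub> F = F \<otimes>\<^bsub>R\<^esub> sc \<kappa>"
  using quot_surj[of F] by (auto simp: sc_quot scl_carrier scl_mult_left scl_mult_right simp flip: quot_mult)

lemma vtx_closed: "x \<in> verts Q \<Longrightarrow> vtx x \<in> carrier R"
  by (simp add: vtx_def quot_closed monomial_carrier)

lemma arr_closed: "a \<in> arcs Q \<Longrightarrow> arr a \<in> carrier R"
  by (simp add: arr_def quot_closed monomial_carrier paths_single wf_digraph)

text \<open>
  The quotient algebra is generated by scalars, vertices and arrows, so a statement about the
  action of all its elements only has to be checked for these.
\<close>
lemma R_induct [consumes 1, case_names add mult sc vtx arr]:
  assumes "F \<in> carrier R"
    and add: "\<And>F G. F \<in> carrier R \<Longrightarrow> G \<in> carrier R \<Longrightarrow> P F \<Longrightarrow> P G \<Longrightarrow> P (F \<oplus>\<^bsub>R\<^esub> G)"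
    and mult: "\<And>F G. F \<in> carrier R \<Longrightarrow> G \<in> carrier R \<Longrightarrow> P F \<Longrightarrow> P G \<Longrightarrow> P (F \<otimes>\<^bsub>R\<^esub> G)"
    and sc: "\<And>\<kappa>. P (sc \<kappa>)"
    and vtx: "\<And>x. x \<in> verts Q \<Longrightarrow> P (vtx x)"
    and arr: "\<And>a. a \<in> arcs Q \<Longrightarrow> P (arr a)"
  shows "P F"
proof -
  have path: "P (quot (monomial 1 (x, p)))" if "(x, p) \<in> paths Q" for x p
    using that
  proof (induction p rule: rev_induct)
    case Nil
    then show ?case using vtx by (simp add: vtx_def)
  next
    case (snoc a p)
    then have p: "(x, p) \<in> paths Q" "a \<in> arcs Q" "tail Q a = path_end Q (x, p)"
      by (auto simp: paths_snoc)
    have "quot (monomial 1 (x, p @ [a])) = arr a \<otimes>\<^bsub>R\<^esub> quot (monomial 1 (x, p))"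
      using p by (simp add: arr_def monomial_carrier paths_single wf_digraph monomial_mult flip: quot_mult)
    then show ?case using p snoc mult arr arr_closed quot_closed monomial_carrier by metis
  qed
  obtain f where f: "f \<in> carrier R0" "F = quot f" using quot_surj assms(1) by blast
  from f(1) have "P (quot f)"
  proof (induction f rule: path_algebra_induct)
    case zero
    then show ?case using sc[of 0] by (simp add: sc_zero quot_zero)
  next
    case (monomial \<kappa> p)
    have "quot (monomial \<kappa> p) = sc \<kappa> \<otimes>\<^bsub>R\<^esub> quot (monomial 1 p)"
      using monomial by (simp add: sc_quot scl_carrier monomial_carrier scl_mult_left flip: quot_mult)
        (simp add: monomial_def if_distrib cong: if_cong)
    then show ?case using monomial mult sc path quot_closed monomial_carrier sc_closed
      by (metis surj_pair)
  next
    case (add f g)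
    then show ?case using assms(2) quot_closed by (simp add: quot_add)
  qed
  then show ?thesis using f by simp
qed

lemma zero_comp_imp:
  assumes "zero_comp Q I b a"
  shows "a \<in> arcs Q" "b \<in> arcs Q" "head Q a = tail Q b"
proof -
  have "path_elt (tail Q a, [a, b]) \<in> carrier R0"
    using assms ideal by (metis zero_comp_def ideal.Icarr)
  then have "(tail Q a, [a, b]) \<in> paths Q" by (auto simp: path_algebra_simps path_elt_def)
  then have "(tail Q a, [a] @ [b]) \<in> paths Q" by simp
  then show "a \<in> arcs Q" "b \<in> arcs Q" "head Q a = tail Q b"
    by (auto simp: paths_altdef path_end_def pre_digraph.cas.simps)
qed

lemma arr_arr_zero: "zero_comp Q I b a \<Longrightarrow> arr b \<otimes>\<^bsub>R\<^esub> arr a = \<zero>\<^bsub>R\<^esub>"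
  using zero_comp_imp[of b a]
  by (simp add: arr_def monomial_carrier paths_single wf_digraph monomial_mult quot_eq_zero
      zero_comp_def path_elt_monomial path_end_def flip: quot_mult)

lemma vtx_vtx: "x \<in> verts Q \<Longrightarrow> y \<in> verts Q \<Longrightarrow>
    vtx x \<otimes>\<^bsub>R\<^esub> vtx y = (if x = y then vtx x else \<zero>\<^bsub>R\<^esub>)"
  by (auto simp: vtx_def monomial_carrier monomial_mult quot_zero simp flip: quot_mult)

lemma arr_vtx: "a \<in> arcs Q \<Longrightarrow> x \<in> verts Q \<Longrightarrow>
    arr a \<otimes>\<^bsub>R\<^esub> vtx x = (if x = tail Q a then arr a else \<zero>\<^bsub>R\<^esub>)"
  by (auto simp: vtx_def arr_def monomial_carrier monomial_mult paths_single wf_digraph quot_zero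
      simp flip: quot_mult)

lemma vtx_arr: "a \<in> arcs Q \<Longrightarrow> x \<in> verts Q \<Longrightarrow>
    vtx x \<otimes>\<^bsub>R\<^esub> arr a = (if x = head Q a then arr a else \<zero>\<^bsub>R\<^esub>)"
  by (auto simp: vtx_def arr_def monomial_carrier monomial_mult paths_single wf_digraph quot_zero
      path_end_def simp flip: quot_mult)

text \<open>
  The bounds on cardinalities in the definition of a gentle algebra are used as statements of
  uniqueness: of two arrows (three, for the arrows that start or end at a vertex) subject to the
  same condition, two coincide.
\<close>

lemma card_le_1D:
  assumes "finite A" "card A \<le> 1" "x \<in> A" "y \<in> A"
  shows "x = y"
  using assms by (metis One_nat_def card_le_Suc0_iff_eq)

lemma gentle_nonzero_left: "b \<in> arcs Q \<Longrightarrow> b' \<in> arcs Q \<Longrightarrow> a \<in> arcs Q \<Longrightarrow> head Q a = tail Q b \<Longrightarrow>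
    head Q a = tail Q b' \<Longrightarrow> \<not> zero_comp Q I b a \<Longrightarrow> \<not> zero_comp Q I b' a \<Longrightarrow> b = b'"
  using gentle finite_arcs
  by (intro card_le_1D[of "{b\<in>arcs Q. head Q a = tail Q b \<and> \<not> zero_comp Q I b a}"]) (auto simp: gentle_def)

lemma gentle_nonzero_right: "b \<in> arcs Q \<Longrightarrow> b' \<in> arcs Q \<Longrightarrow> a \<in> arcs Q \<Longrightarrow> head Q b = tail Q a \<Longrightarrow>
    head Q b' = tail Q a \<Longrightarrow> \<not> zero_comp Q I a b \<Longrightarrow> \<not> zero_comp Q I a b' \<Longrightarrow> b = b'"
  using gentle finite_arcs
  by (intro card_le_1D[of "{b\<in>arcs Q. head Q b = tail Q a \<and> \<not> zero_comp Q I a b}"]) (auto simp: gentle_def)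

lemma gentle_zero_right: "zero_comp Q I a b \<Longrightarrow> zero_comp Q I a b' \<Longrightarrow> b = b'"
  using gentle finite_arcs zero_comp_imp[of a b] zero_comp_imp[of a b']
  by (intro card_le_1D[of "{b\<in>arcs Q. head Q b = tail Q a \<and> zero_comp Q I a b}"]) (auto simp: gentle_def)

lemma card_le_2D:
  assumes "finite A" "card A \<le> 2" "x \<in> A" "y \<in> A" "z \<in> A" "x \<noteq> y" "x \<noteq> z"
  shows "y = z"
proof (rule ccontr)
  assume "y \<noteq> z"
  then have "card {x, y, z} = 3" using assms by simp
  moreover have "card {x, y, z} \<le> card A" using assms by (intro card_mono) auto
  ultimately show False using assms by simp
qed

lemma gentle_out: "a \<in> arcs Q \<Longrightarrow> b \<in> arcs Q \<Longrightarrow> b' \<in> arcs Q \<Longrightarrow> tail Q b = tail Q a \<Longrightarrow> tail Q b' = tail Q a \<Longrightarrow>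
    a \<noteq> b \<Longrightarrow> a \<noteq> b' \<Longrightarrow> b = b'"
  using gentle finite_arcs tail_verts[of a]
  by (intro card_le_2D[of "{b\<in>arcs Q. tail Q b = tail Q a}" a]) (auto simp: gentle_def)

lemma gentle_in: "a \<in> arcs Q \<Longrightarrow> b \<in> arcs Q \<Longrightarrow> b' \<in> arcs Q \<Longrightarrow> head Q b = head Q a \<Longrightarrow> head Q b' = head Q a \<Longrightarrow>
    a \<noteq> b \<Longrightarrow> a \<noteq> b' \<Longrightarrow> b = b'"
  using gentle finite_arcs head_verts[of a]
  by (intro card_le_2D[of "{b\<in>arcs Q. head Q b = head Q a}" a]) (auto simp: gentle_def)

end

section \<open>Modules given by diagrams\<close>

lemma arrow_act_add: "arrow_act ls nx wt a (\<lambda>j. y j + z j) = (\<lambda>j. arrow_act ls nx wt a y j + arrow_act ls nx wt a z j)"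
  unfolding arrow_act_def sum.distrib[symmetric]
  by (intro ext sum.cong refl) (auto split: letter.splits simp: algebra_simps)

lemma arrow_act_smult: "arrow_act ls nx wt a (\<lambda>j. \<kappa> * z j) = (\<lambda>j. \<kappa> * arrow_act ls nx wt a z j)"
  unfolding arrow_act_def sum_distrib_left
  by (intro ext sum.cong refl) (auto split: letter.splits simp: algebra_simps)

lemma arrow_act_zero [simp]: "arrow_act ls nx wt a (\<lambda>_. 0) = (\<lambda>_. 0)"
  using arrow_act_smult[of ls nx wt a 0 "\<lambda>_. 0"] by simp

lemma fold_arrow_act_add: "fold (arrow_act ls nx wt) p (\<lambda>j. y j + z j) =
    (\<lambda>j. fold (arrow_act ls nx wt) p y j + fold (arrow_act ls nx wt) p z j)"
  by (induction p arbitrary: y z) (simp_all add: arrow_act_add)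

lemma fold_arrow_act_smult: "fold (arrow_act ls nx wt) p (\<lambda>j. \<kappa> * z j) =
    (\<lambda>j. \<kappa> * fold (arrow_act ls nx wt) p z j)"
  by (induction p arbitrary: z) (simp_all add: arrow_act_smult)

lemma fold_arrow_act_zero [simp]: "fold (arrow_act ls nx wt) p (\<lambda>_. 0) = (\<lambda>_. 0)"
  by (induction p) simp_all

lemma path_act_add: "path_act N lab ls nx wt p (\<lambda>j. y j + z j) =
    (\<lambda>j. path_act N lab ls nx wt p y j + path_act N lab ls nx wt p z j)"
proof -
  have "vertex_act N lab x (\<lambda>j. y j + z j) = (\<lambda>j. vertex_act N lab x y j + vertex_act N lab x z j)" for x
    by (auto simp: vertex_act_def)
  then show ?thesis by (cases p) (simp add: fold_arrow_act_add)
qed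

lemma path_act_smult: "path_act N lab ls nx wt p (\<lambda>j. \<kappa> * z j) = (\<lambda>j. \<kappa> * path_act N lab ls nx wt p z j)"
proof -
  have "vertex_act N lab x (\<lambda>j. \<kappa> * z j) = (\<lambda>j. \<kappa> * vertex_act N lab x z j)" for x
    by (auto simp: vertex_act_def)
  then show ?thesis by (cases p) (simp add: fold_arrow_act_smult)
qed

lemma path_act_zero [simp]: "path_act N lab ls nx wt p (\<lambda>_. 0) = (\<lambda>_. 0)"
  using path_act_smult[of N lab ls nx wt p 0 "\<lambda>_. 0"] by simp

text \<open>
  String and band modules are treated together. The conditions say that the letters join the basis
  vectors at the right vertices and that zero relations act as zero; by the last one the ideal
  acts as zero, so that the action of a coset does not depend on the representative.
\<close>
locale diagram = gentle_quiver Q I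
  for Q :: "('v, 'a) pre_digraph" and I :: "(('v, 'a) path \<Rightarrow> 'k::field) set" +
  fixes N :: nat and lab :: "nat \<Rightarrow> 'v" and ls :: "'a letter list" and nx :: "nat \<Rightarrow> nat"
    and wt :: "nat \<Rightarrow> 'k"
  assumes nx_less: "k < length ls \<Longrightarrow> k < N \<and> nx k < N"
    and lab_verts: "j < N \<Longrightarrow> lab j \<in> verts Q"
    and letter_arcs: "k < length ls \<Longrightarrow> letter_arrow (ls ! k) \<in> arcs Q"
    and joins: "k < length ls \<Longrightarrow> lab k = letter_start Q (ls ! k) \<and> lab (nx k) = letter_end Q (ls ! k)"
    and relations: "zero_comp Q I b a \<Longrightarrow> arrow_act ls nx wt b (arrow_act ls nx wt a z) = (\<lambda>_. 0)"
begin

abbreviation D :: "((('v, 'a) path \<Rightarrow> 'k) set, nat \<Rightarrow> 'k) module" where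
  "D \<equiv> diagram_module N lab ls nx wt"
abbreviation pact where "pact \<equiv> path_act N lab ls nx wt"
abbreviation act where "act \<equiv> path_algebra_act N lab ls nx wt"

lemma arrow_act_nonzero:
  assumes "arrow_act ls nx wt a z j \<noteq> 0"
  shows "a \<in> arcs Q" "j < N" "lab j = head Q a"
proof -
  have "\<exists>k<length ls. (case ls ! k of Dir b \<Rightarrow> if b = a \<and> j = nx k then wt k * z k else 0
     | Inv b \<Rightarrow> if b = a \<and> j = k then z (nx k) else 0) \<noteq> 0"
    using assms unfolding arrow_act_def by (metis (no_types, lifting) lessThan_iff sum.neutral)
  then obtain k where k0: "k < length ls" "(case ls ! k of Dir b \<Rightarrow> if b = a \<and> j = nx k then wt k * z k else 0
     | Inv b \<Rightarrow> if b = a \<and> j = k then z (nx k) else 0) \<noteq> 0" by blast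
  then have k: "k < length ls" "letter_arrow (ls ! k) = a"
      "(ls ! k = Dir a \<and> j = nx k) \<or> (ls ! k = Inv a \<and> j = k)"
    by (cases "ls ! k"; simp split: if_splits)+
  show "a \<in> arcs Q" "j < N" "lab j = head Q a"
    using k letter_arcs[of k] nx_less[of k] joins[of k] by (cases "ls ! k"; auto)+
qed

lemma arrow_act_cong:
  assumes "\<And>j. j < N \<Longrightarrow> lab j = tail Q a \<Longrightarrow> y j = z j"
  shows "arrow_act ls nx wt a y = arrow_act ls nx wt a z"
  unfolding arrow_act_def
proof (intro ext sum.cong refl)
  fix j k assume "k \<in> {..<length ls}"
  then show "(case ls ! k of Dir b \<Rightarrow> if b = a \<and> j = nx k then wt k * y k else 0
     | Inv b \<Rightarrow> if b = a \<and> j = k then y (nx k) else 0) =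
     (case ls ! k of Dir b \<Rightarrow> if b = a \<and> j = nx k then wt k * z k else 0
     | Inv b \<Rightarrow> if b = a \<and> j = k then z (nx k) else 0)"
    using nx_less[of k] joins[of k] assms by (auto split: letter.splits)
qed

lemma arrow_vertex_act: "arrow_act ls nx wt a (vertex_act N lab x z) =
    (if x = tail Q a then arrow_act ls nx wt a z else (\<lambda>_. 0))"
proof (cases "x = tail Q a")
  case True
  then show ?thesis by (auto simp: vertex_act_def intro: arrow_act_cong)
next
  case False
  then have "arrow_act ls nx wt a (vertex_act N lab x z) = arrow_act ls nx wt a (\<lambda>_. 0)"
    by (intro arrow_act_cong) (auto simp: vertex_act_def)
  then show ?thesis using False by simp
qed

lemma vertex_arrow_act: "vertex_act N lab x (arrow_act ls nx wt a z) =
    (if x = head Q a then arrow_act ls nx wt a z else (\<lambda>_. 0))"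
proof (rule ext)
  fix j
  show "vertex_act N lab x (arrow_act ls nx wt a z) j =
    (if x = head Q a then arrow_act ls nx wt a z else (\<lambda>_. 0)) j"
    using arrow_act_nonzero[of a z j]
    by (cases "arrow_act ls nx wt a z j = 0") (auto simp: vertex_act_def)
qed

lemma vertex_path_act:
  "vertex_act N lab y (pact (x, p) z) = (if y = path_end Q (x, p) then pact (x, p) z else (\<lambda>_. 0))"
proof (cases p rule: rev_cases)
  case Nil
  then show ?thesis by (auto simp: vertex_act_def)
next
  case (snoc r a)
  then show ?thesis by (simp add: vertex_arrow_act)
qed

lemma path_act_path_act:
  "pact (y, q) (pact (x, p) z) = (if y = path_end Q (x, p) then pact (x, p @ q) z else (\<lambda>_. 0))"
proof -
  have "pact (y, q) (pact (x, p) z) = fold (arrow_act ls nx wt) q (vertex_act N lab y (pact (x, p) z))"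
    by simp
  then show ?thesis unfolding vertex_path_act by auto
qed

lemma act_superset:
  assumes "finite S" "{p. f p \<noteq> 0} \<subseteq> S"
  shows "act f z j = (\<Sum>p\<in>S. f p * pact p z j)"
  unfolding path_algebra_act_def using assms by (intro sum.mono_neutral_left) auto

lemma act_monomial: "act (monomial \<kappa> p) z = (\<lambda>j. \<kappa> * pact p z j)"
proof (rule ext)
  show "act (monomial \<kappa> p) z j = \<kappa> * pact p z j" for j
    using act_superset[of "{p}" "monomial \<kappa> p" z j]
    by (simp add: monomial_def subset_iff del: path_act.simps)
qed

lemma act_zero [simp]: "act (\<lambda>_. 0) z = (\<lambda>_. 0)"
  by (simp add: path_algebra_act_def)

lemma act_add:
  assumes "f \<in> carrier R0" "g \<in> carrier R0"
  shows "act (f \<oplus>\<^bsub>R0\<^esub> g) z = (\<lambda>j. act f z j + act g z j)"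
proof (rule ext)
  fix j
  let ?S = "{p. f p \<noteq> 0} \<union> {p. g p \<noteq> 0}"
  have S: "finite ?S" using assms by (auto simp: path_algebra_simps)
  have "{p. f p + g p \<noteq> 0} \<subseteq> ?S" by auto
  then have "act (f \<oplus>\<^bsub>R0\<^esub> g) z j = (\<Sum>p\<in>?S. (f p + g p) * pact p z j)"
    by (simp add: path_algebra_simps act_superset[OF S])
  also have "\<dots> = act f z j + act g z j"
    using act_superset[OF S, of f z j] act_superset[OF S, of g z j]
    by (simp add: ring_distribs sum.distrib)
  finally show "act (f \<oplus>\<^bsub>R0\<^esub> g) z j = act f z j + act g z j" .
qed

lemma act_vec_add: "act f (\<lambda>j. y j + z j) = (\<lambda>j. act f y j + act f z j)"
  by (simp add: path_algebra_act_def path_act_add ring_distribs sum.distrib)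

lemma act_vec_smult: "act f (\<lambda>j. \<kappa> * z j) = (\<lambda>j. \<kappa> * act f z j)"
  by (simp add: path_algebra_act_def path_act_smult sum_distrib_left algebra_simps)

lemma act_vec_zero [simp]: "act f (\<lambda>_. 0) = (\<lambda>_. 0)"
  by (simp add: path_algebra_act_def)

lemma act_mult:
  assumes "f \<in> carrier R0" "g \<in> carrier R0"
  shows "act (f \<otimes>\<^bsub>R0\<^esub> g) z = act f (act g z)"
  using assms(1)
proof (induction f rule: path_algebra_induct)
  case zero
  have "(\<lambda>_. 0) \<otimes>\<^bsub>R0\<^esub> g = (\<lambda>_. 0)"
    using ring.ring_simprules(24)[OF ring_R0 assms(2)] by (simp add: path_algebra_simps)
  then show ?case by simp
next
  case (monomial \<kappa> p)
  from assms(2) show ?case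
  proof (induction g rule: path_algebra_induct)
    case zero
    have "monomial \<kappa> p \<otimes>\<^bsub>R0\<^esub> (\<lambda>_. 0) = (\<lambda>_. 0)"
      using ring.ring_simprules(25)[OF ring_R0 monomial_carrier[OF monomial]] by (simp add: path_algebra_simps)
    then show ?case by simp
  next
    case (monomial \<mu> q)
    obtain y p' x q' where "p = (y, p')" "q = (x, q')" by (metis surj_pair)
    then show ?case
      by (auto simp: monomial_mult act_monomial act_vec_smult path_act_path_act path_act_smult
          mult.assoc simp del: path_act.simps)
  next
    case (add f g)
    note m = monomial_carrier[OF \<open>p \<in> paths Q\<close>, of \<kappa>]
    have "monomial \<kappa> p \<otimes>\<^bsub>R0\<^esub> (f \<oplus>\<^bsub>R0\<^esub> g) = monomial \<kappa> p \<otimes>\<^bsub>R0\<^esub> f \<oplus>\<^bsub>R0\<^esub> monomial \<kappa> p \<otimes>\<^bsub>R0\<^esub> g"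
      using add m by (intro ring.ring_simprules(23)[OF ring_R0])
    then show ?case using add m ring_R0
      by (simp add: act_add act_vec_add ring.ring_simprules(5))
  qed
next
  case (add f f')
  then show ?case using ring_R0 assms(2)
    by (simp add: ring.ring_simprules(13) act_add ring.ring_simprules(5))
qed

lemma arrow_act_carrier: "j \<ge> N \<Longrightarrow> arrow_act ls nx wt a z j = 0"
  using arrow_act_nonzero(2)[of a z j] by fastforce

lemma path_act_carrier: "j \<ge> N \<Longrightarrow> pact p z j = 0"
proof -
  assume j: "j \<ge> N"
  obtain x r where "p = (x, r)" by (cases p)
  then show ?thesis
    using j by (cases r rule: rev_cases) (auto simp: vertex_act_def arrow_act_carrier)
qed

lemma act_carrier: "j \<ge> N \<Longrightarrow> act f z j = 0"
  by (simp add: path_algebra_act_def path_act_carrier)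

text \<open>
  The elements that act as zero form a two-sided ideal, and it contains the generators of \<open>I\<close>,
  because these are paths of length two which act as zero.
\<close>
lemma ideal_act_zero: "f \<in> I \<Longrightarrow> act f z = (\<lambda>_. 0)"
proof -
  assume f: "f \<in> I"
  define J where "J = {f \<in> carrier R0. \<forall>z. act f z = (\<lambda>_. 0)}"
  obtain S where S: "S \<subseteq> {p \<in> paths Q. length (snd p) = 2}" "I = genideal R0 (path_elt ` S)"
    using gentle by (auto simp: gentle_def)
  have "ideal J R0"
  proof (rule idealI[OF ring_R0])
    show "subgroup J (add_monoid R0)"
    proof (rule group.subgroupI)
      show "group (add_monoid R0)"
        by (rule abelian_group.a_group[OF ring.is_abelian_group[OF ring_R0]])
      show "J \<subseteq> carrier (add_monoid R0)" by (auto simp: J_def)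
      show "J \<noteq> {}" using ring.ring_simprules(2)[OF ring_R0] by (auto simp: J_def path_algebra_simps)
      show "a \<otimes>\<^bsub>add_monoid R0\<^esub> b \<in> J" if "a \<in> J" "b \<in> J" for a b
        using that ring.ring_simprules(1)[OF ring_R0] by (simp add: J_def act_add)
      show "inv\<^bsub>add_monoid R0\<^esub> a \<in> J" if "a \<in> J" for a
      proof -
        have a: "a \<in> carrier R0" "\<And>z. act a z = (\<lambda>_. 0)" using that by (auto simp: J_def)
        have m: "\<ominus>\<^bsub>R0\<^esub> a \<in> carrier R0" using a ring_R0 by (simp add: ring.ring_simprules(3))
        have "act (\<ominus>\<^bsub>R0\<^esub> a \<oplus>\<^bsub>R0\<^esub> a) z = act (\<ominus>\<^bsub>R0\<^esub> a) z" for z using act_add[OF m a(1)] a by simp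
        moreover have "\<ominus>\<^bsub>R0\<^esub> a \<oplus>\<^bsub>R0\<^esub> a = (\<lambda>_. 0)" using a ring_R0
          by (simp add: ring.ring_simprules(9) path_algebra_simps(3))
        ultimately show ?thesis using m by (simp add: J_def a_inv_def)
      qed
    qed
    show "x \<otimes>\<^bsub>R0\<^esub> a \<in> J" "a \<otimes>\<^bsub>R0\<^esub> x \<in> J" if "a \<in> J" "x \<in> carrier R0" for a x
      using that ring.ring_simprules(5)[OF ring_R0] by (auto simp: J_def act_mult)
  qed
  moreover have "path_elt ` S \<subseteq> J"
  proof
    fix e :: "('v, 'a) path \<Rightarrow> 'k" assume "e \<in> path_elt ` S"
    then obtain x p where p: "(x, p) \<in> S" "e = path_elt (x, p)" by auto
    have car: "e \<in> carrier R0" using p S by (auto simp: path_elt_monomial monomial_carrier)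
    have "path_elt ` S \<subseteq> carrier R0" using S by (auto simp: path_elt_monomial monomial_carrier)
    then have e: "e \<in> I" using S p ring.genideal_self[OF ring_R0, of "path_elt ` S"] by auto
    obtain a b where ab: "p = [a, b]" using p S by (auto simp: length_Suc_conv numeral_2_eq_2)
    have "([] @ [a]) @ [b] = p" using ab by simp
    moreover have "(x, p) \<in> paths Q" using p S by auto
    ultimately have "x = tail Q a" using paths_snoc[of x "[] @ [a]" b Q] paths_snoc[of x "[]" a Q] by simp
    then have "zero_comp Q I b a" using e ab p by (simp add: zero_comp_def)
    then have "pact (x, p) z = (\<lambda>_. 0)" for z using ab by (simp add: relations)
    then show "e \<in> J" using car p by (simp add: J_def path_elt_monomial act_monomial del: path_act.simps)
  qed
  ultimately have "I \<subseteq> J" using S ring.genideal_minimal[OF ring_R0] by blast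
  then show ?thesis using f by (auto simp: J_def)
qed

lemma smult_D: "f \<in> carrier R0 \<Longrightarrow> quot f \<odot>\<^bsub>D\<^esub> z = act f z"
proof -
  assume f: "f \<in> carrier R0"
  have q: "quot f = {h \<oplus>\<^bsub>R0\<^esub> f | h. h \<in> I}"
    by (auto simp: quot_def a_r_coset_def' )
  have "act (h \<oplus>\<^bsub>R0\<^esub> f) z = act f z" if "h \<in> I" for h
    using that f act_add[of h f z] ideal_act_zero[OF that] ideal.Icarr[OF ideal that] by simp
  moreover have "\<exists>h. h \<in> I" using ideal additive_subgroup.zero_closed ideal.axioms(1) by blast
  moreover have "(\<lambda>f. act f z) ` quot f = (\<lambda>h. act (h \<oplus>\<^bsub>R0\<^esub> f) z) ` I" unfolding q by auto
  ultimately have "(\<lambda>f. act f z) ` quot f = {act f z}" by auto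
  then show ?thesis by (simp add: diagram_module_def)
qed

lemma D_simps:
  "z \<in> carrier D \<longleftrightarrow> (\<forall>j\<ge>N. z j = 0)"
  "y \<oplus>\<^bsub>D\<^esub> z = (\<lambda>j. y j + z j)"
  "\<zero>\<^bsub>D\<^esub> = (\<lambda>_. 0)"
  by (auto simp: diagram_module_def)

lemma act_one: "z \<in> carrier D \<Longrightarrow> act \<one>\<^bsub>R0\<^esub> z = z"
proof (rule ext)
  fix j assume z: "z \<in> carrier D"
  have S: "finite ((\<lambda>x. (x, [])) ` verts Q)" using finite_verts by simp
  have "act \<one>\<^bsub>R0\<^esub> z j = (\<Sum>p\<in>(\<lambda>x. (x, [])) ` verts Q. \<one>\<^bsub>R0\<^esub> p * pact p z j)"
    by (rule act_superset[OF S]) (auto simp: path_algebra_simps split: if_splits)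
  also have "\<dots> = (\<Sum>x\<in>verts Q. if x = lab j then (if j < N then z j else 0) else 0)"
    by (subst sum.reindex) (auto simp: inj_on_def path_algebra_simps vertex_act_def intro!: sum.cong)
  also have "\<dots> = z j" using z lab_verts[of j] finite_verts by (auto simp: D_simps)
  finally show "act \<one>\<^bsub>R0\<^esub> z j = z j" .
qed

lemma left_module_D: "left_module R D"
proof (intro left_module.intro ring_R left_module_axioms.intro)
  show "abelian_group D"
  proof (rule abelian_groupI)
    fix x assume x: "x \<in> carrier D"
    have "(\<lambda>j. - x j) \<in> carrier D" "(\<lambda>j. - x j) \<oplus>\<^bsub>D\<^esub> x = \<zero>\<^bsub>D\<^esub>" using x by (auto simp: D_simps)
    then show "\<exists>y\<in>carrier D. y \<oplus>\<^bsub>D\<^esub> x = \<zero>\<^bsub>D\<^esub>" by blast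
  qed (auto simp: D_simps algebra_simps)
next
  fix r x assume "r \<in> carrier R" "x \<in> carrier D"
  then show "r \<odot>\<^bsub>D\<^esub> x \<in> carrier D"
    using quot_surj[of r] by (auto simp: smult_D D_simps(1) act_carrier)
next
  fix r s x assume "r \<in> carrier R" "s \<in> carrier R" "x \<in> carrier D"
  then show "(r \<oplus>\<^bsub>R\<^esub> s) \<odot>\<^bsub>D\<^esub> x = r \<odot>\<^bsub>D\<^esub> x \<oplus>\<^bsub>D\<^esub> s \<odot>\<^bsub>D\<^esub> x"
    using quot_surj[of r] quot_surj[of s] ring.ring_simprules(1)[OF ring_R0]
    by (auto simp: smult_D D_simps act_add simp flip: quot_add)
next
  fix r x y assume "r \<in> carrier R" "x \<in> carrier D" "y \<in> carrier D"
  then show "r \<odot>\<^bsub>D\<^esub> (x \<oplus>\<^bsub>D\<^esub> y) = r \<odot>\<^bsub>D\<^esub> x \<oplus>\<^bsub>D\<^esub> r \<odot>\<^bsub>D\<^esub> y"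
    using quot_surj[of r] by (auto simp: smult_D D_simps act_vec_add)
next
  fix r s x assume "r \<in> carrier R" "s \<in> carrier R" "x \<in> carrier D"
  then show "(r \<otimes>\<^bsub>R\<^esub> s) \<odot>\<^bsub>D\<^esub> x = r \<odot>\<^bsub>D\<^esub> (s \<odot>\<^bsub>D\<^esub> x)"
    using quot_surj[of r] quot_surj[of s] ring.ring_simprules(5)[OF ring_R0]
    by (auto simp: smult_D act_mult simp flip: quot_mult)
next
  fix x assume "x \<in> carrier D"
  then show "\<one>\<^bsub>R\<^esub> \<odot>\<^bsub>D\<^esub> x = x"
    using ring.ring_simprules(6)[OF ring_R0] by (simp add: smult_D act_one flip: quot_one)
qed

lemma sc_smult_D: "z \<in> carrier D \<Longrightarrow> sc \<kappa> \<odot>\<^bsub>D\<^esub> z = (\<lambda>j. \<kappa> * z j)"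
proof -
  assume z: "z \<in> carrier D"
  have "sc \<kappa> \<odot>\<^bsub>D\<^esub> z = act (scl \<kappa>) z" by (simp add: sc_quot smult_D scl_carrier)
  also have "act (scl \<kappa>) z = (\<lambda>j. \<kappa> * act \<one>\<^bsub>R0\<^esub> z j)"
  proof (rule ext)
    fix j
    have S: "finite {p. \<one>\<^bsub>R0\<^esub> p \<noteq> 0}"
      using ring.ring_simprules(6)[OF ring_R0] path_algebra_simps(1) by blast
    have "act (scl \<kappa>) z j = (\<Sum>p | \<one>\<^bsub>R0\<^esub> p \<noteq> 0. scl \<kappa> p * pact p z j)"
      by (rule act_superset[OF S]) (auto simp: scl_def)
    then show "act (scl \<kappa>) z j = \<kappa> * act \<one>\<^bsub>R0\<^esub> z j"
      by (simp add: path_algebra_act_def scl_def sum_distrib_left mult.assoc)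
  qed
  finally show ?thesis using act_one[OF z] by simp
qed

lemma vtx_smult_D: "x \<in> verts Q \<Longrightarrow> vtx x \<odot>\<^bsub>D\<^esub> z = vertex_act N lab x z"
  by (simp add: vtx_def smult_D monomial_carrier act_monomial)

lemma arr_smult_D: "a \<in> arcs Q \<Longrightarrow> arr a \<odot>\<^bsub>D\<^esub> z = arrow_act ls nx wt a z"
  by (simp add: arr_def smult_D monomial_carrier paths_single wf_digraph act_monomial arrow_vertex_act)

end


lemma (in gentle_quiver) module_hom_generatorsI:
  assumes M: "left_module R M" and N: "left_module R N"
    and maps: "\<And>x. x \<in> carrier M \<Longrightarrow> \<phi> x \<in> carrier N"
    and add: "\<And>x y. x \<in> carrier M \<Longrightarrow> y \<in> carrier M \<Longrightarrow> \<phi> (x \<oplus>\<^bsub>M\<^esub> y) = \<phi> x \<oplus>\<^bsub>N\<^esub> \<phi> y"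
    and sc: "\<And>\<kappa> x. x \<in> carrier M \<Longrightarrow> \<phi> (sc \<kappa> \<odot>\<^bsub>M\<^esub> x) = sc \<kappa> \<odot>\<^bsub>N\<^esub> \<phi> x"
    and vtx: "\<And>v x. v \<in> verts Q \<Longrightarrow> x \<in> carrier M \<Longrightarrow> \<phi> (vtx v \<odot>\<^bsub>M\<^esub> x) = vtx v \<odot>\<^bsub>N\<^esub> \<phi> x"
    and arr: "\<And>a x. a \<in> arcs Q \<Longrightarrow> x \<in> carrier M \<Longrightarrow> \<phi> (arr a \<odot>\<^bsub>M\<^esub> x) = arr a \<odot>\<^bsub>N\<^esub> \<phi> x"
  shows "\<phi> \<in> module_hom R M N"
proof -
  have "\<forall>x\<in>carrier M. \<phi> (F \<odot>\<^bsub>M\<^esub> x) = F \<odot>\<^bsub>N\<^esub> \<phi> x" if "F \<in> carrier R" for F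
    using that
  proof (induction F rule: R_induct)
    case (add F G)
    then show ?case using assms(4) M N maps
      by (simp add: left_module.smult_l_distr left_module.smult_closed)
  next
    case (mult F G)
    then show ?case using M N maps by (simp add: left_module.smult_assoc left_module.smult_closed)
  qed (use assms in auto)
  then show ?thesis using maps add by (auto simp: module_hom_def)
qed

section \<open>Lifting bases along extensions\<close>

lemma (in left_module) smult_zero_right: "r \<in> carrier R \<Longrightarrow> r \<odot>\<^bsub>M\<^esub> \<zero>\<^bsub>M\<^esub> = \<zero>\<^bsub>M\<^esub>"
  using smult_r_distr[of r "\<zero>\<^bsub>M\<^esub>" "\<zero>\<^bsub>M\<^esub>"] smult_closed[of r "\<zero>\<^bsub>M\<^esub>"]
  by (simp add: M.add.l_cancel_one)

lemma (in left_module) smult_zero_left: "x \<in> carrier M \<Longrightarrow> \<zero>\<^bsub>R\<^esub> \<odot>\<^bsub>M\<^esub> x = \<zero>\<^bsub>M\<^esub>"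
  using smult_l_distr[of "\<zero>\<^bsub>R\<^esub>" "\<zero>\<^bsub>R\<^esub>" x] smult_closed[of "\<zero>\<^bsub>R\<^esub>" x]
  by (simp add: M.add.l_cancel_one)

lemma (in left_module) smult_minus_right:
  assumes "r \<in> carrier R" "x \<in> carrier M" shows "r \<odot>\<^bsub>M\<^esub> (\<ominus>\<^bsub>M\<^esub> x) = \<ominus>\<^bsub>M\<^esub> (r \<odot>\<^bsub>M\<^esub> x)"
proof -
  have "r \<odot>\<^bsub>M\<^esub> (\<ominus>\<^bsub>M\<^esub> x) \<oplus>\<^bsub>M\<^esub> r \<odot>\<^bsub>M\<^esub> x = \<zero>\<^bsub>M\<^esub>"
    using assms by (simp add: M.l_neg smult_zero_right flip: smult_r_distr)
  then show ?thesis using assms by (simp add: M.minus_equality smult_closed)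
qed

lemma (in left_module) smult_minus_left:
  assumes "r \<in> carrier R" "x \<in> carrier M" shows "(\<ominus>\<^bsub>R\<^esub> r) \<odot>\<^bsub>M\<^esub> x = \<ominus>\<^bsub>M\<^esub> (r \<odot>\<^bsub>M\<^esub> x)"
proof -
  have "(\<ominus>\<^bsub>R\<^esub> r) \<odot>\<^bsub>M\<^esub> x \<oplus>\<^bsub>M\<^esub> r \<odot>\<^bsub>M\<^esub> x = \<zero>\<^bsub>M\<^esub>"
    using assms by (simp add: R.l_neg smult_zero_left flip: smult_l_distr)
  then show ?thesis using assms by (simp add: M.minus_equality smult_closed)
qed

lemma module_hom_zero:
  assumes "left_module R M" "left_module R N" "\<phi> \<in> module_hom R M N"
  shows "\<phi> \<zero>\<^bsub>M\<^esub> = \<zero>\<^bsub>N\<^esub>"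
proof -
  interpret M: left_module R M by fact
  interpret N: left_module R N by fact
  have "\<phi> \<zero>\<^bsub>M\<^esub> \<oplus>\<^bsub>N\<^esub> \<phi> \<zero>\<^bsub>M\<^esub> = \<phi> \<zero>\<^bsub>M\<^esub>" "\<phi> \<zero>\<^bsub>M\<^esub> \<in> carrier N"
    using assms(3) module_hom_add[of \<phi> R M N "\<zero>\<^bsub>M\<^esub>" "\<zero>\<^bsub>M\<^esub>"] module_hom_closed[of \<phi> R M N] by auto
  then show ?thesis by (simp add: N.M.add.l_cancel_one)
qed

lemma module_hom_carrier: "\<phi> \<in> module_hom R M N \<Longrightarrow> x \<in> carrier M \<Longrightarrow> \<phi> x \<in> carrier N"
  using module_hom_closed by blast

lemma module_hom_minus:
  assumes "left_module R M" "left_module R N" "\<phi> \<in> module_hom R M N" "x \<in> carrier M"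
  shows "\<phi> (\<ominus>\<^bsub>M\<^esub> x) = \<ominus>\<^bsub>N\<^esub> \<phi> x"
proof -
  interpret M: left_module R M by fact
  interpret N: left_module R N by fact
  have "\<phi> (\<ominus>\<^bsub>M\<^esub> x) \<oplus>\<^bsub>N\<^esub> \<phi> x = \<zero>\<^bsub>N\<^esub>"
    using assms module_hom_zero[OF assms(1-3)]
    by (simp add: M.M.l_neg flip: module_hom_add[OF assms(3)])
  then show ?thesis using assms by (simp add: N.M.minus_equality module_hom_carrier)
qed

abbreviation basis_vec :: "nat \<Rightarrow> nat \<Rightarrow> 'k::field" where
  "basis_vec i \<equiv> (\<lambda>j. if j = i then 1 else 0)"

context gentle_quiver
begin

text \<open>
  The linear combination \<open>\<Sum>i<n. x\<^sub>i e\<^sub>i\<close>. When the \<open>e\<^sub>i\<close> lift the basis vectors of \<open>X\<close> to the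
  middle term \<open>E\<close> of an extension, \<open>comb E e n\<close> is a linear section of \<open>E \<rightarrow> X\<close>.
\<close>
primrec comb :: "((('v, 'a) path \<Rightarrow> 'k) set, 'm) module \<Rightarrow> (nat \<Rightarrow> 'm) \<Rightarrow> nat \<Rightarrow> (nat \<Rightarrow> 'k) \<Rightarrow> 'm" where
  "comb M e 0 x = \<zero>\<^bsub>M\<^esub>"
| "comb M e (Suc n) x = comb M e n x \<oplus>\<^bsub>M\<^esub> (sc (x n) \<odot>\<^bsub>M\<^esub> e n)"

lemma comb_closed:
  assumes "left_module R M" "\<And>i. i < n \<Longrightarrow> e i \<in> carrier M"
  shows "comb M e n x \<in> carrier M"
proof -
  interpret left_module R M by fact
  show ?thesis using assms(2) by (induction n) (auto simp: smult_closed)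
qed

lemma comb_cong: "(\<And>i. i < n \<Longrightarrow> e i = e' i) \<Longrightarrow> (\<And>i. i < n \<Longrightarrow> x i = x' i) \<Longrightarrow> comb M e n x = comb M e' n x'"
  by (induction n) auto

lemma comb_add:
  assumes "left_module R M" "\<And>i. i < n \<Longrightarrow> e i \<in> carrier M"
  shows "comb M e n (\<lambda>j. x j + y j) = comb M e n x \<oplus>\<^bsub>M\<^esub> comb M e n y"
proof -
  interpret left_module R M by fact
  show ?thesis using assms(2)
    by (induction n) (auto simp: sc_add smult_l_distr smult_closed comb_closed[OF assms(1)] M.a_ac)
qed

lemma comb_plus:
  assumes "left_module R M" "\<And>i. i < n \<Longrightarrow> e i \<in> carrier M" "\<And>i. i < n \<Longrightarrow> f i \<in> carrier M"
  shows "comb M (\<lambda>i. e i \<oplus>\<^bsub>M\<^esub> f i) n x = comb M e n x \<oplus>\<^bsub>M\<^esub> comb M f n x"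
proof -
  interpret left_module R M by fact
  show ?thesis using assms(2,3)
    by (induction n) (auto simp: smult_r_distr smult_closed comb_closed[OF assms(1)] M.a_ac)
qed

lemma comb_smult:
  assumes "left_module R M" "\<And>i. i < n \<Longrightarrow> e i \<in> carrier M" "F \<in> carrier R"
  shows "F \<odot>\<^bsub>M\<^esub> comb M e n x = comb M (\<lambda>i. F \<odot>\<^bsub>M\<^esub> e i) n x"
proof -
  interpret left_module R M by fact
  have "F \<odot>\<^bsub>M\<^esub> (sc \<kappa> \<odot>\<^bsub>M\<^esub> z) = sc \<kappa> \<odot>\<^bsub>M\<^esub> (F \<odot>\<^bsub>M\<^esub> z)" if "z \<in> carrier M" for z \<kappa>
    using that assms(3) by (simp add: sc_central flip: smult_assoc)
  then show ?thesis using assms(2,3)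
    by (induction n) (auto simp: smult_zero_right smult_r_distr smult_closed comb_closed[OF assms(1)])
qed

lemma comb_scale:
  assumes "left_module R M" "\<And>i. i < n \<Longrightarrow> e i \<in> carrier M"
  shows "comb M e n (\<lambda>j. \<kappa> * x j) = sc \<kappa> \<odot>\<^bsub>M\<^esub> comb M e n x"
proof -
  interpret left_module R M by fact
  show ?thesis using assms(2)
    by (induction n) (auto simp: smult_zero_right sc_mult smult_assoc smult_r_distr smult_closed comb_closed[OF assms(1)])
qed

lemma comb_zero: "left_module R M \<Longrightarrow> (\<And>i. i < n \<Longrightarrow> e i \<in> carrier M) \<Longrightarrow> comb M e n (\<lambda>_. 0) = \<zero>\<^bsub>M\<^esub>"
  using comb_scale[of M n e 0 "\<lambda>_. 0"] comb_closed[of M n e]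
  by (simp add: sc_zero left_module.smult_zero_left)

lemma comb_basis_vec:
  assumes "left_module R M" "\<And>i. i < n \<Longrightarrow> e i \<in> carrier M" "i < n"
  shows "comb M e n (basis_vec i) = e i"
proof -
  interpret left_module R M by fact
  show ?thesis using assms(2,3)
  proof (induction n)
    case (Suc n)
    then show ?case
    proof (cases "i = n")
      case True
      have "comb M e n (basis_vec n) = comb M e n (\<lambda>_. 0)" by (rule comb_cong) auto
      then show ?thesis using True Suc by (simp add: comb_zero[OF assms(1)] sc_one smult_one)
    next
      case False
      then show ?thesis using Suc by (auto simp: sc_zero smult_zero_left)
    qed
  qed simp
qed

lemma comb_hom:
  assumes "left_module R M" "left_module R N" "\<phi> \<in> module_hom R M N" "\<And>i. i < n \<Longrightarrow> e i \<in> carrier M"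
  shows "\<phi> (comb M e n x) = comb N (\<lambda>i. \<phi> (e i)) n x"
  using assms(4)
  by (induction n) (auto simp: module_hom_zero[OF assms(1-3)] module_hom_add[OF assms(3)]
      module_hom_smult[OF assms(3)] comb_closed[OF assms(1)] left_module.smult_closed[OF assms(1)])

text \<open>
  All modules of the theorem have a coordinate space as underlying vector space; for them sections
  and linear combinations can be computed coordinate by coordinate.
\<close>

definition coord_module :: "nat \<Rightarrow> ((('v, 'a) path \<Rightarrow> 'k) set, nat \<Rightarrow> 'k) module \<Rightarrow> bool" where
  "coord_module n X \<longleftrightarrow> left_module R X \<and> carrier X = {z. \<forall>j\<ge>n. z j = 0} \<and>
     (\<forall>y z. y \<oplus>\<^bsub>X\<^esub> z = (\<lambda>j. y j + z j)) \<and> \<zero>\<^bsub>X\<^esub> = (\<lambda>_. 0) \<and>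
     (\<forall>z\<in>carrier X. \<forall>\<kappa>. sc \<kappa> \<odot>\<^bsub>X\<^esub> z = (\<lambda>j. \<kappa> * z j))"

lemma basis_vec_carrier: "coord_module n X \<Longrightarrow> i < n \<Longrightarrow> basis_vec i \<in> carrier X"
  by (auto simp: coord_module_def)

lemma comb_coord:
  assumes "coord_module n X" "x \<in> carrier X"
  shows "comb X basis_vec n x = x"
proof -
  have *: "m \<le> n \<Longrightarrow> comb X basis_vec m x = (\<lambda>j. if j < m then x j else 0)" for m
  proof (induction m)
    case 0
    then show ?case using assms(1) by (simp add: coord_module_def)
  next
    case (Suc m)
    then have "basis_vec m \<in> carrier X" using basis_vec_carrier[OF assms(1)] by simp
    then have "sc (x m) \<odot>\<^bsub>X\<^esub> basis_vec m = (\<lambda>j. x m * basis_vec m j)"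
      using assms(1) by (simp add: coord_module_def)
    then show ?case using Suc assms(1) by (auto simp: coord_module_def fun_eq_iff less_Suc_eq)
  qed
  from *[of n] assms show ?thesis by (force simp: coord_module_def)
qed

lemma smult_coord:
  assumes "coord_module n X" "x \<in> carrier X" "F \<in> carrier R"
  shows "F \<odot>\<^bsub>X\<^esub> x = comb X (\<lambda>i. F \<odot>\<^bsub>X\<^esub> basis_vec i) n x"
  using comb_smult[of X n "\<lambda>i. basis_vec i" F x] comb_coord[OF assms(1,2)] assms(1,3) basis_vec_carrier[OF assms(1)]
  by (simp add: coord_module_def)

definition section_of ::
  "nat \<Rightarrow> ((('v, 'a) path \<Rightarrow> 'k) set, 'y, 'e, nat \<Rightarrow> 'k) ses \<Rightarrow> (nat \<Rightarrow> 'e) \<Rightarrow> bool" where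
  "section_of n \<xi> e \<longleftrightarrow> (case \<xi> of (E, f, g) \<Rightarrow> \<forall>i<n. e i \<in> carrier E \<and> g (e i) = basis_vec i)"

lemma section_proj:
  assumes "is_extension R X Y (E, f, g)" "coord_module n X" "section_of n (E, f, g) e" "x \<in> carrier X"
  shows "g (comb E e n x) = x" "comb E e n x \<in> carrier E"
proof -
  have *: "left_module R E" "left_module R X" "g \<in> module_hom R E X" "\<And>i. i < n \<Longrightarrow> e i \<in> carrier E"
    using assms by (auto simp: section_of_def)
  have "g (comb E e n x) = comb X (\<lambda>i. g (e i)) n x" by (rule comb_hom) (use * in auto)
  also have "\<dots> = comb X (\<lambda>i. basis_vec i) n x"
    using assms(3) by (intro comb_cong) (auto simp: section_of_def)
  finally show "g (comb E e n x) = x" using comb_coord[OF assms(2,4)] by simp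
  show "comb E e n x \<in> carrier E" by (rule comb_closed) (use * in auto)
qed

lemma kernel_image:
  assumes "is_extension R X Y (E, f, g)" "z \<in> carrier E" "z' \<in> carrier E" "g z = g z'"
  shows "\<exists>y\<in>carrier Y. z = z' \<oplus>\<^bsub>E\<^esub> f y"
proof -
  have E: "left_module R E" and X: "left_module R X" and g: "g \<in> module_hom R E X"
    and k: "f ` carrier Y = {e \<in> carrier E. g e = \<zero>\<^bsub>X\<^esub>}" using assms(1) by auto
  interpret E: left_module R E by fact
  interpret X: left_module R X by fact
  have "g (\<ominus>\<^bsub>E\<^esub> z' \<oplus>\<^bsub>E\<^esub> z) = \<zero>\<^bsub>X\<^esub>"
    using assms module_hom_carrier[OF g assms(2)]
    by (simp add: module_hom_add[OF g] module_hom_minus[OF E X g] X.M.l_neg)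
  then have "\<ominus>\<^bsub>E\<^esub> z' \<oplus>\<^bsub>E\<^esub> z \<in> f ` carrier Y" using k assms by simp
  then obtain y where y: "y \<in> carrier Y" "f y = \<ominus>\<^bsub>E\<^esub> z' \<oplus>\<^bsub>E\<^esub> z" by (metis imageE)
  then have "z' \<oplus>\<^bsub>E\<^esub> f y = z" using assms by (simp add: E.M.r_neg2)
  then show ?thesis using y by blast
qed

text \<open>
  Let \<open>S\<close> and \<open>S'\<close> be the linear sections given by \<open>e\<close> and \<open>e'\<close>. Every element of \<open>E\<close> is
  \<open>f y + S x\<close> for unique \<open>y\<close> and \<open>x\<close>, and the required map sends it to \<open>f' (\<beta> y) + S' x\<close>. It is
  linear over the algebra because both sections deviate from linearity by the same elements \<open>y\<close>,
  up to \<open>\<beta>\<close>.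
\<close>
lemma ext_morphismI:
  assumes ext: "is_extension R X Y (E, f, g)" and ext': "is_extension R X Y' (E', f', g')"
    and \<beta>: "\<beta> \<in> module_hom R Y Y'" and X: "coord_module n X"
    and e: "section_of n (E, f, g) e" and e': "section_of n (E', f', g') e'"
    and act: "\<And>F x. F \<in> carrier R \<Longrightarrow> x \<in> carrier X \<Longrightarrow> \<exists>y\<in>carrier Y.
       F \<odot>\<^bsub>E\<^esub> comb E e n x = comb E e n (F \<odot>\<^bsub>X\<^esub> x) \<oplus>\<^bsub>E\<^esub> f y \<and>
       F \<odot>\<^bsub>E'\<^esub> comb E' e' n x = comb E' e' n (F \<odot>\<^bsub>X\<^esub> x) \<oplus>\<^bsub>E'\<^esub> f' (\<beta> y)"
  shows "ext_morphism R Y \<beta> (E, f, g) (E', f', g')"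
proof -
  have mods: "left_module R X" "left_module R Y" "left_module R Y'" "left_module R E" "left_module R E'"
    and f: "f \<in> module_hom R Y E" "inj_on f (carrier Y)" "f ` carrier Y = {e \<in> carrier E. g e = \<zero>\<^bsub>X\<^esub>}"
    and g: "g \<in> module_hom R E X"
    and f': "f' \<in> module_hom R Y' E'" "f' ` carrier Y' = {e \<in> carrier E'. g' e = \<zero>\<^bsub>X\<^esub>}"
    and g': "g' \<in> module_hom R E' X" using ext ext' by auto
  interpret E: left_module R E by fact
  interpret E': left_module R E' by fact
  interpret X: left_module R X by fact
  interpret Y: left_module R Y by fact
  interpret Y': left_module R Y' by fact
  define S where "S = comb E e n"
  define S' where "S' = comb E' e' n"
  have S: "\<And>x. x \<in> carrier X \<Longrightarrow> S x \<in> carrier E" "\<And>x. x \<in> carrier X \<Longrightarrow> g (S x) = x"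
    using section_proj[OF ext X e] by (auto simp: S_def)
  have S': "\<And>x. x \<in> carrier X \<Longrightarrow> S' x \<in> carrier E'" "\<And>x. x \<in> carrier X \<Longrightarrow> g' (S' x) = x"
    using section_proj[OF ext' X e'] by (auto simp: S'_def)
  have fc: "\<And>y. y \<in> carrier Y \<Longrightarrow> f y \<in> carrier E" "\<And>y. y \<in> carrier Y \<Longrightarrow> g (f y) = \<zero>\<^bsub>X\<^esub>"
    using f(3) by blast+
  have fc': "\<And>y. y \<in> carrier Y' \<Longrightarrow> f' y \<in> carrier E'" "\<And>y. y \<in> carrier Y' \<Longrightarrow> g' (f' y) = \<zero>\<^bsub>X\<^esub>"
    using f'(2) by blast+
  have bc: "\<And>y. y \<in> carrier Y \<Longrightarrow> \<beta> y \<in> carrier Y'" using module_hom_carrier[OF \<beta>] .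
  have gc: "\<And>z. z \<in> carrier E \<Longrightarrow> g z \<in> carrier X" using module_hom_carrier[OF g] .
  have S_add: "S (x \<oplus>\<^bsub>X\<^esub> y) = S x \<oplus>\<^bsub>E\<^esub> S y" "S' (x \<oplus>\<^bsub>X\<^esub> y) = S' x \<oplus>\<^bsub>E'\<^esub> S' y" for x y
    using X e e' comb_add[OF mods(4), of n e x y] comb_add[OF mods(5), of n e' x y]
    by (auto simp: coord_module_def S_def S'_def section_of_def)
  (* The element z - S (g z) lies in the kernel of g. *)
  define \<phi> where "\<phi> z = f' (\<beta> (inv_into (carrier Y) f (z \<oplus>\<^bsub>E\<^esub> \<ominus>\<^bsub>E\<^esub> S (g z)))) \<oplus>\<^bsub>E'\<^esub> S' (g z)" for z
  have \<phi>: "\<phi> (f y \<oplus>\<^bsub>E\<^esub> S x) = f' (\<beta> y) \<oplus>\<^bsub>E'\<^esub> S' x" if "y \<in> carrier Y" "x \<in> carrier X" for x y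
  proof -
    have gx: "g (f y \<oplus>\<^bsub>E\<^esub> S x) = x"
      using that S fc by (simp add: module_hom_add[OF g])
    have "f y \<oplus>\<^bsub>E\<^esub> S x \<oplus>\<^bsub>E\<^esub> \<ominus>\<^bsub>E\<^esub> S x = f y"
      using that S fc by (simp add: E.M.a_assoc E.M.r_neg)
    then show ?thesis unfolding \<phi>_def gx using that f(2) by simp
  qed
  have dec: "\<exists>y\<in>carrier Y. z = f y \<oplus>\<^bsub>E\<^esub> S (g z)" if z: "z \<in> carrier E" for z
    using kernel_image[OF ext z S(1)[OF gc[OF z]]] S(2)[OF gc[OF z]] fc S(1)[OF gc[OF z]] E.M.a_comm
    by metis
  have "\<phi> \<in> module_hom R E E'"
    unfolding module_hom_def
  proof (intro CollectI conjI allI impI funcsetI; (elim conjE)?)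
    fix z assume z: "z \<in> carrier E"
    then obtain y where "y \<in> carrier Y" "z = f y \<oplus>\<^bsub>E\<^esub> S (g z)" using dec by blast
    then show "\<phi> z \<in> carrier E'" using \<phi>[of y "g z"] fc' bc S' gc[OF z] by simp
  next
    fix z1 z2 assume z: "z1 \<in> carrier E" "z2 \<in> carrier E"
    obtain y1 y2 where y: "y1 \<in> carrier Y" "z1 = f y1 \<oplus>\<^bsub>E\<^esub> S (g z1)" "y2 \<in> carrier Y" "z2 = f y2 \<oplus>\<^bsub>E\<^esub> S (g z2)"
      using dec z by meson
    have "(f y1 \<oplus>\<^bsub>E\<^esub> S (g z1)) \<oplus>\<^bsub>E\<^esub> (f y2 \<oplus>\<^bsub>E\<^esub> S (g z2)) = f (y1 \<oplus>\<^bsub>Y\<^esub> y2) \<oplus>\<^bsub>E\<^esub> S (g z1 \<oplus>\<^bsub>X\<^esub> g z2)"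
      using y z S fc gc by (simp add: module_hom_add[OF f(1)] S_add E.M.a_ac)
    then have "\<phi> (z1 \<oplus>\<^bsub>E\<^esub> z2) = f' (\<beta> (y1 \<oplus>\<^bsub>Y\<^esub> y2)) \<oplus>\<^bsub>E'\<^esub> S' (g z1 \<oplus>\<^bsub>X\<^esub> g z2)"
      using y z gc \<phi>[of "y1 \<oplus>\<^bsub>Y\<^esub> y2" "g z1 \<oplus>\<^bsub>X\<^esub> g z2"] by simp
    also have "\<dots> = (f' (\<beta> y1) \<oplus>\<^bsub>E'\<^esub> S' (g z1)) \<oplus>\<^bsub>E'\<^esub> (f' (\<beta> y2) \<oplus>\<^bsub>E'\<^esub> S' (g z2))"
      using y z S' fc' bc gc by (simp add: module_hom_add[OF f'(1)] module_hom_add[OF \<beta>] S_add E'.M.a_ac)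
    finally show "\<phi> (z1 \<oplus>\<^bsub>E\<^esub> z2) = \<phi> z1 \<oplus>\<^bsub>E'\<^esub> \<phi> z2"
      using y z gc \<phi>[of y1 "g z1"] \<phi>[of y2 "g z2"] by simp
  next
    fix F z assume F: "F \<in> carrier R" and z: "z \<in> carrier E"
    obtain y where y: "y \<in> carrier Y" "z = f y \<oplus>\<^bsub>E\<^esub> S (g z)" using dec z by meson
    obtain y' where y': "y' \<in> carrier Y" "F \<odot>\<^bsub>E\<^esub> S (g z) = S (F \<odot>\<^bsub>X\<^esub> g z) \<oplus>\<^bsub>E\<^esub> f y'"
       "F \<odot>\<^bsub>E'\<^esub> S' (g z) = S' (F \<odot>\<^bsub>X\<^esub> g z) \<oplus>\<^bsub>E'\<^esub> f' (\<beta> y')"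
      using act[OF F gc[OF z]] by (auto simp: S_def S'_def)
    have Fg: "F \<odot>\<^bsub>X\<^esub> g z \<in> carrier X" and Fy: "F \<odot>\<^bsub>Y\<^esub> y \<in> carrier Y" "F \<odot>\<^bsub>Y'\<^esub> \<beta> y \<in> carrier Y'"
      using F gc[OF z] y X.smult_closed Y.smult_closed Y'.smult_closed bc by auto
    have "F \<odot>\<^bsub>E\<^esub> (f y \<oplus>\<^bsub>E\<^esub> S (g z)) = f (F \<odot>\<^bsub>Y\<^esub> y \<oplus>\<^bsub>Y\<^esub> y') \<oplus>\<^bsub>E\<^esub> S (F \<odot>\<^bsub>X\<^esub> g z)"
      using F y(1) y' S fc gc[OF z] Fg Fy
      by (simp add: E.smult_r_distr E.smult_closed module_hom_add[OF f(1)] module_hom_smult[OF f(1)] E.M.a_ac)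
    then have "\<phi> (F \<odot>\<^bsub>E\<^esub> z) = f' (\<beta> (F \<odot>\<^bsub>Y\<^esub> y \<oplus>\<^bsub>Y\<^esub> y')) \<oplus>\<^bsub>E'\<^esub> S' (F \<odot>\<^bsub>X\<^esub> g z)"
      using y y' Fg Fy \<phi>[of "F \<odot>\<^bsub>Y\<^esub> y \<oplus>\<^bsub>Y\<^esub> y'" "F \<odot>\<^bsub>X\<^esub> g z"] by simp
    also have "\<dots> = F \<odot>\<^bsub>E'\<^esub> (f' (\<beta> y) \<oplus>\<^bsub>E'\<^esub> S' (g z))"
      using F y y' S' fc' bc gc[OF z] Fg Fy
      by (simp add: E'.smult_r_distr E'.smult_closed module_hom_add[OF f'(1)] module_hom_smult[OF f'(1)]
          module_hom_add[OF \<beta>] module_hom_smult[OF \<beta>] E'.M.a_ac)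
    finally show "\<phi> (F \<odot>\<^bsub>E\<^esub> z) = F \<odot>\<^bsub>E'\<^esub> \<phi> z"
      using y z gc \<phi>[of y "g z"] by simp
  qed
  moreover have "\<phi> (f y) = f' (\<beta> y)" if y: "y \<in> carrier Y" for y
  proof -
    have *: "S \<zero>\<^bsub>X\<^esub> = \<zero>\<^bsub>E\<^esub>" "S' \<zero>\<^bsub>X\<^esub> = \<zero>\<^bsub>E'\<^esub>"
      using X e e' comb_zero[OF mods(4), of n e] comb_zero[OF mods(5), of n e']
      by (auto simp: coord_module_def S_def S'_def section_of_def)
    show ?thesis using \<phi>[OF y X.M.zero_closed] y fc fc' bc by (simp add: *)
  qed
  moreover have "g' (\<phi> z) = g z" if z: "z \<in> carrier E" for z
  proof -
    obtain y where "y \<in> carrier Y" "z = f y \<oplus>\<^bsub>E\<^esub> S (g z)" using dec z by meson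
    then show ?thesis using \<phi>[of y "g z"] fc' bc S' gc[OF z] by (simp add: module_hom_add[OF g'])
  qed
  ultimately show ?thesis by auto
qed

text \<open>
  This reduces the hypothesis of the previous lemma to vertices and arrows acting on the lifts of
  a basis: the set of algebra elements that satisfy it is closed under sums and products, where
  the deviation \<open>y\<close> of \<open>F G\<close> is \<open>F y\<^sub>G\<close> plus the deviation of \<open>F\<close> at \<open>G x\<close>.
\<close>

lemma comb_action_generators:
  assumes ext: "is_extension R X Y (E, f, g)" and ext': "is_extension R X Y' (E', f', g')"
    and \<beta>: "\<beta> \<in> module_hom R Y Y'" and X: "coord_module n X"
    and e: "section_of n (E, f, g) e" and e': "section_of n (E', f', g') e'"
    and gen: "\<And>F i. F \<in> vtx ` verts Q \<union> arr ` arcs Q \<Longrightarrow> i < n \<Longrightarrow> \<exists>y\<in>carrier Y.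
       F \<odot>\<^bsub>E\<^esub> e i = comb E e n (F \<odot>\<^bsub>X\<^esub> basis_vec i) \<oplus>\<^bsub>E\<^esub> f y \<and>
       F \<odot>\<^bsub>E'\<^esub> e' i = comb E' e' n (F \<odot>\<^bsub>X\<^esub> basis_vec i) \<oplus>\<^bsub>E'\<^esub> f' (\<beta> y)"
    and F: "F \<in> carrier R"
  shows "\<forall>x\<in>carrier X. \<exists>y\<in>carrier Y.
       F \<odot>\<^bsub>E\<^esub> comb E e n x = comb E e n (F \<odot>\<^bsub>X\<^esub> x) \<oplus>\<^bsub>E\<^esub> f y \<and>
       F \<odot>\<^bsub>E'\<^esub> comb E' e' n x = comb E' e' n (F \<odot>\<^bsub>X\<^esub> x) \<oplus>\<^bsub>E'\<^esub> f' (\<beta> y)"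
proof -
  have mods: "left_module R X" "left_module R Y" "left_module R Y'" "left_module R E" "left_module R E'"
    and f: "f \<in> module_hom R Y E" and f': "f' \<in> module_hom R Y' E'" using ext ext' by auto
  interpret E: left_module R E by fact
  interpret E': left_module R E' by fact
  interpret X: left_module R X by fact
  interpret Y: left_module R Y by fact
  interpret Y': left_module R Y' by fact
  have ec: "\<And>i. i < n \<Longrightarrow> e i \<in> carrier E" "\<And>i. i < n \<Longrightarrow> e' i \<in> carrier E'"
    using e e' by (auto simp: section_of_def)
  note Sc = section_proj(2)[OF ext X e] section_proj(2)[OF ext' X e']
  have fc: "\<And>y. y \<in> carrier Y \<Longrightarrow> f y \<in> carrier E" "\<And>y. y \<in> carrier Y' \<Longrightarrow> f' y \<in> carrier E'"
     "\<And>y. y \<in> carrier Y \<Longrightarrow> \<beta> y \<in> carrier Y'"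
    using module_hom_carrier[OF f] module_hom_carrier[OF f'] module_hom_carrier[OF \<beta>] by auto
  have S_add: "comb E e n (x \<oplus>\<^bsub>X\<^esub> y) = comb E e n x \<oplus>\<^bsub>E\<^esub> comb E e n y"
    "comb E' e' n (x \<oplus>\<^bsub>X\<^esub> y) = comb E' e' n x \<oplus>\<^bsub>E'\<^esub> comb E' e' n y" for x y
    using X ec comb_add[OF mods(4), of n e x y] comb_add[OF mods(5), of n e' x y]
    by (auto simp: coord_module_def)
  have gen': "\<forall>x\<in>carrier X. \<exists>y\<in>carrier Y.
       F \<odot>\<^bsub>E\<^esub> comb E e n x = comb E e n (F \<odot>\<^bsub>X\<^esub> x) \<oplus>\<^bsub>E\<^esub> f y \<and>
       F \<odot>\<^bsub>E'\<^esub> comb E' e' n x = comb E' e' n (F \<odot>\<^bsub>X\<^esub> x) \<oplus>\<^bsub>E'\<^esub> f' (\<beta> y)"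
    if F: "F \<in> vtx ` verts Q \<union> arr ` arcs Q" for F
  proof
    fix x assume x: "x \<in> carrier X"
    have FR: "F \<in> carrier R" using F vtx_closed arr_closed by auto
    have "\<forall>i\<in>{..<n}. \<exists>y. y \<in> carrier Y \<and>
       F \<odot>\<^bsub>E\<^esub> e i = comb E e n (F \<odot>\<^bsub>X\<^esub> basis_vec i) \<oplus>\<^bsub>E\<^esub> f y \<and>
       F \<odot>\<^bsub>E'\<^esub> e' i = comb E' e' n (F \<odot>\<^bsub>X\<^esub> basis_vec i) \<oplus>\<^bsub>E'\<^esub> f' (\<beta> y)" using gen[OF F] by (metis lessThan_iff)
    from bchoice[OF this] obtain y where y: "\<And>i. i < n \<Longrightarrow> y i \<in> carrier Y"
       "\<And>i. i < n \<Longrightarrow> F \<odot>\<^bsub>E\<^esub> e i = comb E e n (F \<odot>\<^bsub>X\<^esub> basis_vec i) \<oplus>\<^bsub>E\<^esub> f (y i)"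
       "\<And>i. i < n \<Longrightarrow> F \<odot>\<^bsub>E'\<^esub> e' i = comb E' e' n (F \<odot>\<^bsub>X\<^esub> basis_vec i) \<oplus>\<^bsub>E'\<^esub> f' (\<beta> (y i))" by auto
    have Fu: "F \<odot>\<^bsub>X\<^esub> basis_vec i \<in> carrier X" if "i < n" for i
      using X.smult_closed FR basis_vec_carrier[OF X that] by blast
    have SF: "comb M (\<lambda>i. comb M d n (F \<odot>\<^bsub>X\<^esub> basis_vec i)) n x = comb M d n (F \<odot>\<^bsub>X\<^esub> x)"
      if M: "left_module R M" and d: "\<And>i. i < n \<Longrightarrow> d i \<in> carrier M"
      for M :: "((('v, 'a) path \<Rightarrow> 'k) set, 'm) module" and d
    proof -
      interpret M: left_module R M by fact
      have "comb M d n (comb X v m x) = comb M (\<lambda>i. comb M d n (v i)) m x"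
        if "\<And>i. i < m \<Longrightarrow> v i \<in> carrier X" for v m
        using that
      proof (induction m)
        case 0
        then show ?case using X comb_zero[OF M, of n d] d by (simp add: coord_module_def)
      next
        case (Suc m)
        have add: "comb M d n (a \<oplus>\<^bsub>X\<^esub> b) = comb M d n a \<oplus>\<^bsub>M\<^esub> comb M d n b" for a b
          using X comb_add[OF M d] by (simp add: coord_module_def)
        have scl: "comb M d n (sc \<kappa> \<odot>\<^bsub>X\<^esub> a) = sc \<kappa> \<odot>\<^bsub>M\<^esub> comb M d n a" if "a \<in> carrier X" for a \<kappa>
          using X comb_scale[OF M d] that by (simp add: coord_module_def)
        show ?case using Suc by (simp add: add scl)
      qed
      from this[of n "\<lambda>i. F \<odot>\<^bsub>X\<^esub> basis_vec i"] show ?thesis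
        using smult_coord[OF X x FR] Fu by simp
    qed
    have "F \<odot>\<^bsub>E\<^esub> comb E e n x = comb E (\<lambda>i. F \<odot>\<^bsub>E\<^esub> e i) n x"
      by (rule comb_smult) (use mods ec FR in auto)
    also have "\<dots> = comb E (\<lambda>i. comb E e n (F \<odot>\<^bsub>X\<^esub> basis_vec i) \<oplus>\<^bsub>E\<^esub> f (y i)) n x"
      by (rule comb_cong) (use y in auto)
    also have "\<dots> = comb E (\<lambda>i. comb E e n (F \<odot>\<^bsub>X\<^esub> basis_vec i)) n x \<oplus>\<^bsub>E\<^esub> comb E (\<lambda>i. f (y i)) n x"
      by (rule comb_plus) (use y fc mods Sc Fu in auto)
    also have "\<dots> = comb E e n (F \<odot>\<^bsub>X\<^esub> x) \<oplus>\<^bsub>E\<^esub> f (comb Y y n x)"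
      using SF[OF mods(4) ec(1)] comb_hom[OF mods(2,4) f y(1)] by simp
    finally have 1: "F \<odot>\<^bsub>E\<^esub> comb E e n x = comb E e n (F \<odot>\<^bsub>X\<^esub> x) \<oplus>\<^bsub>E\<^esub> f (comb Y y n x)" .
    have "F \<odot>\<^bsub>E'\<^esub> comb E' e' n x = comb E' (\<lambda>i. F \<odot>\<^bsub>E'\<^esub> e' i) n x"
      by (rule comb_smult) (use mods ec FR in auto)
    also have "\<dots> = comb E' (\<lambda>i. comb E' e' n (F \<odot>\<^bsub>X\<^esub> basis_vec i) \<oplus>\<^bsub>E'\<^esub> f' (\<beta> (y i))) n x"
      by (rule comb_cong) (use y in auto)
    also have "\<dots> = comb E' (\<lambda>i. comb E' e' n (F \<odot>\<^bsub>X\<^esub> basis_vec i)) n x \<oplus>\<^bsub>E'\<^esub> comb E' (\<lambda>i. f' (\<beta> (y i))) n x"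
      by (rule comb_plus) (use y fc mods Sc Fu in auto)
    also have "\<dots> = comb E' e' n (F \<odot>\<^bsub>X\<^esub> x) \<oplus>\<^bsub>E'\<^esub> f' (\<beta> (comb Y y n x))"
      using SF[OF mods(5) ec(2)] comb_hom[OF mods(2,3) \<beta> y(1)] comb_hom[OF mods(3,5) f', of n "\<lambda>i. \<beta> (y i)"] fc y by simp
    finally have 2: "F \<odot>\<^bsub>E'\<^esub> comb E' e' n x = comb E' e' n (F \<odot>\<^bsub>X\<^esub> x) \<oplus>\<^bsub>E'\<^esub> f' (\<beta> (comb Y y n x))" .
    have "comb Y y n x \<in> carrier Y" by (rule comb_closed[OF mods(2)]) (use y in auto)
    with 1 2 show "\<exists>y\<in>carrier Y. F \<odot>\<^bsub>E\<^esub> comb E e n x = comb E e n (F \<odot>\<^bsub>X\<^esub> x) \<oplus>\<^bsub>E\<^esub> f y \<and>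
       F \<odot>\<^bsub>E'\<^esub> comb E' e' n x = comb E' e' n (F \<odot>\<^bsub>X\<^esub> x) \<oplus>\<^bsub>E'\<^esub> f' (\<beta> y)"
      by blast
  qed
  from F show ?thesis
  proof (induction F rule: R_induct)
    case (add F G)
    show ?case
    proof
      fix x assume x: "x \<in> carrier X"
      obtain y y' where y: "y \<in> carrier Y" "y' \<in> carrier Y"
        "F \<odot>\<^bsub>E\<^esub> comb E e n x = comb E e n (F \<odot>\<^bsub>X\<^esub> x) \<oplus>\<^bsub>E\<^esub> f y"
        "F \<odot>\<^bsub>E'\<^esub> comb E' e' n x = comb E' e' n (F \<odot>\<^bsub>X\<^esub> x) \<oplus>\<^bsub>E'\<^esub> f' (\<beta> y)"
        "G \<odot>\<^bsub>E\<^esub> comb E e n x = comb E e n (G \<odot>\<^bsub>X\<^esub> x) \<oplus>\<^bsub>E\<^esub> f y'"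
        "G \<odot>\<^bsub>E'\<^esub> comb E' e' n x = comb E' e' n (G \<odot>\<^bsub>X\<^esub> x) \<oplus>\<^bsub>E'\<^esub> f' (\<beta> y')" using add x by meson
      have c: "F \<odot>\<^bsub>X\<^esub> x \<in> carrier X" "G \<odot>\<^bsub>X\<^esub> x \<in> carrier X" using add x X.smult_closed by auto
      have "(F \<oplus>\<^bsub>R\<^esub> G) \<odot>\<^bsub>E\<^esub> comb E e n x = comb E e n ((F \<oplus>\<^bsub>R\<^esub> G) \<odot>\<^bsub>X\<^esub> x) \<oplus>\<^bsub>E\<^esub> f (y \<oplus>\<^bsub>Y\<^esub> y')"
        "(F \<oplus>\<^bsub>R\<^esub> G) \<odot>\<^bsub>E'\<^esub> comb E' e' n x = comb E' e' n ((F \<oplus>\<^bsub>R\<^esub> G) \<odot>\<^bsub>X\<^esub> x) \<oplus>\<^bsub>E'\<^esub> f' (\<beta> (y \<oplus>\<^bsub>Y\<^esub> y'))"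
        using y add x Sc fc c
        by (simp_all add: E.smult_l_distr E'.smult_l_distr X.smult_l_distr S_add module_hom_add[OF f]
            module_hom_add[OF f'] module_hom_add[OF \<beta>] E.M.a_ac E'.M.a_ac)
      then show "\<exists>y\<in>carrier Y. (F \<oplus>\<^bsub>R\<^esub> G) \<odot>\<^bsub>E\<^esub> comb E e n x = comb E e n ((F \<oplus>\<^bsub>R\<^esub> G) \<odot>\<^bsub>X\<^esub> x) \<oplus>\<^bsub>E\<^esub> f y \<and>
         (F \<oplus>\<^bsub>R\<^esub> G) \<odot>\<^bsub>E'\<^esub> comb E' e' n x = comb E' e' n ((F \<oplus>\<^bsub>R\<^esub> G) \<odot>\<^bsub>X\<^esub> x) \<oplus>\<^bsub>E'\<^esub> f' (\<beta> y)"
        using y Y.M.a_closed by blast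
    qed
  next
    case (mult F G)
    show ?case
    proof
      fix x assume x: "x \<in> carrier X"
      have c: "F \<odot>\<^bsub>X\<^esub> (G \<odot>\<^bsub>X\<^esub> x) \<in> carrier X" "G \<odot>\<^bsub>X\<^esub> x \<in> carrier X" using mult x X.smult_closed by auto
      obtain y' where y': "y' \<in> carrier Y"
        "G \<odot>\<^bsub>E\<^esub> comb E e n x = comb E e n (G \<odot>\<^bsub>X\<^esub> x) \<oplus>\<^bsub>E\<^esub> f y'"
        "G \<odot>\<^bsub>E'\<^esub> comb E' e' n x = comb E' e' n (G \<odot>\<^bsub>X\<^esub> x) \<oplus>\<^bsub>E'\<^esub> f' (\<beta> y')" using mult x by meson
      obtain y where y: "y \<in> carrier Y"
        "F \<odot>\<^bsub>E\<^esub> comb E e n (G \<odot>\<^bsub>X\<^esub> x) = comb E e n (F \<odot>\<^bsub>X\<^esub> (G \<odot>\<^bsub>X\<^esub> x)) \<oplus>\<^bsub>E\<^esub> f y"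
        "F \<odot>\<^bsub>E'\<^esub> comb E' e' n (G \<odot>\<^bsub>X\<^esub> x) = comb E' e' n (F \<odot>\<^bsub>X\<^esub> (G \<odot>\<^bsub>X\<^esub> x)) \<oplus>\<^bsub>E'\<^esub> f' (\<beta> y)" using mult c(2) by meson
      have Fy: "F \<odot>\<^bsub>Y\<^esub> y' \<in> carrier Y" "F \<odot>\<^bsub>Y'\<^esub> \<beta> y' \<in> carrier Y'"
        using mult y' Y.smult_closed Y'.smult_closed fc by auto
      have "(F \<otimes>\<^bsub>R\<^esub> G) \<odot>\<^bsub>E\<^esub> comb E e n x = comb E e n ((F \<otimes>\<^bsub>R\<^esub> G) \<odot>\<^bsub>X\<^esub> x) \<oplus>\<^bsub>E\<^esub> f (y \<oplus>\<^bsub>Y\<^esub> F \<odot>\<^bsub>Y\<^esub> y')"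
        "(F \<otimes>\<^bsub>R\<^esub> G) \<odot>\<^bsub>E'\<^esub> comb E' e' n x = comb E' e' n ((F \<otimes>\<^bsub>R\<^esub> G) \<odot>\<^bsub>X\<^esub> x) \<oplus>\<^bsub>E'\<^esub> f' (\<beta> (y \<oplus>\<^bsub>Y\<^esub> F \<odot>\<^bsub>Y\<^esub> y'))"
        using y y' mult x Sc fc c Fy
        by (simp_all add: E.smult_closed E'.smult_closed E.smult_assoc E'.smult_assoc X.smult_assoc E.smult_r_distr E'.smult_r_distr
            module_hom_add[OF f] module_hom_smult[OF f] module_hom_add[OF f'] module_hom_smult[OF f']
            module_hom_add[OF \<beta>] module_hom_smult[OF \<beta>] E.M.a_ac E'.M.a_ac)
      then show "\<exists>y\<in>carrier Y. (F \<otimes>\<^bsub>R\<^esub> G) \<odot>\<^bsub>E\<^esub> comb E e n x = comb E e n ((F \<otimes>\<^bsub>R\<^esub> G) \<odot>\<^bsub>X\<^esub> x) \<oplus>\<^bsub>E\<^esub> f y \<and>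
         (F \<otimes>\<^bsub>R\<^esub> G) \<odot>\<^bsub>E'\<^esub> comb E' e' n x = comb E' e' n ((F \<otimes>\<^bsub>R\<^esub> G) \<odot>\<^bsub>X\<^esub> x) \<oplus>\<^bsub>E'\<^esub> f' (\<beta> y)"
        using y Fy Y.M.a_closed by blast
    qed
  next
    case (sc \<kappa>)
    show ?case
    proof
      fix x assume x: "x \<in> carrier X"
      have "sc \<kappa> \<odot>\<^bsub>E\<^esub> comb E e n x = comb E e n (sc \<kappa> \<odot>\<^bsub>X\<^esub> x)"
        "sc \<kappa> \<odot>\<^bsub>E'\<^esub> comb E' e' n x = comb E' e' n (sc \<kappa> \<odot>\<^bsub>X\<^esub> x)"
        using x X comb_scale[OF mods(4) ec(1)] comb_scale[OF mods(5) ec(2)] by (auto simp: coord_module_def)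
      moreover have "f \<zero>\<^bsub>Y\<^esub> = \<zero>\<^bsub>E\<^esub>" "f' (\<beta> \<zero>\<^bsub>Y\<^esub>) = \<zero>\<^bsub>E'\<^esub>"
        using module_hom_zero mods f f' \<beta> by metis+
      moreover have "sc \<kappa> \<odot>\<^bsub>X\<^esub> x \<in> carrier X" using x X.smult_closed by simp
      ultimately show "\<exists>y\<in>carrier Y. sc \<kappa> \<odot>\<^bsub>E\<^esub> comb E e n x = comb E e n (sc \<kappa> \<odot>\<^bsub>X\<^esub> x) \<oplus>\<^bsub>E\<^esub> f y \<and>
         sc \<kappa> \<odot>\<^bsub>E'\<^esub> comb E' e' n x = comb E' e' n (sc \<kappa> \<odot>\<^bsub>X\<^esub> x) \<oplus>\<^bsub>E'\<^esub> f' (\<beta> y)"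
        using Sc Y.M.zero_closed by (intro bexI[of _ "\<zero>\<^bsub>Y\<^esub>"]) simp_all
    qed
  next
    case (vtx x)
    then show ?case using gen' by blast
  next
    case (arr a)
    then show ?case using gen' by blast
  qed
qed

end

section \<open>Strings\<close>

lemma letter_inv_inv [simp]: "letter_inv (letter_inv L) = L"
  by (cases L) auto

lemma letter_inv_simps [simp]:
  "letter_start Q (letter_inv L) = letter_end Q L" "letter_end Q (letter_inv L) = letter_start Q L"
  "letter_arrow (letter_inv L) = letter_arrow L"
  by (cases L; simp)+

lemma letter_inv_neq [simp]: "letter_inv L \<noteq> L" "L \<noteq> letter_inv L"
  by (cases L; simp)+

lemma letter_inv_inject [simp]: "letter_inv L = letter_inv M \<longleftrightarrow> L = M"
  by (metis letter_inv_inv)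

lemma letter_inv_eq_iff: "letter_inv L = Dir a \<longleftrightarrow> L = Inv a" "letter_inv L = Inv a \<longleftrightarrow> L = Dir a"
  by (cases L; auto)+

lemma arrow_act_expand:
  assumes "\<And>k. k < length ls \<Longrightarrow> nx k = j \<longleftrightarrow> k = p"
  shows "arrow_act ls nx wt a z j =
    (if p < length ls \<and> ls ! p = Dir a then wt p * z p else 0) +
    (if j < length ls \<and> ls ! j = Inv a then z (nx j) else 0)"
proof -
  have "arrow_act ls nx wt a z j = (\<Sum>k<length ls.
      (if k = p then (if ls ! p = Dir a then wt p * z p else 0) else 0) +
      (if k = j then (if ls ! j = Inv a then z (nx j) else 0) else 0))"
    unfolding arrow_act_def
  proof (intro sum.cong refl)
    fix k assume "k \<in> {..<length ls}"
    then have "nx k = j \<longleftrightarrow> k = p" using assms by simp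
    then have "j = nx k \<longleftrightarrow> k = p" by auto
    then show "(case ls ! k of Dir b \<Rightarrow> if b = a \<and> j = nx k then wt k * z k else 0
       | Inv b \<Rightarrow> if b = a \<and> j = k then z (nx k) else 0) =
      (if k = p then (if ls ! p = Dir a then wt p * z p else 0) else 0) +
      (if k = j then (if ls ! j = Inv a then z (nx j) else 0) else 0)"
      by (cases "ls ! k") auto
  qed
  also have "\<dots> = (if p < length ls then (if ls ! p = Dir a then wt p * z p else 0) else 0) +
      (if j < length ls then (if ls ! j = Inv a then z (nx j) else 0) else 0)"
    unfolding sum.distrib by (simp add: sum.delta)
  finally show ?thesis by simp
qed

lemma string_arrow_act:
  "arrow_act ls Suc (\<lambda>_. 1) a z j =
    (if 0 < j \<and> j \<le> length ls \<and> ls ! (j - 1) = Dir a then z (j - 1) else 0) +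
    (if j < length ls \<and> ls ! j = Inv a then z (Suc j) else 0)"
proof (cases j)
  case 0
  then show ?thesis using arrow_act_expand[of ls Suc j "length ls" "\<lambda>_. 1" a z] by simp
next
  case (Suc p)
  then show ?thesis using arrow_act_expand[of ls Suc j p "\<lambda>_. 1" a z] by simp
qed

context gentle_quiver
begin

text \<open>
  The local conditions on two consecutive letters of a string: they are composable, not mutually
  inverse, and do not form a zero relation in either direction.
\<close>
definition compat :: "'a letter \<Rightarrow> 'a letter \<Rightarrow> bool" where
  "compat L M \<longleftrightarrow> letter_start Q M = letter_end Q L \<and> M \<noteq> letter_inv L \<and>
     (\<forall>a b. L = Dir a \<longrightarrow> M = Dir b \<longrightarrow> \<not> zero_comp Q I b a) \<and>
     (\<forall>a b. L = Inv a \<longrightarrow> M = Inv b \<longrightarrow> \<not> zero_comp Q I a b)"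

definition word_ok :: "'a letter list \<Rightarrow> bool" where
  "word_ok ls \<longleftrightarrow> letter_arrow ` set ls \<subseteq> arcs Q \<and> (\<forall>i. Suc i < length ls \<longrightarrow> compat (ls ! i) (ls ! Suc i))"

lemma compat_inv: "compat (letter_inv M) (letter_inv L) \<longleftrightarrow> compat L M"
  unfolding compat_def by (cases L; cases M) auto

lemma word_ok_append: "word_ok (xs @ ys) \<longleftrightarrow> word_ok xs \<and> word_ok ys \<and>
    (xs \<noteq> [] \<longrightarrow> ys \<noteq> [] \<longrightarrow> compat (last xs) (hd ys))"
proof -
  have "(\<forall>i. Suc i < length (xs @ ys) \<longrightarrow> compat ((xs @ ys) ! i) ((xs @ ys) ! Suc i)) \<longleftrightarrow>
    (\<forall>i. Suc i < length xs \<longrightarrow> compat (xs ! i) (xs ! Suc i)) \<and>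
    (\<forall>i. Suc i < length ys \<longrightarrow> compat (ys ! i) (ys ! Suc i)) \<and>
    (xs \<noteq> [] \<longrightarrow> ys \<noteq> [] \<longrightarrow> compat (last xs) (hd ys))" (is "?l \<longleftrightarrow> ?a \<and> ?b \<and> ?c")
  proof
    assume l: ?l
    have ?a
    proof (intro allI impI)
      fix i assume "Suc i < length xs"
      then show "compat (xs ! i) (xs ! Suc i)" using l[rule_format, of i] by (simp add: nth_append)
    qed
    moreover have ?b
    proof (intro allI impI)
      fix i assume "Suc i < length ys"
      then show "compat (ys ! i) (ys ! Suc i)" using l[rule_format, of "length xs + i"] by (simp add: nth_append)
    qed
    moreover have ?c
    proof (intro impI)
      assume "xs \<noteq> []" "ys \<noteq> []"
      then show "compat (last xs) (hd ys)"
        using l[rule_format, of "length xs - 1"] by (simp add: nth_append last_conv_nth hd_conv_nth)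
    qed
    ultimately show "?a \<and> ?b \<and> ?c" by blast
  next
    assume r: "?a \<and> ?b \<and> ?c"
    show ?l
    proof (intro allI impI)
      fix i assume i: "Suc i < length (xs @ ys)"
      consider "Suc i < length xs" | "Suc i = length xs" | "length xs \<le> i" by linarith
      then show "compat ((xs @ ys) ! i) ((xs @ ys) ! Suc i)"
      proof cases
        case 1
        then show ?thesis using r by (simp add: nth_append)
      next
        case 2
        then have "xs ! i = last xs" by (metis diff_Suc_1 last_conv_nth length_0_conv nat.distinct(1))
        then show ?thesis using r 2 i by (auto simp: nth_append hd_conv_nth)
      next
        case 3
        then show ?thesis using r i by (auto simp: nth_append Suc_diff_le)
      qed
    qed
  qed
  then show ?thesis unfolding word_ok_def by auto
qed

lemma word_ok_single: "word_ok [L] \<longleftrightarrow> letter_arrow L \<in> arcs Q" and word_ok_Nil [simp]: "word_ok []"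
  by (auto simp: word_ok_def)

lemma word_ok_Cons: "word_ok (L # ls) \<longleftrightarrow> letter_arrow L \<in> arcs Q \<and> word_ok ls \<and> (ls \<noteq> [] \<longrightarrow> compat L (hd ls))"
  using word_ok_append[of "[L]" ls] by (auto simp: word_ok_single)

lemma word_ok_inv: "word_ok (rev (map letter_inv ls)) \<longleftrightarrow> word_ok ls"
proof (induction ls)
  case (Cons L ls)
  then show ?case
    using compat_inv[of "hd ls" L]
    by (auto simp: word_ok_append word_ok_Cons last_rev hd_map)
qed simp

lemma word_ok_sublist: "word_ok ls \<Longrightarrow> sublist ms ls \<Longrightarrow> word_ok ms"
  by (auto simp: sublist_def word_ok_append)

lemma word_end_take_Suc: "j < length ls \<Longrightarrow> word_end Q (x, take (Suc j) ls) = letter_end Q (ls ! j)"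
  by (auto simp: take_Suc_conv_app_nth)

lemma word_end_take:
  assumes "word_ok ls" "ls \<noteq> [] \<Longrightarrow> letter_start Q (hd ls) = x" "j < length ls"
  shows "word_end Q (x, take j ls) = letter_start Q (ls ! j)"
proof (cases j)
  case 0
  then show ?thesis using assms by (auto simp: hd_conv_nth)
next
  case (Suc i)
  then have "compat (ls ! i) (ls ! Suc i)" using assms by (auto simp: word_ok_def)
  then show ?thesis using Suc assms(3) word_end_take_Suc[of i ls x] by (auto simp: compat_def)
qed

lemma letter_verts: "letter_arrow L \<in> arcs Q \<Longrightarrow> letter_start Q L \<in> verts Q"
  "letter_arrow L \<in> arcs Q \<Longrightarrow> letter_end Q L \<in> verts Q"
  using tail_verts head_verts by (cases L; auto)+

lemma word_ok_nth_arcs: "word_ok ls \<Longrightarrow> k < length ls \<Longrightarrow> letter_arrow (ls ! k) \<in> arcs Q"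
  by (auto simp: word_ok_def)

lemma string_diagram:
  assumes "x \<in> verts Q" "word_ok ls" "ls \<noteq> [] \<Longrightarrow> letter_start Q (hd ls) = x"
  shows "diagram Q I (Suc (length ls)) (\<lambda>j. word_end Q (x, take j ls)) ls Suc (\<lambda>_. 1)"
proof (intro diagram.intro gentle_quiver_axioms diagram_axioms.intro)
  fix j assume "j < Suc (length ls)"
  then show "word_end Q (x, take j ls) \<in> verts Q"
    using assms(1) word_end_take_Suc[of "j - 1" ls x] letter_verts(2)[OF word_ok_nth_arcs[OF assms(2), of "j - 1"]]
    by (cases j) auto
next
  fix k assume "k < length ls"
  then show "word_end Q (x, take k ls) = letter_start Q (ls ! k) \<and>
      word_end Q (x, take (Suc k) ls) = letter_end Q (ls ! k)"
    using word_end_take[OF assms(2,3)] word_end_take_Suc by simp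
next
  fix b a and z :: "nat \<Rightarrow> 'k" assume z: "zero_comp Q I b a"
  show "arrow_act ls Suc (\<lambda>_. 1) b (arrow_act ls Suc (\<lambda>_. 1) a z) = (\<lambda>_. 0)"
  proof (rule ext)
    fix j
    have 1: "\<not> (ls ! i = Dir a \<and> ls ! Suc i = Dir b)" "\<not> (ls ! i = Inv b \<and> ls ! Suc i = Inv a)"
      if "Suc i < length ls" for i
      using assms(2) that z by (auto simp: word_ok_def compat_def)
    have "ls ! (j - 1 - 1) = Dir a \<longrightarrow> ls ! (j - 1) = Dir b \<longrightarrow> 0 < j - 1 \<longrightarrow> j \<le> length ls \<longrightarrow> False"
    proof (intro impI)
      assume h: "ls ! (j - 1 - 1) = Dir a" "ls ! (j - 1) = Dir b" "0 < j - 1" "j \<le> length ls"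
      then have "Suc (j - 1 - 1) = j - 1" "Suc (j - 1 - 1) < length ls" by auto
      then show False using 1(1)[of "j - 1 - 1"] h by metis
    qed
    then show "arrow_act ls Suc (\<lambda>_. 1) b (arrow_act ls Suc (\<lambda>_. 1) a z) j = 0"
      using 1(2)[of j] by (auto simp: string_arrow_act)
  qed
qed (use assms word_ok_nth_arcs in auto)

lemma path_fold_string:
  "i \<le> length p \<Longrightarrow> fold (arrow_act (map Dir p) Suc (\<lambda>_. 1)) (take i p) (basis_vec 0) = (basis_vec i :: nat \<Rightarrow> 'k)"
proof (induction i)
  case (Suc i)
  then have "take (Suc i) p = take i p @ [p ! i]" by (simp add: take_Suc_conv_app_nth)
  moreover have "arrow_act (map Dir p) Suc (\<lambda>_. 1) (p ! i) (basis_vec i) = (basis_vec (Suc i) :: nat \<Rightarrow> 'k)"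
    using Suc.prems by (auto simp: string_arrow_act fun_eq_iff)
  ultimately show ?case using Suc by simp
qed simp

text \<open>
  A path without consecutive zero relations acts on its own string module and moves the first
  basis vector to the last one, so it does not lie in \<open>I\<close>.
\<close>
lemma path_not_in_ideal:
  assumes "p \<noteq> []" "word_ok (map Dir p)"
  shows "path_elt (tail Q (hd p), p) \<notin> I"
proof
  assume I: "path_elt (tail Q (hd p), p) \<in> I"
  define x where "x = tail Q (hd p)"
  have hd: "letter_start Q (hd (map Dir p)) = x" using assms(1) by (cases p) (auto simp: x_def)
  have "hd p \<in> arcs Q" using assms by (cases p) (auto simp: word_ok_Cons)
  then interpret D: diagram Q I "Suc (length (map Dir p))" "\<lambda>j. word_end Q (x, take j (map Dir p))" "map Dir p" Suc "\<lambda>_. 1"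
    using string_diagram[of x "map Dir p"] assms hd tail_verts x_def by auto
  have "vertex_act (Suc (length (map Dir p))) (\<lambda>j. word_end Q (x, take j (map Dir p))) x (basis_vec 0) = (basis_vec 0 :: nat \<Rightarrow> 'k)"
    by (auto simp: vertex_act_def fun_eq_iff)
  then have "D.pact (x, p) (basis_vec 0) = basis_vec (length p)"
    using path_fold_string[of "length p" p] by (simp only: path_act.simps take_all order.refl)
  moreover have "D.act (path_elt (x, p)) (basis_vec 0) = D.pact (x, p) (basis_vec 0)"
    by (simp only: path_elt_monomial D.act_monomial mult_1)
  ultimately have "(basis_vec (length p) :: nat \<Rightarrow> 'k) = (\<lambda>_. 0)"
    using D.ideal_act_zero[OF I, folded x_def] by simp
  then show False by (metis zero_neq_one)
qed

lemma zero_comp_sublist: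
  assumes "Suc i < length ls"
  shows "ls ! i = Dir a \<Longrightarrow> ls ! Suc i = Dir b \<Longrightarrow> sublist (map Dir [a, b]) ls"
    and "ls ! i = Inv b \<Longrightarrow> ls ! Suc i = Inv a \<Longrightarrow> sublist (rev (map Inv [a, b])) ls"
proof -
  have "ls = take i ls @ [ls ! i, ls ! Suc i] @ drop (Suc (Suc i)) ls"
    using assms by (simp add: Cons_nth_drop_Suc)
  then show "ls ! i = Dir a \<Longrightarrow> ls ! Suc i = Dir b \<Longrightarrow> sublist (map Dir [a, b]) ls"
    "ls ! i = Inv b \<Longrightarrow> ls ! Suc i = Inv a \<Longrightarrow> sublist (rev (map Inv [a, b])) ls"
    unfolding sublist_def
    by (intro exI[of _ "take i ls"] exI[of _ "drop (Suc (Suc i)) ls"]; simp)+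
qed

text \<open>
  A string is defined by avoiding all paths in \<open>I\<close>. Since \<open>I\<close> is generated by paths of length two,
  it is enough to look at consecutive letters.
\<close>
lemma is_string_iff:
  "is_string Q I (x, ls) \<longleftrightarrow> x \<in> verts Q \<and> word_ok ls \<and> (ls \<noteq> [] \<longrightarrow> letter_start Q (hd ls) = x)"
proof
  assume s: "is_string Q I (x, ls)"
  have "compat (ls ! i) (ls ! Suc i)" if i: "Suc i < length ls" for i
    unfolding compat_def
  proof (intro conjI allI impI notI)
    show "letter_start Q (ls ! Suc i) = letter_end Q (ls ! i)" using s i by (auto simp: is_string_def)
    show "ls ! Suc i = letter_inv (ls ! i) \<Longrightarrow> False" using s i by (auto simp: is_string_def)
  next
    fix a b assume ab: "ls ! i = Dir a" "ls ! Suc i = Dir b" "zero_comp Q I b a"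
    then have "path_elt (tail Q (hd [a, b]), [a, b]) \<notin> I"
      using s zero_comp_sublist(1)[OF i ab(1,2)] unfolding is_string_def by (metis list.discI snd_conv)
    then show False using ab by (simp add: zero_comp_def)
  next
    fix a b assume ab: "ls ! i = Inv a" "ls ! Suc i = Inv b" "zero_comp Q I a b"
    then have "path_elt (tail Q (hd [b, a]), [b, a]) \<notin> I"
      using s zero_comp_sublist(2)[OF i ab(1,2)] unfolding is_string_def by (metis list.discI snd_conv)
    then show False using ab by (simp add: zero_comp_def)
  qed
  then show "x \<in> verts Q \<and> word_ok ls \<and> (ls \<noteq> [] \<longrightarrow> letter_start Q (hd ls) = x)"
    using s by (auto simp: is_string_def word_ok_def)
next
  assume r: "x \<in> verts Q \<and> word_ok ls \<and> (ls \<noteq> [] \<longrightarrow> letter_start Q (hd ls) = x)"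
  have "path_elt (tail Q (hd p), p) \<notin> I"
    if "p \<noteq> []" "sublist (map Dir p) ls \<or> sublist (rev (map Inv p)) ls" for p
  proof (rule path_not_in_ideal[OF that(1)])
    have "rev (map Inv p) = rev (map letter_inv (map Dir p))" by simp
    then show "word_ok (map Dir p)" using that(2) r word_ok_sublist word_ok_inv by metis
  qed
  moreover have "is_walk Q (x, ls)" using r by (auto simp: word_ok_def compat_def)
  ultimately show "is_string Q I (x, ls)" by (auto simp: is_string_def)
qed

lemma string_module_diagram:
  assumes "is_string Q I (x, ls)"
  shows "diagram Q I (Suc (length ls)) (\<lambda>j. word_end Q (x, take j ls)) ls Suc (\<lambda>_. 1)"
  using assms string_diagram by (simp add: is_string_iff)

lemma word_end_full:
  assumes "word_ok ls" "ls \<noteq> [] \<Longrightarrow> letter_start Q (hd ls) = x" "j \<le> length ls"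
  shows "word_end Q (word_end Q (x, ls), take j (rev (map letter_inv ls))) = word_end Q (x, take (length ls - j) ls)"
proof (cases j)
  case (Suc i)
  then have "rev (map letter_inv ls) ! i = letter_inv (ls ! (length ls - j))" "length ls - j < length ls"
    using assms(3) by (auto simp: rev_nth)
  then show ?thesis
    using Suc assms(3) word_end_take_Suc[of i "rev (map letter_inv ls)"] word_end_take[OF assms(1,2), of "length ls - j"]
    by simp
qed simp

lemma is_string_inv: "is_string Q I w \<Longrightarrow> is_string Q I (word_inv Q w)"
proof -
  assume s: "is_string Q I w"
  obtain x ls where w: "w = (x, ls)" by (cases w)
  have ok: "x \<in> verts Q" "word_ok ls" "ls \<noteq> [] \<longrightarrow> letter_start Q (hd ls) = x" using s by (auto simp: w is_string_iff)
  have "word_end Q (x, ls) \<in> verts Q"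
    using ok by (cases ls rule: rev_cases) (auto simp: word_ok_def letter_verts)
  moreover have "rev (map letter_inv ls) \<noteq> [] \<longrightarrow> letter_start Q (hd (rev (map letter_inv ls))) = word_end Q (x, ls)"
    by (cases ls rule: rev_cases) auto
  ultimately show ?thesis using ok by (simp add: w is_string_iff word_ok_inv)
qed

lemma diagram_coord:
  assumes "diagram Q I N lab ls nx wt"
  shows "coord_module N (diagram_module N lab ls nx wt)"
proof -
  interpret diagram Q I N lab ls nx wt by fact
  show ?thesis unfolding coord_module_def using left_module_D D_simps sc_smult_D by (auto simp: diagram_module_def)
qed

text \<open>
  By gentleness a string can be continued after a given letter by at most one direct and at most
  one inverse letter: an arrow composes to something nonzero with at most one arrow on either
  side, and at most two arrows start or end at a vertex.
\<close>

lemma compat_unique: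
  assumes "letter_arrow L \<in> arcs Q" "letter_arrow M \<in> arcs Q" "letter_arrow M' \<in> arcs Q"
    and "compat L M" "compat L M'" and "(\<exists>a b. M = Dir a \<and> M' = Dir b) \<or> (\<exists>a b. M = Inv a \<and> M' = Inv b)"
  shows "M = M'"
  using assms(6)
proof (elim disjE exE conjE)
  fix b b' assume M: "M = Dir b" "M' = Dir b'"
  show ?thesis
  proof (cases L)
    case (Dir a)
    with assms M have "b = b'" by (intro gentle_nonzero_left[of b b' a]) (simp_all add: compat_def)
    then show ?thesis using M by simp
  next
    case (Inv a)
    with assms M have "b = b'" by (intro gentle_out[of a b b']) (auto simp: compat_def)
    then show ?thesis using M by simp
  qed
next
  fix b b' assume M: "M = Inv b" "M' = Inv b'"
  show ?thesis
  proof (cases L)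
    case (Dir a)
    with assms M have "b = b'" by (intro gentle_in[of a b b']) (auto simp: compat_def)
    then show ?thesis using M by simp
  next
    case (Inv a)
    with assms M have "b = b'" by (intro gentle_nonzero_right[of b b' a]) (simp_all add: compat_def)
    then show ?thesis using M by simp
  qed
qed

lemma compat_unique_left:
  assumes "letter_arrow L \<in> arcs Q" "letter_arrow M \<in> arcs Q" "letter_arrow M' \<in> arcs Q"
    and "compat M L" "compat M' L" and "(\<exists>a b. M = Dir a \<and> M' = Dir b) \<or> (\<exists>a b. M = Inv a \<and> M' = Inv b)"
  shows "M = M'"
proof -
  have "letter_inv M = letter_inv M'"
    using assms compat_inv by (intro compat_unique[of "letter_inv L"]) auto
  then show ?thesis by simp
qed

end

lemma (in abelian_group) add_left_cancelD:
  assumes "x \<oplus> y = x \<oplus> z" "x \<in> carrier G" "y \<in> carrier G" "z \<in> carrier G"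
  shows "y = z"
  using assms by (metis r_neg1)

section \<open>Fibre products of extensions\<close>

lemma left_module_direct_sum:
  assumes "left_module R M" "left_module R N"
  shows "left_module R (direct_sum M N)"
proof -
  interpret M: left_module R M by fact
  interpret N: left_module R N by fact
  have "abelian_group (direct_sum M N)"
  proof (rule abelian_groupI)
    fix x assume x: "x \<in> carrier (direct_sum M N)"
    then have "(\<ominus>\<^bsub>M\<^esub> fst x, \<ominus>\<^bsub>N\<^esub> snd x) \<oplus>\<^bsub>direct_sum M N\<^esub> x = \<zero>\<^bsub>direct_sum M N\<^esub>"
      "(\<ominus>\<^bsub>M\<^esub> fst x, \<ominus>\<^bsub>N\<^esub> snd x) \<in> carrier (direct_sum M N)"
      by (auto simp: direct_sum_def M.M.l_neg N.M.l_neg)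
    then show "\<exists>y\<in>carrier (direct_sum M N). y \<oplus>\<^bsub>direct_sum M N\<^esub> x = \<zero>\<^bsub>direct_sum M N\<^esub>" by blast
  qed (auto simp: direct_sum_def M.M.a_ac N.M.a_ac)
  then show ?thesis
    by (intro left_module.intro left_module_axioms.intro M.R.ring_axioms)
      (auto simp: direct_sum_def M.smult_closed N.smult_closed M.smult_l_distr N.smult_l_distr
        M.smult_r_distr N.smult_r_distr M.smult_assoc N.smult_assoc M.smult_one N.smult_one)
qed

lemma left_module_restrict:
  assumes "left_module R M" "S \<subseteq> carrier M" "\<zero>\<^bsub>M\<^esub> \<in> S"
    and "\<And>x y. x \<in> S \<Longrightarrow> y \<in> S \<Longrightarrow> x \<oplus>\<^bsub>M\<^esub> y \<in> S"
    and "\<And>r x. r \<in> carrier R \<Longrightarrow> x \<in> S \<Longrightarrow> r \<odot>\<^bsub>M\<^esub> x \<in> S"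
  shows "left_module R (M\<lparr>carrier := S\<rparr>)"
proof -
  interpret M: left_module R M by fact
  have S: "x \<in> carrier M" if "x \<in> S" for x using that assms(2) by blast
  have "abelian_group (M\<lparr>carrier := S\<rparr>)"
  proof (rule abelian_groupI)
    fix x assume "x \<in> carrier (M\<lparr>carrier := S\<rparr>)"
    then have x: "x \<in> S" by simp
    have "\<ominus>\<^bsub>M\<^esub> x = (\<ominus>\<^bsub>R\<^esub> \<one>\<^bsub>R\<^esub>) \<odot>\<^bsub>M\<^esub> x"
      using S[OF x] by (simp add: M.smult_minus_left M.smult_one)
    then have "\<ominus>\<^bsub>M\<^esub> x \<in> S" using assms(5)[of "\<ominus>\<^bsub>R\<^esub> \<one>\<^bsub>R\<^esub>" x] x by simp
    then show "\<exists>y\<in>carrier (M\<lparr>carrier := S\<rparr>). y \<oplus>\<^bsub>M\<lparr>carrier := S\<rparr>\<^esub> x = \<zero>\<^bsub>M\<lparr>carrier := S\<rparr>\<^esub>"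
      using S[OF x] M.M.l_neg by auto
  qed (use assms S M.M.a_ac in auto)
  then show ?thesis
    by (intro left_module.intro left_module_axioms.intro M.R.ring_axioms)
      (use assms S in \<open>auto simp: M.smult_l_distr M.smult_r_distr M.smult_assoc M.smult_one\<close>)
qed

lemma fibre_is_extension:
  assumes "is_extension R X Y (E, f, g)" "is_extension R X Y (E', f', g')"
  shows "is_extension R X (direct_sum Y Y) (fibre_ext (E, f, g) (E', f', g'))"
proof -
  have m: "left_module R X" "left_module R Y" "left_module R E" "left_module R E'"
    and f: "f \<in> module_hom R Y E" "inj_on f (carrier Y)" "f ` carrier Y = {e \<in> carrier E. g e = \<zero>\<^bsub>X\<^esub>}"
    and g: "g \<in> module_hom R E X" "g ` carrier E = carrier X"
    and f': "f' \<in> module_hom R Y E'" "inj_on f' (carrier Y)" "f' ` carrier Y = {e \<in> carrier E'. g' e = \<zero>\<^bsub>X\<^esub>}"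
    and g': "g' \<in> module_hom R E' X" "g' ` carrier E' = carrier X"
    using assms by auto
  interpret X: left_module R X by fact
  interpret Y: left_module R Y by fact
  interpret E: left_module R E by fact
  interpret E': left_module R E' by fact
  define S where "S = {(e, e'). e \<in> carrier E \<and> e' \<in> carrier E' \<and> g e = g' e'}"
  note z = module_hom_zero[OF m(3,1) g(1)] module_hom_zero[OF m(4,1) g'(1)]
  have P: "left_module R ((direct_sum E E')\<lparr>carrier := S\<rparr>)"
    by (rule left_module_restrict[OF left_module_direct_sum[OF m(3,4)]])
      (auto simp: S_def direct_sum_def z module_hom_add[OF g(1)] module_hom_add[OF g'(1)]
        module_hom_smult[OF g(1)] module_hom_smult[OF g'(1)] E.smult_closed E'.smult_closed)
  have fc: "y \<in> carrier Y \<Longrightarrow> f y \<in> carrier E \<and> g (f y) = \<zero>\<^bsub>X\<^esub>" "y \<in> carrier Y \<Longrightarrow> f' y \<in> carrier E' \<and> g' (f' y) = \<zero>\<^bsub>X\<^esub>" for y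
    using f(3) f'(3) by blast+
  have 1: "(\<lambda>(y, y'). (f y, f' y')) \<in> module_hom R (direct_sum Y Y) ((direct_sum E E')\<lparr>carrier := S\<rparr>)"
    unfolding module_hom_def using fc
    by (auto simp: S_def direct_sum_def module_hom_add[OF f(1)] module_hom_add[OF f'(1)]
        module_hom_smult[OF f(1)] module_hom_smult[OF f'(1)])
  have 2: "(\<lambda>(e, e'). g e) \<in> module_hom R ((direct_sum E E')\<lparr>carrier := S\<rparr>) X"
    unfolding module_hom_def using module_hom_carrier[OF g(1)]
    by (auto simp: S_def direct_sum_def module_hom_add[OF g(1)] module_hom_smult[OF g(1)])
  have 3: "inj_on (\<lambda>(y, y'). (f y, f' y')) (carrier (direct_sum Y Y))"
    using f(2) f'(2) by (auto simp: inj_on_def direct_sum_def)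
  have 4: "(\<lambda>(e, e'). g e) ` S = carrier X"
  proof (intro equalityI subsetI)
    fix x assume x: "x \<in> carrier X"
    then obtain e e' where "e \<in> carrier E" "g e = x" "e' \<in> carrier E'" "g' e' = x" using g(2) g'(2) by (metis imageE)
    then show "x \<in> (\<lambda>(e, e'). g e) ` S" by (intro image_eqI[of _ _ "(e, e')"]) (auto simp: S_def)
  qed (use module_hom_carrier[OF g(1)] in \<open>auto simp: S_def\<close>)
  have 5: "(\<lambda>(y, y'). (f y, f' y')) ` carrier (direct_sum Y Y) = {e \<in> S. (case e of (e, e') \<Rightarrow> g e) = \<zero>\<^bsub>X\<^esub>}"
  proof (intro equalityI subsetI)
    fix p assume "p \<in> {e \<in> S. (case e of (e, e') \<Rightarrow> g e) = \<zero>\<^bsub>X\<^esub>}"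
    then obtain e e' where p: "p = (e, e')" "e \<in> carrier E" "e' \<in> carrier E'" "g e = \<zero>\<^bsub>X\<^esub>" "g' e' = \<zero>\<^bsub>X\<^esub>"
      by (auto simp: S_def)
    then have "e \<in> f ` carrier Y" "e' \<in> f' ` carrier Y" using f(3) f'(3) by auto
    then obtain y y' where "y \<in> carrier Y" "y' \<in> carrier Y" "e = f y" "e' = f' y'" by blast
    then show "p \<in> (\<lambda>(y, y'). (f y, f' y')) ` carrier (direct_sum Y Y)"
      by (intro image_eqI[of _ _ "(y, y')"]) (auto simp: direct_sum_def p)
  qed (use fc in \<open>auto simp: S_def direct_sum_def\<close>)
  show ?thesis using m left_module_direct_sum[OF m(2,2)] P 1 2 3 4 5 unfolding S_def[symmetric]
    by (simp add: S_def[symmetric])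
qed

section \<open>Extensions from cocycles\<close>

context gentle_quiver
begin

lemma comb_coord_sum:
  assumes "coord_module m X" "\<And>i. i < n \<Longrightarrow> e i \<in> carrier X"
  shows "comb X e n x = (\<lambda>j. \<Sum>i<n. x i * e i j)"
  using assms(2)
proof (induction n)
  case 0
  then show ?case using assms(1) by (simp add: coord_module_def)
next
  case (Suc n)
  then show ?case using assms(1) by (simp add: coord_module_def)
qed

lemma coord_smult_comb:
  assumes X: "coord_module N X" and F: "F \<in> carrier R" and yz: "y \<in> carrier X" "z \<in> carrier X"
  shows "F \<odot>\<^bsub>X\<^esub> (\<lambda>j. \<kappa> * y j + \<mu> * z j) = (\<lambda>j. \<kappa> * (F \<odot>\<^bsub>X\<^esub> y) j + \<mu> * (F \<odot>\<^bsub>X\<^esub> z) j)"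
proof -
  interpret X: left_module R X using X by (simp add: coord_module_def)
  have Xs: "p \<oplus>\<^bsub>X\<^esub> q = (\<lambda>j. p j + q j)" "p \<in> carrier X \<Longrightarrow> sc \<nu> \<odot>\<^bsub>X\<^esub> p = (\<lambda>j. \<nu> * p j)" for p q \<nu>
    using X by (auto simp: coord_module_def)
  have "(\<lambda>j. \<kappa> * y j + \<mu> * z j) = sc \<kappa> \<odot>\<^bsub>X\<^esub> y \<oplus>\<^bsub>X\<^esub> sc \<mu> \<odot>\<^bsub>X\<^esub> z" using yz by (simp add: Xs)
  then have "F \<odot>\<^bsub>X\<^esub> (\<lambda>j. \<kappa> * y j + \<mu> * z j) = (F \<otimes>\<^bsub>R\<^esub> sc \<kappa>) \<odot>\<^bsub>X\<^esub> y \<oplus>\<^bsub>X\<^esub> (F \<otimes>\<^bsub>R\<^esub> sc \<mu>) \<odot>\<^bsub>X\<^esub> z"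
    using F yz X.smult_closed by (simp add: X.smult_r_distr X.smult_assoc)
  also have "\<dots> = sc \<kappa> \<odot>\<^bsub>X\<^esub> (F \<odot>\<^bsub>X\<^esub> y) \<oplus>\<^bsub>X\<^esub> sc \<mu> \<odot>\<^bsub>X\<^esub> (F \<odot>\<^bsub>X\<^esub> z)"
    using F yz by (simp add: X.smult_assoc flip: sc_central)
  finally show ?thesis using F yz X.smult_closed by (simp add: Xs)
qed

text \<open>
  A cocycle measures by how much a linear section \<open>S\<close> of an extension fails to be linear over the
  algebra: \<open>F S(x) = S(F x) + D F x\<close>. It vanishes on scalars.
\<close>
definition cocycle ::
  "((('v, 'a) path \<Rightarrow> 'k) set, nat \<Rightarrow> 'k) module \<Rightarrow> ((('v, 'a) path \<Rightarrow> 'k) set, nat \<Rightarrow> 'k) module \<Rightarrow>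
   ((('v, 'a) path \<Rightarrow> 'k) set \<Rightarrow> (nat \<Rightarrow> 'k) \<Rightarrow> nat \<Rightarrow> 'k) \<Rightarrow> bool" where
  "cocycle X Y D \<longleftrightarrow>
     (\<forall>F\<in>carrier R. \<forall>x\<in>carrier X. D F x \<in> carrier Y \<and>
        (\<forall>x'\<in>carrier X. D F (x \<oplus>\<^bsub>X\<^esub> x') = D F x \<oplus>\<^bsub>Y\<^esub> D F x') \<and>
        (\<forall>G\<in>carrier R. D (F \<oplus>\<^bsub>R\<^esub> G) x = D F x \<oplus>\<^bsub>Y\<^esub> D G x \<and>
           D (F \<otimes>\<^bsub>R\<^esub> G) x = F \<odot>\<^bsub>Y\<^esub> D G x \<oplus>\<^bsub>Y\<^esub> D F (G \<odot>\<^bsub>X\<^esub> x))) \<and>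
     (\<forall>\<kappa>. \<forall>x\<in>carrier X. D (sc \<kappa>) x = \<zero>\<^bsub>Y\<^esub>)"

text \<open>
  The section is a section of vector spaces, so \<open>F S(x) - S(F x)\<close> lies in the kernel of \<open>E \<rightarrow> X\<close>,
  which is the image of \<open>Y\<close>.
\<close>
lemma cocycle_of_extension:
  assumes ext: "is_extension R X Y (E, f, g)" and X: "coord_module n X" and e: "section_of n (E, f, g) e"
  shows "\<exists>D. cocycle X Y D \<and> (\<forall>F\<in>carrier R. \<forall>x\<in>carrier X.
           F \<odot>\<^bsub>E\<^esub> comb E e n x = comb E e n (F \<odot>\<^bsub>X\<^esub> x) \<oplus>\<^bsub>E\<^esub> f (D F x))"
proof -
  have mods: "left_module R X" "left_module R Y" "left_module R E"
    and f: "f \<in> module_hom R Y E" "inj_on f (carrier Y)" and g: "g \<in> module_hom R E X" using ext by auto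
  interpret E: left_module R E by fact
  interpret X: left_module R X by fact
  interpret Y: left_module R Y by fact
  define S where "S = comb E e n"
  have ec: "\<And>i. i < n \<Longrightarrow> e i \<in> carrier E" using e by (auto simp: section_of_def)
  have S: "\<And>x. x \<in> carrier X \<Longrightarrow> S x \<in> carrier E" "\<And>x. x \<in> carrier X \<Longrightarrow> g (S x) = x"
    using section_proj[OF ext X e] by (auto simp: S_def)
  have S_add: "S (x \<oplus>\<^bsub>X\<^esub> y) = S x \<oplus>\<^bsub>E\<^esub> S y" for x y
    using X comb_add[OF mods(3), of n e x y] ec by (auto simp: coord_module_def S_def)
  have S_sc: "S (sc \<kappa> \<odot>\<^bsub>X\<^esub> x) = sc \<kappa> \<odot>\<^bsub>E\<^esub> S x" if "x \<in> carrier X" for x \<kappa>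
    using that X comb_scale[OF mods(3), of n e \<kappa> x] ec by (auto simp: coord_module_def S_def)
  have "\<exists>y. y \<in> carrier Y \<and> F \<odot>\<^bsub>E\<^esub> S x = S (F \<odot>\<^bsub>X\<^esub> x) \<oplus>\<^bsub>E\<^esub> f y" if "F \<in> carrier R" "x \<in> carrier X" for F x
  proof -
    have Fx: "F \<odot>\<^bsub>X\<^esub> x \<in> carrier X" using that X.smult_closed by simp
    have "g (F \<odot>\<^bsub>E\<^esub> S x) = g (S (F \<odot>\<^bsub>X\<^esub> x))"
      using that S Fx by (simp add: module_hom_smult[OF g])
    then show ?thesis using kernel_image[OF ext, of "F \<odot>\<^bsub>E\<^esub> S x" "S (F \<odot>\<^bsub>X\<^esub> x)"] that S Fx E.smult_closed by auto
  qed
  then obtain D where D: "\<And>F x. F \<in> carrier R \<Longrightarrow> x \<in> carrier X \<Longrightarrow> D F x \<in> carrier Y"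
     "\<And>F x. F \<in> carrier R \<Longrightarrow> x \<in> carrier X \<Longrightarrow> F \<odot>\<^bsub>E\<^esub> S x = S (F \<odot>\<^bsub>X\<^esub> x) \<oplus>\<^bsub>E\<^esub> f (D F x)"
    by metis
  have fc: "\<And>y. y \<in> carrier Y \<Longrightarrow> f y \<in> carrier E" using module_hom_carrier[OF f(1)] .
  have uniq: "D F x = y" if "F \<in> carrier R" "x \<in> carrier X" "y \<in> carrier Y" "F \<odot>\<^bsub>E\<^esub> S x = S (F \<odot>\<^bsub>X\<^esub> x) \<oplus>\<^bsub>E\<^esub> f y" for F x y
  proof -
    have "S (F \<odot>\<^bsub>X\<^esub> x) \<in> carrier E" using that S X.smult_closed by simp
    then have "f (D F x) = f y" using that D[OF that(1,2)] fc E.M.add_left_cancelD by metis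
    then show ?thesis using f(2) that D by (auto simp: inj_on_def)
  qed
  have "cocycle X Y D" unfolding cocycle_def
  proof (intro conjI ballI allI)
    fix F x assume F: "F \<in> carrier R" and x: "x \<in> carrier X"
    have Fx: "F \<odot>\<^bsub>X\<^esub> x \<in> carrier X" using F x X.smult_closed by simp
    show "D F x \<in> carrier Y" using D F x by simp
    show "D F (x \<oplus>\<^bsub>X\<^esub> x') = D F x \<oplus>\<^bsub>Y\<^esub> D F x'" if x': "x' \<in> carrier X" for x'
    proof (rule uniq)
      have "F \<odot>\<^bsub>X\<^esub> x' \<in> carrier X" using F x' X.smult_closed by simp
      then show "F \<odot>\<^bsub>E\<^esub> S (x \<oplus>\<^bsub>X\<^esub> x') = S (F \<odot>\<^bsub>X\<^esub> (x \<oplus>\<^bsub>X\<^esub> x')) \<oplus>\<^bsub>E\<^esub> f (D F x \<oplus>\<^bsub>Y\<^esub> D F x')"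
        using F x x' Fx D[OF F x] D[OF F x'] S fc
        by (simp add: S_add E.smult_r_distr X.smult_r_distr module_hom_add[OF f(1)] E.M.a_ac)
    qed (use F x x' D in auto)
    fix G assume G: "G \<in> carrier R"
    have Gx: "G \<odot>\<^bsub>X\<^esub> x \<in> carrier X" using G x X.smult_closed by simp
    have FGx: "F \<odot>\<^bsub>X\<^esub> (G \<odot>\<^bsub>X\<^esub> x) \<in> carrier X" using F Gx X.smult_closed by simp
    show "D (F \<oplus>\<^bsub>R\<^esub> G) x = D F x \<oplus>\<^bsub>Y\<^esub> D G x"
    proof (rule uniq)
      show "(F \<oplus>\<^bsub>R\<^esub> G) \<odot>\<^bsub>E\<^esub> S x = S ((F \<oplus>\<^bsub>R\<^esub> G) \<odot>\<^bsub>X\<^esub> x) \<oplus>\<^bsub>E\<^esub> f (D F x \<oplus>\<^bsub>Y\<^esub> D G x)"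
        using F G x Fx Gx D[OF F x] D[OF G x] S fc
        by (simp add: S_add E.smult_l_distr X.smult_l_distr module_hom_add[OF f(1)] E.M.a_ac)
    qed (use F G x D in auto)
    show "D (F \<otimes>\<^bsub>R\<^esub> G) x = F \<odot>\<^bsub>Y\<^esub> D G x \<oplus>\<^bsub>Y\<^esub> D F (G \<odot>\<^bsub>X\<^esub> x)"
    proof (rule uniq)
      show "(F \<otimes>\<^bsub>R\<^esub> G) \<odot>\<^bsub>E\<^esub> S x = S ((F \<otimes>\<^bsub>R\<^esub> G) \<odot>\<^bsub>X\<^esub> x) \<oplus>\<^bsub>E\<^esub> f (F \<odot>\<^bsub>Y\<^esub> D G x \<oplus>\<^bsub>Y\<^esub> D F (G \<odot>\<^bsub>X\<^esub> x))"
        using F G x FGx Gx D[OF F Gx] D[OF G x] S fc E.smult_closed Y.smult_closed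
        by (simp add: E.smult_assoc X.smult_assoc E.smult_r_distr module_hom_add[OF f(1)]
            module_hom_smult[OF f(1)] E.M.a_ac)
    qed (use F G x Gx D Y.smult_closed in auto)
  next
    fix \<kappa> x assume x: "x \<in> carrier X"
    show "D (sc \<kappa>) x = \<zero>\<^bsub>Y\<^esub>"
      by (rule uniq) (use x S X.smult_closed E.smult_closed in
          \<open>auto simp: S_sc module_hom_zero[OF mods(2,3) f(1)]\<close>)
  qed
  then show ?thesis using D(2) S_def by auto
qed

lemma cocycle_combination:
  assumes X: "coord_module n X" and Y: "coord_module m Y" and "cocycle X Y D" "cocycle X Y D'"
  shows "cocycle X Y (\<lambda>F x j. \<kappa> * D F x j + \<mu> * D' F x j)"
proof -
  have Ys: "y \<oplus>\<^bsub>Y\<^esub> z = (\<lambda>j. y j + z j)" "\<zero>\<^bsub>Y\<^esub> = (\<lambda>_. 0)" "z \<in> carrier Y \<longleftrightarrow> (\<forall>j\<ge>m. z j = 0)" for y z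
    using Y by (auto simp: coord_module_def)
  interpret X: left_module R X using X by (simp add: coord_module_def)
  show ?thesis
    using assms(3,4) X.smult_closed coord_smult_comb[OF Y] unfolding cocycle_def
    by (auto simp: Ys algebra_simps)
qed

text \<open>
  The middle term is \<open>Y \<times> X\<close> with the action \<open>F (y, x) = (F y + D F x, F x)\<close>. A pair is stored as
  one coordinate function, \<open>y\<close> in the first \<open>m\<close> coordinates and \<open>x\<close> shifted by \<open>m\<close>.
\<close>
lemma extension_of_cocycle:
  assumes X: "coord_module n X" and Y: "coord_module m Y" and D: "cocycle X Y D"
  shows "\<exists>E f g e. is_extension R X Y (E :: (_, nat \<Rightarrow> 'k) module, f, g) \<and> section_of n (E, f, g) e \<and>
     (\<forall>F\<in>carrier R. \<forall>x\<in>carrier X. F \<odot>\<^bsub>E\<^esub> comb E e n x = comb E e n (F \<odot>\<^bsub>X\<^esub> x) \<oplus>\<^bsub>E\<^esub> f (D F x))"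
proof -
  have Xadd: "y \<oplus>\<^bsub>X\<^esub> z = (\<lambda>j. y j + z j)" and X0: "\<zero>\<^bsub>X\<^esub> = (\<lambda>_. 0)"
    and Xsc: "z \<in> carrier X \<Longrightarrow> sc \<nu> \<odot>\<^bsub>X\<^esub> z = (\<lambda>j. \<nu> * z j)"
    and Xc: "z \<in> carrier X \<longleftrightarrow> (\<forall>j\<ge>n. z j = 0)" for y z \<nu>
    using X by (auto simp: coord_module_def)
  have Yadd: "y \<oplus>\<^bsub>Y\<^esub> z = (\<lambda>j. y j + z j)" and Y0: "\<zero>\<^bsub>Y\<^esub> = (\<lambda>_. 0)"
    and Ysc: "z \<in> carrier Y \<Longrightarrow> sc \<nu> \<odot>\<^bsub>Y\<^esub> z = (\<lambda>j. \<nu> * z j)"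
    and Yc: "z \<in> carrier Y \<longleftrightarrow> (\<forall>j\<ge>m. z j = 0)" for y z \<nu>
    using Y by (auto simp: coord_module_def)
  interpret Y: left_module R Y using Y by (simp add: coord_module_def)
  interpret X: left_module R X using X by (simp add: coord_module_def)
  have Dc: "F \<in> carrier R \<Longrightarrow> x \<in> carrier X \<Longrightarrow> D F x \<in> carrier Y"
    and Dadd: "F \<in> carrier R \<Longrightarrow> x \<in> carrier X \<Longrightarrow> x' \<in> carrier X \<Longrightarrow> D F (\<lambda>j. x j + x' j) = (\<lambda>j. D F x j + D F x' j)"
    and Dplus: "F \<in> carrier R \<Longrightarrow> G \<in> carrier R \<Longrightarrow> x \<in> carrier X \<Longrightarrow> D (F \<oplus>\<^bsub>R\<^esub> G) x = (\<lambda>j. D F x j + D G x j)"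
    and Dmult: "F \<in> carrier R \<Longrightarrow> G \<in> carrier R \<Longrightarrow> x \<in> carrier X \<Longrightarrow>
       D (F \<otimes>\<^bsub>R\<^esub> G) x = (\<lambda>j. (F \<odot>\<^bsub>Y\<^esub> D G x) j + D F (G \<odot>\<^bsub>X\<^esub> x) j)"
    and Dsc: "x \<in> carrier X \<Longrightarrow> D (sc \<kappa>) x = (\<lambda>_. 0)" for F G x x' \<kappa>
    using D by (auto simp: cocycle_def Xadd Yadd Y0)
  (* The two components of a vector of the middle term, and the vector with given components. *)
  define lo where "lo z = (\<lambda>j. if j < m then z j else 0)" for z :: "nat \<Rightarrow> 'k"
  define hi where "hi z = (\<lambda>j. z (j + m))" for z :: "nat \<Rightarrow> 'k"
  define mg where "mg y x = (\<lambda>j. if j < m then y j else x (j - m))" for x y :: "nat \<Rightarrow> 'k"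
  have lomg: "y \<in> carrier Y \<Longrightarrow> lo (mg y x) = y" and himg: "hi (mg y x) = x"
    and mglh: "mg (lo z) (hi z) = z" for x y z
    by (auto simp: lo_def hi_def mg_def Yc fun_eq_iff)
  have loadd: "lo (\<lambda>j. y j + z j) = (\<lambda>j. lo y j + lo z j)" and hiadd: "hi (\<lambda>j. y j + z j) = (\<lambda>j. hi y j + hi z j)" for y z
    by (auto simp: lo_def hi_def)
  have loc: "lo z \<in> carrier Y" for z by (auto simp: lo_def Yc)
  define C where "C = {z :: nat \<Rightarrow> 'k. \<forall>j\<ge>m + n. z j = 0}"
  have hic: "hi z \<in> carrier X" if "z \<in> C" for z using that by (auto simp: hi_def Xc C_def)
  have mgc: "mg y x \<in> C" if "x \<in> carrier X" for x y using that by (auto simp: mg_def Xc C_def)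
  define E :: "((('v, 'a) path \<Rightarrow> 'k) set, nat \<Rightarrow> 'k) module" where
    "E = \<lparr>carrier = C, monoid.mult = undefined, one = undefined, zero = (\<lambda>_. 0), add = (\<lambda>y z j. y j + z j),
       smult = (\<lambda>F z. mg (\<lambda>j. (F \<odot>\<^bsub>Y\<^esub> lo z) j + D F (hi z) j) (F \<odot>\<^bsub>X\<^esub> hi z))\<rparr>"
  have Es: "carrier E = C" "\<zero>\<^bsub>E\<^esub> = (\<lambda>_. 0)" "y \<oplus>\<^bsub>E\<^esub> z = (\<lambda>j. y j + z j)"
    "F \<odot>\<^bsub>E\<^esub> z = mg (\<lambda>j. (F \<odot>\<^bsub>Y\<^esub> lo z) j + D F (hi z) j) (F \<odot>\<^bsub>X\<^esub> hi z)" for F y z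
    by (simp_all add: E_def)
  have mg_add: "mg (\<lambda>j. y j + y' j) (\<lambda>j. x j + x' j) = (\<lambda>j. mg y x j + mg y' x' j)" for x x' y y'
    by (auto simp: mg_def)
  have YD: "(\<lambda>j. (F \<odot>\<^bsub>Y\<^esub> lo z) j + D F (hi z) j) \<in> carrier Y" if "F \<in> carrier R" "z \<in> C" for F z
    using Y.smult_closed[OF that(1) loc, of z] Dc[OF that(1) hic[OF that(2)]] by (auto simp: Yc)
  have Ymod: "F \<odot>\<^bsub>Y\<^esub> (\<lambda>j. y j + z j) = (\<lambda>j. (F \<odot>\<^bsub>Y\<^esub> y) j + (F \<odot>\<^bsub>Y\<^esub> z) j)"
    if "F \<in> carrier R" "y \<in> carrier Y" "z \<in> carrier Y" for F y z
    using Y.smult_r_distr[OF that] by (simp add: Yadd)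
  have Xmod: "F \<odot>\<^bsub>X\<^esub> (\<lambda>j. y j + z j) = (\<lambda>j. (F \<odot>\<^bsub>X\<^esub> y) j + (F \<odot>\<^bsub>X\<^esub> z) j)"
    if "F \<in> carrier R" "y \<in> carrier X" "z \<in> carrier X" for F y z
    using X.smult_r_distr[OF that] by (simp add: Xadd)
  have Emod: "left_module R E"
  proof (intro left_module.intro ring_R left_module_axioms.intro)
    show "abelian_group E"
    proof (rule abelian_groupI)
      fix x assume x: "x \<in> carrier E"
      have "(\<lambda>j. - x j) \<in> carrier E" "(\<lambda>j. - x j) \<oplus>\<^bsub>E\<^esub> x = \<zero>\<^bsub>E\<^esub>" using x by (auto simp: Es C_def)
      then show "\<exists>y\<in>carrier E. y \<oplus>\<^bsub>E\<^esub> x = \<zero>\<^bsub>E\<^esub>" by blast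
    qed (auto simp: Es C_def algebra_simps)
  next
    fix r x assume r: "r \<in> carrier R" "x \<in> carrier E"
    then show "r \<odot>\<^bsub>E\<^esub> x \<in> carrier E" using hic X.smult_closed mgc by (simp add: Es)
  next
    fix r s x assume r: "r \<in> carrier R" "s \<in> carrier R" "x \<in> carrier E"
    have h: "hi x \<in> carrier X" using r hic by (simp add: Es)
    have "(\<lambda>j. ((r \<oplus>\<^bsub>R\<^esub> s) \<odot>\<^bsub>Y\<^esub> lo x) j + D (r \<oplus>\<^bsub>R\<^esub> s) (hi x) j) =
        (\<lambda>j. ((r \<odot>\<^bsub>Y\<^esub> lo x) j + D r (hi x) j) + ((s \<odot>\<^bsub>Y\<^esub> lo x) j + D s (hi x) j))"
      using Y.smult_l_distr[OF r(1,2) loc] Dplus[OF r(1,2) h] by (auto simp: Yadd algebra_simps)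
    moreover have "(r \<oplus>\<^bsub>R\<^esub> s) \<odot>\<^bsub>X\<^esub> hi x = (\<lambda>j. (r \<odot>\<^bsub>X\<^esub> hi x) j + (s \<odot>\<^bsub>X\<^esub> hi x) j)"
      using X.smult_l_distr[OF r(1,2) h] by (simp add: Xadd)
    ultimately show "(r \<oplus>\<^bsub>R\<^esub> s) \<odot>\<^bsub>E\<^esub> x = r \<odot>\<^bsub>E\<^esub> x \<oplus>\<^bsub>E\<^esub> s \<odot>\<^bsub>E\<^esub> x" by (simp only: Es mg_add)
  next
    fix r x y assume r: "r \<in> carrier R" "x \<in> carrier E" "y \<in> carrier E"
    have h: "hi x \<in> carrier X" "hi y \<in> carrier X" using r hic by (auto simp: Es)
    have "(\<lambda>j. (r \<odot>\<^bsub>Y\<^esub> lo (x \<oplus>\<^bsub>E\<^esub> y)) j + D r (hi (x \<oplus>\<^bsub>E\<^esub> y)) j) =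
        (\<lambda>j. ((r \<odot>\<^bsub>Y\<^esub> lo x) j + D r (hi x) j) + ((r \<odot>\<^bsub>Y\<^esub> lo y) j + D r (hi y) j))"
      using Ymod[OF r(1) loc loc] Dadd[OF r(1) h] by (auto simp: Es loadd hiadd algebra_simps)
    moreover have "r \<odot>\<^bsub>X\<^esub> hi (x \<oplus>\<^bsub>E\<^esub> y) = (\<lambda>j. (r \<odot>\<^bsub>X\<^esub> hi x) j + (r \<odot>\<^bsub>X\<^esub> hi y) j)"
      using Xmod[OF r(1) h] by (simp add: Es hiadd)
    ultimately show "r \<odot>\<^bsub>E\<^esub> (x \<oplus>\<^bsub>E\<^esub> y) = r \<odot>\<^bsub>E\<^esub> x \<oplus>\<^bsub>E\<^esub> r \<odot>\<^bsub>E\<^esub> y"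
      unfolding Es(4) by (simp only: mg_add Es(3))
  next
    fix r s x assume r: "r \<in> carrier R" "s \<in> carrier R" "x \<in> carrier E"
    have h: "hi x \<in> carrier X" using r hic by (simp add: Es)
    have xC: "x \<in> C" using r by (simp add: Es)
    have "(\<lambda>j. (r \<odot>\<^bsub>Y\<^esub> (\<lambda>j. (s \<odot>\<^bsub>Y\<^esub> lo x) j + D s (hi x) j)) j + D r (s \<odot>\<^bsub>X\<^esub> hi x) j) =
          (\<lambda>j. ((r \<otimes>\<^bsub>R\<^esub> s) \<odot>\<^bsub>Y\<^esub> lo x) j + D (r \<otimes>\<^bsub>R\<^esub> s) (hi x) j)"
      using Ymod[OF r(1) Y.smult_closed[OF r(2) loc] Dc[OF r(2) h]] Y.smult_assoc[OF r(1,2) loc]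
        Dmult[OF r(1,2) h] by (auto simp: algebra_simps)
    then show "(r \<otimes>\<^bsub>R\<^esub> s) \<odot>\<^bsub>E\<^esub> x = r \<odot>\<^bsub>E\<^esub> (s \<odot>\<^bsub>E\<^esub> x)"
      using X.smult_assoc[OF r(1,2) h] by (simp only: Es(4) lomg[OF YD[OF r(2) xC]] himg)
  next
    fix x assume r: "x \<in> carrier E"
    have h: "hi x \<in> carrier X" using r hic by (simp add: Es)
    show "\<one>\<^bsub>R\<^esub> \<odot>\<^bsub>E\<^esub> x = x"
      using h by (simp add: Es Dsc Y.smult_one[OF loc] X.smult_one mglh flip: sc_one)
        (simp add: sc_one Y.smult_one[OF loc] X.smult_one mglh)
  qed
  have scE: "sc \<kappa> \<odot>\<^bsub>E\<^esub> z = (\<lambda>j. \<kappa> * z j)" if "z \<in> C" for \<kappa> z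
    unfolding Es(4) Dsc[OF hic[OF that]] Ysc[OF loc] Xsc[OF hic[OF that]]
    by (auto simp: mg_def lo_def hi_def fun_eq_iff)
  have Ecoord: "coord_module (m + n) E"
    using Emod scE unfolding coord_module_def by (simp add: Es C_def)
  define e where "e i = (basis_vec (m + i) :: nat \<Rightarrow> 'k)" for i
  have ec: "i < n \<Longrightarrow> e i \<in> carrier E" for i by (auto simp: e_def Es C_def)
  have comb_e: "comb E e n x = mg (\<lambda>_. 0) x" if "x \<in> carrier X" for x
  proof (rule ext)
    fix j
    have "comb E e n x = (\<lambda>j. \<Sum>i<n. x i * e i j)"
      using comb_coord_sum[OF Ecoord] ec by blast
    then have "comb E e n x j = (\<Sum>i<n. x i * e i j)" by simp
    also have "\<dots> = (\<Sum>i<n. if i + m = j then x i else 0)"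
      by (intro sum.cong) (auto simp: e_def add.commute)
    also have "\<dots> = mg (\<lambda>_. 0) x j"
    proof (cases "j < m")
      case False
      then have "(\<Sum>i<n. if i + m = j then x i else 0) = (\<Sum>i<n. if i = j - m then x i else 0)"
        by (intro sum.cong) auto
      then show ?thesis using False that by (simp add: mg_def Xc)
    qed (auto simp: mg_def intro!: sum.neutral)
    finally show "comb E e n x j = mg (\<lambda>_. 0) x j" .
  qed
  have act: "F \<odot>\<^bsub>E\<^esub> mg y x = mg (\<lambda>j. (F \<odot>\<^bsub>Y\<^esub> y) j + D F x j) (F \<odot>\<^bsub>X\<^esub> x)" if "y \<in> carrier Y" for F x y
    using that by (simp add: Es lomg himg)
  have Yin: "y = mg y (\<lambda>_. 0)" if "y \<in> carrier Y" for y
    using that by (auto simp: mg_def Yc fun_eq_iff)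
  have D0: "D F (\<lambda>_. 0) = (\<lambda>_. 0)" if "F \<in> carrier R" for F
  proof (rule ext)
    fix j
    have "D F (\<lambda>j. 0 + 0) = (\<lambda>j. D F (\<lambda>_. 0) j + D F (\<lambda>_. 0) j)"
      using Dadd[OF that, of "\<lambda>_. 0" "\<lambda>_. 0"] by (simp only: Xc) simp
    then show "D F (\<lambda>_. 0) j = 0" by (metis add.right_neutral add_left_cancel)
  qed
  have FX0: "F \<odot>\<^bsub>X\<^esub> (\<lambda>_. 0) = (\<lambda>_. 0)" if "F \<in> carrier R" for F
    using X.smult_zero_right[OF that] by (simp add: X0)
  have f: "(\<lambda>y. y) \<in> module_hom R Y E"
    unfolding module_hom_def
  proof (intro CollectI conjI allI impI funcsetI; (elim conjE)?)
    show "y \<in> carrier E" if "y \<in> carrier Y" for y using that by (auto simp: Yc Es C_def)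
    show "y \<oplus>\<^bsub>Y\<^esub> z = y \<oplus>\<^bsub>E\<^esub> z" for y z by (simp add: Yadd Es)
    show "F \<odot>\<^bsub>Y\<^esub> y = F \<odot>\<^bsub>E\<^esub> y" if "F \<in> carrier R" "y \<in> carrier Y" for F y
      using act[OF that(2), of F "\<lambda>_. 0"] Yin[OF that(2)] Yin[OF Y.smult_closed[OF that]] D0[OF that(1)] FX0[OF that(1)]
      by simp
  qed
  have g: "hi \<in> module_hom R E X"
    unfolding module_hom_def using hic by (auto simp: Es hiadd Xadd himg)
  have "is_extension R X Y (E, \<lambda>y. y, hi)"
    unfolding is_extension.simps
  proof (intro conjI X.left_module_axioms Y.left_module_axioms Emod f g)
    show "inj_on (\<lambda>y. y) (carrier Y)" by simp
    show "hi ` carrier E = carrier X"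
    proof (intro equalityI subsetI)
      fix x assume "x \<in> carrier X"
      then show "x \<in> hi ` carrier E" using himg[of "\<lambda>_. 0" x] mgc[of x] by (metis Es(1) imageI)
    qed (use hic Es in auto)
    show "(\<lambda>y. y) ` carrier Y = {e \<in> carrier E. hi e = \<zero>\<^bsub>X\<^esub>}"
    proof (intro equalityI subsetI)
      fix z assume "z \<in> {e \<in> carrier E. hi e = \<zero>\<^bsub>X\<^esub>}"
      then have "z (j - m + m) = 0" for j by (auto simp: hi_def X0 fun_eq_iff)
      then have "z \<in> carrier Y" by (auto simp: Yc) (metis le_add_diff_inverse2)
      then show "z \<in> (\<lambda>y. y) ` carrier Y" by simp
    qed (auto simp: Yc Es C_def X0 hi_def)
  qed
  moreover have "section_of n (E, \<lambda>y. y, hi) e"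
    using ec by (auto simp: section_of_def e_def hi_def fun_eq_iff)
  moreover have "F \<odot>\<^bsub>E\<^esub> comb E e n x = comb E e n (F \<odot>\<^bsub>X\<^esub> x) \<oplus>\<^bsub>E\<^esub> D F x"
    if F: "F \<in> carrier R" and x: "x \<in> carrier X" for F x
  proof -
    have "F \<odot>\<^bsub>Y\<^esub> (\<lambda>_. 0) = (\<lambda>_. 0)" using Y.smult_zero_right[OF F] by (simp add: Y0)
    then have "F \<odot>\<^bsub>E\<^esub> comb E e n x = mg (D F x) (F \<odot>\<^bsub>X\<^esub> x)"
      using act[of "\<lambda>_. 0" F x] by (simp add: comb_e[OF x] Yc)
    also have "\<dots> = (\<lambda>j. mg (\<lambda>_. 0) (F \<odot>\<^bsub>X\<^esub> x) j + mg (D F x) (\<lambda>_. 0) j)"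
      by (simp flip: mg_add)
    finally show ?thesis using Yin[OF Dc[OF F x]] comb_e[OF X.smult_closed[OF F x]] by (simp add: Es)
  qed
  ultimately show ?thesis by blast
qed

end

section \<open>Extensions of a band module\<close>

text \<open>
  The letters of the band and the basis vectors of its module are indexed by \<open>0, \<dots>, n - 1\<close>
  cyclically; the \<open>i\<close>-th letter joins \<open>i\<close> to \<open>succ i\<close>.
\<close>
locale band = gentle_quiver Q I
  for Q :: "('v, 'a) pre_digraph" and I :: "(('v, 'a) path \<Rightarrow> 'k::field) set" +
  fixes c :: "'a letter list" and t :: nat and lam :: 'k
  assumes band: "is_band Q I c" and t: "t < length c" and ct: "\<exists>a. c ! t = Dir a" and lam: "lam \<noteq> 0"
begin

abbreviation n :: nat where "n \<equiv> length c"
definition succ :: "nat \<Rightarrow> nat" where "succ i = Suc i mod n"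
definition pred :: "nat \<Rightarrow> nat" where "pred i = (i + n - 1) mod n"
definition wt :: "nat \<Rightarrow> 'k" where "wt k = (if k = t then lam else 1)"
definition v :: "nat \<Rightarrow> 'v" where "v i = letter_start Q (c ! i)"
definition B :: "((('v, 'a) path \<Rightarrow> 'k) set, nat \<Rightarrow> 'k) module" where "B = band_module Q c t lam"

lemma n_pos: "0 < n" using t by linarith
lemma wt_nonzero [simp]: "wt k \<noteq> 0" using lam by (simp add: wt_def)
lemma succ_less [simp]: "succ i < n" and pred_less [simp]: "pred i < n"
  using n_pos by (auto simp: succ_def pred_def)

lemma succ_pred [simp]: "i < n \<Longrightarrow> succ (pred i) = i"
proof -
  assume i: "i < n"
  have "succ (pred i) = Suc (i + n - 1) mod n" unfolding succ_def pred_def mod_Suc_eq ..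
  also have "Suc (i + n - 1) = i + n" using i by simp
  finally show ?thesis using i by simp
qed

lemma pred_succ [simp]: "i < n \<Longrightarrow> pred (succ i) = i"
  by (cases "Suc i = n") (auto simp: succ_def pred_def)

lemma succ_eq_iff: "i < n \<Longrightarrow> j < n \<Longrightarrow> succ i = j \<longleftrightarrow> i = pred j"
  using succ_pred pred_succ by metis

lemma succ_mod: "succ (nat (p mod int n)) = nat ((p + 1) mod int n)"
proof -
  have "int (Suc (nat (p mod int n)) mod n) = (p mod int n + 1) mod int n"
    using n_pos by (simp add: zmod_int algebra_simps)
  also have "\<dots> = (p + 1) mod int n" by (simp add: mod_add_left_eq)
  finally show ?thesis unfolding succ_def by (metis nat_int)
qed

lemma pred_mod: "nat ((p - 1) mod int n) = pred (nat (p mod int n))"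
proof -
  have "nat ((p - 1) mod int n) < n" using n_pos by (simp add: nat_less_iff)
  then show ?thesis using succ_mod[of "p - 1"] pred_succ[of "nat ((p - 1) mod int n)"] by simp
qed

lemma c_ok: "word_ok c"
  using band by (simp add: is_band_def is_string_iff)

lemma c_arcs: "i < n \<Longrightarrow> letter_arrow (c ! i) \<in> arcs Q"
  using c_ok by (auto simp: word_ok_def)

lemma compat_c: "i < n \<Longrightarrow> compat (c ! i) (c ! succ i)"
proof (cases "Suc i = n")
  case True
  have "c \<noteq> []" using n_pos by auto
  moreover have "i = n - 1" using True by simp
  ultimately have "c ! i = last c" "c ! succ i = hd c"
    using True by (simp_all add: succ_def last_conv_nth hd_conv_nth)
  moreover have "word_ok [last c, hd c]"
    using band by (simp add: is_band_def is_string_iff)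
  ultimately show ?thesis by (simp add: word_ok_Cons)
next
  case False
  assume "i < n"
  then show ?thesis using False c_ok by (simp add: word_ok_def succ_def)
qed

lemma v_succ: "i < n \<Longrightarrow> v (succ i) = letter_end Q (c ! i)"
  using compat_c by (simp add: v_def compat_def)

lemma v_verts: "i < n \<Longrightarrow> v i \<in> verts Q"
  using letter_verts(1)[OF c_arcs] by (simp add: v_def)

lemma B_diagram: "B = diagram_module n v c succ wt"
  by (simp add: B_def band_module_def v_def[abs_def] succ_def[abs_def] wt_def[abs_def])

lemma band_arrow_act:
  assumes "j < n"
  shows "arrow_act c succ wt a x j =
    (if c ! pred j = Dir a then wt (pred j) * x (pred j) else 0) + (if c ! j = Inv a then x (succ j) else 0)"
  using arrow_act_expand[of c succ j "pred j" wt a x] assms succ_eq_iff by simp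

lemma band_relation:
  assumes z: "zero_comp Q I b a"
  shows "arrow_act c succ wt b (arrow_act c succ wt a x) j = 0"
proof (cases "j < n")
  case j: True
  have c: "compat (c ! i) (c ! succ i)" if "i < n" for i using compat_c that .
  have 1: "\<not> (c ! pred (pred j) = Dir a \<and> c ! pred j = Dir b)" using c[of "pred (pred j)"] z by (auto simp: compat_def)
  have 2: "\<not> (c ! j = Inv b \<and> c ! succ j = Inv a)" using c[OF j] z by (auto simp: compat_def)
  show ?thesis using j 1 2 by (auto simp: band_arrow_act)
next
  case False
  then show ?thesis
    by (auto simp: arrow_act_def not_less intro!: sum.neutral split: letter.splits) (metis leD succ_less)+
qed

sublocale B: diagram Q I n v c succ wt
  using c_arcs v_verts v_succ band_relation
  by unfold_locales (auto simp: v_def fun_eq_iff)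

lemma B_coord: "coord_module n B"
  using diagram_coord[OF B.diagram_axioms] by (simp add: B_diagram)

lemma B_left_module: "left_module R B"
  using B_coord by (simp add: coord_module_def)

lemma B_add: "x \<oplus>\<^bsub>B\<^esub> y = (\<lambda>j. x j + y j)" and B_zero: "\<zero>\<^bsub>B\<^esub> = (\<lambda>_. 0)"
  and B_carrier: "x \<in> carrier B \<longleftrightarrow> (\<forall>j\<ge>n. x j = 0)"
  and B_sc: "x \<in> carrier B \<Longrightarrow> sc \<kappa> \<odot>\<^bsub>B\<^esub> x = (\<lambda>j. \<kappa> * x j)"
  using B_coord by (auto simp: coord_module_def)

lemma B_basis: "i < n \<Longrightarrow> basis_vec i \<in> carrier B"
  by (auto simp: B_carrier)

lemma vtx_basis:
  "x \<in> verts Q \<Longrightarrow> i < n \<Longrightarrow> vtx x \<odot>\<^bsub>B\<^esub> basis_vec i = (if v i = x then basis_vec i else (\<lambda>_. 0))"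
  by (auto simp: B_diagram B.vtx_smult_D vertex_act_def fun_eq_iff)

lemma arr_basis:
  assumes "a \<in> arcs Q" "i < n"
  shows "arr a \<odot>\<^bsub>B\<^esub> basis_vec i = (\<lambda>j. (if c ! i = Dir a then wt i * basis_vec (succ i) j else 0) +
     (if c ! pred i = Inv a then basis_vec (pred i) j else 0))"
proof (rule ext)
  fix j
  show "(arr a \<odot>\<^bsub>B\<^esub> basis_vec i) j = (if c ! i = Dir a then wt i * basis_vec (succ i) j else 0) +
     (if c ! pred i = Inv a then basis_vec (pred i) j else 0)"
  proof (cases "j < n")
    case True
    then have "pred j = i \<longleftrightarrow> j = succ i" "succ j = i \<longleftrightarrow> j = pred i"
      using assms succ_eq_iff by (metis succ_pred pred_succ succ_less)+
    then show ?thesis using True assms by (auto simp: B_diagram B.arr_smult_D band_arrow_act)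
  next
    case False
    then have "j \<noteq> succ i" "j \<noteq> pred i" by (metis succ_less, metis pred_less)
    then show ?thesis using False assms B.arrow_act_carrier[of j] by (auto simp: B_diagram B.arr_smult_D)
  qed
qed

text \<open>
  The \<open>e\<^sub>i\<close> are lifts of the basis vectors of the band module to the middle term, each at its
  vertex. The letters of the band act on them as in the band module, up to errors \<open>\<eta>\<^sub>i\<close> in \<open>Y\<close>.
  These errors are the coordinates in which the extension group is computed.
\<close>
fun lift ::
  "((('v, 'a) path \<Rightarrow> 'k) set, 'y) module \<Rightarrow> ((('v, 'a) path \<Rightarrow> 'k) set, 'y, 'e, nat \<Rightarrow> 'k) ses \<Rightarrow>
   (nat \<Rightarrow> 'e) \<Rightarrow> (nat \<Rightarrow> 'y) \<Rightarrow> bool" where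
  "lift Y (E, f, g) e \<eta> \<longleftrightarrow> is_extension R B Y (E, f, g) \<and> section_of n (E, f, g) e \<and>
     (\<forall>i<n. \<eta> i \<in> carrier Y \<and> vtx (v i) \<odot>\<^bsub>E\<^esub> e i = e i \<and>
       (\<forall>a. c ! i = Dir a \<longrightarrow> arr a \<odot>\<^bsub>E\<^esub> e i = sc (wt i) \<odot>\<^bsub>E\<^esub> e (succ i) \<oplus>\<^bsub>E\<^esub> f (\<eta> i)) \<and>
       (\<forall>a. c ! i = Inv a \<longrightarrow> arr a \<odot>\<^bsub>E\<^esub> e (succ i) = e i \<oplus>\<^bsub>E\<^esub> f (\<eta> i)))"

lemma liftD:
  assumes "lift Y (E, f, g) e \<eta>" "i < n"
  shows "\<eta> i \<in> carrier Y" "e i \<in> carrier E" "g (e i) = basis_vec i" "vtx (v i) \<odot>\<^bsub>E\<^esub> e i = e i"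
    "c ! i = Dir a \<Longrightarrow> arr a \<odot>\<^bsub>E\<^esub> e i = sc (wt i) \<odot>\<^bsub>E\<^esub> e (succ i) \<oplus>\<^bsub>E\<^esub> f (\<eta> i)"
    "c ! i = Inv a \<Longrightarrow> arr a \<odot>\<^bsub>E\<^esub> e (succ i) = e i \<oplus>\<^bsub>E\<^esub> f (\<eta> i)"
  using assms by (auto simp: section_of_def)

lemma c_arcs': "i < n \<Longrightarrow> c ! i = Dir a \<Longrightarrow> a \<in> arcs Q" "i < n \<Longrightarrow> c ! i = Inv a \<Longrightarrow> a \<in> arcs Q"
  using c_arcs[of i] by auto

lemma not_Dir_Inv: "i < n \<Longrightarrow> c ! i = Dir a \<Longrightarrow> c ! pred i \<noteq> Inv a"
  using compat_c[of "pred i"] by (auto simp: compat_def)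

lemma arr_basis_Dir: "i < n \<Longrightarrow> c ! i = Dir a \<Longrightarrow> arr a \<odot>\<^bsub>B\<^esub> basis_vec i = (\<lambda>j. wt i * basis_vec (succ i) j)"
  using not_Dir_Inv[of i a] arr_basis[of a i] c_arcs'(1)[of i a] by simp

lemma arr_basis_Inv: "i < n \<Longrightarrow> c ! i = Inv a \<Longrightarrow> arr a \<odot>\<^bsub>B\<^esub> basis_vec (succ i) = basis_vec i"
proof -
  assume i: "i < n" "c ! i = Inv a"
  then have "c ! succ i \<noteq> Dir a" using not_Dir_Inv[of "succ i" a] by auto
  then show ?thesis using arr_basis[of a "succ i"] c_arcs'(2)[of i a] i by simp
qed

text \<open>
  Any lift of a basis vector becomes one at the right vertex by applying the idempotent of that
  vertex; the errors lie in \<open>Y\<close> since they vanish in the band module.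
\<close>
lemma lift_exists:
  assumes ext: "is_extension R B Y (E, f, g)"
  shows "\<exists>e \<eta>. lift Y (E, f, g) e \<eta>"
proof -
  have E: "left_module R E" and g: "g \<in> module_hom R E B" and surj: "g ` carrier E = carrier B" using ext by auto
  interpret E: left_module R E by fact
  have "\<exists>z. i < n \<longrightarrow> z \<in> carrier E \<and> g z = basis_vec i" for i
  proof (cases "i < n")
    case True
    then have "basis_vec i \<in> g ` carrier E" using surj B_basis by simp
    then obtain z where "z \<in> carrier E" "basis_vec i = g z" by (rule imageE)
    then show ?thesis by auto
  qed simp
  then obtain z where z: "\<And>i. i < n \<Longrightarrow> z i \<in> carrier E" "\<And>i. i < n \<Longrightarrow> g (z i) = basis_vec i" by metis
  define e where "e i = vtx (v i) \<odot>\<^bsub>E\<^esub> z i" for i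
  have ec: "e i \<in> carrier E" "g (e i) = basis_vec i" "vtx (v i) \<odot>\<^bsub>E\<^esub> e i = e i" if "i < n" for i
    using that z[OF that] v_verts[OF that] vtx_closed E.smult_closed
    by (auto simp: e_def module_hom_smult[OF g] vtx_basis vtx_vtx simp flip: E.smult_assoc)
  have "\<exists>y. y \<in> carrier Y \<and> (\<forall>a. c ! i = Dir a \<longrightarrow> arr a \<odot>\<^bsub>E\<^esub> e i = sc (wt i) \<odot>\<^bsub>E\<^esub> e (succ i) \<oplus>\<^bsub>E\<^esub> f y) \<and>
      (\<forall>a. c ! i = Inv a \<longrightarrow> arr a \<odot>\<^bsub>E\<^esub> e (succ i) = e i \<oplus>\<^bsub>E\<^esub> f y)" if i: "i < n" for i
  proof (cases "c ! i")
    case (Dir a)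
    note a = c_arcs'(1)[OF i Dir]
    have "\<exists>y\<in>carrier Y. arr a \<odot>\<^bsub>E\<^esub> e i = sc (wt i) \<odot>\<^bsub>E\<^esub> e (succ i) \<oplus>\<^bsub>E\<^esub> f y"
      by (rule kernel_image[OF ext])
        (use ec i a arr_closed E.smult_closed B_basis in
          \<open>auto simp: module_hom_smult[OF g] arr_basis_Dir[OF i Dir] B_sc\<close>)
    then show ?thesis using Dir by auto
  next
    case (Inv a)
    note a = c_arcs'(2)[OF i Inv]
    have "\<exists>y\<in>carrier Y. arr a \<odot>\<^bsub>E\<^esub> e (succ i) = e i \<oplus>\<^bsub>E\<^esub> f y"
      by (rule kernel_image[OF ext])
        (use ec i a arr_closed E.smult_closed in
          \<open>auto simp: module_hom_smult[OF g] arr_basis_Inv[OF i Inv]\<close>)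
    then show ?thesis using Inv by auto
  qed
  then obtain \<eta> where "\<And>i. i < n \<Longrightarrow> \<eta> i \<in> carrier Y \<and> (\<forall>a. c ! i = Dir a \<longrightarrow> arr a \<odot>\<^bsub>E\<^esub> e i = sc (wt i) \<odot>\<^bsub>E\<^esub> e (succ i) \<oplus>\<^bsub>E\<^esub> f (\<eta> i)) \<and>
      (\<forall>a. c ! i = Inv a \<longrightarrow> arr a \<odot>\<^bsub>E\<^esub> e (succ i) = e i \<oplus>\<^bsub>E\<^esub> f (\<eta> i))" by metis
  then have "lift Y (E, f, g) e \<eta>" using ext ec by (auto simp: section_of_def)
  then show ?thesis by blast
qed

text \<open>
  How the arrow \<open>a\<close> acts on \<open>e\<^sub>i\<close>: as in the band module up to the error \<open>F \<eta>\<^sub>j\<close>. There is no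
  error if \<open>a\<close> starts elsewhere, and it is \<open>\<eta>\<^sub>j\<close> if the \<open>j\<close>-th letter of the band lets \<open>a\<close> act on
  \<open>e\<^sub>i\<close>. In the remaining two cases \<open>a\<close> forms a zero relation with the arrow \<open>b\<close> of a letter, and
  \<open>b\<close> sends some lift to a multiple of \<open>e\<^sub>i\<close> plus an error; since \<open>a\<close> kills this element, \<open>a e\<^sub>i\<close>
  can be read off.
\<close>
definition defect :: "'a \<Rightarrow> nat \<Rightarrow> (('v, 'a) path \<Rightarrow> 'k) set \<Rightarrow> nat \<Rightarrow> bool" where
  "defect a i F j \<longleftrightarrow>
     (tail Q a \<noteq> v i \<and> F = \<zero>\<^bsub>R\<^esub> \<and> j = i) \<or>
     (c ! i = Dir a \<and> F = \<one>\<^bsub>R\<^esub> \<and> j = i) \<or>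
     (c ! pred i = Inv a \<and> F = \<one>\<^bsub>R\<^esub> \<and> j = pred i) \<or>
     (c ! i \<noteq> Dir a \<and> c ! pred i \<noteq> Inv a \<and> (\<exists>b. c ! pred i = Dir b \<and> zero_comp Q I a b) \<and>
        F = \<ominus>\<^bsub>R\<^esub> (sc (inverse (wt (pred i))) \<otimes>\<^bsub>R\<^esub> arr a) \<and> j = pred i) \<or>
     (c ! i \<noteq> Dir a \<and> c ! pred i \<noteq> Inv a \<and> (\<exists>b. c ! i = Inv b \<and> zero_comp Q I a b) \<and>
        F = \<ominus>\<^bsub>R\<^esub> arr a \<and> j = i)"

lemma defect_carrier:
  assumes "defect a i F j" "a \<in> arcs Q" "i < n"
  shows "F \<in> carrier R" "j < n"
proof -
  interpret R: ring R by (rule ring_R)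
  show "F \<in> carrier R" "j < n" using assms arr_closed unfolding defect_def by auto
qed

text \<open>
  Here gentleness enters. An arrow \<open>a\<close> that starts at the vertex of \<open>e\<^sub>i\<close> and is not a letter of
  the band there forms a zero relation with one of the two letters meeting at \<open>i\<close>: otherwise \<open>a\<close>
  and these letters would be too many arrows at the vertex, or too many arrows composing to
  something nonzero.
\<close>
lemma defect_exists:
  assumes "a \<in> arcs Q" "i < n"
  shows "\<exists>F j. defect a i F j"
proof (cases "tail Q a = v i \<and> c ! i \<noteq> Dir a \<and> c ! pred i \<noteq> Inv a")
  case False
  then show ?thesis by (auto simp: defect_def)
next
  case True
  have "(\<exists>b. c ! pred i = Dir b \<and> zero_comp Q I a b) \<or> (\<exists>b. c ! i = Inv b \<and> zero_comp Q I a b)"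
  proof (rule ccontr)
    assume n: "\<not> ?thesis"
    have vi: "letter_end Q (c ! pred i) = v i" using v_succ[of "pred i"] assms by simp
    have vs: "letter_start Q (c ! i) = v i" by (simp add: v_def)
    have cp: "compat (c ! pred i) (c ! i)" using compat_c[of "pred i"] assms by simp
    show False
    proof (cases "c ! pred i")
      case L: (Dir l)
      have l: "l \<in> arcs Q" using c_arcs'(1)[OF _ L] by simp
      have nl: "\<not> zero_comp Q I a l" using n L by auto
      show False
      proof (cases "c ! i")
        case M: (Dir m)
        then show False using gentle_nonzero_left[of a m l] True L l nl c_arcs'(1)[OF assms(2) M] assms cp vi vs
          by (auto simp: compat_def)
      next
        case M: (Inv m)
        then show False using gentle_nonzero_right[of l m a] True L l nl c_arcs'(2)[OF assms(2) M] assms cp vi vs n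
          by (auto simp: compat_def)
      qed
    next
      case L: (Inv l)
      have l: "l \<in> arcs Q" using c_arcs'(2)[OF _ L] by simp
      show False
      proof (cases "c ! i")
        case M: (Dir m)
        then show False using gentle_out[of a l m] True L l c_arcs'(1)[OF assms(2) M] assms cp vi vs
          by (auto simp: compat_def)
      next
        case M: (Inv m)
        then have "\<not> zero_comp Q I l m" "\<not> zero_comp Q I a m" using cp L n by (auto simp: compat_def)
        then show False using gentle_nonzero_left[of a l m] True L M l c_arcs'(2)[OF assms(2) M] assms vi vs by auto
      qed
    qed
  qed
  then show ?thesis using True by (auto simp: defect_def)
qed

lemma defect_lift:
  assumes l: "lift Y (E, f, g) e \<eta>" and d: "defect a i F j" and a: "a \<in> arcs Q" and i: "i < n"
  shows "arr a \<odot>\<^bsub>E\<^esub> e i = comb E e n (arr a \<odot>\<^bsub>B\<^esub> basis_vec i) \<oplus>\<^bsub>E\<^esub> f (F \<odot>\<^bsub>Y\<^esub> \<eta> j)"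
proof -
  have E: "left_module R E" and Y: "left_module R Y" and f: "f \<in> module_hom R Y E" using l by auto
  interpret E: left_module R E by fact
  interpret Y: left_module R Y by fact
  note ec = liftD(2)[OF l] and \<eta>c = liftD(1)[OF l]
  have fc: "\<And>y. y \<in> carrier Y \<Longrightarrow> f y \<in> carrier E" using module_hom_carrier[OF f] .
  have c0: "comb E e n (\<lambda>_. 0) = \<zero>\<^bsub>E\<^esub>" by (rule comb_zero[OF E ec])
  have cu: "comb E e n (basis_vec k) = e k" if "k < n" for k by (rule comb_basis_vec[OF E ec that])
  note ac = arr_closed[OF a]
  have aec: "arr a \<odot>\<^bsub>E\<^esub> e k \<in> carrier E" if "k < n" for k using E.smult_closed[OF ac ec[OF that]] .
  from d show ?thesis unfolding defect_def
  proof (elim disjE exE conjE)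
    assume h: "tail Q a \<noteq> v i" "F = \<zero>\<^bsub>R\<^esub>" "j = i"
    have "arr a \<odot>\<^bsub>E\<^esub> e i = (arr a \<otimes>\<^bsub>R\<^esub> vtx (v i)) \<odot>\<^bsub>E\<^esub> e i"
      using liftD(4)[OF l i] ac vtx_closed[OF v_verts[OF i]] ec[OF i] by (simp add: E.smult_assoc)
    then have 1: "arr a \<odot>\<^bsub>E\<^esub> e i = \<zero>\<^bsub>E\<^esub>" using h(1) a v_verts[OF i] ec[OF i] by (simp add: arr_vtx E.smult_zero_left)
    have "v (succ (pred i)) = letter_end Q (c ! pred i)" by (rule v_succ) simp
    then have "c ! i \<noteq> Dir a" "c ! pred i \<noteq> Inv a" using h(1) i by (auto simp: v_def)
    then have "arr a \<odot>\<^bsub>B\<^esub> basis_vec i = (\<lambda>_. 0)" using a i by (simp add: arr_basis)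
    then show ?thesis using 1 h \<eta>c[OF i] by (simp add: c0 Y.smult_zero_left module_hom_zero[OF Y E f])
  next
    assume h: "c ! i = Dir a" "F = \<one>\<^bsub>R\<^esub>" "j = i"
    have "comb E e n (\<lambda>j. wt i * basis_vec (succ i) j) = sc (wt i) \<odot>\<^bsub>E\<^esub> comb E e n (basis_vec (succ i))"
      by (rule comb_scale[OF E ec])
    then show ?thesis using liftD(5)[OF l i h(1)] h \<eta>c[OF i]
      by (simp add: arr_basis_Dir[OF i h(1)] cu Y.smult_one)
  next
    assume h: "c ! pred i = Inv a" "F = \<one>\<^bsub>R\<^esub>" "j = pred i"
    then show ?thesis using liftD(6)[OF l _ h(1)] \<eta>c[of "pred i"] arr_basis_Inv[OF _ h(1)] i
      by (simp add: cu Y.smult_one)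
  next
    fix b assume h: "c ! i \<noteq> Dir a" "c ! pred i \<noteq> Inv a" "c ! pred i = Dir b" "zero_comp Q I a b"
      "F = \<ominus>\<^bsub>R\<^esub> (sc (inverse (wt (pred i))) \<otimes>\<^bsub>R\<^esub> arr a)" "j = pred i"
    let ?w = "wt (pred i)" and ?p = "pred i"
    have b: "b \<in> arcs Q" using c_arcs'(1)[OF _ h(3)] by simp
    have p: "?p < n" by simp
    have "arr a \<odot>\<^bsub>E\<^esub> (arr b \<odot>\<^bsub>E\<^esub> e ?p) = \<zero>\<^bsub>E\<^esub>"
      using arr_arr_zero[OF h(4)] ac arr_closed[OF b] ec[OF p] by (simp add: E.smult_zero_left flip: E.smult_assoc)
    then have "arr a \<odot>\<^bsub>E\<^esub> (sc ?w \<odot>\<^bsub>E\<^esub> e i \<oplus>\<^bsub>E\<^esub> f (\<eta> ?p)) = \<zero>\<^bsub>E\<^esub>"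
      using liftD(5)[OF l p h(3)] i by simp
    then have "sc ?w \<odot>\<^bsub>E\<^esub> (arr a \<odot>\<^bsub>E\<^esub> e i) \<oplus>\<^bsub>E\<^esub> f (arr a \<odot>\<^bsub>Y\<^esub> \<eta> ?p) = \<zero>\<^bsub>E\<^esub>"
      using ac ec[OF i] \<eta>c[OF p] fc E.smult_closed
      by (simp add: E.smult_r_distr module_hom_smult[OF f] sc_central flip: E.smult_assoc)
    then have "sc ?w \<odot>\<^bsub>E\<^esub> (arr a \<odot>\<^bsub>E\<^esub> e i) = \<ominus>\<^bsub>E\<^esub> f (arr a \<odot>\<^bsub>Y\<^esub> \<eta> ?p)"
      using E.M.minus_equality aec[OF i] E.smult_closed fc Y.smult_closed[OF ac \<eta>c[OF p]] by (metis sc_closed)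
    then have "sc (inverse ?w) \<odot>\<^bsub>E\<^esub> (sc ?w \<odot>\<^bsub>E\<^esub> (arr a \<odot>\<^bsub>E\<^esub> e i)) = f (F \<odot>\<^bsub>Y\<^esub> \<eta> ?p)"
      using h(5) ac \<eta>c[OF p] Y.smult_closed fc
      by (simp add: Y.smult_minus_left Y.smult_assoc module_hom_minus[OF Y E f] E.smult_minus_right E.smult_closed module_hom_smult[OF f])
    then have 1: "arr a \<odot>\<^bsub>E\<^esub> e i = f (F \<odot>\<^bsub>Y\<^esub> \<eta> ?p)"
      using aec[OF i] by (simp add: E.smult_one sc_one flip: E.smult_assoc sc_mult)
    have "arr a \<odot>\<^bsub>B\<^esub> basis_vec i = (\<lambda>_. 0)" using a i h by (simp add: arr_basis)
    then show ?thesis using 1 h(6) aec[OF i] by (simp add: c0)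
  next
    fix b assume h: "c ! i \<noteq> Dir a" "c ! pred i \<noteq> Inv a" "c ! i = Inv b" "zero_comp Q I a b"
      "F = \<ominus>\<^bsub>R\<^esub> arr a" "j = i"
    have b: "b \<in> arcs Q" using c_arcs'(2)[OF i h(3)] by simp
    have "arr a \<odot>\<^bsub>E\<^esub> (arr b \<odot>\<^bsub>E\<^esub> e (succ i)) = \<zero>\<^bsub>E\<^esub>"
      using arr_arr_zero[OF h(4)] ac arr_closed[OF b] ec[of "succ i"] by (simp add: E.smult_zero_left flip: E.smult_assoc)
    then have "arr a \<odot>\<^bsub>E\<^esub> (e i \<oplus>\<^bsub>E\<^esub> f (\<eta> i)) = \<zero>\<^bsub>E\<^esub>"
      using liftD(6)[OF l i h(3)] i by simp
    then have "arr a \<odot>\<^bsub>E\<^esub> e i \<oplus>\<^bsub>E\<^esub> f (arr a \<odot>\<^bsub>Y\<^esub> \<eta> i) = \<zero>\<^bsub>E\<^esub>"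
      using ac ec[OF i] \<eta>c[OF i] fc by (simp add: E.smult_r_distr module_hom_smult[OF f])
    then have "arr a \<odot>\<^bsub>E\<^esub> e i = \<ominus>\<^bsub>E\<^esub> f (arr a \<odot>\<^bsub>Y\<^esub> \<eta> i)"
      using E.M.minus_equality aec[OF i] fc Y.smult_closed[OF ac \<eta>c[OF i]] by metis
    then have 1: "arr a \<odot>\<^bsub>E\<^esub> e i = f (F \<odot>\<^bsub>Y\<^esub> \<eta> i)"
      using h(5) ac \<eta>c[OF i] Y.smult_closed by (simp add: Y.smult_minus_left module_hom_minus[OF Y E f])
    have "arr a \<odot>\<^bsub>B\<^esub> basis_vec i = (\<lambda>_. 0)" using a i h by (simp add: arr_basis)
    then show ?thesis using 1 h(6) aec[OF i] by (simp add: c0)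
  qed
qed

lemma lift_vtx:
  assumes l: "lift Y (E, f, g) e \<eta>" and x: "x \<in> verts Q" and i: "i < n"
  shows "vtx x \<odot>\<^bsub>E\<^esub> e i = comb E e n (vtx x \<odot>\<^bsub>B\<^esub> basis_vec i)"
proof -
  have E: "left_module R E" using l by auto
  interpret E: left_module R E by fact
  note ec = liftD(2)[OF l]
  have "vtx x \<odot>\<^bsub>E\<^esub> e i = (vtx x \<otimes>\<^bsub>R\<^esub> vtx (v i)) \<odot>\<^bsub>E\<^esub> e i"
    using liftD(4)[OF l i] vtx_closed[OF x] vtx_closed[OF v_verts[OF i]] ec[OF i] by (simp add: E.smult_assoc)
  also have "\<dots> = comb E e n (vtx x \<odot>\<^bsub>B\<^esub> basis_vec i)"
    using liftD(4)[OF l i] x v_verts[OF i] ec[OF i] i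
    by (auto simp: vtx_vtx vtx_basis comb_zero[OF E ec] comb_basis_vec[OF E ec] E.smult_zero_left)
  finally show ?thesis .
qed

lemma lift_action:
  assumes l: "lift Y (E, f, g) e \<eta>" and l': "lift Y' (E', f', g') e' \<eta>'"
    and \<beta>: "\<beta> \<in> module_hom R Y Y'" and \<eta>: "\<And>i. i < n \<Longrightarrow> \<eta>' i = \<beta> (\<eta> i)" and F: "F \<in> carrier R"
  shows "\<forall>x\<in>carrier B. \<exists>y\<in>carrier Y.
       F \<odot>\<^bsub>E\<^esub> comb E e n x = comb E e n (F \<odot>\<^bsub>B\<^esub> x) \<oplus>\<^bsub>E\<^esub> f y \<and>
       F \<odot>\<^bsub>E'\<^esub> comb E' e' n x = comb E' e' n (F \<odot>\<^bsub>B\<^esub> x) \<oplus>\<^bsub>E'\<^esub> f' (\<beta> y)"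
proof (rule comb_action_generators[OF _ _ \<beta> B_coord _ _ _ F])
  show ext: "is_extension R B Y (E, f, g)" and ext': "is_extension R B Y' (E', f', g')"
    and s: "section_of n (E, f, g) e" "section_of n (E', f', g') e'" using l l' by auto
  have mods: "left_module R Y" "left_module R Y'" "left_module R E" "left_module R E'"
    and f: "f \<in> module_hom R Y E" and f': "f' \<in> module_hom R Y' E'" using ext ext' by auto
  interpret E: left_module R E by fact
  interpret E': left_module R E' by fact
  interpret Y: left_module R Y by fact
  interpret BM: left_module R B by (rule B_left_module)
  fix G i assume G: "G \<in> vtx ` verts Q \<union> arr ` arcs Q" and i: "i < n"
  have GR: "G \<in> carrier R" using G vtx_closed arr_closed by auto
  have GB: "G \<odot>\<^bsub>B\<^esub> basis_vec i \<in> carrier B" using BM.smult_closed[OF GR B_basis[OF i]] .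
  from G show "\<exists>y\<in>carrier Y. G \<odot>\<^bsub>E\<^esub> e i = comb E e n (G \<odot>\<^bsub>B\<^esub> basis_vec i) \<oplus>\<^bsub>E\<^esub> f y \<and>
      G \<odot>\<^bsub>E'\<^esub> e' i = comb E' e' n (G \<odot>\<^bsub>B\<^esub> basis_vec i) \<oplus>\<^bsub>E'\<^esub> f' (\<beta> y)"
  proof (elim UnE imageE)
    fix x assume x: "G = vtx x" "x \<in> verts Q"
    have "f \<zero>\<^bsub>Y\<^esub> = \<zero>\<^bsub>E\<^esub>" "f' (\<beta> \<zero>\<^bsub>Y\<^esub>) = \<zero>\<^bsub>E'\<^esub>"
      using module_hom_zero[OF mods(1,3) f] module_hom_zero[OF mods(1,2) \<beta>] module_hom_zero[OF mods(2,4) f'] by auto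
    then show ?thesis
      using lift_vtx[OF l x(2) i] lift_vtx[OF l' x(2) i] x(1)
        section_proj(2)[OF ext B_coord s(1) GB] section_proj(2)[OF ext' B_coord s(2) GB]
      by (intro bexI[of _ "\<zero>\<^bsub>Y\<^esub>"]) simp_all
  next
    fix a assume a: "G = arr a" "a \<in> arcs Q"
    obtain H j where d: "defect a i H j" using defect_exists[OF a(2) i] by blast
    note c = defect_carrier[OF d a(2) i]
    note y = liftD(1)[OF l c(2)]
    have "H \<odot>\<^bsub>Y'\<^esub> \<eta>' j = \<beta> (H \<odot>\<^bsub>Y\<^esub> \<eta> j)"
      using \<eta>[OF c(2)] c(1) y by (simp add: module_hom_smult[OF \<beta>])
    then show ?thesis
      using defect_lift[OF l d a(2) i] defect_lift[OF l' d a(2) i] a(1) Y.smult_closed[OF c(1) y]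
      by (intro bexI[of _ "H \<odot>\<^bsub>Y\<^esub> \<eta> j"]) simp_all
  qed
qed

text \<open>
  By \<open>defect_lift\<close> all arrows act on the lifts through formulas in the errors that do not depend
  on the extension, so extensions with corresponding errors admit a morphism.
\<close>
lemma lift_morphism:
  assumes l: "lift Y (E, f, g) e \<eta>" and l': "lift Y' (E', f', g') e' \<eta>'"
    and \<beta>: "\<beta> \<in> module_hom R Y Y'" and \<eta>: "\<And>i. i < n \<Longrightarrow> \<eta>' i = \<beta> (\<eta> i)"
  shows "ext_morphism R Y \<beta> (E, f, g) (E', f', g')"
  by (rule ext_morphismI[OF _ _ \<beta> B_coord]) (use l l' lift_action[OF l l' \<beta> \<eta>] in auto)

text \<open>
  Replacing the lifts \<open>e\<^sub>i\<close> by \<open>e\<^sub>i - y\<^sub>i\<close> changes the errors \<open>\<eta>\<close> into \<open>\<eta>'\<close>.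
\<close>
definition homotopic ::
  "((('v, 'a) path \<Rightarrow> 'k) set, 'y) module \<Rightarrow> (nat \<Rightarrow> 'y) \<Rightarrow> (nat \<Rightarrow> 'y) \<Rightarrow> bool" where
  "homotopic Y \<eta> \<eta>' \<longleftrightarrow> (\<exists>y. \<forall>i<n. y i \<in> carrier Y \<and> vtx (v i) \<odot>\<^bsub>Y\<^esub> y i = y i \<and>
     (\<forall>a. c ! i = Dir a \<longrightarrow> \<eta>' i \<oplus>\<^bsub>Y\<^esub> arr a \<odot>\<^bsub>Y\<^esub> y i = \<eta> i \<oplus>\<^bsub>Y\<^esub> sc (wt i) \<odot>\<^bsub>Y\<^esub> y (succ i)) \<and>
     (\<forall>a. c ! i = Inv a \<longrightarrow> \<eta>' i \<oplus>\<^bsub>Y\<^esub> arr a \<odot>\<^bsub>Y\<^esub> y (succ i) = \<eta> i \<oplus>\<^bsub>Y\<^esub> y i))"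

text \<open>
  A morphism maps the lifts \<open>e\<^sub>i\<close> to lifts \<open>e'\<^sub>i + y\<^sub>i\<close> with errors \<open>\<beta> (\<eta>\<^sub>i)\<close>.
\<close>
lemma morphism_homotopic:
  assumes l: "lift Y (E, f, g) e \<eta>" and l': "lift Y' (E', f', g') e' \<eta>'"
    and \<beta>: "\<beta> \<in> module_hom R Y Y'" and m: "ext_morphism R Y \<beta> (E, f, g) (E', f', g')"
  shows "homotopic Y' (\<lambda>i. \<beta> (\<eta> i)) \<eta>'"
proof -
  have ext: "is_extension R B Y (E, f, g)" and ext': "is_extension R B Y' (E', f', g')" using l l' by auto
  have mods: "left_module R Y" "left_module R Y'" "left_module R E" "left_module R E'"
    and f: "f \<in> module_hom R Y E" and f': "f' \<in> module_hom R Y' E'" "inj_on f' (carrier Y')" using ext ext' by auto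
  interpret E: left_module R E by fact
  interpret E': left_module R E' by fact
  interpret Y': left_module R Y' by fact
  obtain \<phi> where \<phi>: "\<phi> \<in> module_hom R E E'" "\<And>y. y \<in> carrier Y \<Longrightarrow> \<phi> (f y) = f' (\<beta> y)"
     "\<And>z. z \<in> carrier E \<Longrightarrow> g' (\<phi> z) = g z" using m by auto
  have fc: "\<And>y. y \<in> carrier Y \<Longrightarrow> f y \<in> carrier E" "\<And>y. y \<in> carrier Y' \<Longrightarrow> f' y \<in> carrier E'"
     "\<And>y. y \<in> carrier Y \<Longrightarrow> \<beta> y \<in> carrier Y'" "\<And>z. z \<in> carrier E \<Longrightarrow> \<phi> z \<in> carrier E'"
    using module_hom_carrier[OF f] module_hom_carrier[OF f'(1)] module_hom_carrier[OF \<beta>] module_hom_carrier[OF \<phi>(1)] by auto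
  have "\<exists>y. y \<in> carrier Y' \<and> \<phi> (e i) = e' i \<oplus>\<^bsub>E'\<^esub> f' y" if "i < n" for i
    using kernel_image[OF ext', of "\<phi> (e i)" "e' i"] liftD(2,3)[OF l that] liftD(2,3)[OF l' that] \<phi> fc by auto
  then obtain y where y: "\<And>i. i < n \<Longrightarrow> y i \<in> carrier Y'" "\<And>i. i < n \<Longrightarrow> \<phi> (e i) = e' i \<oplus>\<^bsub>E'\<^esub> f' (y i)" by metis
  have inj: "p = q" if "p \<in> carrier Y'" "q \<in> carrier Y'" "z \<in> carrier E'" "z \<oplus>\<^bsub>E'\<^esub> f' p = z \<oplus>\<^bsub>E'\<^esub> f' q" for p q z
    using E'.M.add_left_cancelD[OF that(4,3)] fc that(1,2) f'(2) by (auto simp: inj_on_def)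
  have "y i \<in> carrier Y' \<and> vtx (v i) \<odot>\<^bsub>Y'\<^esub> y i = y i \<and>
     (\<forall>a. c ! i = Dir a \<longrightarrow> \<eta>' i \<oplus>\<^bsub>Y'\<^esub> arr a \<odot>\<^bsub>Y'\<^esub> y i = \<beta> (\<eta> i) \<oplus>\<^bsub>Y'\<^esub> sc (wt i) \<odot>\<^bsub>Y'\<^esub> y (succ i)) \<and>
     (\<forall>a. c ! i = Inv a \<longrightarrow> \<eta>' i \<oplus>\<^bsub>Y'\<^esub> arr a \<odot>\<^bsub>Y'\<^esub> y (succ i) = \<beta> (\<eta> i) \<oplus>\<^bsub>Y'\<^esub> y i)" if i: "i < n" for i
  proof (intro conjI allI impI)
    note li = liftD(1-4)[OF l i] and li' = liftD(1-4)[OF l' i]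
    note ls = liftD(2)[OF l succ_less] and ls' = liftD(2)[OF l' succ_less]
    show "y i \<in> carrier Y'" using y i by simp
    have vc: "vtx (v i) \<in> carrier R" using vtx_closed[OF v_verts[OF i]] .
    have "\<phi> (e i) = \<phi> (vtx (v i) \<odot>\<^bsub>E\<^esub> e i)" using li(4) by simp
    also have "\<dots> = vtx (v i) \<odot>\<^bsub>E'\<^esub> \<phi> (e i)" by (rule module_hom_smult[OF \<phi>(1) vc li(2)])
    finally have "\<phi> (e i) = vtx (v i) \<odot>\<^bsub>E'\<^esub> \<phi> (e i)" .
    then have "e' i \<oplus>\<^bsub>E'\<^esub> f' (y i) = e' i \<oplus>\<^bsub>E'\<^esub> f' (vtx (v i) \<odot>\<^bsub>Y'\<^esub> y i)"
      using y[OF i] li' vc fc by (simp add: E'.smult_r_distr module_hom_smult[OF f'(1)])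
    then show "vtx (v i) \<odot>\<^bsub>Y'\<^esub> y i = y i"
      using inj[of "y i" "vtx (v i) \<odot>\<^bsub>Y'\<^esub> y i" "e' i"] y(1)[OF i] li' Y'.smult_closed[OF vc] by simp
    fix a
    show "\<eta>' i \<oplus>\<^bsub>Y'\<^esub> arr a \<odot>\<^bsub>Y'\<^esub> y i = \<beta> (\<eta> i) \<oplus>\<^bsub>Y'\<^esub> sc (wt i) \<odot>\<^bsub>Y'\<^esub> y (succ i)" if a: "c ! i = Dir a"
    proof -
      have ac: "arr a \<in> carrier R" using arr_closed c_arcs'(1)[OF i a] by simp
      have swc: "sc (wt i) \<odot>\<^bsub>E'\<^esub> e' (succ i) \<in> carrier E'" using ls' E'.smult_closed by simp
      have "arr a \<odot>\<^bsub>E'\<^esub> \<phi> (e i) = \<phi> (arr a \<odot>\<^bsub>E\<^esub> e i)" using li ac by (simp add: module_hom_smult[OF \<phi>(1)])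
      also have "\<dots> = sc (wt i) \<odot>\<^bsub>E'\<^esub> \<phi> (e (succ i)) \<oplus>\<^bsub>E'\<^esub> f' (\<beta> (\<eta> i))"
        using liftD(5)[OF l i a] ls li fc E.smult_closed \<phi>(2)
        by (simp add: module_hom_add[OF \<phi>(1)] module_hom_smult[OF \<phi>(1)])
      also have "\<dots> = sc (wt i) \<odot>\<^bsub>E'\<^esub> e' (succ i) \<oplus>\<^bsub>E'\<^esub> f' (\<beta> (\<eta> i) \<oplus>\<^bsub>Y'\<^esub> sc (wt i) \<odot>\<^bsub>Y'\<^esub> y (succ i))"
        using y[of "succ i"] ls' fc li swc Y'.smult_closed
        by (simp add: E'.smult_r_distr module_hom_add[OF f'(1)] module_hom_smult[OF f'(1)] E'.smult_closed E'.M.a_ac)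
      finally have r: "arr a \<odot>\<^bsub>E'\<^esub> \<phi> (e i) = \<dots>" .
      have "arr a \<odot>\<^bsub>E'\<^esub> \<phi> (e i) = arr a \<odot>\<^bsub>E'\<^esub> e' i \<oplus>\<^bsub>E'\<^esub> f' (arr a \<odot>\<^bsub>Y'\<^esub> y i)"
        using y[OF i] li' ac fc by (simp add: E'.smult_r_distr module_hom_smult[OF f'(1)])
      also have "\<dots> = sc (wt i) \<odot>\<^bsub>E'\<^esub> e' (succ i) \<oplus>\<^bsub>E'\<^esub> f' (\<eta>' i \<oplus>\<^bsub>Y'\<^esub> arr a \<odot>\<^bsub>Y'\<^esub> y i)"
        using liftD(5)[OF l' i a] y[OF i] li' ac fc swc Y'.smult_closed
        by (simp add: module_hom_add[OF f'(1)] E'.M.a_assoc)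
      finally show ?thesis using r
        by (intro inj[OF _ _ swc]) (use y i ac li li' fc Y'.smult_closed in auto)
    qed
    show "\<eta>' i \<oplus>\<^bsub>Y'\<^esub> arr a \<odot>\<^bsub>Y'\<^esub> y (succ i) = \<beta> (\<eta> i) \<oplus>\<^bsub>Y'\<^esub> y i" if a: "c ! i = Inv a"
    proof -
      have ac: "arr a \<in> carrier R" using arr_closed c_arcs'(2)[OF i a] by simp
      have "arr a \<odot>\<^bsub>E'\<^esub> \<phi> (e (succ i)) = \<phi> (arr a \<odot>\<^bsub>E\<^esub> e (succ i))" using ls ac by (simp add: module_hom_smult[OF \<phi>(1)])
      also have "\<dots> = \<phi> (e i) \<oplus>\<^bsub>E'\<^esub> f' (\<beta> (\<eta> i))"
        using liftD(6)[OF l i a] ls li fc \<phi>(2) by (simp add: module_hom_add[OF \<phi>(1)])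
      also have "\<dots> = e' i \<oplus>\<^bsub>E'\<^esub> f' (\<beta> (\<eta> i) \<oplus>\<^bsub>Y'\<^esub> y i)"
        using y[OF i] li' li fc by (simp add: module_hom_add[OF f'(1)] E'.M.a_ac)
      finally have r: "arr a \<odot>\<^bsub>E'\<^esub> \<phi> (e (succ i)) = \<dots>" .
      have "arr a \<odot>\<^bsub>E'\<^esub> \<phi> (e (succ i)) = arr a \<odot>\<^bsub>E'\<^esub> e' (succ i) \<oplus>\<^bsub>E'\<^esub> f' (arr a \<odot>\<^bsub>Y'\<^esub> y (succ i))"
        using y[of "succ i"] ls' ac fc by (simp add: E'.smult_r_distr module_hom_smult[OF f'(1)])
      also have "\<dots> = e' i \<oplus>\<^bsub>E'\<^esub> f' (\<eta>' i \<oplus>\<^bsub>Y'\<^esub> arr a \<odot>\<^bsub>Y'\<^esub> y (succ i))"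
        using liftD(6)[OF l' i a] y[of "succ i"] li' ac fc Y'.smult_closed
        by (simp add: module_hom_add[OF f'(1)] E'.M.a_assoc)
      finally show ?thesis using r
        by (intro inj[OF _ _ li'(2)]) (use y i ac li li' fc Y'.smult_closed in auto)
    qed
  qed
  then show ?thesis unfolding homotopic_def by blast
qed

lemma lift_change:
  assumes l: "lift Y (E, f, g) e \<eta>" and h: "homotopic Y \<eta> \<eta>'" and \<eta>': "\<And>i. i < n \<Longrightarrow> \<eta>' i \<in> carrier Y"
  shows "\<exists>e'. lift Y (E, f, g) e' \<eta>'"
proof -
  have ext: "is_extension R B Y (E, f, g)" using l by auto
  have mods: "left_module R Y" "left_module R E" "left_module R B"
    and f: "f \<in> module_hom R Y E" "f ` carrier Y = {e \<in> carrier E. g e = \<zero>\<^bsub>B\<^esub>}" and g: "g \<in> module_hom R E B" using ext by auto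
  interpret E: left_module R E by fact
  interpret Y: left_module R Y by fact
  have fc: "\<And>y. y \<in> carrier Y \<Longrightarrow> f y \<in> carrier E" "\<And>y. y \<in> carrier Y \<Longrightarrow> g (f y) = \<zero>\<^bsub>B\<^esub>"
    using f(2) by blast+
  obtain y where y: "\<And>i. i < n \<Longrightarrow> y i \<in> carrier Y" "\<And>i. i < n \<Longrightarrow> vtx (v i) \<odot>\<^bsub>Y\<^esub> y i = y i"
    "\<And>i a. i < n \<Longrightarrow> c ! i = Dir a \<Longrightarrow> \<eta>' i \<oplus>\<^bsub>Y\<^esub> arr a \<odot>\<^bsub>Y\<^esub> y i = \<eta> i \<oplus>\<^bsub>Y\<^esub> sc (wt i) \<odot>\<^bsub>Y\<^esub> y (succ i)"
    "\<And>i a. i < n \<Longrightarrow> c ! i = Inv a \<Longrightarrow> \<eta>' i \<oplus>\<^bsub>Y\<^esub> arr a \<odot>\<^bsub>Y\<^esub> y (succ i) = \<eta> i \<oplus>\<^bsub>Y\<^esub> y i"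
    using h unfolding homotopic_def by blast
  define e' where "e' i = e i \<oplus>\<^bsub>E\<^esub> f (\<ominus>\<^bsub>Y\<^esub> y i)" for i
  have move: "\<eta>0 \<oplus>\<^bsub>Y\<^esub> \<ominus>\<^bsub>Y\<^esub> p = \<ominus>\<^bsub>Y\<^esub> q \<oplus>\<^bsub>Y\<^esub> \<eta>1" if "\<eta>1 \<oplus>\<^bsub>Y\<^esub> p = \<eta>0 \<oplus>\<^bsub>Y\<^esub> q"
    "p \<in> carrier Y" "q \<in> carrier Y" "\<eta>0 \<in> carrier Y" "\<eta>1 \<in> carrier Y" for p q \<eta>0 \<eta>1
  proof -
    have "\<ominus>\<^bsub>Y\<^esub> q \<oplus>\<^bsub>Y\<^esub> \<eta>1 = \<ominus>\<^bsub>Y\<^esub> q \<oplus>\<^bsub>Y\<^esub> ((\<eta>1 \<oplus>\<^bsub>Y\<^esub> p) \<oplus>\<^bsub>Y\<^esub> \<ominus>\<^bsub>Y\<^esub> p)"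
      using that(2-) by (simp add: Y.M.a_assoc Y.M.r_neg)
    also have "\<dots> = \<ominus>\<^bsub>Y\<^esub> q \<oplus>\<^bsub>Y\<^esub> (q \<oplus>\<^bsub>Y\<^esub> (\<eta>0 \<oplus>\<^bsub>Y\<^esub> \<ominus>\<^bsub>Y\<^esub> p))"
      unfolding that(1) using that(2-) by (simp add: Y.M.a_ac)
    also have "\<dots> = \<eta>0 \<oplus>\<^bsub>Y\<^esub> \<ominus>\<^bsub>Y\<^esub> p"
      using that by (simp add: Y.M.r_neg1)
    finally show ?thesis by simp
  qed
  have e'c: "e' i \<in> carrier E" if "i < n" for i using liftD(2)[OF l that] y(1)[OF that] fc by (simp add: e'_def)
  have "lift Y (E, f, g) e' \<eta>'"
    unfolding lift.simps
  proof (intro conjI allI impI ext)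
    show "section_of n (E, f, g) e'"
      using liftD(2,3)[OF l] y(1) fc e'c by (auto simp: section_of_def e'_def module_hom_add[OF g] B_add B_zero)
    fix i assume i: "i < n"
    note li = liftD(1-4)[OF l i] and ls = liftD(2)[OF l succ_less]
    show "\<eta>' i \<in> carrier Y" using \<eta>' i .
    have vc: "vtx (v i) \<in> carrier R" using vtx_closed[OF v_verts[OF i]] .
    show "vtx (v i) \<odot>\<^bsub>E\<^esub> e' i = e' i"
      using li y(1,2)[OF i] vc fc
      by (simp add: e'_def E.smult_r_distr Y.smult_minus_right flip: module_hom_smult[OF f(1)])
    fix a
    show "arr a \<odot>\<^bsub>E\<^esub> e' i = sc (wt i) \<odot>\<^bsub>E\<^esub> e' (succ i) \<oplus>\<^bsub>E\<^esub> f (\<eta>' i)" if a: "c ! i = Dir a"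
    proof -
      have ac: "arr a \<in> carrier R" using arr_closed c_arcs'(1)[OF i a] by simp
      have yc: "arr a \<odot>\<^bsub>Y\<^esub> y i \<in> carrier Y" "sc (wt i) \<odot>\<^bsub>Y\<^esub> y (succ i) \<in> carrier Y" "y i \<in> carrier Y" "y (succ i) \<in> carrier Y"
        using Y.smult_closed ac y(1)[OF i] y(1)[OF succ_less] by auto
      have sc: "sc (wt i) \<odot>\<^bsub>E\<^esub> e (succ i) \<in> carrier E" using E.smult_closed ls by simp
      have "arr a \<odot>\<^bsub>E\<^esub> e' i = sc (wt i) \<odot>\<^bsub>E\<^esub> e (succ i) \<oplus>\<^bsub>E\<^esub> f (\<eta> i \<oplus>\<^bsub>Y\<^esub> \<ominus>\<^bsub>Y\<^esub> (arr a \<odot>\<^bsub>Y\<^esub> y i))"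
        using liftD(5)[OF l i a] li yc ac fc sc
        by (simp add: e'_def E.smult_r_distr Y.smult_minus_right module_hom_add[OF f(1)] E.M.a_assoc flip: module_hom_smult[OF f(1)])
      also have "\<dots> = sc (wt i) \<odot>\<^bsub>E\<^esub> e' (succ i) \<oplus>\<^bsub>E\<^esub> f (\<eta>' i)"
        unfolding move[OF y(3)[OF i a] yc(1,2) li(1) \<eta>'[OF i]]
        using yc fc ls sc \<eta>'[OF i]
        by (simp add: e'_def E.smult_r_distr Y.smult_minus_right module_hom_add[OF f(1)] E.M.a_assoc flip: module_hom_smult[OF f(1)])
      finally show ?thesis .
    qed
    show "arr a \<odot>\<^bsub>E\<^esub> e' (succ i) = e' i \<oplus>\<^bsub>E\<^esub> f (\<eta>' i)" if a: "c ! i = Inv a"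
    proof -
      have ac: "arr a \<in> carrier R" using arr_closed c_arcs'(2)[OF i a] by simp
      have yc: "arr a \<odot>\<^bsub>Y\<^esub> y (succ i) \<in> carrier Y" "y i \<in> carrier Y" "y (succ i) \<in> carrier Y"
        using Y.smult_closed ac y(1)[OF i] y(1)[OF succ_less] by auto
      have "arr a \<odot>\<^bsub>E\<^esub> e' (succ i) = e i \<oplus>\<^bsub>E\<^esub> f (\<eta> i \<oplus>\<^bsub>Y\<^esub> \<ominus>\<^bsub>Y\<^esub> (arr a \<odot>\<^bsub>Y\<^esub> y (succ i)))"
        using liftD(6)[OF l i a] li ls yc ac fc
        by (simp add: e'_def E.smult_r_distr Y.smult_minus_right module_hom_add[OF f(1)] E.M.a_assoc flip: module_hom_smult[OF f(1)])
      also have "\<dots> = e' i \<oplus>\<^bsub>E\<^esub> f (\<eta>' i)"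
        unfolding move[OF y(4)[OF i a] yc(1,2) li(1) \<eta>'[OF i]]
        using yc fc li \<eta>'[OF i]
        by (simp add: e'_def module_hom_add[OF f(1)] E.M.a_assoc)
      finally show ?thesis .
    qed
  qed
  then show ?thesis by blast
qed

text \<open>
  A section of modules provides lifts without errors; conversely, without errors the linear
  section commutes with all arrows.
\<close>
lemma split_iff_lift_zero:
  assumes ext: "is_extension R B Y (E, f, g)"
  shows "split_extension R B (E, f, g) \<longleftrightarrow> (\<exists>e. lift Y (E, f, g) e (\<lambda>_. \<zero>\<^bsub>Y\<^esub>))"
proof -
  have mods: "left_module R Y" "left_module R E" "left_module R B"
    and f: "f \<in> module_hom R Y E" and g: "g \<in> module_hom R E B" using ext by auto
  interpret E: left_module R E by fact
  interpret Y: left_module R Y by fact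
  have f0: "f \<zero>\<^bsub>Y\<^esub> = \<zero>\<^bsub>E\<^esub>" by (rule module_hom_zero[OF mods(1,2) f])
  show ?thesis
  proof
    assume "split_extension R B (E, f, g)"
    then obtain s where s: "s \<in> module_hom R B E" "\<And>x. x \<in> carrier B \<Longrightarrow> g (s x) = x" by auto
    define e where "e i = s (basis_vec i)" for i
    have ec: "i < n \<Longrightarrow> e i \<in> carrier E" for i using module_hom_carrier[OF s(1) B_basis] by (simp add: e_def)
    have "lift Y (E, f, g) e (\<lambda>_. \<zero>\<^bsub>Y\<^esub>)"
      unfolding lift.simps
    proof (intro conjI allI impI ext)
      show "section_of n (E, f, g) e" using s B_basis ec by (auto simp: section_of_def e_def)
      fix i assume i: "i < n"
      show "\<zero>\<^bsub>Y\<^esub> \<in> carrier Y" by simp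
      show "vtx (v i) \<odot>\<^bsub>E\<^esub> e i = e i"
        using i v_verts[OF i] B_basis[OF i] vtx_closed by (simp add: e_def vtx_basis flip: module_hom_smult[OF s(1)])
      fix a
      show "arr a \<odot>\<^bsub>E\<^esub> e i = sc (wt i) \<odot>\<^bsub>E\<^esub> e (succ i) \<oplus>\<^bsub>E\<^esub> f \<zero>\<^bsub>Y\<^esub>" if a: "c ! i = Dir a"
      proof -
        have "s (arr a \<odot>\<^bsub>B\<^esub> basis_vec i) = s (sc (wt i) \<odot>\<^bsub>B\<^esub> basis_vec (succ i))"
          by (simp add: arr_basis_Dir[OF i a] B_sc[OF B_basis[OF succ_less]])
        then have "arr a \<odot>\<^bsub>E\<^esub> e i = sc (wt i) \<odot>\<^bsub>E\<^esub> e (succ i)"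
          using arr_closed[OF c_arcs'(1)[OF i a]] B_basis[OF i] B_basis[OF succ_less]
          by (simp add: e_def module_hom_smult[OF s(1)])
        then show ?thesis using ec[OF succ_less] E.smult_closed by (simp add: f0)
      qed
      show "arr a \<odot>\<^bsub>E\<^esub> e (succ i) = e i \<oplus>\<^bsub>E\<^esub> f \<zero>\<^bsub>Y\<^esub>" if a: "c ! i = Inv a"
      proof -
        have "arr a \<odot>\<^bsub>E\<^esub> e (succ i) = s (arr a \<odot>\<^bsub>B\<^esub> basis_vec (succ i))"
          using arr_closed[OF c_arcs'(2)[OF i a]] B_basis[OF succ_less]
          by (simp add: e_def module_hom_smult[OF s(1)])
        then show ?thesis using ec[OF i] by (simp add: f0 arr_basis_Inv[OF i a] e_def)
      qed
    qed
    then show "\<exists>e. lift Y (E, f, g) e (\<lambda>_. \<zero>\<^bsub>Y\<^esub>)" by blast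
  next
    assume "\<exists>e. lift Y (E, f, g) e (\<lambda>_. \<zero>\<^bsub>Y\<^esub>)"
    then obtain e where l: "lift Y (E, f, g) e (\<lambda>_. \<zero>\<^bsub>Y\<^esub>)" by blast
    then have sec: "section_of n (E, f, g) e" by auto
    have z: "(\<lambda>_. \<zero>\<^bsub>Y\<^esub>) \<in> module_hom R Y Y"
      by (auto simp: module_hom_def Y.smult_zero_right)
    have hom: "F \<odot>\<^bsub>E\<^esub> comb E e n x = comb E e n (F \<odot>\<^bsub>B\<^esub> x)" if "F \<in> carrier R" "x \<in> carrier B" for F x
    proof -
      interpret BM: left_module R B by fact
      have "comb E e n (F \<odot>\<^bsub>B\<^esub> x) \<in> carrier E"
        using section_proj(2)[OF ext B_coord sec BM.smult_closed[OF that]] .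
      then show ?thesis using lift_action[OF l l z _ that(1)] that(2) by (auto simp: f0)
    qed
    have "comb E e n \<in> module_hom R B E"
      unfolding module_hom_def
      using section_proj(2)[OF ext B_coord sec] comb_add[OF mods(2) liftD(2)[OF l]] hom
      by (auto simp: B_add)
    then show "split_extension R B (E, f, g)" using section_proj(1)[OF ext B_coord sec] by auto
  qed
qed

lemma fibre_lift:
  assumes l: "lift Y (E, f, g) e \<eta>" and l': "lift Y (E', f', g') e' \<eta>'"
  shows "lift (direct_sum Y Y) (fibre_ext (E, f, g) (E', f', g')) (\<lambda>i. (e i, e' i)) (\<lambda>i. (\<eta> i, \<eta>' i))"
proof -
  have "is_extension R B Y (E, f, g)" "is_extension R B Y (E', f', g')" using l l' by auto
  from fibre_is_extension[OF this] show ?thesis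
    unfolding fibre_ext.simps lift.simps
    using liftD[OF l] liftD[OF l'] by (auto simp: section_of_def direct_sum_def)
qed

end

section \<open>The first extension group as a space of errors\<close>

declare is_extension.simps [simp del] split_extension.simps [simp del]

locale band_coord = band Q I c t lam
  for Q :: "('v, 'a) pre_digraph" and I :: "(('v, 'a) path \<Rightarrow> 'k::field) set"
    and c :: "'a letter list" and t :: nat and lam :: 'k +
  fixes Y :: "((('v, 'a) path \<Rightarrow> 'k) set, nat \<Rightarrow> 'k) module" and m :: nat
  assumes Y_coord: "coord_module m Y"
begin

declare lift.simps [simp del]

lemma Y_left_module: "left_module R Y"
  using Y_coord by (simp add: coord_module_def)

sublocale Y: left_module R Y by (rule Y_left_module)

lemma Y_add: "y \<oplus>\<^bsub>Y\<^esub> z = (\<lambda>j. y j + z j)" and Y_zero: "\<zero>\<^bsub>Y\<^esub> = (\<lambda>_. 0)"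
  and Y_carrier: "z \<in> carrier Y \<longleftrightarrow> (\<forall>j\<ge>m. z j = 0)"
  and Y_sc: "z \<in> carrier Y \<Longrightarrow> sc \<kappa> \<odot>\<^bsub>Y\<^esub> z = (\<lambda>j. \<kappa> * z j)"
  using Y_coord by (auto simp: coord_module_def)

text \<open>The errors produced by changing the lifts of the split extension.\<close>
definition boundary :: "(nat \<Rightarrow> nat \<Rightarrow> 'k) \<Rightarrow> bool" where
  "boundary \<eta> \<longleftrightarrow> (\<exists>y. \<forall>i<n. y i \<in> carrier Y \<and> vtx (v i) \<odot>\<^bsub>Y\<^esub> y i = y i \<and>
     (\<forall>a. c ! i = Dir a \<longrightarrow> \<eta> i = (\<lambda>j. (arr a \<odot>\<^bsub>Y\<^esub> y i) j - wt i * y (succ i) j)) \<and>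
     (\<forall>a. c ! i = Inv a \<longrightarrow> \<eta> i = (\<lambda>j. (arr a \<odot>\<^bsub>Y\<^esub> y (succ i)) j - y i j)))"

lemma boundary_comb:
  assumes "boundary \<eta>" "boundary \<eta>'"
  shows "boundary (\<lambda>i j. \<kappa> * \<eta> i j + \<mu> * \<eta>' i j)"
proof -
  obtain y where y: "\<And>i. i < n \<Longrightarrow> y i \<in> carrier Y \<and> vtx (v i) \<odot>\<^bsub>Y\<^esub> y i = y i \<and>
     (\<forall>a. c ! i = Dir a \<longrightarrow> \<eta> i = (\<lambda>j. (arr a \<odot>\<^bsub>Y\<^esub> y i) j - wt i * y (succ i) j)) \<and>
     (\<forall>a. c ! i = Inv a \<longrightarrow> \<eta> i = (\<lambda>j. (arr a \<odot>\<^bsub>Y\<^esub> y (succ i)) j - y i j))"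
    using assms(1) unfolding boundary_def by blast
  obtain z where z: "\<And>i. i < n \<Longrightarrow> z i \<in> carrier Y \<and> vtx (v i) \<odot>\<^bsub>Y\<^esub> z i = z i \<and>
     (\<forall>a. c ! i = Dir a \<longrightarrow> \<eta>' i = (\<lambda>j. (arr a \<odot>\<^bsub>Y\<^esub> z i) j - wt i * z (succ i) j)) \<and>
     (\<forall>a. c ! i = Inv a \<longrightarrow> \<eta>' i = (\<lambda>j. (arr a \<odot>\<^bsub>Y\<^esub> z (succ i)) j - z i j))"
    using assms(2) unfolding boundary_def by blast
  have yc: "y i \<in> carrier Y" "z i \<in> carrier Y" if "i < n" for i using y z that by auto
  show ?thesis unfolding boundary_def
  proof (intro exI[of _ "\<lambda>i j. \<kappa> * y i j + \<mu> * z i j"] allI impI conjI)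
    fix i assume i: "i < n"
    show "(\<lambda>j. \<kappa> * y i j + \<mu> * z i j) \<in> carrier Y" using yc[OF i] by (simp add: Y_carrier)
    show "vtx (v i) \<odot>\<^bsub>Y\<^esub> (\<lambda>j. \<kappa> * y i j + \<mu> * z i j) = (\<lambda>j. \<kappa> * y i j + \<mu> * z i j)"
      using coord_smult_comb[OF Y_coord vtx_closed[OF v_verts[OF i]] yc[OF i]] y[OF i] z[OF i] by simp
    fix a
    show "(\<lambda>j. \<kappa> * \<eta> i j + \<mu> * \<eta>' i j) = (\<lambda>j. (arr a \<odot>\<^bsub>Y\<^esub> (\<lambda>j. \<kappa> * y i j + \<mu> * z i j)) j - wt i * (\<kappa> * y (succ i) j + \<mu> * z (succ i) j))"
      if "c ! i = Dir a"
      using coord_smult_comb[OF Y_coord arr_closed[OF c_arcs'(1)[OF i that]] yc[OF i]] y[OF i] z[OF i] that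
      by (auto simp: algebra_simps)
    show "(\<lambda>j. \<kappa> * \<eta> i j + \<mu> * \<eta>' i j) = (\<lambda>j. (arr a \<odot>\<^bsub>Y\<^esub> (\<lambda>j. \<kappa> * y (succ i) j + \<mu> * z (succ i) j)) j - (\<kappa> * y i j + \<mu> * z i j))"
      if "c ! i = Inv a"
      using coord_smult_comb[OF Y_coord arr_closed[OF c_arcs'(2)[OF i that]] yc[OF succ_less]] y[OF i] z[OF i] that
      by (auto simp: algebra_simps)
  qed
qed

lemma boundary_zero: "boundary (\<lambda>_ _. 0)"
proof -
  have "F \<odot>\<^bsub>Y\<^esub> (\<lambda>_. 0) = (\<lambda>_. 0)" if "F \<in> carrier R" for F
    using Y.smult_zero_right[OF that] by (simp add: Y_zero)
  then show ?thesis unfolding boundary_def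
    by (intro exI[of _ "\<lambda>_ _. 0"]) (auto simp: Y_carrier vtx_closed v_verts arr_closed c_arcs')
qed

lemma homotopic_iff: "homotopic Y \<eta> \<eta>' \<longleftrightarrow> boundary (\<lambda>i j. \<eta> i j - \<eta>' i j)"
proof -
  have 1: "(\<lambda>j. p j + q j) = (\<lambda>j. r j + s j) \<longleftrightarrow> (\<lambda>j. r j - p j) = (\<lambda>j. q j - s j)" for p q r s :: "nat \<Rightarrow> 'k"
    by (auto simp: fun_eq_iff algebra_simps)
  have sc: "sc (wt i) \<odot>\<^bsub>Y\<^esub> y (succ i) = (\<lambda>j. wt i * y (succ i) j)"
    if "\<forall>i<n. y i \<in> carrier Y" for y i using that Y_sc[of "y (succ i)"] by simp
  show ?thesis
    unfolding homotopic_def boundary_def Y_add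
  proof (intro iffI; elim exE)
    fix y assume *: "\<forall>i<n. y i \<in> carrier Y \<and> vtx (v i) \<odot>\<^bsub>Y\<^esub> y i = y i \<and>
       (\<forall>a. c ! i = Dir a \<longrightarrow> (\<lambda>j. \<eta>' i j + (arr a \<odot>\<^bsub>Y\<^esub> y i) j) = (\<lambda>j. \<eta> i j + (sc (wt i) \<odot>\<^bsub>Y\<^esub> y (succ i)) j)) \<and>
       (\<forall>a. c ! i = Inv a \<longrightarrow> (\<lambda>j. \<eta>' i j + (arr a \<odot>\<^bsub>Y\<^esub> y (succ i)) j) = (\<lambda>j. \<eta> i j + y i j))"
    then have "\<forall>i<n. y i \<in> carrier Y" by blast
    from sc[OF this] show "\<exists>y. \<forall>i<n. y i \<in> carrier Y \<and> vtx (v i) \<odot>\<^bsub>Y\<^esub> y i = y i \<and>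
       (\<forall>a. c ! i = Dir a \<longrightarrow> (\<lambda>j. \<eta> i j - \<eta>' i j) = (\<lambda>j. (arr a \<odot>\<^bsub>Y\<^esub> y i) j - wt i * y (succ i) j)) \<and>
       (\<forall>a. c ! i = Inv a \<longrightarrow> (\<lambda>j. \<eta> i j - \<eta>' i j) = (\<lambda>j. (arr a \<odot>\<^bsub>Y\<^esub> y (succ i)) j - y i j))"
      using * unfolding 1 by (intro exI[of _ y]) simp
  next
    fix y assume *: "\<forall>i<n. y i \<in> carrier Y \<and> vtx (v i) \<odot>\<^bsub>Y\<^esub> y i = y i \<and>
       (\<forall>a. c ! i = Dir a \<longrightarrow> (\<lambda>j. \<eta> i j - \<eta>' i j) = (\<lambda>j. (arr a \<odot>\<^bsub>Y\<^esub> y i) j - wt i * y (succ i) j)) \<and>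
       (\<forall>a. c ! i = Inv a \<longrightarrow> (\<lambda>j. \<eta> i j - \<eta>' i j) = (\<lambda>j. (arr a \<odot>\<^bsub>Y\<^esub> y (succ i)) j - y i j))"
    then have "\<forall>i<n. y i \<in> carrier Y" by blast
    from sc[OF this] show "\<exists>y. \<forall>i<n. y i \<in> carrier Y \<and> vtx (v i) \<odot>\<^bsub>Y\<^esub> y i = y i \<and>
       (\<forall>a. c ! i = Dir a \<longrightarrow> (\<lambda>j. \<eta>' i j + (arr a \<odot>\<^bsub>Y\<^esub> y i) j) = (\<lambda>j. \<eta> i j + (sc (wt i) \<odot>\<^bsub>Y\<^esub> y (succ i)) j)) \<and>
       (\<forall>a. c ! i = Inv a \<longrightarrow> (\<lambda>j. \<eta>' i j + (arr a \<odot>\<^bsub>Y\<^esub> y (succ i)) j) = (\<lambda>j. \<eta> i j + y i j))"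
      using * unfolding 1 by (intro exI[of _ y]) simp
  qed
qed

text \<open>
  The equivalence class of extensions with errors \<open>\<eta>\<close>. It is empty if \<open>\<eta>\<close> does not belong to an
  extension, for instance if some \<open>\<eta>\<^sub>i\<close> is not at the end of the arrow of the \<open>i\<close>-th letter.
\<close>
definition cls :: "(nat \<Rightarrow> nat \<Rightarrow> 'k) \<Rightarrow> ((('v, 'a) path \<Rightarrow> 'k) set, nat \<Rightarrow> 'k, nat \<Rightarrow> 'k, nat \<Rightarrow> 'k) ses set" where
  "cls \<eta> = {\<xi>. \<exists>e. lift Y \<xi> e \<eta>}"

definition realised :: "(nat \<Rightarrow> nat \<Rightarrow> 'k) \<Rightarrow> bool" where
  "realised \<eta> \<longleftrightarrow> cls \<eta> \<noteq> {}"

abbreviation Ext :: "('k, ((('v, 'a) path \<Rightarrow> 'k) set, nat \<Rightarrow> 'k, nat \<Rightarrow> 'k, nat \<Rightarrow> 'k) ses set) module" where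
  "Ext \<equiv> Ext1 R sc B Y"

lemma lift_is_extension: "lift Y' \<xi> e \<eta> \<Longrightarrow> is_extension R B Y' \<xi>"
  by (cases \<xi> rule: prod_cases3) (simp add: lift.simps)

lemma lift_ex: "is_extension R B Y' \<xi> \<Longrightarrow> \<exists>e \<eta>. lift Y' \<xi> e \<eta>"
  using lift_exists by (cases \<xi> rule: prod_cases3) blast

lemma lift_carrier: "lift Y' \<xi> e \<eta> \<Longrightarrow> i < n \<Longrightarrow> \<eta> i \<in> carrier Y'"
  by (cases \<xi> rule: prod_cases3) (auto simp: lift.simps)

lemma boundary_minus: "boundary (\<lambda>i j. \<eta> i j - \<eta>' i j) \<Longrightarrow> boundary (\<lambda>i j. \<eta>' i j - \<eta> i j)"
  using boundary_comb[of "\<lambda>i j. \<eta> i j - \<eta>' i j" "\<lambda>_ _. 0" "-1" 0] boundary_zero by simp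

lemma morphism_iff:
  assumes l: "lift Y' \<xi> e \<eta>" and l': "lift Y \<zeta> e' \<eta>'" and \<beta>: "\<beta> \<in> module_hom R Y' Y"
  shows "ext_morphism R Y' \<beta> \<xi> \<zeta> \<longleftrightarrow> boundary (\<lambda>i j. \<beta> (\<eta> i) j - \<eta>' i j)"
proof -
  obtain E f g E' f' g' where x: "\<xi> = (E, f, g)" "\<zeta> = (E', f', g')" by (metis prod_cases3)
  show ?thesis
  proof
    assume "ext_morphism R Y' \<beta> \<xi> \<zeta>"
    then show "boundary (\<lambda>i j. \<beta> (\<eta> i) j - \<eta>' i j)"
      using morphism_homotopic[of Y' E f g e \<eta> Y E' f' g' e' \<eta>' \<beta>] l l' \<beta> unfolding x homotopic_iff by blast
  next
    assume b: "boundary (\<lambda>i j. \<beta> (\<eta> i) j - \<eta>' i j)"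
    have "\<exists>e''. lift Y (E', f', g') e'' (\<lambda>i. \<beta> (\<eta> i))"
    proof (rule lift_change)
      show "lift Y (E', f', g') e' \<eta>'" using l' x by simp
      show "homotopic Y \<eta>' (\<lambda>i. \<beta> (\<eta> i))" using boundary_minus[OF b] by (simp add: homotopic_iff)
      show "\<beta> (\<eta> i) \<in> carrier Y" if "i < n" for i using lift_carrier[OF l that] module_hom_carrier[OF \<beta>] by blast
    qed
    then obtain e'' where "lift Y (E', f', g') e'' (\<lambda>i. \<beta> (\<eta> i))" by blast
    then show "ext_morphism R Y' \<beta> \<xi> \<zeta>"
      using lift_morphism[of Y' E f g e \<eta> Y E' f' g' e'' "\<lambda>i. \<beta> (\<eta> i)" \<beta>] l \<beta> unfolding x by blast
  qed
qed

lemma mem_cls_iff: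
  assumes "lift Y \<zeta> e' \<eta>'" and \<eta>: "\<forall>i<n. \<eta> i \<in> carrier Y"
  shows "\<zeta> \<in> cls \<eta> \<longleftrightarrow> boundary (\<lambda>i j. \<eta> i j - \<eta>' i j)"
proof -
  obtain E f g where x: "\<zeta> = (E, f, g)" by (metis prod_cases3)
  have id: "(\<lambda>y. y) \<in> module_hom R Y Y" by (auto simp: module_hom_def)
  show ?thesis
  proof
    assume "\<zeta> \<in> cls \<eta>"
    then obtain e where e: "lift Y \<zeta> e \<eta>" by (auto simp: cls_def)
    have "ext_morphism R Y (\<lambda>y. y) \<zeta> \<zeta>"
      unfolding x by (simp, intro bexI[of _ "\<lambda>z. z"]) (auto simp: module_hom_def)
    then show "boundary (\<lambda>i j. \<eta> i j - \<eta>' i j)" using morphism_iff[OF e assms(1) id] by simp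
  next
    assume b: "boundary (\<lambda>i j. \<eta> i j - \<eta>' i j)"
    have "\<exists>e''. lift Y (E, f, g) e'' \<eta>"
    proof (rule lift_change)
      show "lift Y (E, f, g) e' \<eta>'" using assms x by simp
      show "homotopic Y \<eta>' \<eta>" using boundary_minus[OF b] by (simp add: homotopic_iff)
    qed (use \<eta> in auto)
    then show "\<zeta> \<in> cls \<eta>" by (simp add: cls_def x)
  qed
qed

lemma realised_carrier: "realised \<eta> \<Longrightarrow> i < n \<Longrightarrow> \<eta> i \<in> carrier Y"
  using lift_carrier by (auto simp: realised_def cls_def)

lemma realised_carrier': "realised \<eta> \<Longrightarrow> \<forall>i<n. \<eta> i \<in> carrier Y"
  using realised_carrier by blast

lemma realised_lift: "realised \<eta> \<Longrightarrow> \<exists>\<xi> e. lift Y \<xi> e \<eta> \<and> \<xi> \<in> cls \<eta>"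
  by (auto simp: realised_def cls_def)

lemma cls_eq_iff:
  assumes "realised \<eta>" "realised \<eta>'"
  shows "cls \<eta> = cls \<eta>' \<longleftrightarrow> boundary (\<lambda>i j. \<eta> i j - \<eta>' i j)"
proof -
  obtain \<xi>' e' where l: "lift Y \<xi>' e' \<eta>'" "\<xi>' \<in> cls \<eta>'" using realised_lift assms(2) by blast
  note c = realised_carrier'[OF assms(1)] realised_carrier'[OF assms(2)]
  show ?thesis
  proof
    assume "cls \<eta> = cls \<eta>'"
    then show "boundary (\<lambda>i j. \<eta> i j - \<eta>' i j)" using mem_cls_iff[OF l(1) c(1)] l(2) by simp
  next
    assume b: "boundary (\<lambda>i j. \<eta> i j - \<eta>' i j)"
    have "\<zeta> \<in> cls \<eta> \<longleftrightarrow> \<zeta> \<in> cls \<eta>'" for \<zeta>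
    proof (cases "\<exists>e \<eta>''. lift Y \<zeta> e \<eta>''")
      case True
      then obtain e \<eta>'' where lz: "lift Y \<zeta> e \<eta>''" by blast
      have "boundary (\<lambda>i j. \<eta> i j - \<eta>'' i j) \<longleftrightarrow> boundary (\<lambda>i j. \<eta>' i j - \<eta>'' i j)"
        using boundary_comb[OF _ b, of "\<lambda>i j. \<eta> i j - \<eta>'' i j" 1 "-1"]
          boundary_comb[OF _ b, of "\<lambda>i j. \<eta>' i j - \<eta>'' i j" 1 1] by auto
      then show ?thesis using mem_cls_iff[OF lz c(1)] mem_cls_iff[OF lz c(2)] by simp
    qed (auto simp: cls_def)
    then show "cls \<eta> = cls \<eta>'" by blast
  qed
qed

lemma extensions_cls: "extensions R B Y = (\<Union>\<eta>. cls \<eta>)"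
proof (intro equalityI subsetI)
  fix \<xi> assume "\<xi> \<in> extensions R B Y"
  then obtain e \<eta> where "lift Y \<xi> e \<eta>" using lift_ex[of Y \<xi>] unfolding extensions_def by blast
  then show "\<xi> \<in> (\<Union>\<eta>. cls \<eta>)" unfolding cls_def by blast
next
  fix \<xi> assume "\<xi> \<in> (\<Union>\<eta>. cls \<eta>)"
  then show "\<xi> \<in> extensions R B Y"
    unfolding cls_def extensions_def using lift_is_extension[of Y \<xi>] by blast
qed

lemma equiv_class_cls:
  assumes "\<xi> \<in> cls \<eta>"
  shows "ext_equiv R B Y `` {\<xi>} = cls \<eta>"
proof -
  obtain e where e: "lift Y \<xi> e \<eta>" using assms by (auto simp: cls_def)
  have id: "(\<lambda>y. y) \<in> module_hom R Y Y" by (auto simp: module_hom_def)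
  have "\<zeta> \<in> ext_equiv R B Y `` {\<xi>} \<longleftrightarrow> \<zeta> \<in> cls \<eta>" for \<zeta>
  proof (cases "\<exists>e \<eta>''. lift Y \<zeta> e \<eta>''")
    case True
    then obtain e' \<eta>' where lz: "lift Y \<zeta> e' \<eta>'" by blast
    have "\<zeta> \<in> ext_equiv R B Y `` {\<xi>} \<longleftrightarrow> ext_morphism R Y (\<lambda>y. y) \<xi> \<zeta>"
      using lift_is_extension[OF e] lift_is_extension[OF lz] by (auto simp: ext_equiv_def extensions_def)
    also have "\<dots> \<longleftrightarrow> \<zeta> \<in> cls \<eta>"
      using morphism_iff[OF e lz id] mem_cls_iff[OF lz, of \<eta>] lift_carrier[OF e] by simp
    finally show ?thesis .
  next
    case False
    then show ?thesis using lift_ex[of Y \<zeta>] by (auto simp: ext_equiv_def extensions_def cls_def)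
  qed
  then show ?thesis by blast
qed

lemma Ext_carrier: "carrier Ext = cls ` Collect realised"
proof -
  have "carrier Ext = (\<Union>\<xi>\<in>extensions R B Y. {ext_equiv R B Y `` {\<xi>}})"
    by (simp add: Ext1_def quotient_def)
  also have "\<dots> = cls ` Collect realised"
  proof (intro equalityI subsetI)
    fix x assume "x \<in> (\<Union>\<xi>\<in>extensions R B Y. {ext_equiv R B Y `` {\<xi>}})"
    then obtain \<xi> \<eta> where "\<xi> \<in> cls \<eta>" "x = ext_equiv R B Y `` {\<xi>}" unfolding extensions_cls by blast
    then show "x \<in> cls ` Collect realised" using equiv_class_cls[of \<xi> \<eta>] unfolding realised_def by blast
  next
    fix x assume "x \<in> cls ` Collect realised"
    then obtain \<xi> \<eta> where "\<xi> \<in> cls \<eta>" "x = cls \<eta>" unfolding realised_def by blast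
    then show "x \<in> (\<Union>\<xi>\<in>extensions R B Y. {ext_equiv R B Y `` {\<xi>}})"
      using equiv_class_cls[of \<xi> \<eta>] unfolding extensions_cls by blast
  qed
  finally show ?thesis .
qed

text \<open>
  Cocycles form a vector space, and the errors of an extension are values of its cocycle: on the
  arrow of the letter and the basis vector at which that arrow starts.
\<close>
lemma realised_comb:
  assumes "realised \<eta>" "realised \<eta>'"
  shows "realised (\<lambda>i j. \<kappa> * \<eta> i j + \<mu> * \<eta>' i j)"
proof -
  have main: "\<exists>D. cocycle B Y D \<and> (\<forall>i<n. D (vtx (v i)) (basis_vec i) = \<zero>\<^bsub>Y\<^esub> \<and>
     (\<forall>a. c ! i = Dir a \<longrightarrow> D (arr a) (basis_vec i) = \<eta> i) \<and>
     (\<forall>a. c ! i = Inv a \<longrightarrow> D (arr a) (basis_vec (succ i)) = \<eta> i))"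
    if real: "realised \<eta>" for \<eta>
  proof -
    obtain \<xi> e where "lift Y \<xi> e \<eta>" "\<xi> \<in> cls \<eta>" using realised_lift[OF real] by blast
    then obtain E f g where l: "lift Y (E, f, g) e \<eta>" by (metis prod_cases3)
    then have ext: "is_extension R B Y (E, f, g)" and sec: "section_of n (E, f, g) e" by (auto simp: lift.simps)
    have mods: "left_module R E" "left_module R Y"
      and f: "f \<in> module_hom R Y E" "inj_on f (carrier Y)" using ext by (auto simp: is_extension.simps)
    interpret E: left_module R E by fact
    interpret BM: left_module R B by (rule B_left_module)
    obtain D where D: "cocycle B Y D" "\<And>F x. F \<in> carrier R \<Longrightarrow> x \<in> carrier B \<Longrightarrow>
        F \<odot>\<^bsub>E\<^esub> comb E e n x = comb E e n (F \<odot>\<^bsub>B\<^esub> x) \<oplus>\<^bsub>E\<^esub> f (D F x)"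
      using cocycle_of_extension[OF ext B_coord sec] by blast
    have Dc: "F \<in> carrier R \<Longrightarrow> x \<in> carrier B \<Longrightarrow> D F x \<in> carrier Y" for F x using D(1) by (simp add: cocycle_def)
    note ec = liftD(2)[OF l]
    have cu: "comb E e n (basis_vec k) = e k" if "k < n" for k by (rule comb_basis_vec[OF mods(1) ec that])
    have uniq: "D F x = y" if "F \<in> carrier R" "x \<in> carrier B" "y \<in> carrier Y"
        "F \<odot>\<^bsub>E\<^esub> comb E e n x = comb E e n (F \<odot>\<^bsub>B\<^esub> x) \<oplus>\<^bsub>E\<^esub> f y" for F x y
    proof -
      have "comb E e n (F \<odot>\<^bsub>B\<^esub> x) \<in> carrier E" using section_proj(2)[OF ext B_coord sec BM.smult_closed[OF that(1,2)]] .
      then have "f (D F x) = f y"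
        using E.M.add_left_cancelD[of "comb E e n (F \<odot>\<^bsub>B\<^esub> x)" "f (D F x)" "f y"] D(2)[OF that(1,2)] that(4)
          module_hom_carrier[OF f(1)] that(3) Dc[OF that(1,2)] by simp
      then show ?thesis using f(2) that(3) Dc[OF that(1,2)] by (auto simp: inj_on_def)
    qed
    show ?thesis
    proof (intro exI[of _ D] conjI D(1) allI impI)
      fix i assume i: "i < n"
      note li = liftD(1-4)[OF l i] and vi = v_verts[OF i]
      show "D (vtx (v i)) (basis_vec i) = \<zero>\<^bsub>Y\<^esub>"
        using i vi li vtx_closed[OF vi] B_basis[OF i]
        by (intro uniq) (auto simp: vtx_basis cu module_hom_zero[OF mods(2,1) f(1)])
      fix a
      show "D (arr a) (basis_vec i) = \<eta> i" if a: "c ! i = Dir a"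
      proof (rule uniq)
        have "comb E e n (\<lambda>j. wt i * basis_vec (succ i) j) = sc (wt i) \<odot>\<^bsub>E\<^esub> comb E e n (basis_vec (succ i))"
          by (rule comb_scale[OF mods(1) ec])
        then show "arr a \<odot>\<^bsub>E\<^esub> comb E e n (basis_vec i) = comb E e n (arr a \<odot>\<^bsub>B\<^esub> basis_vec i) \<oplus>\<^bsub>E\<^esub> f (\<eta> i)"
          using liftD(5)[OF l i a] i by (simp add: arr_basis_Dir[OF i a] cu)
      qed (use li i B_basis arr_closed c_arcs'(1)[OF i a] in auto)
      show "D (arr a) (basis_vec (succ i)) = \<eta> i" if a: "c ! i = Inv a"
      proof (rule uniq)
        show "arr a \<odot>\<^bsub>E\<^esub> comb E e n (basis_vec (succ i)) = comb E e n (arr a \<odot>\<^bsub>B\<^esub> basis_vec (succ i)) \<oplus>\<^bsub>E\<^esub> f (\<eta> i)"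
          using liftD(6)[OF l i a] i by (simp add: arr_basis_Inv[OF i a] cu)
      qed (use li i B_basis arr_closed c_arcs'(2)[OF i a] in auto)
    qed
  qed
  obtain D1 where D1: "cocycle B Y D1" "\<And>i. i < n \<Longrightarrow> D1 (vtx (v i)) (basis_vec i) = \<zero>\<^bsub>Y\<^esub>"
     "\<And>i a. i < n \<Longrightarrow> c ! i = Dir a \<Longrightarrow> D1 (arr a) (basis_vec i) = \<eta> i"
     "\<And>i a. i < n \<Longrightarrow> c ! i = Inv a \<Longrightarrow> D1 (arr a) (basis_vec (succ i)) = \<eta> i" using main[OF assms(1)] by blast
  obtain D2 where D2: "cocycle B Y D2" "\<And>i. i < n \<Longrightarrow> D2 (vtx (v i)) (basis_vec i) = \<zero>\<^bsub>Y\<^esub>"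
     "\<And>i a. i < n \<Longrightarrow> c ! i = Dir a \<Longrightarrow> D2 (arr a) (basis_vec i) = \<eta>' i"
     "\<And>i a. i < n \<Longrightarrow> c ! i = Inv a \<Longrightarrow> D2 (arr a) (basis_vec (succ i)) = \<eta>' i" using main[OF assms(2)] by blast
  define D where "D = (\<lambda>F x j. \<kappa> * D1 F x j + \<mu> * D2 F x j)"
  have D: "cocycle B Y D" unfolding D_def by (rule cocycle_combination[OF B_coord Y_coord D1(1) D2(1)])
  from extension_of_cocycle[OF B_coord Y_coord D]
  obtain E :: "((('v, 'a) path \<Rightarrow> 'k) set, nat \<Rightarrow> 'k) module" and f g e
    where ext: "is_extension R B Y (E, f, g)" and sec: "section_of n (E, f, g) e"
      and act: "\<And>F x. F \<in> carrier R \<Longrightarrow> x \<in> carrier B \<Longrightarrow> F \<odot>\<^bsub>E\<^esub> comb E e n x = comb E e n (F \<odot>\<^bsub>B\<^esub> x) \<oplus>\<^bsub>E\<^esub> f (D F x)"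
    by blast
  have mods: "left_module R E" "left_module R Y" and f: "f \<in> module_hom R Y E" using ext by (auto simp: is_extension.simps)
  interpret E: left_module R E by fact
  have ec: "i < n \<Longrightarrow> e i \<in> carrier E" for i using sec by (auto simp: section_of_def)
  have cu: "comb E e n (basis_vec k) = e k" if "k < n" for k by (rule comb_basis_vec[OF mods(1) ec that])
  have "lift Y (E, f, g) e (\<lambda>i j. \<kappa> * \<eta> i j + \<mu> * \<eta>' i j)"
    unfolding lift.simps
  proof (intro conjI allI impI ext sec)
    fix i assume i: "i < n"
    show "(\<lambda>j. \<kappa> * \<eta> i j + \<mu> * \<eta>' i j) \<in> carrier Y"
      using realised_carrier[OF assms(1) i] realised_carrier[OF assms(2) i] by (simp add: Y_carrier)
    have vi: "vtx (v i) \<in> carrier R" using vtx_closed[OF v_verts[OF i]] .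
    have "D (vtx (v i)) (basis_vec i) = \<zero>\<^bsub>Y\<^esub>" using D1(2)[OF i] D2(2)[OF i] by (simp add: D_def Y_zero)
    then show "vtx (v i) \<odot>\<^bsub>E\<^esub> e i = e i"
      using act[OF vi B_basis[OF i]] i v_verts[OF i] ec[OF i]
      by (simp add: cu vtx_basis module_hom_zero[OF mods(2,1) f])
    fix a
    show "arr a \<odot>\<^bsub>E\<^esub> e i = sc (wt i) \<odot>\<^bsub>E\<^esub> e (succ i) \<oplus>\<^bsub>E\<^esub> f (\<lambda>j. \<kappa> * \<eta> i j + \<mu> * \<eta>' i j)" if a: "c ! i = Dir a"
    proof -
      have "comb E e n (\<lambda>j. wt i * basis_vec (succ i) j) = sc (wt i) \<odot>\<^bsub>E\<^esub> comb E e n (basis_vec (succ i))"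
        by (rule comb_scale[OF mods(1) ec])
      then show ?thesis
        using act[OF arr_closed[OF c_arcs'(1)[OF i a]] B_basis[OF i]] i D1(3)[OF i a] D2(3)[OF i a]
        by (simp add: cu arr_basis_Dir[OF i a] D_def)
    qed
    show "arr a \<odot>\<^bsub>E\<^esub> e (succ i) = e i \<oplus>\<^bsub>E\<^esub> f (\<lambda>j. \<kappa> * \<eta> i j + \<mu> * \<eta>' i j)" if a: "c ! i = Inv a"
      using act[OF arr_closed[OF c_arcs'(2)[OF i a]] B_basis[OF succ_less]] i D1(4)[OF i a] D2(4)[OF i a]
      by (simp add: cu arr_basis_Inv[OF i a] D_def)
  qed
  then show ?thesis by (auto simp: realised_def cls_def)
qed

lemma realised_zero: "realised (\<lambda>_ _. 0)"
proof -
  have "cocycle B Y (\<lambda>_ _ _. 0)"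
    using Y.smult_zero_right by (auto simp: cocycle_def Y_add Y_zero Y_carrier)
  from extension_of_cocycle[OF B_coord Y_coord this]
  obtain E :: "((('v, 'a) path \<Rightarrow> 'k) set, nat \<Rightarrow> 'k) module" and f g where "is_extension R B Y (E, f, g)"
    by blast
  then obtain e \<eta> where "lift Y (E, f, g) e \<eta>" using lift_exists by blast
  then have "realised \<eta>" by (auto simp: realised_def cls_def)
  from realised_comb[OF this this, of 0 0] show ?thesis by simp
qed

lemma realised_boundary:
  assumes "boundary \<eta>" "\<And>i. i < n \<Longrightarrow> \<eta> i \<in> carrier Y" shows "realised \<eta>"
proof -
  obtain \<xi> e where *: "lift Y \<xi> e (\<lambda>_ _. 0)" "\<xi> \<in> cls (\<lambda>_ _. 0)" using realised_lift[OF realised_zero] by blast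
  from mem_cls_iff[OF *(1), of \<eta>] assms show ?thesis by (auto simp: realised_def)
qed

lemma Ext_zero: "\<zero>\<^bsub>Ext\<^esub> = cls (\<lambda>_ _. 0)"
proof -
  have "\<xi> \<in> extensions R B Y \<and> split_extension R B \<xi> \<longleftrightarrow> \<xi> \<in> cls (\<lambda>_ _. 0)" for \<xi>
  proof (cases "is_extension R B Y \<xi>")
    case True
    then show ?thesis using split_iff_lift_zero[of Y]
      by (cases \<xi> rule: prod_cases3) (simp add: extensions_def cls_def Y_zero)
  qed (auto simp: extensions_def cls_def dest: lift_is_extension)
  then show ?thesis by (auto simp: Ext1_def)
qed

text \<open>
  The fibre product has the pairs of lifts as lifts and the pairs of errors as errors, and the
  codiagonal adds the two errors.
\<close>
lemma Ext_add:
  assumes "realised \<eta>" "realised \<eta>'"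
  shows "cls \<eta> \<oplus>\<^bsub>Ext\<^esub> cls \<eta>' = cls (\<lambda>i j. \<eta> i j + \<eta>' i j)"
proof -
  have real: "realised (\<lambda>i j. \<eta> i j + \<eta>' i j)" using realised_comb[OF assms, of 1 1] by simp
  note c = realised_carrier'[OF real]
  have hom: "(\<lambda>(y, y'). y \<oplus>\<^bsub>Y\<^esub> y') \<in> module_hom R (direct_sum Y Y) Y"
    by (auto simp: module_hom_def direct_sum_def Y.smult_r_distr Y.M.a_ac)
  have 1: "ext_morphism R (direct_sum Y Y) (\<lambda>(y, y'). y \<oplus>\<^bsub>Y\<^esub> y') (fibre_ext \<xi> \<xi>') \<zeta> \<longleftrightarrow> \<zeta> \<in> cls (\<lambda>i j. \<eta> i j + \<eta>' i j)"
    if x: "\<xi> \<in> cls \<eta>" "\<xi>' \<in> cls \<eta>'" and z: "\<zeta> \<in> extensions R B Y" for \<xi> \<xi>' \<zeta>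
  proof -
    obtain e e' where l: "lift Y \<xi> e \<eta>" "lift Y \<xi>' e' \<eta>'" using x by (auto simp: cls_def)
    obtain d \<theta> where lz: "lift Y \<zeta> d \<theta>" using z lift_ex[of Y \<zeta>] by (auto simp: extensions_def)
    have "lift (direct_sum Y Y) (fibre_ext \<xi> \<xi>') (\<lambda>i. (e i, e' i)) (\<lambda>i. (\<eta> i, \<eta>' i))"
      using l fibre_lift by (cases \<xi> rule: prod_cases3; cases \<xi>' rule: prod_cases3) blast
    from morphism_iff[OF this lz hom] mem_cls_iff[OF lz c] show ?thesis by (simp add: Y_add)
  qed
  obtain \<xi> \<xi>' where x: "\<xi> \<in> cls \<eta>" "\<xi>' \<in> cls \<eta>'" using assms by (auto simp: realised_def)
  have "cls \<eta> \<oplus>\<^bsub>Ext\<^esub> cls \<eta>' = {\<zeta> \<in> extensions R B Y. \<exists>\<xi>\<in>cls \<eta>. \<exists>\<xi>'\<in>cls \<eta>'.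
     ext_morphism R (direct_sum Y Y) (\<lambda>(y, y'). y \<oplus>\<^bsub>Y\<^esub> y') (fibre_ext \<xi> \<xi>') \<zeta>}"
    by (simp add: Ext1_def)
  also have "\<dots> = {\<zeta> \<in> extensions R B Y. \<zeta> \<in> cls (\<lambda>i j. \<eta> i j + \<eta>' i j)}"
    using 1 x by blast
  also have "\<dots> = cls (\<lambda>i j. \<eta> i j + \<eta>' i j)" by (auto simp: extensions_cls)
  finally show ?thesis .
qed

lemma Ext_smult:
  assumes "realised \<eta>"
  shows "\<kappa> \<odot>\<^bsub>Ext\<^esub> cls \<eta> = cls (\<lambda>i j. \<kappa> * \<eta> i j)"
proof -
  have real: "realised (\<lambda>i j. \<kappa> * \<eta> i j)" using realised_comb[OF assms assms, of \<kappa> 0] by simp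
  note c = realised_carrier'[OF real]
  have hom: "(\<lambda>y. sc \<kappa> \<odot>\<^bsub>Y\<^esub> y) \<in> module_hom R Y Y"
    by (auto simp: module_hom_def Y.smult_r_distr Y.smult_closed sc_central simp flip: Y.smult_assoc)
  have 1: "ext_morphism R Y (\<lambda>y. sc \<kappa> \<odot>\<^bsub>Y\<^esub> y) \<xi> \<zeta> \<longleftrightarrow> \<zeta> \<in> cls (\<lambda>i j. \<kappa> * \<eta> i j)"
    if x: "\<xi> \<in> cls \<eta>" and z: "\<zeta> \<in> extensions R B Y" for \<xi> \<zeta>
  proof -
    obtain e where l: "lift Y \<xi> e \<eta>" using x by (auto simp: cls_def)
    obtain d \<theta> where lz: "lift Y \<zeta> d \<theta>" using z lift_ex[of Y \<zeta>] by (auto simp: extensions_def)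
    have "boundary (\<lambda>i j. (sc \<kappa> \<odot>\<^bsub>Y\<^esub> \<eta> i) j - \<theta> i j) \<longleftrightarrow> boundary (\<lambda>i j. \<kappa> * \<eta> i j - \<theta> i j)"
      unfolding boundary_def using Y_sc realised_carrier[OF assms] by auto
    then show ?thesis using morphism_iff[OF l lz hom] mem_cls_iff[OF lz c] by simp
  qed
  obtain \<xi> where x: "\<xi> \<in> cls \<eta>" using assms by (auto simp: realised_def)
  have "\<kappa> \<odot>\<^bsub>Ext\<^esub> cls \<eta> = {\<zeta> \<in> extensions R B Y. \<exists>\<xi>\<in>cls \<eta>. ext_morphism R Y (\<lambda>y. sc \<kappa> \<odot>\<^bsub>Y\<^esub> y) \<xi> \<zeta>}"
    by (simp add: Ext1_def)
  also have "\<dots> = {\<zeta> \<in> extensions R B Y. \<zeta> \<in> cls (\<lambda>i j. \<kappa> * \<eta> i j)}" using 1 x by blast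
  also have "\<dots> = cls (\<lambda>i j. \<kappa> * \<eta> i j)" by (auto simp: extensions_cls)
  finally show ?thesis .
qed

lemma Ext_vectorspace: "vectorspace class_ring Ext"
proof -
  have r1: "realised (\<lambda>i j. \<eta> i j + \<eta>' i j)" if "realised \<eta>" "realised \<eta>'" for \<eta> \<eta>'
    using realised_comb[OF that, of 1 1] by simp
  have r2: "realised (\<lambda>i j. \<kappa> * \<eta> i j)" if "realised \<eta>" for \<eta> \<kappa>
    using realised_comb[OF that that, of \<kappa> 0] by simp
  have ab: "abelian_group Ext"
  proof (rule abelian_groupI)
    fix x assume "x \<in> carrier Ext"
    then obtain \<eta> where e: "realised \<eta>" "x = cls \<eta>" by (auto simp: Ext_carrier)
    then have "cls (\<lambda>i j. - 1 * \<eta> i j) \<oplus>\<^bsub>Ext\<^esub> x = \<zero>\<^bsub>Ext\<^esub>" using r2[of \<eta> "-1"] by (simp add: Ext_add Ext_zero)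
    then show "\<exists>y\<in>carrier Ext. y \<oplus>\<^bsub>Ext\<^esub> x = \<zero>\<^bsub>Ext\<^esub>" using r2[OF e(1), of "-1"] Ext_carrier by blast
  qed (auto simp: Ext_carrier Ext_add Ext_zero realised_zero r1 algebra_simps)
  have "module class_ring Ext"
  proof (rule moduleI)
    show "cring (class_ring :: 'k ring)" using field.axioms(1)[OF class_field] domain.axioms(1) by blast
  qed (use ab in \<open>auto simp: Ext_carrier Ext_add Ext_smult r1 r2 algebra_simps\<close>)
  then show ?thesis using class_field by (simp add: vectorspace_def)
qed

text \<open>
  Errors \<open>h d\<close> with dual functionals \<open>\<psi> d\<close>, both taken modulo boundaries, are linearly
  independent. Spanning is required in the form that every set \<open>W\<close> of errors which contains the
  boundaries and the \<open>h d\<close>, and is closed under linear combinations, contains all realised errors;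
  it is used for the preimage of the span.
\<close>
lemma Ext_basis_criterion:
  fixes h :: "'d \<Rightarrow> nat \<Rightarrow> nat \<Rightarrow> 'k" and \<psi> :: "'d \<Rightarrow> (nat \<Rightarrow> nat \<Rightarrow> 'k) \<Rightarrow> 'k"
  assumes h: "\<And>d. d \<in> \<Lambda> \<Longrightarrow> realised (h d)"
    and lin: "\<And>d \<eta> \<eta>' \<kappa> \<mu>. d \<in> \<Lambda> \<Longrightarrow> \<psi> d (\<lambda>i j. \<kappa> * \<eta> i j + \<mu> * \<eta>' i j) = \<kappa> * \<psi> d \<eta> + \<mu> * \<psi> d \<eta>'"
    and bd: "\<And>d \<eta>. d \<in> \<Lambda> \<Longrightarrow> boundary \<eta> \<Longrightarrow> \<psi> d \<eta> = 0"
    and nz: "\<And>d. d \<in> \<Lambda> \<Longrightarrow> \<psi> d (h d) \<noteq> 0"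
    and ort: "\<And>d d'. d \<in> \<Lambda> \<Longrightarrow> d' \<in> \<Lambda> \<Longrightarrow> d \<noteq> d' \<Longrightarrow> \<psi> d (h d') = 0"
    and span: "\<And>W \<eta>. realised \<eta> \<Longrightarrow> (\<And>d. d \<in> \<Lambda> \<Longrightarrow> h d \<in> W) \<Longrightarrow>
       (\<And>\<eta>. boundary \<eta> \<Longrightarrow> (\<And>i. i < n \<Longrightarrow> \<eta> i \<in> carrier Y) \<Longrightarrow> \<eta> \<in> W) \<Longrightarrow>
       (\<And>\<eta> \<eta>' \<kappa> \<mu>. \<eta> \<in> W \<Longrightarrow> \<eta>' \<in> W \<Longrightarrow> (\<lambda>i j. \<kappa> * \<eta> i j + \<mu> * \<eta>' i j) \<in> W) \<Longrightarrow> \<eta> \<in> W"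
  shows "inj_on (\<lambda>d. cls (h d)) \<Lambda>" "vectorspace.basis class_ring Ext ((\<lambda>d. cls (h d)) ` \<Lambda>)"
proof -
  interpret V: vectorspace class_ring Ext by (rule Ext_vectorspace)
  define C where "C = (\<lambda>d. cls (h d))"
  have well: "\<psi> d \<eta> = \<psi> d \<eta>'" if "d \<in> \<Lambda>" "realised \<eta>" "realised \<eta>'" "cls \<eta> = cls \<eta>'" for d \<eta> \<eta>'
    using bd[OF that(1), of "\<lambda>i j. \<eta> i j - \<eta>' i j"] lin[OF that(1), of 1 \<eta> "-1" \<eta>'] that cls_eq_iff by simp
  have inj: "inj_on C \<Lambda>"
    using well ort nz h unfolding inj_on_def C_def by metis
  then show "inj_on (\<lambda>d. cls (h d)) \<Lambda>" by (simp add: C_def)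
  have CV: "C ` \<Lambda> \<subseteq> carrier Ext" using h by (auto simp: C_def Ext_carrier)
  have lc: "\<exists>\<eta>. realised \<eta> \<and> V.lincomb a A = cls \<eta> \<and>
      (\<forall>d\<in>\<Lambda>. \<psi> d \<eta> = (if C d \<in> A then a (C d) * \<psi> d (h d) else 0))"
    if "finite A" "A \<subseteq> C ` \<Lambda>" for a A
    using that
  proof (induction A rule: finite_induct)
    case empty
    have "\<psi> d (\<lambda>_ _. 0) = 0" if "d \<in> \<Lambda>" for d using bd[OF that boundary_zero] .
    then show ?case using realised_zero by (intro exI[of _ "\<lambda>_ _. 0"]) (auto simp: V.lincomb_def Ext_zero)
  next
    case (insert x A)
    then obtain \<eta> where \<eta>: "realised \<eta>" "V.lincomb a A = cls \<eta>"
      "\<forall>d\<in>\<Lambda>. \<psi> d \<eta> = (if C d \<in> A then a (C d) * \<psi> d (h d) else 0)" by auto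
    obtain d0 where d0: "d0 \<in> \<Lambda>" "x = C d0" using insert by auto
    have "V.lincomb a (A \<union> {x}) = a x \<odot>\<^bsub>Ext\<^esub> x \<oplus>\<^bsub>Ext\<^esub> V.lincomb a A"
      using insert CV d0 by (intro V.lincomb_insert) auto
    also have "\<dots> = cls (\<lambda>i j. a x * h d0 i j + 1 * \<eta> i j)"
      using d0 \<eta>(1,2) h[OF d0(1)] realised_comb[of "h d0" "h d0" "a x" 0] by (simp add: C_def Ext_smult Ext_add)
    finally have "V.lincomb a (insert x A) = cls (\<lambda>i j. a x * h d0 i j + 1 * \<eta> i j)" by simp
    moreover have "realised (\<lambda>i j. a x * h d0 i j + 1 * \<eta> i j)" by (rule realised_comb[OF h[OF d0(1)] \<eta>(1)])
    moreover have "\<psi> d (\<lambda>i j. a x * h d0 i j + 1 * \<eta> i j) = (if C d \<in> insert x A then a (C d) * \<psi> d (h d) else 0)"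
      if d: "d \<in> \<Lambda>" for d
    proof (cases "d = d0")
      case True
      then show ?thesis using lin[OF d, of "a x" "h d0" 1 \<eta>] \<eta>(3) d d0 insert by auto
    next
      case False
      then have "C d \<noteq> x" using inj d d0 by (auto simp: inj_on_def)
      then show ?thesis using lin[OF d, of "a x" "h d0" 1 \<eta>] \<eta>(3) d d0 ort[OF d d0(1) False] by auto
    qed
    ultimately show ?case by blast
  qed
  have "V.lin_indpt (C ` \<Lambda>)"
  proof
    assume "V.lin_dep (C ` \<Lambda>)"
    then obtain A a x where A: "finite A" "A \<subseteq> C ` \<Lambda>" "V.lincomb a A = \<zero>\<^bsub>Ext\<^esub>" "x \<in> A" "a x \<noteq> 0"
      by (auto simp: V.lin_dep_def)
    obtain \<eta> where \<eta>: "realised \<eta>" "V.lincomb a A = cls \<eta>"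
      "\<forall>d\<in>\<Lambda>. \<psi> d \<eta> = (if C d \<in> A then a (C d) * \<psi> d (h d) else 0)" using lc[OF A(1,2)] by blast
    obtain d where d: "d \<in> \<Lambda>" "x = C d" using A by auto
    have "\<psi> d \<eta> = \<psi> d (\<lambda>_ _. 0)" using well[OF d(1) \<eta>(1) realised_zero] \<eta>(2) A(3) Ext_zero by simp
    then have "a x * \<psi> d (h d) = 0" using \<eta>(3) d A(4) bd[OF d(1) boundary_zero] by auto
    then show False using A(5) nz[OF d(1)] by simp
  qed
  moreover have "V.span (C ` \<Lambda>) = carrier Ext"
  proof
    have sub: "submodule class_ring (V.span (C ` \<Lambda>)) Ext" using V.span_is_submodule CV by blast
    then show "V.span (C ` \<Lambda>) \<subseteq> carrier Ext" by (simp add: submodule_def)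
    define W where "W = {\<eta>. realised \<eta> \<and> cls \<eta> \<in> V.span (C ` \<Lambda>)}"
    have "\<eta> \<in> W" if "realised \<eta>" for \<eta>
      using that
    proof (rule span)
      show "h d \<in> W" if "d \<in> \<Lambda>" for d
        using h[OF that] V.in_own_span[OF CV] that by (auto simp: W_def C_def)
      show "\<eta> \<in> W" if "boundary \<eta>" "\<And>i. i < n \<Longrightarrow> \<eta> i \<in> carrier Y" for \<eta>
      proof -
        have r: "realised \<eta>" using realised_boundary that by blast
        then have "cls \<eta> = \<zero>\<^bsub>Ext\<^esub>" using cls_eq_iff[OF r realised_zero] that(1) by (simp add: Ext_zero)
        then show ?thesis using r submodule.zero_closed[OF sub] by (simp add: W_def)
      qed
      show "(\<lambda>i j. \<kappa> * \<eta> i j + \<mu> * \<eta>' i j) \<in> W" if "\<eta> \<in> W" "\<eta>' \<in> W" for \<eta> \<eta>' \<kappa> \<mu>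
      proof -
        have r: "realised \<eta>" "realised \<eta>'" using that by (auto simp: W_def)
        have r': "realised (\<lambda>i j. \<kappa> * \<eta> i j)" "realised (\<lambda>i j. \<mu> * \<eta>' i j)"
          using realised_comb[OF r(1) r(1), of \<kappa> 0] realised_comb[OF r(2) r(2), of \<mu> 0] by auto
        have "cls (\<lambda>i j. \<kappa> * \<eta> i j + \<mu> * \<eta>' i j) = \<kappa> \<odot>\<^bsub>Ext\<^esub> cls \<eta> \<oplus>\<^bsub>Ext\<^esub> \<mu> \<odot>\<^bsub>Ext\<^esub> cls \<eta>'"
          using r r' by (simp add: Ext_smult Ext_add)
        then show ?thesis
          using that realised_comb[OF r] submodule.m_closed[OF sub] submodule.smult_closed[OF sub] by (simp add: W_def)
      qed
    qed
    then show "carrier Ext \<subseteq> V.span (C ` \<Lambda>)" by (auto simp: Ext_carrier W_def)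
  qed
  ultimately show "V.basis ((\<lambda>d. cls (h d)) ` \<Lambda>)" using CV by (simp add: V.basis_def C_def)
qed

end

section \<open>Overlap extensions\<close>

context gentle_quiver
begin

lemma string_coord: "is_string Q I (x, ls) \<Longrightarrow> coord_module (Suc (length ls)) (string_module Q (x, ls))"
  using diagram_coord[OF string_module_diagram] by simp

lemma string_vtx:
  assumes "is_string Q I (x, ls)" "y \<in> verts Q"
  shows "vtx y \<odot>\<^bsub>string_module Q (x, ls)\<^esub> z = (\<lambda>j. if j \<le> length ls \<and> word_end Q (x, take j ls) = y then z j else 0)"
proof -
  interpret D: diagram Q I "Suc (length ls)" "\<lambda>j. word_end Q (x, take j ls)" ls Suc "\<lambda>_. 1"
    by (rule string_module_diagram[OF assms(1)])
  show ?thesis using D.vtx_smult_D[OF assms(2), of z] by (simp add: vertex_act_def less_Suc_eq_le)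
qed

lemma string_arr:
  assumes "is_string Q I (x, ls)" "a \<in> arcs Q"
  shows "arr a \<odot>\<^bsub>string_module Q (x, ls)\<^esub> z = arrow_act ls Suc (\<lambda>_. 1) a z"
proof -
  interpret D: diagram Q I "Suc (length ls)" "\<lambda>j. word_end Q (x, take j ls)" ls Suc "\<lambda>_. 1"
    by (rule string_module_diagram[OF assms(1)])
  show ?thesis using D.arr_smult_D[OF assms(2), of z] by simp
qed

lemma coord_homI:
  assumes X: "coord_module N X" and X': "coord_module N' X'"
    and maps: "\<And>z. (\<forall>j\<ge>N. z j = 0) \<Longrightarrow> \<forall>j\<ge>N'. \<phi> z j = 0"
    and add: "\<And>y z. \<phi> (\<lambda>j. y j + z j) = (\<lambda>j. \<phi> y j + \<phi> z j)"
    and sc: "\<And>\<kappa> z. \<phi> (\<lambda>j. \<kappa> * z j) = (\<lambda>j. \<kappa> * \<phi> z j)"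
    and vtx: "\<And>v z. v \<in> verts Q \<Longrightarrow> \<forall>j\<ge>N. z j = 0 \<Longrightarrow> \<phi> (vtx v \<odot>\<^bsub>X\<^esub> z) = vtx v \<odot>\<^bsub>X'\<^esub> \<phi> z"
    and arr: "\<And>a z. a \<in> arcs Q \<Longrightarrow> \<forall>j\<ge>N. z j = 0 \<Longrightarrow> \<phi> (arr a \<odot>\<^bsub>X\<^esub> z) = arr a \<odot>\<^bsub>X'\<^esub> \<phi> z"
  shows "\<phi> \<in> module_hom R X X'"
  by (rule module_hom_generatorsI) (use assms in \<open>auto simp: coord_module_def\<close>)

lemma module_hom_comp:
  assumes "f \<in> module_hom R X Y" "g \<in> module_hom R Y Z"
  shows "(\<lambda>x. g (f x)) \<in> module_hom R X Z"
  using assms by (auto simp: module_hom_def Pi_def)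

lemma string_reverse_hom:
  assumes s: "is_string Q I (x, ls)" and s': "is_string Q I (x', ls')" and inv: "(x', ls') = word_inv Q (x, ls)"
  shows "(\<lambda>z j. if j \<le> length ls then z (length ls - j) else 0) \<in> module_hom R (string_module Q (x, ls)) (string_module Q (x', ls'))"
    (is "?\<phi> \<in> _")
proof (rule coord_homI[OF string_coord[OF s] string_coord[OF s']])
  have ls': "ls' = rev (map letter_inv ls)" "x' = word_end Q (x, ls)" using inv by auto
  have ok: "word_ok ls" "ls \<noteq> [] \<Longrightarrow> letter_start Q (hd ls) = x" using s by (auto simp: is_string_iff)
  let ?l = "length ls"
  show "\<forall>j\<ge>Suc (length ls'). ?\<phi> z j = 0" for z by (auto simp: ls')
  show "?\<phi> (\<lambda>j. y j + z j) = (\<lambda>j. ?\<phi> y j + ?\<phi> z j)" "?\<phi> (\<lambda>j. \<kappa> * z j) = (\<lambda>j. \<kappa> * ?\<phi> z j)" for y z \<kappa>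
    by (auto simp: fun_eq_iff)
  show "?\<phi> (vtx v \<odot>\<^bsub>string_module Q (x, ls)\<^esub> z) = vtx v \<odot>\<^bsub>string_module Q (x', ls')\<^esub> ?\<phi> z" if "v \<in> verts Q" for v z
    using word_end_full[OF ok] unfolding string_vtx[OF s that] string_vtx[OF s' that]
    by (auto simp: fun_eq_iff ls' simp del: word_end.simps)
  show "?\<phi> (arr a \<odot>\<^bsub>string_module Q (x, ls)\<^esub> z) = arr a \<odot>\<^bsub>string_module Q (x', ls')\<^esub> ?\<phi> z"
    if a: "a \<in> arcs Q" and z: "\<forall>j\<ge>Suc (length ls). z j = 0" for a z
  proof (rule ext)
    fix j
    have 1: "ls' ! (j - 1) = Dir a \<longleftrightarrow> ls ! (?l - j) = Inv a" if "0 < j" "j \<le> ?l"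
    proof -
      have "?l - Suc (j - 1) = ?l - j" "j - 1 < ?l" using that by auto
      then show ?thesis by (simp add: ls' rev_nth letter_inv_eq_iff)
    qed
    have 2: "ls' ! j = Inv a \<longleftrightarrow> ls ! (?l - j - 1) = Dir a" if "j < ?l"
      using that by (simp add: ls' rev_nth letter_inv_eq_iff)
    show "?\<phi> (arr a \<odot>\<^bsub>string_module Q (x, ls)\<^esub> z) j = (arr a \<odot>\<^bsub>string_module Q (x', ls')\<^esub> ?\<phi> z) j"
    proof (cases "j \<le> ?l")
      case True
      have 3: "?l - (j - 1) = Suc (?l - j)" "?l - j < ?l" "j - 1 \<le> ?l" if "0 < j" using that True by auto
      have "(if 0 < j \<and> j \<le> length ls' \<and> ls' ! (j - 1) = Dir a then ?\<phi> z (j - 1) else 0) =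
          (if ?l - j < ?l \<and> ls ! (?l - j) = Inv a then z (Suc (?l - j)) else 0)"
        using 1 3 True by (cases "0 < j") (simp_all add: ls')
      moreover have "(if j < length ls' \<and> ls' ! j = Inv a then ?\<phi> z (Suc j) else 0) =
          (if 0 < ?l - j \<and> ?l - j \<le> ?l \<and> ls ! (?l - j - 1) = Dir a then z (?l - j - 1) else 0)"
        using 2 True by (cases "j < ?l") (simp_all add: ls')
      ultimately show ?thesis
        using True unfolding string_arr[OF s a] string_arr[OF s' a] string_arrow_act by simp
    next
      case False
      then show ?thesis unfolding string_arr[OF s a] string_arr[OF s' a] string_arrow_act by (simp add: ls')
    qed
  qed
qed

end

locale band_string = band Q I c t lam
  for Q :: "('v, 'a) pre_digraph" and I :: "(('v, 'a) path \<Rightarrow> 'k::field) set"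
    and c :: "'a letter list" and t :: nat and lam :: 'k +
  fixes w :: "('v, 'a) qword"
  assumes w: "is_string Q I w"
begin

abbreviation l :: nat where "l \<equiv> length (snd w)"

lemma string_module_coord: "is_string Q I u \<Longrightarrow> coord_module (Suc (length (snd u))) (string_module Q u)"
  using string_coord by (cases u) simp

sublocale band_coord Q I c t lam "string_module Q w" "Suc (length (snd w))"
  using string_module_coord[OF w] by unfold_locales

abbreviation "Y \<equiv> (string_module Q w :: ((('v, 'a) path \<Rightarrow> 'k) set, nat \<Rightarrow> 'k) module)"

end

text \<open>
  Notation for an overlap: \<open>(x, ls)\<close> is the word \<open>w\<close> or its inverse in which \<open>m\<close> is found, \<open>r\<close> the
  place in \<open>ls\<close> at which \<open>m\<close> starts and \<open>M\<close> its length; \<open>us\<close> are the letters of the middle word.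
  The \<open>s\<close>-th vertex of \<open>m\<close>, counted on in the periodic word, lies above the basis vector \<open>ix s\<close> of
  the band module, and \<open>ex s\<close> is the power of \<open>\<lambda>\<close> that goes with it.
\<close>
locale band_overlap = band_string Q I c t lam w
  for Q :: "('v, 'a) pre_digraph" and I :: "(('v, 'a) path \<Rightarrow> 'k::field) set"
    and c :: "'a letter list" and t :: nat and lam :: 'k and w :: "('v, 'a) qword" +
  fixes d :: "('v, 'a) overlap"
  assumes ov: "is_overlap Q I c d" and ow: "ov_word d \<in> {w, word_inv Q w}"
begin

definition ls where "ls = snd (ov_word d)"
definition x where "x = fst (ov_word d)"
abbreviation r where "r \<equiv> length (ov_right d)"
abbreviation M where "M \<equiv> ov_len d"
definition us where "us = snd (ov_middle c d)"
definition ix :: "nat \<Rightarrow> nat" where "ix s = nat ((ov_pos d + int s) mod int n)"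
definition ex :: "nat \<Rightarrow> nat" where "ex s = card {i. i < s \<and> ix i = t}"

lemma ov_word_eq: "ov_word d = (x, ls)" by (simp add: x_def ls_def)

lemma word_string: "is_string Q I (x, ls)"
  using ow w is_string_inv[OF w] by (auto simp flip: ov_word_eq)

lemma ls_ok: "word_ok ls" "x \<in> verts Q" "ls \<noteq> [] \<Longrightarrow> letter_start Q (hd ls) = x"
  using word_string by (auto simp: is_string_iff)

lemma length_ls: "length ls = l"
  using ow by (cases w) (auto simp: ls_def)

lemma ls_split: "ls = ov_right d @ snd (ov_m d) @ ov_left d"
  using ov by (simp add: is_overlap_def ls_def)

lemma l_eq: "l = r + M + length (ov_left d)"
  using ls_split length_ls by (simp add: ov_len_def flip: length_append) 

lemma ix_less [simp]: "ix s < n"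
  using n_pos by (simp add: ix_def nat_less_iff)

lemma ix_Suc: "ix (Suc s) = succ (ix s)"
  using succ_mod[of "ov_pos d + int s"] by (simp add: ix_def algebra_simps)

lemma ix_add_n [simp]: "ix (s + n) = ix s"
  by (simp add: ix_def flip: add.assoc)

lemma biinf_ix: "biinf c (ov_pos d + int s) = c ! ix s"
  by (simp add: biinf_def ix_def)

lemma ix_0: "pred (ix 0) = nat ((ov_pos d - 1) mod int n)"
  by (simp add: ix_def pred_mod)

lemma c_A: "c ! pred (ix 0) = Dir (ov_A d)"
  using ov by (simp add: is_overlap_def biinf_def ix_0)

lemma c_B: "c ! ix M = Inv (ov_B d)"
  using ov by (simp add: is_overlap_def biinf_ix)

lemma ls_m: "s < M \<Longrightarrow> ls ! (r + s) = c ! ix s"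
proof -
  assume s: "s < M"
  have "snd (ov_m d) = biinf_segment c (ov_pos d) M" using ov by (simp add: is_overlap_def)
  then have "snd (ov_m d) ! s = c ! ix s" using s by (simp add: biinf_segment_def biinf_ix)
  then show ?thesis using s by (simp add: ls_split nth_append ov_len_def)
qed

lemma ls_left: "r + M < l \<Longrightarrow> \<exists>D. ls ! (r + M) = Dir D \<and> ov_D d = Some D"
proof -
  assume "r + M < l"
  then have "ov_left d \<noteq> []" using l_eq by auto
  then obtain D where D: "ov_D d = Some D" using ov by (cases "ov_D d") (auto simp: ov_left_def is_overlap_def)
  have "ls ! (r + M) = ov_left d ! 0" by (simp add: ls_split nth_append ov_len_def)
  then show ?thesis using D by (simp add: ov_left_def)
qed

lemma ls_right: "0 < r \<Longrightarrow> \<exists>C. ls ! (r - 1) = Inv C \<and> ov_C d = Some C"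
proof -
  assume r: "0 < r"
  then obtain C where C: "ov_C d = Some C" using ov by (cases "ov_C d") (auto simp: ov_right_def is_overlap_def)
  have "ls ! (r - 1) = last (ov_right d)" using r by (simp add: ls_split nth_append last_conv_nth)
  then show ?thesis using C by (simp add: ov_right_def)
qed

lemma us_eq: "us = ov_right d @ map (\<lambda>s. c ! ix s) [0..<M + n] @ ov_left d"
  by (simp add: us_def ov_middle_def biinf_segment_def biinf_ix)

lemma middle_eq: "ov_middle c d = (x, us)"
  by (simp add: us_def x_def ov_middle_def)

lemma length_us: "length us = l + n"
  using l_eq by (simp add: us_eq)

lemma us_y: "s < M + n \<Longrightarrow> us ! (r + s) = c ! ix s"
  by (simp add: us_eq nth_append)

lemma us_first: "k < r + M \<Longrightarrow> us ! k = ls ! k"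
proof (cases "k < r")
  case True
  then show ?thesis by (simp add: us_eq ls_split nth_append)
next
  case False
  assume "k < r + M"
  then show ?thesis using us_y[of "k - r"] ls_m[of "k - r"] False by simp
qed

lemma us_last: "r + n \<le> k \<Longrightarrow> k < l + n \<Longrightarrow> us ! k = ls ! (k - n)"
proof (cases "k < r + n + M")
  case True
  assume k: "r + n \<le> k" "k < l + n"
  have "us ! k = c ! ix (k - r)" using us_y[of "k - r"] k True by simp
  also have "ix (k - r) = ix (k - n - r)" using ix_add_n[of "k - n - r"] k by (simp add: algebra_simps)
  also have "c ! \<dots> = ls ! (k - n)" using ls_m[of "k - n - r"] k True by simp
  finally show ?thesis .
next
  case False
  assume k: "r + n \<le> k" "k < l + n"
  have "us ! k = ov_left d ! (k - r - (M + n))"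
    unfolding us_eq nth_append using k False by auto
  moreover have "ls ! (k - n) = ov_left d ! (k - n - r - M)"
    unfolding ls_split nth_append using k False by (auto simp: ov_len_def)
  moreover have "k - r - (M + n) = k - n - r - M" by simp
  ultimately show ?thesis by simp
qed

lemma ix_n_pred: "ix (n - 1) = pred (ix 0)"
proof -
  have "succ (ix (n - 1)) = ix 0" using ix_Suc[of "n - 1"] ix_add_n[of 0] n_pos by simp
  then show ?thesis using pred_succ[of "ix (n - 1)"] by simp
qed

lemma us_A: "us ! (r + n - 1) = Dir (ov_A d)"
proof -
  have "r + n - 1 = r + (n - 1)" "n - 1 < M + n" using n_pos by linarith+
  then show ?thesis using us_y[of "n - 1"] c_A ix_n_pred by metis
qed

lemma us_B: "us ! (r + M) = Inv (ov_B d)"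
  using us_y[of M] n_pos c_B by simp

lemma v_ix_0: "v (ix 0) = head Q (ov_A d)"
  using v_succ[of "pred (ix 0)"] c_A by simp

lemma word_end_r: "word_end Q (x, take r ls) = head Q (ov_A d)"
proof -
  have "take r ls = ov_right d" by (simp add: ls_split)
  moreover have "fst (ov_m d) = head Q (ov_A d)" "fst (ov_m d) = word_end Q (x, ov_right d)"
    using ov unfolding is_overlap_def x_def by blast+
  ultimately show ?thesis by metis
qed

lemma A_neq_B: "M = 0 \<Longrightarrow> ov_A d \<noteq> ov_B d"
  using compat_c[of "pred (ix 0)"] c_A c_B by (auto simp: compat_def)

lemma word_ok_cyclic: "word_ok (map (\<lambda>s. c ! ix s) [0..<k])"
  using c_arcs compat_c ix_Suc by (auto simp: word_ok_def)

text \<open>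
  Only the two places where \<open>w\<close> and the periodic word are joined need an argument. If \<open>m\<close> is
  nontrivial, the letters meeting there are already neighbours in \<open>w\<close>. If \<open>m\<close> is trivial, \<open>C A\<close>
  and \<open>D B\<close> are zero relations, hence \<open>C B\<close> and \<open>D A\<close> are not.
\<close>
lemma us_ok: "word_ok us"
proof -
  let ?y = "map (\<lambda>s. c ! ix s) [0..<M + n]"
  have ok: "word_ok (ov_right d)" "word_ok (ov_left d)"
    using ls_ok(1) by (auto simp: ls_split word_ok_append)
  have ne: "?y \<noteq> []" using n_pos by auto
  have hd: "hd ?y = c ! ix 0" using n_pos by (simp add: hd_map hd_upt)
  have la: "last ?y = c ! ix (M + n - 1)" using n_pos by (simp add: last_map)
  have right: "compat (last (ov_right d)) (c ! ix 0)" if ne: "ov_right d \<noteq> []"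
  proof -
    have r: "0 < r" using ne by simp
    obtain C where C: "ls ! (r - 1) = Inv C" "ov_C d = Some C" using ls_right r by blast
    have la: "last (ov_right d) = Inv C" using C(1) r ne by (simp add: ls_split nth_append last_conv_nth)
    show ?thesis
    proof (cases "M = 0")
      case False
      have "Suc (r - 1) < length ls" using False r length_ls l_eq by linarith
      then have "compat (ls ! (r - 1)) (ls ! Suc (r - 1))" using ls_ok(1) unfolding word_ok_def by blast
      then show ?thesis using C la r ls_m[of 0] False by simp
    next
      case True
      then have "zero_comp Q I C (ov_A d)" using ov C by (simp add: is_overlap_def ov_len_def)
      then have z: "\<not> zero_comp Q I C (ov_B d)" using gentle_zero_right A_neq_B[OF True] by blast
      have "tail Q C = head Q (ov_A d)"
      proof -
        have "Suc (r - 1) = r" "r - 1 < length ls" using r l_eq length_ls by linarith+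
        then show ?thesis using word_end_r word_end_take_Suc[of "r - 1" ls x] C(1) by simp
      qed
      then show ?thesis using z la c_B True v_ix_0 by (simp add: compat_def v_def)
    qed
  qed
  have left: "compat (c ! ix (M + n - 1)) (hd (ov_left d))" if ne: "ov_left d \<noteq> []"
  proof -
    have rl: "r + M < l" using ne l_eq by simp
    obtain D where D: "ls ! (r + M) = Dir D" "ov_D d = Some D" using ls_left[OF rl] by blast
    have hd: "hd (ov_left d) = Dir D" using D(1) ne by (simp add: ls_split nth_append hd_conv_nth ov_len_def)
    show ?thesis
    proof (cases "M = 0")
      case False
      then have "ix (M + n - 1) = ix (M - 1)" using ix_add_n[of "M - 1"] by simp
      moreover have "Suc (r + (M - 1)) < length ls" using rl length_ls False by linarith
      then have "compat (ls ! (r + (M - 1))) (ls ! Suc (r + (M - 1)))"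
        using ls_ok(1) unfolding word_ok_def by blast
      ultimately show ?thesis using D hd ls_m[of "M - 1"] False by simp
    next
      case True
      then have "zero_comp Q I D (ov_B d)" using ov D by (simp add: is_overlap_def ov_len_def)
      then have z: "\<not> zero_comp Q I D (ov_A d)" using gentle_zero_right A_neq_B[OF True] by metis
      have "tail Q D = head Q (ov_A d)"
        using word_end_r word_end_take[OF ls_ok(1,3), of r] rl True D(1) length_ls by simp
      then show ?thesis using z hd c_A True ix_n_pred by (simp add: compat_def)
    qed
  qed
  show ?thesis unfolding us_eq word_ok_append
    using ok word_ok_cyclic ne hd la right left n_pos by (auto simp del: map_eq_conv)
qed

lemma us_string: "is_string Q I (x, us)"
proof -
  have "letter_start Q (hd us) = x"
  proof (cases "ov_right d = []")
    case True
    then have "hd us = c ! ix 0" using n_pos by (simp add: us_eq hd_map hd_upt)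
    moreover have "x = v (ix 0)" using word_end_r v_ix_0 True by simp
    ultimately show ?thesis by (simp add: v_def)
  next
    case False
    then have "hd us = hd ls" "ls \<noteq> []" by (auto simp: us_eq ls_split)
    then show ?thesis using ls_ok(3) by simp
  qed
  then show ?thesis using us_ok ls_ok(2) by (simp add: is_string_iff)
qed

lemma middle_string: "is_string Q I (ov_middle c d)"
  using us_string by (simp add: middle_eq)

lemma us_vertex_first: "j \<le> r + M \<Longrightarrow> word_end Q (x, take j us) = word_end Q (x, take j ls)"
proof (cases j)
  case (Suc i)
  assume "j \<le> r + M"
  then show ?thesis using Suc word_end_take_Suc[of i us x] word_end_take_Suc[of i ls x] us_first[of i] length_us length_ls l_eq
    by (simp del: word_end.simps)
qed simp

lemma us_vertex_last: "r + n \<le> j \<Longrightarrow> j \<le> l + n \<Longrightarrow> word_end Q (x, take j us) = word_end Q (x, take (j - n) ls)"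
proof -
  assume j: "r + n \<le> j" "j \<le> l + n"
  obtain i where i: "j = Suc i" using j n_pos by (cases j) auto
  have 1: "word_end Q (x, take j us) = letter_end Q (us ! i)"
    using word_end_take_Suc[of i us x] i j length_us by (simp del: word_end.simps)
  show ?thesis
  proof (cases "j = r + n")
    case True
    then have "r + n - 1 = i" using i by simp
    then have "us ! i = Dir (ov_A d)" using us_A by simp
    then show ?thesis using 1 word_end_r True by (simp del: word_end.simps)
  next
    case False
    then have "us ! i = ls ! (i - n)" "i - n < length ls" "Suc (i - n) = j - n" using us_last[of i] i j length_ls by auto
    then show ?thesis using 1 word_end_take_Suc[of "i - n" ls x] by (simp del: word_end.simps)
  qed
qed

text \<open>
  The two natural maps \<open>M(w) \<rightarrow> M(u)\<close>. The word \<open>u\<close> begins with \<open>w\<^sub>R\<close>, \<open>C\<close> and a copy of \<open>m\<close>, and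
  ends with a copy of \<open>m\<close>, \<open>D\<close> and \<open>w\<^sub>L\<close>, which is \<open>n\<close> places further on than in \<open>w\<close>; \<open>P\<close>
  identifies the former and \<open>S\<close> the latter parts and they kill the rest.
\<close>
definition P :: "(nat \<Rightarrow> 'k) \<Rightarrow> nat \<Rightarrow> 'k" where "P z = (\<lambda>j. if j \<le> r + M then z j else 0)"
definition S :: "(nat \<Rightarrow> 'k) \<Rightarrow> nat \<Rightarrow> 'k" where "S z = (\<lambda>j. if r + n \<le> j then z (j - n) else 0)"

lemma P_hom: "P \<in> module_hom R (string_module Q (x, ls)) (string_module Q (x, us))"
proof (rule coord_homI[OF string_coord[OF word_string] string_coord[OF us_string]])
  show "\<forall>j\<ge>Suc (length us). P z j = 0" for z using length_us l_eq by (auto simp: P_def)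
  show "P (\<lambda>j. y j + z j) = (\<lambda>j. P y j + P z j)" "P (\<lambda>j. \<kappa> * z j) = (\<lambda>j. \<kappa> * P z j)" for y z \<kappa>
    by (auto simp: P_def fun_eq_iff)
  show "P (vtx v \<odot>\<^bsub>string_module Q (x, ls)\<^esub> z) = vtx v \<odot>\<^bsub>string_module Q (x, us)\<^esub> P z" if "v \<in> verts Q" for v z
    using us_vertex_first length_us length_ls l_eq unfolding string_vtx[OF word_string that] string_vtx[OF us_string that]
    by (auto simp: P_def fun_eq_iff simp del: word_end.simps)
  show "P (arr a \<odot>\<^bsub>string_module Q (x, ls)\<^esub> z) = arr a \<odot>\<^bsub>string_module Q (x, us)\<^esub> P z" if a: "a \<in> arcs Q" for a z
  proof (rule ext)
    fix j
    consider "j < r + M" | "j = r + M" | "j = Suc (r + M)" | "Suc (r + M) < j" by linarith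
    then show "P (arr a \<odot>\<^bsub>string_module Q (x, ls)\<^esub> z) j = (arr a \<odot>\<^bsub>string_module Q (x, us)\<^esub> P z) j"
      unfolding string_arr[OF word_string a] string_arr[OF us_string a] string_arrow_act P_def
    proof cases
      case 1
      then have "us ! (j - 1) = ls ! (j - 1)" "us ! j = ls ! j" "j - 1 \<le> r + M" using us_first by auto
      then show "(if j \<le> r + M then (if 0 < j \<and> j \<le> length ls \<and> ls ! (j - 1) = Dir a then z (j - 1) else 0) +
            (if j < length ls \<and> ls ! j = Inv a then z (Suc j) else 0) else 0) =
        (if 0 < j \<and> j \<le> length us \<and> us ! (j - 1) = Dir a then if j - 1 \<le> r + M then z (j - 1) else 0 else 0) +
        (if j < length us \<and> us ! j = Inv a then if Suc j \<le> r + M then z (Suc j) else 0 else 0)"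
        using 1 length_us length_ls l_eq by simp
    next
      case 2
      have "0 < j \<Longrightarrow> us ! (j - 1) = ls ! (j - 1)" using us_first 2 by auto
      moreover have "j < length ls \<Longrightarrow> ls ! j \<noteq> Inv a" using ls_left 2 length_ls by auto
      ultimately show "(if j \<le> r + M then (if 0 < j \<and> j \<le> length ls \<and> ls ! (j - 1) = Dir a then z (j - 1) else 0) +
            (if j < length ls \<and> ls ! j = Inv a then z (Suc j) else 0) else 0) =
        (if 0 < j \<and> j \<le> length us \<and> us ! (j - 1) = Dir a then if j - 1 \<le> r + M then z (j - 1) else 0 else 0) +
        (if j < length us \<and> us ! j = Inv a then if Suc j \<le> r + M then z (Suc j) else 0 else 0)"
        using 2 length_us length_ls l_eq by auto
    qed (use us_B in auto)
  qed
qed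

lemma S_hom: "S \<in> module_hom R (string_module Q (x, ls)) (string_module Q (x, us))"
proof (rule coord_homI[OF string_coord[OF word_string] string_coord[OF us_string]])
  show "\<forall>j\<ge>Suc (length us). S z j = 0" if "\<forall>j\<ge>Suc (length ls). z j = 0" for z
    using that length_us length_ls by (auto simp: S_def)
  show "S (\<lambda>j. y j + z j) = (\<lambda>j. S y j + S z j)" "S (\<lambda>j. \<kappa> * z j) = (\<lambda>j. \<kappa> * S z j)" for y z \<kappa>
    by (auto simp: S_def fun_eq_iff)
  show "S (vtx v \<odot>\<^bsub>string_module Q (x, ls)\<^esub> z) = vtx v \<odot>\<^bsub>string_module Q (x, us)\<^esub> S z" if "v \<in> verts Q" for v z
    using us_vertex_last length_us length_ls unfolding string_vtx[OF word_string that] string_vtx[OF us_string that]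
    by (auto simp: S_def fun_eq_iff simp del: word_end.simps)
  show "S (arr a \<odot>\<^bsub>string_module Q (x, ls)\<^esub> z) = arr a \<odot>\<^bsub>string_module Q (x, us)\<^esub> S z" if a: "a \<in> arcs Q" for a z
  proof (rule ext)
    fix j
    have u2: "r + n \<le> j \<Longrightarrow> j < l + n \<Longrightarrow> us ! j = ls ! (j - n)" using us_last .
    have u1: "r + n < j \<Longrightarrow> j \<le> l + n \<Longrightarrow> us ! (j - 1) = ls ! (j - n - 1)"
      using us_last[of "j - 1"] by (simp add: algebra_simps)
    have 0: "0 < r \<Longrightarrow> ls ! (r - 1) \<noteq> Dir a" using ls_right by auto
    have A: "us ! (r + n - 1) \<noteq> Inv a" using us_A by simp
    consider "j < r + n - 1" | "j = r + n - 1" | "j = r + n" | "r + n < j" by linarith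
    then show "S (arr a \<odot>\<^bsub>string_module Q (x, ls)\<^esub> z) j = (arr a \<odot>\<^bsub>string_module Q (x, us)\<^esub> S z) j"
      unfolding string_arr[OF word_string a] string_arr[OF us_string a] string_arrow_act S_def
    proof cases
      case 3
      then show "(if r + n \<le> j then (if 0 < j - n \<and> j - n \<le> length ls \<and> ls ! (j - n - 1) = Dir a then z (j - n - 1) else 0) +
           (if j - n < length ls \<and> ls ! (j - n) = Inv a then z (Suc (j - n)) else 0) else 0) =
        (if 0 < j \<and> j \<le> length us \<and> us ! (j - 1) = Dir a then if r + n \<le> j - 1 then z (j - 1 - n) else 0 else 0) +
        (if j < length us \<and> us ! j = Inv a then if r + n \<le> Suc j then z (Suc j - n) else 0 else 0)"
      proof -
        have e: "j - n = r" "Suc j - n = Suc r" "\<not> r + n \<le> j - 1" "r + n \<le> j" "r + n \<le> Suc j" "r < length ls \<longleftrightarrow> j < length us"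
          using 3 n_pos length_us length_ls by (simp, simp, linarith, simp, simp, simp)
        show ?thesis unfolding e(1,2) using e(3-) 0 u2 length_us by (cases "0 < r") (auto simp: e(1))
      qed
    next
      case 4
      have e: "Suc j - n = Suc (j - n)" "j - 1 - n = j - n - 1" "0 < j - n" "r + n \<le> j - 1" "j - n < length ls \<longleftrightarrow> j < length us"
        "j - n \<le> length ls \<longleftrightarrow> j \<le> length us"
        using 4 length_us length_ls by auto
      then show "(if r + n \<le> j then (if 0 < j - n \<and> j - n \<le> length ls \<and> ls ! (j - n - 1) = Dir a then z (j - n - 1) else 0) +
           (if j - n < length ls \<and> ls ! (j - n) = Inv a then z (Suc (j - n)) else 0) else 0) =
        (if 0 < j \<and> j \<le> length us \<and> us ! (j - 1) = Dir a then if r + n \<le> j - 1 then z (j - 1 - n) else 0 else 0) +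
        (if j < length us \<and> us ! j = Inv a then if r + n \<le> Suc j then z (Suc j - n) else 0 else 0)"
        using 4 u1 u2 length_us by auto
    qed (use A n_pos in auto)
  qed
qed

end

declare string_module.simps [simp del] word_end.simps [simp del]

context gentle_quiver
begin

lemma coord_hom_comb:
  assumes X: "coord_module N X" and X': "coord_module N' X'"
    and f: "f \<in> module_hom R X X'" and g: "g \<in> module_hom R X X'"
  shows "(\<lambda>z j. \<kappa> * f z j + \<mu> * g z j) \<in> module_hom R X X'"
proof -
  have "(\<lambda>j. \<kappa> * y j + \<mu> * z j) \<in> carrier X'" if "y \<in> carrier X'" "z \<in> carrier X'" for y z
    using that X' by (auto simp: coord_module_def)
  then show ?thesis
    using X' module_hom_carrier[OF f] module_hom_carrier[OF g] module_hom_add[OF f] module_hom_add[OF g]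
      module_hom_smult[OF f] module_hom_smult[OF g] coord_smult_comb[OF X']
    unfolding module_hom_def coord_module_def by (auto simp: algebra_simps)
qed

lemma string_arr_basis:
  assumes s: "is_string Q I (x, ls)" and k: "k < length ls"
  shows "ls ! k = Dir a \<Longrightarrow> arrow_act ls Suc (\<lambda>_. 1) a (basis_vec k) = (basis_vec (Suc k) :: nat \<Rightarrow> 'k)"
    and "ls ! k = Inv a \<Longrightarrow> arrow_act ls Suc (\<lambda>_. 1) a (basis_vec (Suc k)) = (basis_vec k :: nat \<Rightarrow> 'k)"
proof -
  have c: "compat (ls ! i) (ls ! Suc i)" if "Suc i < length ls" for i
    using s that by (simp add: is_string_iff word_ok_def)
  show "arrow_act ls Suc (\<lambda>_. 1) a (basis_vec k) = (basis_vec (Suc k) :: nat \<Rightarrow> 'k)" if D: "ls ! k = Dir a"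
  proof (rule ext)
    fix j
    have "\<not> (j < length ls \<and> ls ! j = Inv a \<and> Suc j = k)" using c[of j] D k by (auto simp: compat_def)
    then show "arrow_act ls Suc (\<lambda>_. 1) a (basis_vec k) j = (basis_vec (Suc k) j :: 'k)"
      using D k by (auto simp: string_arrow_act)
  qed
  show "arrow_act ls Suc (\<lambda>_. 1) a (basis_vec (Suc k)) = (basis_vec k :: nat \<Rightarrow> 'k)" if D: "ls ! k = Inv a"
  proof (rule ext)
    fix j
    have "\<not> (0 < j \<and> j \<le> length ls \<and> ls ! (j - 1) = Dir a \<and> j - 1 = Suc k)"
      using c[of k] D k by (auto simp: compat_def)
    then have "(if 0 < j \<and> j \<le> length ls \<and> ls ! (j - 1) = Dir a then basis_vec (Suc k) (j - 1) else 0) = (0 :: 'k)"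
      by auto
    moreover have "(if j < length ls \<and> ls ! j = Inv a then basis_vec (Suc k) (Suc j) else 0) = (basis_vec k j :: 'k)"
      using D k by (cases "j = k") simp_all
    ultimately show "arrow_act ls Suc (\<lambda>_. 1) a (basis_vec (Suc k)) j = (basis_vec k j :: 'k)"
      unfolding string_arrow_act by simp
  qed
qed

end

context band_overlap
begin

abbreviation "MW \<equiv> (string_module Q (x, ls) :: ((('v, 'a) path \<Rightarrow> 'k) set, nat \<Rightarrow> 'k) module)"
abbreviation "U \<equiv> (string_module Q (x, us) :: ((('v, 'a) path \<Rightarrow> 'k) set, nat \<Rightarrow> 'k) module)"
abbreviation "\<pi> \<equiv> (ov_proj c t lam d :: (nat \<Rightarrow> 'k) \<Rightarrow> nat \<Rightarrow> 'k)"

lemma MW_coord: "coord_module (Suc l) MW"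
  using string_coord[OF word_string] length_ls by simp

lemma U_coord: "coord_module (Suc (l + n)) U"
  using string_coord[OF us_string] length_us by simp

lemma carriers: "z \<in> carrier MW \<longleftrightarrow> (\<forall>j\<ge>Suc l. z j = 0)" "z \<in> carrier U \<longleftrightarrow> (\<forall>j\<ge>Suc (l + n). z j = 0)"
  using MW_coord U_coord by (auto simp: coord_module_def)

definition incl :: "(nat \<Rightarrow> 'k) \<Rightarrow> nat \<Rightarrow> 'k" where
  "incl z = (\<lambda>j. 1 * P z j + (- inverse lam) * S z j)"

text \<open>
  The isomorphism from \<open>M(w)\<close> to \<open>M(x, ls)\<close> that reverses the basis if \<open>ls\<close> is read off the
  inverse of \<open>w\<close>; the place \<open>j\<close> of \<open>ls\<close> is the place \<open>place j\<close> of \<open>w\<close>.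
\<close>
definition reorient :: "(nat \<Rightarrow> 'k) \<Rightarrow> nat \<Rightarrow> 'k" where
  "reorient z = (if ov_word d = w then z else (\<lambda>j. if j \<le> l then z (l - j) else 0))"

definition place :: "nat \<Rightarrow> nat" where "place j = (if ov_word d = w then j else l - j)"

lemma incl_hom: "incl \<in> module_hom R MW U"
  using coord_hom_comb[OF MW_coord U_coord P_hom S_hom, of 1 "- inverse lam"] by (simp add: incl_def[abs_def])

lemma incl_comb: "incl (\<lambda>j. \<kappa> * y j + \<mu> * z j) = (\<lambda>j. \<kappa> * incl y j + \<mu> * incl z j)"
  by (auto simp: incl_def P_def S_def algebra_simps)

lemma reorient_hom: "reorient \<in> module_hom R Y MW"
proof (cases "ov_word d = w")
  case True
  then show ?thesis by (auto simp: reorient_def[abs_def] module_hom_def ov_word_eq[symmetric])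
next
  case False
  then have "(x, ls) = word_inv Q w" using ow by (auto simp: ov_word_eq)
  then show ?thesis
    using string_reverse_hom[of "fst w" "snd w" x ls] w word_string False by (simp add: reorient_def[abs_def])
qed

lemma reorient_reorient: "\<forall>j\<ge>Suc l. z j = 0 \<Longrightarrow> reorient (reorient z) = z"
  by (auto simp: reorient_def fun_eq_iff)

lemma reorient_image: "reorient ` carrier Y = carrier MW"
proof (intro equalityI subsetI)
  fix z assume z: "z \<in> carrier MW"
  then have "reorient z \<in> carrier Y" by (auto simp: carriers Y_carrier reorient_def)
  moreover have "reorient (reorient z) = z" using z reorient_reorient by (auto simp: carriers)
  ultimately show "z \<in> reorient ` carrier Y" by (metis imageI)
qed (use module_hom_carrier[OF reorient_hom] in auto)

lemma reorient_inj: "inj_on reorient (carrier Y)"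
  by (rule inj_on_inverseI[of _ reorient]) (auto simp: Y_carrier reorient_reorient)

lemma reorient_basis: "k \<le> l \<Longrightarrow> j \<le> l \<Longrightarrow> reorient (basis_vec k) j = (if place j = k then 1 else 0)"
  by (auto simp: reorient_def place_def)

lemma place_le: "j \<le> l \<Longrightarrow> place j \<le> l" and place_place: "j \<le> l \<Longrightarrow> place (place j) = j"
  by (auto simp: place_def)

lemma reorient_basis_place: "k \<le> l \<Longrightarrow> reorient (basis_vec (place k)) = basis_vec k"
  by (auto simp: reorient_def place_def fun_eq_iff)

lemma ov_incl_eq: "ov_incl c lam w d = (\<lambda>z. incl (reorient z))"
  by (auto simp: ov_incl_def Let_def incl_def P_def S_def reorient_def fun_eq_iff)

lemma ix_eq_iff: "int j = (ov_pos d + int s) mod int n \<longleftrightarrow> j = ix s"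
  using n_pos by (auto simp: ix_def)

lemma \<pi>_eq: "\<pi> z = (\<lambda>j. \<Sum>s\<le>M + n. if j = ix s then lam ^ ex s * z (r + s) else 0)"
proof -
  have "{i. i < s \<and> (ov_pos d + int i) mod int n = int t} = {i. i < s \<and> ix i = t}" for s
    using ix_eq_iff[of t] by metis
  then show ?thesis by (simp add: ov_proj_def ex_def ix_eq_iff cong: if_cong)
qed

lemma \<pi>_comb: "\<pi> (\<lambda>j. \<kappa> * y j + \<mu> * z j) = (\<lambda>j. \<kappa> * \<pi> y j + \<mu> * \<pi> z j)"
  unfolding \<pi>_eq sum_distrib_left sum.distrib[symmetric]
  by (intro ext sum.cong) (auto simp: algebra_simps)

lemma us_vertex_y: "s \<le> M + n \<Longrightarrow> word_end Q (x, take (r + s) us) = v (ix s)"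
proof (cases s)
  case 0
  then show ?thesis using us_vertex_first[of r] word_end_r v_ix_0 by (simp del: word_end.simps)
next
  case (Suc i)
  assume "s \<le> M + n"
  then have "r + i < length us" "us ! (r + i) = c ! ix i" using Suc us_y[of i] length_us l_eq by auto
  then show ?thesis using Suc word_end_take_Suc[of "r + i" us x] v_succ[of "ix i"] by (simp add: ix_Suc del: word_end.simps)
qed

lemma lam_ex_Suc: "lam ^ ex (Suc s) = lam ^ ex s * wt (ix s)"
proof -
  have "{i. i < Suc s \<and> ix i = t} = (if ix s = t then insert s {i. i < s \<and> ix i = t} else {i. i < s \<and> ix i = t})"
    by (auto simp: less_Suc_eq)
  then show ?thesis by (simp add: ex_def wt_def)
qed

lemma ex_0 [simp]: "ex 0 = 0" by (simp add: ex_def)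

lemma ix_inj: "s < n \<Longrightarrow> s' < n \<Longrightarrow> ix s = ix s' \<Longrightarrow> s = s'"
proof -
  assume s: "s < n" "s' < n" "ix s = ix s'"
  have "(ov_pos d + int s) mod int n = (ov_pos d + int s') mod int n"
    using s(3) n_pos by (simp add: ix_def nat_eq_iff2 split: if_splits)
  then have "(ov_pos d + int s - ov_pos d) mod int n = (ov_pos d + int s' - ov_pos d) mod int n"
    by (metis mod_diff_left_eq)
  then show "s = s'" using s(1,2) by simp
qed

text \<open>
  The first vertex of the periodic word, counted from the start of \<open>m\<close>, that lies above \<open>i\<close>.
\<close>
definition si :: "nat \<Rightarrow> nat" where "si i = nat ((int i - ov_pos d) mod int n)"

lemma si_less [simp]: "si i < n"
  using n_pos by (simp add: si_def nat_less_iff)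

lemma ix_si: "i < n \<Longrightarrow> ix (si i) = i"
proof -
  assume i: "i < n"
  have "int (si i) = (int i - ov_pos d) mod int n" using n_pos by (simp add: si_def)
  then have "(ov_pos d + int (si i)) mod int n = (ov_pos d + (int i - ov_pos d)) mod int n"
    by (metis mod_add_right_eq)
  then show ?thesis using i by (simp add: ix_def)
qed

lemma si_ix: "s < n \<Longrightarrow> si (ix s) = s"
  using ix_inj[of "si (ix s)" s] ix_si[of "ix s"] by simp

lemma ex_n: "ex n = 1"
proof -
  have "{i. i < n \<and> ix i = t} = {si t}" using si_ix ix_si[OF t] by auto
  then show ?thesis by (simp add: ex_def)
qed

lemma lam_ex_add_n: "lam ^ ex (s + n) = lam ^ ex s * lam"
  by (induction s) (simp_all add: ex_n lam_ex_Suc)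

text \<open>
  An arrow contributes to a coordinate of \<open>M(u)\<close> through the letter before and the letter after
  it. Inside \<open>y\<close> these are the letters of the band. At the two ends \<open>C\<close> and \<open>D\<close> lead out of \<open>y\<close>,
  to basis vectors killed by the projection, and the letters \<open>A\<close> and \<open>B\<close> of the band lead into
  \<open>y\<close>, so that they do not act on the basis vectors at the ends.
\<close>
lemma \<pi>_hom: "\<pi> \<in> module_hom R U B"
proof (rule coord_homI[OF U_coord B_coord])
  show "\<forall>j\<ge>n. \<pi> z j = 0" for z
  proof (intro allI impI)
    fix j assume "n \<le> j"
    then have "j \<noteq> ix s" for s using ix_less[of s] by linarith
    then show "\<pi> z j = 0" by (simp add: \<pi>_eq)
  qed
  show "\<pi> (\<lambda>j. y j + z j) = (\<lambda>j. \<pi> y j + \<pi> z j)" for y z using \<pi>_comb[of 1 y 1 z] by simp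
  show "\<pi> (\<lambda>j. \<kappa> * z j) = (\<lambda>j. \<kappa> * \<pi> z j)" for \<kappa> z using \<pi>_comb[of \<kappa> z 0 z] by simp
  show "\<pi> (vtx u \<odot>\<^bsub>U\<^esub> z) = vtx u \<odot>\<^bsub>B\<^esub> \<pi> z" if u: "u \<in> verts Q" for u z
  proof (rule ext)
    fix j
    have "\<pi> (vtx u \<odot>\<^bsub>U\<^esub> z) j = (\<Sum>s\<le>M + n. if j = ix s then lam ^ ex s * (if v j = u then z (r + s) else 0) else 0)"
      unfolding \<pi>_eq string_vtx[OF us_string u]
      by (intro sum.cong) (use us_vertex_y length_us l_eq in \<open>auto simp del: word_end.simps\<close>)
    also have "\<dots> = (if j < n \<and> v j = u then \<pi> z j else 0)"
    proof (cases "j < n")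
      case True
      then show ?thesis by (cases "v j = u") (auto simp: \<pi>_eq intro!: sum.cong sum.neutral)
    next
      case False
      then have "j \<noteq> ix s" for s using ix_less[of s] by linarith
      then show ?thesis using False by simp
    qed
    finally show "\<pi> (vtx u \<odot>\<^bsub>U\<^esub> z) j = (vtx u \<odot>\<^bsub>B\<^esub> \<pi> z) j"
      by (simp add: B_diagram B.vtx_smult_D[OF u] vertex_act_def)
  qed
  show "\<pi> (arr a \<odot>\<^bsub>U\<^esub> z) = arr a \<odot>\<^bsub>B\<^esub> \<pi> z" if a: "a \<in> arcs Q" for a z
  proof (rule ext)
    fix j
    show "\<pi> (arr a \<odot>\<^bsub>U\<^esub> z) j = (arr a \<odot>\<^bsub>B\<^esub> \<pi> z) j"
    proof (cases "j < n")
      case False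
      then have "j \<noteq> ix s" for s using ix_less[of s] by linarith
      then show ?thesis using False B.arrow_act_carrier[of j] by (simp add: \<pi>_eq B_diagram B.arr_smult_D[OF a])
    next
      case j: True
      obtain K where K: "M + n = Suc K" using n_pos by (cases "M + n") auto
      define g where "g s = (if ix s = pred j \<and> c ! pred j = Dir a then lam ^ ex s * wt (pred j) * z (r + s) else 0)" for s
      define h where "h s = (if ix s = j \<and> c ! j = Inv a then lam ^ ex s * z (Suc (r + s)) else 0)" for s
      have t1: "(if j = ix s then lam ^ ex s * (if 0 < r + s \<and> r + s \<le> length us \<and> us ! (r + s - 1) = Dir a then z (r + s - 1) else 0) else 0)
         = (if s = 0 then 0 else g (s - 1))" if s: "s \<le> M + n" for s
      proof (cases s)
        case 0
        have "\<not> (0 < r \<and> us ! (r - 1) = Dir a)"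
        proof
          assume r: "0 < r \<and> us ! (r - 1) = Dir a"
          then have "r - 1 < r + M" by linarith
          then show False using ls_right us_first[of "r - 1"] r by auto
        qed
        then show ?thesis using 0 by auto
      next
        case (Suc i)
        then have e: "us ! (r + s - 1) = c ! ix i" "r + s \<le> length us" using us_y[of i] s length_us l_eq by auto
        have jj: "j = ix s \<longleftrightarrow> ix i = pred j" using succ_eq_iff[OF ix_less[of i] j] Suc by (auto simp: ix_Suc)
        show ?thesis using Suc e jj by (auto simp: g_def lam_ex_Suc)
      qed
      have t2: "(if j = ix s then lam ^ ex s * (if r + s < length us \<and> us ! (r + s) = Inv a then z (Suc (r + s)) else 0) else 0)
         = (if s = M + n then 0 else h s)" if s: "s \<le> M + n" for s
      proof (cases "s = M + n")
        case True
        have "r + s < length us \<Longrightarrow> us ! (r + s) \<noteq> Inv a"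
          using us_last[of "r + s"] ls_left True length_us by (auto simp: algebra_simps)
        then show ?thesis using True by auto
      next
        case False
        then have "us ! (r + s) = c ! ix s" "r + s < length us" using us_y[of s] s length_us l_eq by auto
        then show ?thesis using False by (auto simp: h_def)
      qed
      have "\<pi> (arr a \<odot>\<^bsub>U\<^esub> z) j = (\<Sum>s\<le>M + n. (if s = 0 then 0 else g (s - 1)) + (if s = M + n then 0 else h s))"
        unfolding \<pi>_eq string_arr[OF us_string a] string_arrow_act
        by (intro sum.cong refl) (use t1 t2 in \<open>simp add: distrib_left flip: t1 t2\<close>)
      also have "\<dots> = (\<Sum>s\<le>K. g s) + (\<Sum>s\<le>K. h s)"
        unfolding K sum.distrib by (subst sum.atMost_Suc_shift) (auto intro!: sum.cong)
      finally have L: "\<pi> (arr a \<odot>\<^bsub>U\<^esub> z) j = (\<Sum>s\<le>K. g s) + (\<Sum>s\<le>K. h s)" .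
      have g0: "g (Suc K) = 0"
      proof -
        have "ix (Suc K) = ix M" using K ix_add_n[of M] by simp
        then show ?thesis using c_B by (auto simp: g_def)
      qed
      have "(if c ! pred j = Dir a then wt (pred j) * \<pi> z (pred j) else 0) = (\<Sum>s\<le>Suc K. g s)"
      proof (cases "c ! pred j = Dir a")
        case True
        have "wt (pred j) * \<pi> z (pred j) = (\<Sum>s\<le>Suc K. g s)"
          unfolding \<pi>_eq K g_def sum_distrib_left by (intro sum.cong) (use True in auto)
        then show ?thesis using True by simp
      qed (simp add: g_def)
      then have G: "(if c ! pred j = Dir a then wt (pred j) * \<pi> z (pred j) else 0) = (\<Sum>s\<le>K. g s)" using g0 by simp
      have "(if c ! j = Inv a then \<pi> z (succ j) else 0) = (\<Sum>s\<le>Suc K. if s = 0 then 0 else h (s - 1))"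
      proof (cases "c ! j = Inv a")
        case True
        have "(if succ j = ix s then lam ^ ex s * z (r + s) else 0) = (if s = 0 then 0 else h (s - 1))" for s
        proof (cases s)
          case 0
          have "succ j \<noteq> ix 0" using True c_A pred_succ[OF j] by auto
          then show ?thesis using 0 by simp
        next
          case (Suc i)
          have "succ j = ix s \<longleftrightarrow> ix i = j" using Suc pred_succ[OF j] pred_succ[OF ix_less[of i]] by (auto simp: ix_Suc)
          moreover have "ix i = j \<Longrightarrow> wt (ix i) = 1" using True ct by (auto simp: wt_def)
          ultimately show ?thesis using Suc True by (auto simp: h_def lam_ex_Suc)
        qed
        then show ?thesis using True by (simp add: \<pi>_eq K)
      qed (auto simp: h_def intro!: sum.neutral)
      also have "\<dots> = (\<Sum>s\<le>K. h s)" by (subst sum.atMost_Suc_shift) simp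
      finally have H: "(if c ! j = Inv a then \<pi> z (succ j) else 0) = (\<Sum>s\<le>K. h s)" .
      show ?thesis unfolding L B_diagram B.arr_smult_D[OF a] band_arrow_act[OF j] G H ..
    qed
  qed
qed

lemma \<pi>_P: "\<pi> (P z) = (\<lambda>j. \<Sum>s\<le>M. if j = ix s then lam ^ ex s * z (r + s) else 0)"
proof (rule ext)
  fix j
  have "\<pi> (P z) j = (\<Sum>s\<in>{..M + n}. if s \<le> M then (if j = ix s then lam ^ ex s * z (r + s) else 0) else 0)"
    unfolding \<pi>_eq by (intro sum.cong) (auto simp: P_def)
  also have "\<dots> = (\<Sum>s\<le>M. if j = ix s then lam ^ ex s * z (r + s) else 0)"
    by (rule sum.mono_neutral_cong_right) auto
  finally show "\<pi> (P z) j = \<dots>" .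
qed

text \<open>
  The copy of \<open>m\<close> at the end of \<open>y\<close> is one period after the first one, hence the factor \<open>\<lambda>\<close>. This
  is why \<open>P - \<lambda>\<^sup>-\<^sup>1 S\<close> is annihilated by the projection.
\<close>
lemma \<pi>_S: "\<pi> (S z) = (\<lambda>j. lam * \<pi> (P z) j)"
proof (rule ext)
  fix j
  have "\<pi> (S z) j = (\<Sum>s\<in>{n..M + n}. if j = ix s then lam ^ ex s * z (r + s - n) else 0)"
    unfolding \<pi>_eq by (rule sum.mono_neutral_cong_right) (auto simp: S_def)
  also have "\<dots> = (\<Sum>s\<le>M. if j = ix s then lam ^ ex (s + n) * z (r + s) else 0)"
  proof (rule sum.reindex_bij_witness[of _ "\<lambda>s. s + n" "\<lambda>s. s - n"])
    fix s assume "s \<in> {n..M + n}"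
    then have "s - n + n = s" "ix (s - n) = ix s" "r + (s - n) = r + s - n"
      using ix_add_n[of "s - n"] by auto
    then show "(if j = ix (s - n) then lam ^ ex (s - n + n) * z (r + (s - n)) else 0) =
        (if j = ix s then lam ^ ex s * z (r + s - n) else 0)" by metis
  qed auto
  also have "\<dots> = lam * \<pi> (P z) j"
    unfolding \<pi>_P sum_distrib_left by (intro sum.cong) (auto simp: lam_ex_add_n)
  finally show "\<pi> (S z) j = lam * \<pi> (P z) j" .
qed

lemma \<pi>_incl: "\<pi> (incl z) = (\<lambda>_. 0)"
  unfolding incl_def \<pi>_comb \<pi>_S using lam by (simp add: fun_eq_iff)

lemma incl_basis_small: "k < r \<Longrightarrow> incl (basis_vec k) = basis_vec k"
  by (auto simp: incl_def P_def S_def fun_eq_iff)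

text \<open>
  Modulo the image of \<open>incl\<close> a vector of \<open>M(u)\<close> can be moved into the \<open>n\<close> places from \<open>r\<close> on.
  Beyond them a basis vector is removed, from the top down, by a multiple of the image of the
  basis vector \<open>n\<close> places before; and the places before \<open>r\<close> are fixed by \<open>incl\<close>.
\<close>
lemma reduce_support:
  assumes "K \<le> Suc (l + n)" "\<forall>j\<ge>K. u j = 0"
  shows "\<exists>z\<in>carrier MW. \<forall>j. j < r \<or> r + n \<le> j \<longrightarrow> u j = incl z j"
  using assms
proof (induction K arbitrary: u)
  case 0
  then show ?case by (intro bexI[of _ "\<lambda>_. 0"]) (auto simp: incl_def P_def S_def carriers)
next
  case (Suc K)
  have rl: "r \<le> l" using l_eq by simp
  have "(r \<le> K \<and> K < r + n) \<or> K < r \<or> r + n \<le> K" by linarith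
  have upd: "\<forall>j\<ge>K. (u(K := 0)) j = 0" using Suc.prems(2) by (metis fun_upd_apply le_neq_implies_less Suc_leI)
  from \<open>(r \<le> K \<and> K < r + n) \<or> K < r \<or> r + n \<le> K\<close> consider "r \<le> K" "K < r + n" | "K < r" | "r + n \<le> K" by blast
  then show ?case
  proof cases
    case 1
    obtain z where z: "z \<in> carrier MW" "\<forall>j. j < r \<or> r + n \<le> j \<longrightarrow> (u(K := 0)) j = incl z j"
      using Suc.IH[OF _ upd] Suc.prems(1) by auto
    then show ?thesis using 1 by (intro bexI[OF _ z(1)]) (auto simp: fun_upd_def split: if_splits)
  next
    case 2
    obtain z where z: "z \<in> carrier MW" "\<forall>j. j < r \<or> r + n \<le> j \<longrightarrow> (u(K := 0)) j = incl z j"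
      using Suc.IH[OF _ upd] Suc.prems(1) by auto
    define z' where "z' = (\<lambda>j. 1 * z j + u K * basis_vec K j)"
    have "incl z' = (\<lambda>j. 1 * incl z j + u K * basis_vec K j)"
      unfolding z'_def incl_comb incl_basis_small[OF 2] ..
    moreover have "z' \<in> carrier MW" unfolding z'_def using z(1) 2 rl by (auto simp: carriers)
    moreover have "\<forall>j. j < r \<or> r + n \<le> j \<longrightarrow> u j = 1 * incl z j + u K * basis_vec K j"
    proof (intro allI impI)
      fix j assume j: "j < r \<or> r + n \<le> j"
      then have "(u(K := 0)) j = incl z j" using z(2) by blast
      then show "u j = 1 * incl z j + u K * basis_vec K j" by (auto split: if_splits)
    qed
    ultimately show ?thesis by (intro bexI[of _ z']) simp_all
  next
    case 3
    define b where "b = K - n"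
    have b: "r \<le> b" "b + n = K" "b \<le> l" "b < K" using 3 Suc.prems(1) n_pos unfolding b_def by linarith+
    have ib: "incl (basis_vec b) j = (if j = b \<and> j \<le> r + M then 1 else 0) - (if j = K then inverse lam else 0)" for j
    proof -
      have "r + n \<le> j \<and> j - n = b \<longleftrightarrow> j = K" using b(1,2) by arith
      then show ?thesis by (auto simp: incl_def P_def S_def)
    qed
    define u' where "u' = (\<lambda>j. 1 * u j + lam * u K * incl (basis_vec b) j)"
    have "\<forall>j\<ge>K. u' j = 0"
      using Suc.prems(2) b lam by (auto simp: u'_def ib le_Suc_eq)
    then obtain z where z: "z \<in> carrier MW" "\<forall>j. j < r \<or> r + n \<le> j \<longrightarrow> u' j = incl z j"
      using Suc.IH[of u'] Suc.prems by auto
    define z' where "z' = (\<lambda>j. 1 * z j + (- lam * u K) * basis_vec b j)"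
    have "incl z' = (\<lambda>j. 1 * incl z j + (- lam * u K) * incl (basis_vec b) j)"
      unfolding z'_def incl_comb ..
    moreover have "z' \<in> carrier MW" unfolding z'_def using z(1) b(3) by (auto simp: carriers)
    moreover have "\<forall>j. j < r \<or> r + n \<le> j \<longrightarrow> u j = 1 * incl z j + (- lam * u K) * incl (basis_vec b) j"
    proof (intro allI impI)
      fix j assume j: "j < r \<or> r + n \<le> j"
      then have "u' j = incl z j" using z(2) by blast
      then show "u j = 1 * incl z j + (- lam * u K) * incl (basis_vec b) j" by (simp add: u'_def algebra_simps flip: \<open>u' j = incl z j\<close>)
    qed
    ultimately show ?thesis by (intro bexI[of _ z']) simp_all
  qed
qed

text \<open>
  The places \<open>r, \<dots>, r + n - 1\<close> form a fundamental period of \<open>y\<close>, so they are mapped bijectively to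
  the basis of the band module.
\<close>
lemma \<pi>_fundamental:
  assumes "\<forall>j. j < r \<or> r + n \<le> j \<longrightarrow> u j = 0" "s < n"
  shows "\<pi> u (ix s) = lam ^ ex s * u (r + s)"
proof -
  have "\<pi> u (ix s) = (\<Sum>s'\<le>M + n. if s' = s then lam ^ ex s * u (r + s) else 0)"
    unfolding \<pi>_eq
  proof (intro sum.cong refl)
    fix s'
    show "(if ix s = ix s' then lam ^ ex s' * u (r + s') else 0) = (if s' = s then lam ^ ex s * u (r + s) else 0)"
      using assms ix_inj[of s' s] by (cases "s' < n") auto
  qed
  then show ?thesis using assms(2) by simp
qed

lemma kernel_\<pi>:
  assumes "u \<in> carrier U" "\<pi> u = (\<lambda>_. 0)"
  shows "u \<in> incl ` carrier MW"
proof -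
  obtain z where z: "z \<in> carrier MW" "\<forall>j. j < r \<or> r + n \<le> j \<longrightarrow> u j = incl z j"
    using reduce_support[of "Suc (l + n)" u] assms(1) by (auto simp: carriers)
  define \<delta> where "\<delta> = (\<lambda>j. 1 * u j + (-1) * incl z j)"
  have s: "\<forall>j. j < r \<or> r + n \<le> j \<longrightarrow> \<delta> j = 0" using z(2) by (simp add: \<delta>_def)
  have "\<pi> \<delta> = (\<lambda>_. 0)" unfolding \<delta>_def \<pi>_comb using assms(2) \<pi>_incl by simp
  then have f: "\<delta> (r + s) = 0" if "s < n" for s using \<pi>_fundamental[OF s that] lam by simp
  have "\<delta> j = 0" for j
  proof (cases "j < r \<or> r + n \<le> j")
    case False
    then have "r + (j - r) = j" "j - r < n" by auto
    then show ?thesis using f[of "j - r"] by simp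
  qed (use s in blast)
  then have "u = incl z" by (auto simp: \<delta>_def fun_eq_iff)
  then show ?thesis using z(1) by blast
qed

lemma incl_inj: "inj_on incl (carrier MW)"
proof (rule inj_onI)
  fix y z assume yz: "y \<in> carrier MW" "z \<in> carrier MW" "incl y = incl z"
  define \<delta> where "\<delta> = (\<lambda>j. 1 * y j + (-1) * z j)"
  have i: "incl \<delta> = (\<lambda>_. 0)" unfolding \<delta>_def incl_comb using yz(3) by simp
  have "\<delta> j = 0" for j
  proof (induction j rule: less_induct)
    case (less j)
    show ?case
    proof (cases "j \<le> r + M")
      case True
      have "\<delta> (j - n) = 0" if "r + n \<le> j"
      proof -
        have "j - n < j" using that n_pos by linarith
        then show ?thesis by (rule less)
      qed
      then show ?thesis using fun_cong[OF i, of j] True by (auto simp: incl_def P_def S_def split: if_splits)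
    next
      case False
      then show ?thesis using fun_cong[OF i, of "j + n"] lam by (auto simp: incl_def P_def S_def)
    qed
  qed
  then show "y = z" by (auto simp: \<delta>_def fun_eq_iff)
qed

lemma \<pi>_surj: "\<pi> ` carrier U = carrier B"
proof (intro equalityI subsetI)
  fix b assume b: "b \<in> carrier B"
  define u where "u j = (if r \<le> j \<and> j < r + n then inverse (lam ^ ex (j - r)) * b (ix (j - r)) else 0)" for j
  have "r + n \<le> l + n" using l_eq by simp
  then have "u \<in> carrier U" by (auto simp: u_def carriers)
  moreover have "\<pi> u = b"
  proof (rule ext)
    fix j
    show "\<pi> u j = b j"
    proof (cases "j < n")
      case True
      have "\<pi> u (ix (si j)) = lam ^ ex (si j) * u (r + si j)" by (rule \<pi>_fundamental) (auto simp: u_def)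
      then show ?thesis using True lam by (simp add: ix_si u_def)
    next
      case False
      then show ?thesis using b module_hom_carrier[OF \<pi>_hom \<open>u \<in> carrier U\<close>] by (auto simp: B_carrier)
    qed
  qed
  ultimately show "b \<in> \<pi> ` carrier U" by blast
qed (use module_hom_carrier[OF \<pi>_hom] in auto)

lemma ov_ext_eq: "ov_ext Q c t lam w d = (U, \<lambda>z. incl (reorient z), \<pi>)"
  by (simp add: ov_ext_def middle_eq ov_incl_eq)

theorem overlap_is_extension: "is_extension R B Y (U, \<lambda>z. incl (reorient z), \<pi>)"
  unfolding is_extension.simps
proof (intro conjI)
  show "left_module R B" "left_module R Y" using B_left_module Y_left_module .
  show "left_module R U" using U_coord by (simp add: coord_module_def)
  show "(\<lambda>z. incl (reorient z)) \<in> module_hom R Y U" by (rule module_hom_comp[OF reorient_hom incl_hom])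
  show "\<pi> \<in> module_hom R U B" by (rule \<pi>_hom)
  show "\<pi> ` carrier U = carrier B" by (rule \<pi>_surj)
  show "inj_on (\<lambda>z. incl (reorient z)) (carrier Y)"
    using comp_inj_on[OF reorient_inj, of incl] incl_inj by (simp add: reorient_image o_def)
  have "(\<lambda>z. incl (reorient z)) ` carrier Y = incl ` carrier MW" by (simp add: image_image flip: reorient_image)
  also have "\<dots> = {u \<in> carrier U. \<pi> u = \<zero>\<^bsub>B\<^esub>}"
    using kernel_\<pi> \<pi>_incl module_hom_carrier[OF incl_hom] by (auto simp: B_zero)
  finally show "(\<lambda>z. incl (reorient z)) ` carrier Y = {u \<in> carrier U. \<pi> u = \<zero>\<^bsub>B\<^esub>}" .
qed

text \<open>
  The errors of the overlap extension: only the letter \<open>A\<close>, which closes the fundamental period,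
  acts differently than in the band module. The error is a multiple of the basis vector of \<open>w\<close> at
  which \<open>m\<close> starts.
\<close>
definition overlap_coords :: "nat \<Rightarrow> nat \<Rightarrow> 'k" where
  "overlap_coords i = (\<lambda>j. if i = pred (ix 0) then - wt i * basis_vec (place r) j else 0)"

text \<open>
  The basis vectors of the band module are lifted to multiples of the \<open>n\<close> basis vectors of the
  fundamental period. The letter \<open>A\<close> leads from its last vertex to the first vertex of the next
  period, and that basis vector is \<open>\<lambda>\<close> times the first one of the period, up to the image of
  \<open>M(w)\<close>.
\<close>
lemma overlap_lift: "lift Y (U, \<lambda>z. incl (reorient z), \<pi>) (\<lambda>i j. inverse (lam ^ ex (si i)) * basis_vec (r + si i) j) overlap_coords"
  (is "lift Y _ ?e _")
  unfolding lift.simps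
proof (intro conjI allI impI overlap_is_extension)
  have rl: "r \<le> l" using l_eq by simp
  have Uadd: "p \<oplus>\<^bsub>U\<^esub> q = (\<lambda>j. p j + q j)" and Usc: "p \<in> carrier U \<Longrightarrow> sc \<nu> \<odot>\<^bsub>U\<^esub> p = (\<lambda>j. \<nu> * p j)" for p q \<nu>
    using U_coord by (auto simp: coord_module_def)
  have ec: "?e i \<in> carrier U" for i
  proof -
    have "r + si i \<le> l + n" using rl si_less[of i] by linarith
    then show ?thesis by (auto simp: carriers)
  qed
  have f0: "incl (reorient (\<lambda>_. 0)) = (\<lambda>_. 0)" by (auto simp: incl_def P_def S_def reorient_def)
  show "section_of n (U, \<lambda>z. incl (reorient z), \<pi>) ?e"
    unfolding section_of_def prod.case
  proof (intro allI impI conjI ec ext)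
    fix i j assume i: "i < n"
    have "\<not> n \<le> si i" using si_less[of i] by linarith
    then have supp: "\<forall>j. j < r \<or> r + n \<le> j \<longrightarrow> ?e i j = 0" by auto
    show "\<pi> (?e i) j = basis_vec i j"
    proof (cases "j < n")
      case True
      have "\<pi> (?e i) (ix (si j)) = lam ^ ex (si j) * ?e i (r + si j)" by (rule \<pi>_fundamental[OF supp]) simp
      moreover have "si j = si i \<longleftrightarrow> j = i" using ix_si[OF i] ix_si[OF True] by metis
      ultimately show ?thesis using True lam by (auto simp: ix_si)
    next
      case False
      then show ?thesis using i module_hom_carrier[OF \<pi>_hom ec[of i]] by (auto simp: B_carrier)
    qed
  qed
  fix i assume i: "i < n"
  show "overlap_coords i \<in> carrier Y" using place_le[OF rl] by (auto simp: overlap_coords_def Y_carrier)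
  let ?s = "si i"
  have s: "ix ?s = i" "?s < n" "r + ?s < length us" using ix_si[OF i] si_less[of i] length_us rl by (auto intro: add_le_less_mono)
  have us: "us ! (r + ?s) = c ! i" using us_y[of ?s] s(1) si_less[of i] by simp
  show "vtx (v i) \<odot>\<^bsub>U\<^esub> ?e i = ?e i"
    unfolding string_vtx[OF us_string v_verts[OF i]] using us_vertex_y[of ?s] s length_us
    by (auto simp: fun_eq_iff simp del: word_end.simps)
  have si_succ: "si (succ i) = (if Suc ?s < n then Suc ?s else 0)"
  proof (cases "Suc ?s < n")
    case True
    then show ?thesis using si_ix[OF True] s(1) by (simp add: ix_Suc)
  next
    case False
    then have "Suc ?s = n" using si_less[of i] by linarith
    then have "succ i = ix 0" using ix_Suc[of ?s] ix_add_n[of 0] s(1) by simp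
    then show ?thesis using False si_ix[of 0] n_pos by simp
  qed
  have last: "i = pred (ix 0) \<longleftrightarrow> \<not> Suc ?s < n"
  proof -
    have "si (pred (ix 0)) = n - 1" using si_ix[of "n - 1"] ix_n_pred n_pos by simp
    moreover have "i = pred (ix 0) \<longleftrightarrow> si i = si (pred (ix 0))" by (metis ix_si[OF i] ix_si[OF pred_less])
    ultimately show ?thesis using si_less[of i] by linarith
  qed
  have pow: "lam ^ ex (Suc ?s) = lam ^ ex ?s * wt i" using lam_ex_Suc[of ?s] s(1) by simp
  fix a
  show "arr a \<odot>\<^bsub>U\<^esub> ?e i = sc (wt i) \<odot>\<^bsub>U\<^esub> ?e (succ i) \<oplus>\<^bsub>U\<^esub> incl (reorient (overlap_coords i))" if a: "c ! i = Dir a"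
  proof -
    have aq: "a \<in> arcs Q" using c_arcs'(1)[OF i a] .
    have L: "arr a \<odot>\<^bsub>U\<^esub> ?e i = (\<lambda>j. inverse (lam ^ ex ?s) * basis_vec (Suc (r + ?s)) j)"
      unfolding string_arr[OF us_string aq] arrow_act_smult
      using string_arr_basis(1)[OF us_string s(3), of a] us a by simp
    show ?thesis
    proof (cases "Suc ?s < n")
      case True
      then have "overlap_coords i = (\<lambda>_. 0)" using last by (auto simp: overlap_coords_def)
      then have "incl (reorient (overlap_coords i)) = (\<lambda>_. 0)" using f0 by simp
      then show ?thesis unfolding L Uadd Usc[OF ec] using True pow lam
        by (auto simp: si_succ fun_eq_iff field_simps)
    next
      case False
      then have sn: "Suc ?s = n" using si_less[of i] by linarith
      have "overlap_coords i = (\<lambda>j. - wt i * basis_vec (place r) j)" using last False by (simp add: overlap_coords_def)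
      moreover have "reorient (\<lambda>j. - wt i * basis_vec (place r) j) = (\<lambda>j. - wt i * reorient (basis_vec (place r)) j)"
        by (auto simp: reorient_def)
      ultimately have "reorient (overlap_coords i) = (\<lambda>j. - wt i * basis_vec r j + 0 * basis_vec r j)" using reorient_basis_place[OF rl] by simp
      then have f: "incl (reorient (overlap_coords i)) = (\<lambda>j. - wt i * incl (basis_vec r) j)" by (simp only: incl_comb) simp
      have ib: "incl (basis_vec r) j = basis_vec r j - inverse lam * basis_vec (r + n) j" for j
        using n_pos by (auto simp: incl_def P_def S_def)
      have "lam ^ ex ?s * wt i = lam" using pow sn ex_n by simp
      then have "inverse (lam ^ ex ?s) = wt i * inverse lam" using lam by (simp add: field_simps)
      moreover have "Suc (r + ?s) = r + n" using sn by simp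
      ultimately show ?thesis unfolding L Uadd Usc[OF ec] f ib using False
        by (auto simp: si_succ fun_eq_iff algebra_simps)
    qed
  qed
  show "arr a \<odot>\<^bsub>U\<^esub> ?e (succ i) = ?e i \<oplus>\<^bsub>U\<^esub> incl (reorient (overlap_coords i))" if a: "c ! i = Inv a"
  proof -
    have aq: "a \<in> arcs Q" using c_arcs'(2)[OF i a] .
    have ne: "i \<noteq> pred (ix 0)" using a c_A by auto
    then have True: "Suc ?s < n" using last by blast
    have w1: "wt i = 1" using a ct by (auto simp: wt_def)
    have "arr a \<odot>\<^bsub>U\<^esub> ?e (succ i) = (\<lambda>j. inverse (lam ^ ex (Suc ?s)) * arrow_act us Suc (\<lambda>_. 1) a (basis_vec (Suc (r + ?s))) j)"
      unfolding string_arr[OF us_string aq] arrow_act_smult using True by (simp add: si_succ)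
    also have "\<dots> = (\<lambda>j. inverse (lam ^ ex (Suc ?s)) * basis_vec (r + ?s) j)"
      using string_arr_basis(2)[OF us_string s(3), of a] us a by simp
    finally show ?thesis using ne pow w1 by (simp add: Uadd overlap_coords_def f0)
  qed
qed

text \<open>
  The homomorphism \<open>M(w) \<rightarrow> M(m) \<rightarrow> B\<close>. The first map exists since \<open>C\<close> and \<open>D\<close> point out of \<open>m\<close>, the
  second one since \<open>A\<close> and \<open>B\<close> point into \<open>m\<close>. It is written as a composite through \<open>M(u)\<close>, whose
  factors are known to be homomorphisms.
\<close>
definition graph_map :: "(nat \<Rightarrow> 'k) \<Rightarrow> nat \<Rightarrow> 'k" where "graph_map z = \<pi> (P (reorient z))"

lemma graph_map_hom: "graph_map \<in> module_hom R Y B"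
  unfolding graph_map_def[abs_def] by (rule module_hom_comp[OF module_hom_comp[OF reorient_hom P_hom] \<pi>_hom])

lemma graph_map_comb: "graph_map (\<lambda>j. \<kappa> * y j + \<mu> * z j) = (\<lambda>j. \<kappa> * graph_map y j + \<mu> * graph_map z j)"
proof -
  have "P (reorient (\<lambda>j. \<kappa> * y j + \<mu> * z j)) = (\<lambda>j. \<kappa> * P (reorient y) j + \<mu> * P (reorient z) j)"
    by (auto simp: P_def reorient_def fun_eq_iff)
  then show ?thesis by (simp add: graph_map_def \<pi>_comb)
qed

lemma graph_map_basis: "k \<le> l \<Longrightarrow> graph_map (basis_vec k) = (\<lambda>j. \<Sum>s\<le>M. if j = ix s \<and> place (r + s) = k then lam ^ ex s else 0)"
  unfolding graph_map_def \<pi>_P by (intro ext sum.cong refl) (use l_eq in \<open>auto simp: reorient_basis\<close>)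

text \<open>
  The push-forward along \<open>graph_map\<close> turns an extension of \<open>B\<close> by \<open>M(w)\<close> into a self-extension of
  \<open>B\<close>. The weighted sum of its errors around the cycle does not depend on the lifts: a change of
  the lifts contributes a telescoping sum.
\<close>
definition pairing :: "(nat \<Rightarrow> nat \<Rightarrow> 'k) \<Rightarrow> 'k" where
  "pairing \<eta> = (\<Sum>i<n. case c ! i of Dir _ \<Rightarrow> inverse (wt i) * graph_map (\<eta> i) (succ i) | Inv _ \<Rightarrow> - graph_map (\<eta> i) i)"

lemma pairing_comb: "pairing (\<lambda>i j. \<kappa> * \<eta> i j + \<mu> * \<eta>' i j) = \<kappa> * pairing \<eta> + \<mu> * pairing \<eta>'"
  unfolding pairing_def sum_distrib_left sum.distrib[symmetric] graph_map_comb
  by (intro sum.cong refl) (auto split: letter.splits simp: algebra_simps)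

lemma pairing_boundary: "boundary \<eta> \<Longrightarrow> pairing \<eta> = 0"
proof -
  assume "boundary \<eta>"
  then obtain y where y: "\<And>i. i < n \<Longrightarrow> y i \<in> carrier Y"
     "\<And>i a. i < n \<Longrightarrow> c ! i = Dir a \<Longrightarrow> \<eta> i = (\<lambda>j. (arr a \<odot>\<^bsub>Y\<^esub> y i) j - wt i * y (succ i) j)"
     "\<And>i a. i < n \<Longrightarrow> c ! i = Inv a \<Longrightarrow> \<eta> i = (\<lambda>j. (arr a \<odot>\<^bsub>Y\<^esub> y (succ i)) j - y i j)"
    unfolding boundary_def by blast
  have "(case c ! i of Dir _ \<Rightarrow> inverse (wt i) * graph_map (\<eta> i) (succ i) | Inv _ \<Rightarrow> - graph_map (\<eta> i) i) =
      graph_map (y i) i - graph_map (y (succ i)) (succ i)" if i: "i < n" for i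
  proof (cases "c ! i")
    case (Dir a)
    have aq: "a \<in> arcs Q" using c_arcs'(1)[OF i Dir] .
    have ni: "c ! succ i \<noteq> Inv a" using compat_c[OF i] Dir by (auto simp: compat_def)
    have "graph_map (\<eta> i) = (\<lambda>j. 1 * graph_map (arr a \<odot>\<^bsub>Y\<^esub> y i) j + (- wt i) * graph_map (y (succ i)) j)"
      unfolding graph_map_comb[symmetric] using y(2)[OF i Dir] by simp
    moreover have "graph_map (arr a \<odot>\<^bsub>Y\<^esub> y i) = arr a \<odot>\<^bsub>B\<^esub> graph_map (y i)"
      by (rule module_hom_smult[OF graph_map_hom arr_closed[OF aq] y(1)[OF i]])
    moreover have "(arr a \<odot>\<^bsub>B\<^esub> graph_map (y i)) (succ i) = wt i * graph_map (y i) i"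
      using ni Dir i by (simp add: B_diagram B.arr_smult_D[OF aq] band_arrow_act)
    ultimately show ?thesis using Dir by (simp add: field_simps)
  next
    case (Inv a)
    have aq: "a \<in> arcs Q" using c_arcs'(2)[OF i Inv] .
    have ni: "c ! pred i \<noteq> Dir a" using compat_c[of "pred i"] Inv i by (auto simp: compat_def)
    have "graph_map (\<eta> i) = (\<lambda>j. 1 * graph_map (arr a \<odot>\<^bsub>Y\<^esub> y (succ i)) j + (- 1) * graph_map (y i) j)"
      unfolding graph_map_comb[symmetric] using y(3)[OF i Inv] by simp
    moreover have "graph_map (arr a \<odot>\<^bsub>Y\<^esub> y (succ i)) = arr a \<odot>\<^bsub>B\<^esub> graph_map (y (succ i))"
      by (rule module_hom_smult[OF graph_map_hom arr_closed[OF aq] y(1)[OF succ_less]])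
    moreover have "(arr a \<odot>\<^bsub>B\<^esub> graph_map (y (succ i))) i = graph_map (y (succ i)) (succ i)"
      using ni Inv i by (simp add: B_diagram B.arr_smult_D[OF aq] band_arrow_act)
    ultimately show ?thesis using Inv by simp
  qed
  then have "pairing \<eta> = (\<Sum>i<n. graph_map (y i) i - graph_map (y (succ i)) (succ i))"
    unfolding pairing_def by (intro sum.cong) auto
  also have "\<dots> = (\<Sum>i<n. graph_map (y i) i) - (\<Sum>i<n. graph_map (y (succ i)) (succ i))" by (rule sum_subtractf)
  also have "(\<Sum>i<n. graph_map (y (succ i)) (succ i)) = (\<Sum>i<n. graph_map (y i) i)"
    by (rule sum.reindex_bij_witness[of _ pred succ]) auto
  finally show ?thesis by simp
qed

lemma pairing_single:
  assumes "i < n" "c ! i = Dir a" "k \<le> l"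
  shows "pairing (\<lambda>i' j. if i' = i then - wt i' * basis_vec k j else 0) = - graph_map (basis_vec k) (succ i)"
proof -
  have "graph_map (\<lambda>_. 0) = (\<lambda>_. 0)" using graph_map_comb[of 0 "\<lambda>_. 0" 0 "\<lambda>_. 0"] by simp
  moreover have "graph_map (\<lambda>j. - wt i * basis_vec k j) = (\<lambda>j. - wt i * graph_map (basis_vec k) j)"
    using graph_map_comb[of "- wt i" "basis_vec k" 0 "basis_vec k"] by simp
  ultimately have "pairing (\<lambda>i' j. if i' = i then - wt i' * basis_vec k j else 0) =
     (\<Sum>i'<n. if i' = i then - graph_map (basis_vec k) (succ i) else 0)"
    unfolding pairing_def by (intro sum.cong refl) (use assms in \<open>auto split: letter.splits\<close>)
  then show ?thesis using assms(1) by simp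
qed

end

section \<open>Spanning\<close>

text \<open>
  In the string given by \<open>ls\<close> the letter \<open>L\<close> leads from the \<open>k\<close>-th to the \<open>k'\<close>-th vertex, read in
  either direction. For \<open>L = Dir a\<close> this means that \<open>a\<close> sends the \<open>k\<close>-th basis vector to the
  \<open>k'\<close>-th one.
\<close>
definition step :: "'a letter list \<Rightarrow> 'a letter \<Rightarrow> nat \<Rightarrow> nat \<Rightarrow> bool" where
  "step ls L k k' \<longleftrightarrow> (k' = Suc k \<and> k < length ls \<and> ls ! k = L) \<or>
     (k = Suc k' \<and> k' < length ls \<and> ls ! k' = letter_inv L)"

lemma step_rev:
  assumes "k \<le> length ls" "k' \<le> length ls"
  shows "step (rev (map letter_inv ls)) L k k' \<longleftrightarrow> step ls L (length ls - k) (length ls - k')"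
proof -
  have 1: "k' = Suc k \<and> k < length ls \<and> rev (map letter_inv ls) ! k = L \<longleftrightarrow>
     length ls - k = Suc (length ls - k') \<and> length ls - k' < length ls \<and> ls ! (length ls - k') = letter_inv L"
    if "k \<le> length ls" "k' \<le> length ls" for k k' and L :: "'a letter"
    using that by (cases "k' = Suc k") (auto simp: rev_nth)
  from 1[OF assms] 1[OF assms(2,1), of "letter_inv L"] show ?thesis unfolding step_def by auto
qed

lemma step_le: "step ls L k k' \<Longrightarrow> k \<le> length ls \<and> k' \<le> length ls"
  by (auto simp: step_def)

context gentle_quiver
begin

text \<open>
  In a word that equals its inverse, the middle letter would be its own inverse or the two middle
  letters would cancel.
\<close>
lemma inv_fixed_trivial:
  assumes "word_ok ls" "rev (map letter_inv ls) = ls"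
  shows "ls = []"
proof (rule ccontr)
  assume ne: "ls \<noteq> []"
  let ?l = "length ls"
  have e: "ls ! k = letter_inv (ls ! (?l - Suc k))" if "k < ?l" for k
  proof -
    have "rev (map letter_inv ls) ! k = letter_inv (ls ! (?l - Suc k))" using that by (simp add: rev_nth)
    then show ?thesis using assms(2) by simp
  qed
  show False
  proof (cases "even ?l")
    case True
    then obtain h where h: "?l = 2 * Suc h" using ne by (metis evenE length_0_conv mult_0_right not0_implies_Suc)
    then have "ls ! h = letter_inv (ls ! Suc h)" using e[of h] by simp
    moreover have "compat (ls ! h) (ls ! Suc h)" using assms(1) h by (simp add: word_ok_def)
    ultimately show False by (simp add: compat_def)
  next
    case False
    then obtain h where h: "?l = 2 * h + 1" by (auto elim: oddE)
    then have "ls ! h = letter_inv (ls ! h)" using e[of h] by simp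
    then show False by simp
  qed
qed

lemma string_arr_step:
  assumes s: "is_string Q I (x, ls)" and st: "step ls (Dir a) k k'"
  shows "arrow_act ls Suc (\<lambda>_. 1) a (basis_vec k) = (basis_vec k' :: nat \<Rightarrow> 'k)"
  using st string_arr_basis[OF s, of k a] string_arr_basis[OF s, of k' a]
  by (auto simp: step_def)

lemma string_arr_no_step:
  assumes "\<And>k'. \<not> step ls (Dir a) k k'"
  shows "arrow_act ls Suc (\<lambda>_. 1) a (basis_vec k) = (\<lambda>_. 0 :: 'k)"
proof (rule ext)
  fix j
  have "\<not> (0 < j \<and> j \<le> length ls \<and> ls ! (j - 1) = Dir a \<and> j - 1 = k)" "\<not> (j < length ls \<and> ls ! j = Inv a \<and> Suc j = k)"
    using assms[of j] by (auto simp: step_def)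
  then show "arrow_act ls Suc (\<lambda>_. 1) a (basis_vec k) j = (0 :: 'k)"
    unfolding string_arrow_act by auto
qed

end

context band_string
begin


lemma w_ok: "word_ok (snd w)" "fst w \<in> verts Q" "snd w \<noteq> [] \<Longrightarrow> letter_start Q (hd (snd w)) = fst w"
  using w by (cases w; simp add: is_string_iff)+

lemma Y_arr: "a \<in> arcs Q \<Longrightarrow> arr a \<odot>\<^bsub>Y\<^esub> z = arrow_act (snd w) Suc (\<lambda>_. 1) a z"
  using string_arr[of "fst w" "snd w" a z] w by simp

lemma Y_vtx: "x \<in> verts Q \<Longrightarrow> vtx x \<odot>\<^bsub>Y\<^esub> z = (\<lambda>j. if j \<le> l \<and> word_end Q (fst w, take j (snd w)) = x then z j else 0)"
  using string_vtx[of "fst w" "snd w" x z] w by simp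

lemma word_inv_w: "word_inv Q w = (word_end Q w, rev (map letter_inv (snd w)))"
  by (cases w) (simp add: word_end.simps)

lemma word_inv_eq_w: "word_inv Q w = w \<longleftrightarrow> l = 0"
proof
  assume "word_inv Q w = w"
  then have "rev (map letter_inv (snd w)) = snd w" by (metis word_inv_w snd_conv)
  then show "l = 0" using inv_fixed_trivial[OF w_ok(1)] by simp
qed (cases w, simp add: word_end.simps)

definition single :: "nat \<Rightarrow> (nat \<Rightarrow> 'k) \<Rightarrow> nat \<Rightarrow> nat \<Rightarrow> 'k" where
  "single i y = (\<lambda>i' j. if i' = i then y j else 0)"

text \<open>
  Changing one lift \<open>e\<^sub>i\<close> by \<open>z\<close> affects only the errors of the two letters at \<open>i\<close>: that of the
  letter \<open>i\<close> by \<open>Rv i z\<close> and that of the letter \<open>pred i\<close> by \<open>Lv i z\<close>.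
\<close>
definition Rv :: "nat \<Rightarrow> (nat \<Rightarrow> 'k) \<Rightarrow> nat \<Rightarrow> 'k" where
  "Rv i z = (case c ! i of Dir a \<Rightarrow> arr a \<odot>\<^bsub>Y\<^esub> z | Inv a \<Rightarrow> (\<lambda>j. - z j))"

definition Lv :: "nat \<Rightarrow> (nat \<Rightarrow> 'k) \<Rightarrow> nat \<Rightarrow> 'k" where
  "Lv i z = (case c ! pred i of Dir a \<Rightarrow> (\<lambda>j. - wt (pred i) * z j) | Inv a \<Rightarrow> arr a \<odot>\<^bsub>Y\<^esub> z)"

lemma arr_zero: "a \<in> arcs Q \<Longrightarrow> arr a \<odot>\<^bsub>Y\<^esub> (\<lambda>_. 0) = (\<lambda>_. 0)"
  by (simp add: Y_arr)

lemma single_boundary: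
  assumes i: "i < n" and z: "z \<in> carrier Y" "vtx (v i) \<odot>\<^bsub>Y\<^esub> z = z"
  shows "boundary (\<lambda>i' j. 1 * single i (Rv i z) i' j + 1 * single (pred i) (Lv i z) i' j)"
  unfolding boundary_def
proof (intro exI[of _ "\<lambda>i'. if i' = i then z else (\<lambda>_. 0)"] allI impI conjI)
  fix i' assume i': "i' < n"
  show "(if i' = i then z else (\<lambda>_. 0)) \<in> carrier Y" using z by (simp add: Y_carrier)
  show "vtx (v i') \<odot>\<^bsub>Y\<^esub> (if i' = i then z else (\<lambda>_. 0)) = (if i' = i then z else (\<lambda>_. 0))"
    using z Y_vtx[OF v_verts[OF i']] by auto
  have s: "succ i' = i \<longleftrightarrow> i' = pred i" using succ_eq_iff[OF i' i] .
  fix a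
  show "(\<lambda>j. 1 * single i (Rv i z) i' j + 1 * single (pred i) (Lv i z) i' j) =
      (\<lambda>j. (arr a \<odot>\<^bsub>Y\<^esub> (if i' = i then z else (\<lambda>_. 0))) j - wt i' * (if succ i' = i then z else (\<lambda>_. 0)) j)"
    if a: "c ! i' = Dir a"
    using a arr_zero[OF c_arcs'(1)[OF i' a]] by (auto simp: single_def Rv_def Lv_def s)
  show "(\<lambda>j. 1 * single i (Rv i z) i' j + 1 * single (pred i) (Lv i z) i' j) =
      (\<lambda>j. (arr a \<odot>\<^bsub>Y\<^esub> (if succ i' = i then z else (\<lambda>_. 0))) j - (if i' = i then z else (\<lambda>_. 0)) j)"
    if a: "c ! i' = Inv a"
    using a arr_zero[OF c_arcs'(2)[OF i' a]] by (auto simp: single_def Rv_def Lv_def s)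
qed

lemma Lv_Rv_carrier: "i < n \<Longrightarrow> z \<in> carrier Y \<Longrightarrow> Rv i z \<in> carrier Y \<and> Lv i z \<in> carrier Y"
proof -
  assume i: "i < n" and z: "z \<in> carrier Y"
  have "arr a \<odot>\<^bsub>Y\<^esub> z \<in> carrier Y" if "a \<in> arcs Q" for a using Y.smult_closed[OF arr_closed[OF that] z] .
  then show ?thesis using z c_arcs'[OF i] c_arcs'[OF pred_less, of i]
    by (cases "c ! i"; cases "c ! pred i") (auto simp: Rv_def Lv_def Y_carrier)
qed

end

text \<open>One of the two ways to read the string \<open>w\<close>.\<close>
locale string_orient = band_string Q I c t lam w
  for Q :: "('v, 'a) pre_digraph" and I :: "(('v, 'a) path \<Rightarrow> 'k::field) set"
    and c :: "'a letter list" and t :: nat and lam :: 'k and w :: "('v, 'a) qword" +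
  fixes x :: 'v and ls :: "'a letter list"
  assumes orient: "(x, ls) \<in> {w, word_inv Q w}"
begin

definition place :: "nat \<Rightarrow> nat" where "place j = (if (x, ls) = w then j else l - j)"

lemma word_string: "is_string Q I (x, ls)"
  using orient w is_string_inv[OF w] by auto

lemma ls_ok: "word_ok ls" "x \<in> verts Q" "ls \<noteq> [] \<Longrightarrow> letter_start Q (hd ls) = x"
  using word_string by (auto simp: is_string_iff)

lemma length_ls: "length ls = l"
  using orient by (cases w) auto

lemma place_le: "k \<le> l \<Longrightarrow> place k \<le> l" and place_place: "k \<le> l \<Longrightarrow> place (place k) = k"
  by (auto simp: place_def)

lemma step_place: "k \<le> l \<Longrightarrow> k' \<le> l \<Longrightarrow> step (snd w) L (place k) (place k') \<longleftrightarrow> step ls L k k'"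
proof (cases "(x, ls) = w")
  case True
  then have "snd w = ls" "place k = k" "place k' = k'" by (auto simp: place_def)
  then show ?thesis by simp
next
  case False
  assume k: "k \<le> l" "k' \<le> l"
  have "ls = rev (map letter_inv (snd w))" using orient False by (auto simp: word_inv_w)
  moreover have "place k = l - k" "place k' = l - k'" using False by (simp_all add: place_def)
  ultimately show ?thesis using step_rev[of k "snd w" k' L] k by simp
qed

lemma vertex_place: "k \<le> l \<Longrightarrow> word_end Q (fst w, take (place k) (snd w)) = word_end Q (x, take k ls)"
proof (cases "(x, ls) = w")
  case True
  then have "snd w = ls" "fst w = x" "place k = k" by (auto simp: place_def)
  then show ?thesis by simp
next
  case False
  assume k: "k \<le> l"
  have "ls = rev (map letter_inv (snd w))" "x = word_end Q (fst w, snd w)" using orient False by (auto simp: word_inv_w)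
  moreover have "place k = l - k" using False by (simp add: place_def)
  ultimately show ?thesis using word_end_full[OF w_ok(1,3) k] by simp
qed

lemma arr_step: "a \<in> arcs Q \<Longrightarrow> step ls (Dir a) k k' \<Longrightarrow> arr a \<odot>\<^bsub>Y\<^esub> basis_vec (place k) = basis_vec (place k')"
  using step_le[of ls "Dir a" k k'] length_ls step_place[of k k' "Dir a"] string_arr_step[of "fst w" "snd w" a "place k" "place k'"] w
  by (simp add: Y_arr)

lemma arr_no_step: "a \<in> arcs Q \<Longrightarrow> k \<le> l \<Longrightarrow> (\<And>k'. \<not> step ls (Dir a) k k') \<Longrightarrow> arr a \<odot>\<^bsub>Y\<^esub> basis_vec (place k) = (\<lambda>_. 0)"
proof -
  assume a: "a \<in> arcs Q" "k \<le> l" "\<And>k'. \<not> step ls (Dir a) k k'"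
  have "\<not> step (snd w) (Dir a) (place k) k'" for k'
  proof
    assume s: "step (snd w) (Dir a) (place k) k'"
    then have "k' \<le> l" using step_le by blast
    then have "step (snd w) (Dir a) (place k) (place (place k'))" using s place_place by simp
    then show False using step_place[OF a(2) place_le[OF \<open>k' \<le> l\<close>]] a(3) by blast
  qed
  then show ?thesis using string_arr_no_step[of "snd w" a "place k"] by (simp add: Y_arr[OF a(1)])
qed

end

text \<open>
  The set \<open>W\<close> stands for a vector space of errors that contains the boundaries and the errors of
  all overlap extensions; it has to contain all realised errors.
\<close>
locale span_set = band_string Q I c t lam w
  for Q :: "('v, 'a) pre_digraph" and I :: "(('v, 'a) path \<Rightarrow> 'k::field) set"
    and c :: "'a letter list" and t :: nat and lam :: 'k and w :: "('v, 'a) qword" +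
  fixes W :: "(nat \<Rightarrow> nat \<Rightarrow> 'k) set"
  assumes W_boundary: "boundary \<eta> \<Longrightarrow> (\<And>i. i < n \<Longrightarrow> \<eta> i \<in> carrier Y) \<Longrightarrow> \<eta> \<in> W"
    and W_comb: "\<eta> \<in> W \<Longrightarrow> \<eta>' \<in> W \<Longrightarrow> (\<lambda>i j. \<kappa> * \<eta> i j + \<mu> * \<eta>' i j) \<in> W"
    and W_overlap: "d \<in> overlaps Q I c w \<Longrightarrow> band_overlap.overlap_coords c t lam w d \<in> W"
begin

lemma W_zero: "(\<lambda>_ _. 0) \<in> W"
  by (rule W_boundary[OF boundary_zero]) (simp add: Y_carrier)

lemma W_scale: "\<kappa> \<noteq> 0 \<Longrightarrow> (\<lambda>i j. \<kappa> * \<eta> i j) \<in> W \<longleftrightarrow> \<eta> \<in> W"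
  using W_comb[of \<eta> \<eta> \<kappa> 0] W_comb[of "\<lambda>i j. \<kappa> * \<eta> i j" "\<lambda>i j. \<kappa> * \<eta> i j" "inverse \<kappa>" 0]
  by (auto simp flip: mult.assoc)

text \<open>
  A basis vector \<open>z\<^sub>k\<close> of \<open>M(w)\<close> and a basis vector \<open>i\<close> of the band module at the same vertex form
  a state. Its two halves are congruent up to sign modulo boundaries, so both lie in \<open>W\<close> or
  neither does.
\<close>
definition RW :: "nat \<Rightarrow> nat \<Rightarrow> bool" where "RW i k \<longleftrightarrow> single i (Rv i (basis_vec k)) \<in> W"
definition LW :: "nat \<Rightarrow> nat \<Rightarrow> bool" where "LW i k \<longleftrightarrow> single (pred i) (Lv i (basis_vec k)) \<in> W"
definition state :: "nat \<Rightarrow> nat \<Rightarrow> bool" where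
  "state i k \<longleftrightarrow> i < n \<and> k \<le> l \<and> word_end Q (fst w, take k (snd w)) = v i"

lemma RW_LW: "state i k \<Longrightarrow> RW i k \<longleftrightarrow> LW i k"
proof -
  assume s: "state i k"
  then have i: "i < n" and z: "basis_vec k \<in> carrier Y" "vtx (v i) \<odot>\<^bsub>Y\<^esub> basis_vec k = basis_vec k"
    using Y_vtx[OF v_verts[of i]] by (auto simp: state_def Y_carrier fun_eq_iff)
  have b: "(\<lambda>i' j. 1 * single i (Rv i (basis_vec k)) i' j + 1 * single (pred i) (Lv i (basis_vec k)) i' j) \<in> W"
    by (rule W_boundary[OF single_boundary[OF i z]])
      (use Lv_Rv_carrier[OF i z(1)] in \<open>auto simp: single_def Y_carrier\<close>)
  show ?thesis unfolding RW_def LW_def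
    using W_comb[OF b, of "single i (Rv i (basis_vec k))" 1 "-1"]
      W_comb[OF b, of "single (pred i) (Lv i (basis_vec k))" 1 "-1"] by auto
qed

end

locale span_orient = span_set Q I c t lam w W + string_orient Q I c t lam w x ls
  for Q :: "('v, 'a) pre_digraph" and I :: "(('v, 'a) path \<Rightarrow> 'k::field) set"
    and c :: "'a letter list" and t :: nat and lam :: 'k and w :: "('v, 'a) qword"
    and W :: "(nat \<Rightarrow> nat \<Rightarrow> 'k) set" and x :: 'v and ls :: "'a letter list"
begin

definition ostate :: "nat \<Rightarrow> nat \<Rightarrow> bool" where "ostate i k \<longleftrightarrow> i < n \<and> k \<le> l \<and> word_end Q (x, take k ls) = v i"

lemma ostate_state: "ostate i k \<Longrightarrow> state i (place k)"
  using vertex_place place_le by (auto simp: ostate_def state_def)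

lemma ostate_succ: "ostate i k \<Longrightarrow> k < l \<Longrightarrow> ls ! k = c ! i \<Longrightarrow> ostate (succ i) (Suc k)"
  using word_end_take_Suc[of k ls x] length_ls v_succ[of i] by (auto simp: ostate_def)

lemma ostate_pred: "ostate i (Suc k) \<Longrightarrow> ls ! k = c ! pred i \<Longrightarrow> ostate (pred i) k"
  using word_end_take[OF ls_ok(1,3), of k] length_ls by (auto simp: ostate_def v_def)

text \<open>
  When the letters of \<open>w\<close> and of the band after \<open>(i, k)\<close> agree, the right half of \<open>(i, k)\<close> and the
  left half of \<open>(i + 1, k + 1)\<close> are nonzero multiples of the same errors. So membership in \<open>W\<close> is
  constant along common subwords.
\<close>
lemma move:
  assumes i: "i < n" and k: "k < l" "ls ! k = c ! i"
  shows "RW i (place k) \<longleftrightarrow> LW (succ i) (place (Suc k))"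
proof (cases "c ! i")
  case (Dir a)
  have "step ls (Dir a) k (Suc k)" using k Dir length_ls by (simp add: step_def)
  then have "Rv i (basis_vec (place k)) = basis_vec (place (Suc k))"
    using Dir arr_step[OF c_arcs'(1)[OF i Dir]] by (simp add: Rv_def)
  moreover have "single i (\<lambda>j. - wt i * basis_vec (place (Suc k)) j) = (\<lambda>i' j. - wt i * single i (basis_vec (place (Suc k))) i' j)"
    by (auto simp: single_def fun_eq_iff)
  ultimately show ?thesis using Dir i W_scale[of "- wt i"] by (simp add: RW_def LW_def Lv_def)
next
  case (Inv a)
  have "step ls (Dir a) (Suc k) k" using k Inv length_ls by (simp add: step_def)
  then have "Lv (succ i) (basis_vec (place (Suc k))) = basis_vec (place k)"
    using Inv i arr_step[OF c_arcs'(2)[OF i Inv]] by (simp add: Lv_def)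
  moreover have "single i (\<lambda>j. - basis_vec (place k) j) = (\<lambda>i' j. - 1 * single i (basis_vec (place k)) i' j)"
    by (auto simp: single_def fun_eq_iff)
  ultimately show ?thesis using Inv i W_scale[of "- 1"] by (simp add: RW_def LW_def Rv_def)
qed

text \<open>The index of the band reached from \<open>i\<close> after \<open>s\<close> letters.\<close>
definition ii :: "nat \<Rightarrow> nat \<Rightarrow> nat" where "ii i s = (succ ^^ s) i"

lemma ii_simps [simp]: "ii i 0 = i" "ii i (Suc s) = succ (ii i s)" and ii_succ: "ii (succ i) s = succ (ii i s)"
  by (auto simp: ii_def funpow_swap1)

lemma ii_less [simp]: "i < n \<Longrightarrow> ii i s < n"
  by (cases s) auto

lemma right_run:
  assumes "ostate i k" "\<And>s'. s' < s \<Longrightarrow> k + s' < l \<and> ls ! (k + s') = c ! ii i s'"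
    and "RW (ii i s) (place (k + s))"
  shows "LW i (place k)"
  using assms
proof (induction s arbitrary: i k)
  case 0
  then show ?case using RW_LW[OF ostate_state[OF 0(1)]] by simp
next
  case (Suc s)
  have k: "k < l" "ls ! k = c ! i" using Suc.prems(2)[of 0] by auto
  have i: "i < n" using Suc.prems(1) by (simp add: ostate_def)
  have "LW (succ i) (place (Suc k))"
  proof (rule Suc.IH)
    show "ostate (succ i) (Suc k)" by (rule ostate_succ[OF Suc.prems(1) k])
    show "Suc k + s' < l \<and> ls ! (Suc k + s') = c ! ii (succ i) s'" if "s' < s" for s'
      using Suc.prems(2)[of "Suc s'"] that by (simp add: ii_succ)
    show "RW (ii (succ i) s) (place (Suc k + s))" using Suc.prems(3) by (simp add: ii_succ)
  qed
  then show ?case using move[OF i k] RW_LW[OF ostate_state[OF Suc.prems(1)]] by blast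
qed

lemma compat_ls: "Suc k < l \<Longrightarrow> compat (ls ! k) (ls ! Suc k)"
  using ls_ok(1) length_ls by (simp add: word_ok_def)

lemma arcs_ls: "k < l \<Longrightarrow> letter_arrow (ls ! k) \<in> arcs Q"
  using word_ok_nth_arcs[OF ls_ok(1)] length_ls by simp

lemma vertex_before: "k \<le> l \<Longrightarrow> 0 < k \<Longrightarrow> letter_end Q (ls ! (k - 1)) = word_end Q (x, take k ls)"
  using word_end_take_Suc[of "k - 1" ls x] length_ls by simp

lemma vertex_after: "k < l \<Longrightarrow> letter_start Q (ls ! k) = word_end Q (x, take k ls)"
  using word_end_take[OF ls_ok(1,3), of k] length_ls by simp

text \<open>
  A common subword of \<open>w\<close> and the periodic word that cannot be extended backwards and is preceded
  in the latter by a direct letter \<open>A\<close> is extended forwards as far as possible. If the periodic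
  word then continues by a direct letter, this letter acts as zero on the basis vector reached,
  and the right half there is zero. If it continues by an inverse letter \<open>B\<close>, the common subword
  is an overlap: a letter of \<open>w\<close> before it is inverse and one after it is direct, by maximality
  and gentleness, and the left half in question is the family of errors of the overlap extension.
  The hypothesis \<open>right\<close> covers empty common subwords, for which the third overlap condition is
  needed.
\<close>
lemma left_end:
  assumes st: "ostate i k" and A: "c ! pred i = Dir A" and no_A: "\<And>k0. \<not> step ls (Dir A) k0 k"
    and right: "(k < l \<and> ls ! k = c ! i) \<or> ((\<forall>k'. \<not> step ls (c ! i) k k') \<and>
       (\<forall>B. c ! i = Inv B \<longrightarrow> (\<forall>C. 0 < k \<longrightarrow> ls ! (k - 1) = Inv C \<longrightarrow> zero_comp Q I C A) \<and>
          (\<forall>D. k < l \<longrightarrow> ls ! k = Dir D \<longrightarrow> zero_comp Q I D B)))"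
  shows "LW i (place k)"
proof -
  have i: "i < n" and kl: "k \<le> l" and vi: "word_end Q (x, take k ls) = v i" using st by (auto simp: ostate_def)
  (* The first s letters from (i, k) on agree, and s is maximal. *)
  define ma where "ma s \<longleftrightarrow> k + s < l \<and> ls ! (k + s) = c ! ii i s" for s
  define s where "s = (LEAST s. \<not> ma s)"
  have "\<not> ma l" by (simp add: ma_def)
  then have ns: "\<not> ma s" unfolding s_def by (rule LeastI)
  have run: "ma s'" if "s' < s" for s' using not_less_Least[of s' "\<lambda>s. \<not> ma s"] that by (auto simp: s_def)
  have ks: "k + s \<le> l" using run[of "s - 1"] kl by (cases s) (auto simp: ma_def)
  have run': "\<And>s'. s' < s \<Longrightarrow> k + s' < l \<and> ls ! (k + s') = c ! ii i s'" using run by (auto simp: ma_def)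
  have s0: "s = 0 \<Longrightarrow> (\<forall>k'. \<not> step ls (c ! i) k k')" using right ns by (auto simp: ma_def)
  have ce: "0 < s \<Longrightarrow> compat (c ! ii i (s - 1)) (c ! ii i s)"
    using compat_c[of "ii i (s - 1)"] i by (cases s) auto
  have le: "0 < s \<Longrightarrow> ls ! (k + s - 1) = c ! ii i (s - 1)" using run'[of "s - 1"] by (cases s) auto
  have lA: "A \<in> arcs Q" "head Q A = v i" using c_arcs'(1)[OF _ A] v_succ[of "pred i"] A i by auto
  show ?thesis
  proof (cases "c ! ii i s")
    case (Dir a)
    have "\<not> step ls (Dir a) (k + s) k'" for k'
    proof
      assume "step ls (Dir a) (k + s) k'"
      then consider "k' = Suc (k + s)" "k + s < l" "ls ! (k + s) = Dir a" | "k + s = Suc k'" "ls ! k' = Inv a"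
        using length_ls by (auto simp: step_def)
      then show False
      proof cases
        case 1
        then show ?thesis using ns Dir by (simp add: ma_def)
      next
        case 2
        show ?thesis
        proof (cases "s = 0")
          case True
          then show ?thesis using s0 Dir \<open>step ls (Dir a) (k + s) k'\<close> by simp
        next
          case False
          then have "c ! ii i (s - 1) = Inv a" using le 2 by simp
          then show ?thesis using ce False Dir by (simp add: compat_def)
        qed
      qed
    qed
    then have "Rv (ii i s) (basis_vec (place (k + s))) = (\<lambda>_. 0)"
      using arr_no_step[OF c_arcs'(1)[OF ii_less[OF i] Dir] ks] Dir by (simp add: Rv_def)
    then have "RW (ii i s) (place (k + s))" using W_zero by (simp add: RW_def single_def)
    then show ?thesis using right_run[OF st run'] by blast
  next
    case B: (Inv B)
    have Bq: "B \<in> arcs Q" using c_arcs'(2)[OF ii_less[OF i] B] .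
    have s0B: "s = 0 \<Longrightarrow> A \<noteq> B \<and> head Q B = v i"
      using compat_c[of "pred i"] A B i by (auto simp: compat_def v_def)
    (* A direct letter before the subword would be a third arrow ending at the vertex, or equal
       to A by gentleness. *)
    have C: "\<exists>C. ls ! (k - 1) = Inv C" if k0: "0 < k"
    proof (rule ccontr)
      assume "\<nexists>C. ls ! (k - 1) = Inv C"
      then obtain a' where a': "ls ! (k - 1) = Dir a'" by (cases "ls ! (k - 1)") auto
      have aq: "a' \<in> arcs Q" using arcs_ls[of "k - 1"] a' k0 kl by auto
      have "step ls (Dir a') (k - 1) k" using a' k0 kl length_ls by (auto simp: step_def)
      then have nA: "a' \<noteq> A" using no_A by blast
      show False
      proof (cases "s = 0")
        case True
        have "step ls (Inv a') k (k - 1)" using a' k0 kl length_ls by (auto simp: step_def)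
        then have "a' \<noteq> B" using s0[OF True] B True by auto
        moreover have "head Q a' = v i" using vertex_before[OF kl k0] a' vi by simp
        ultimately show False using gentle_in[of A B a'] lA Bq aq nA s0B[OF True] by auto
      next
        case False
        then have m: "ls ! k = c ! i" "k < l" using run'[of 0] by auto
        have "compat (ls ! (k - 1)) (ls ! k)" using compat_ls[of "k - 1"] k0 m by simp
        moreover have "compat (Dir A) (ls ! k)" using compat_c[of "pred i"] i m A by simp
        ultimately have "ls ! (k - 1) = Dir A"
          using a' aq lA c_arcs[OF i] m by (intro compat_unique_left[of "ls ! k"]) auto
        then show False using a' nA by simp
      qed
    qed
    (* An inverse letter after the subword would equal B by gentleness, against maximality, or
       be a third arrow ending at the vertex. *)
    have D: "\<exists>D. ls ! (k + s) = Dir D" if kl': "k + s < l"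
    proof (rule ccontr)
      assume "\<nexists>D. ls ! (k + s) = Dir D"
      then obtain b' where b': "ls ! (k + s) = Inv b'" by (cases "ls ! (k + s)") auto
      have bq: "b' \<in> arcs Q" using arcs_ls[OF kl'] b' by auto
      have nB: "b' \<noteq> B" using ns kl' b' B by (auto simp: ma_def)
      show False
      proof (cases "s = 0")
        case True
        have "step ls (Dir b') (Suc k) k" using b' True kl' length_ls by (auto simp: step_def)
        then have "b' \<noteq> A" using no_A by blast
        moreover have "head Q b' = v i" using vertex_after[of k] b' vi True kl' by simp
        ultimately show False using gentle_in[of A B b'] lA Bq bq nB s0B[OF True] by auto
      next
        case False
        have "compat (c ! ii i (s - 1)) (Inv b')" using compat_ls[of "k + s - 1"] le False kl' b' by simp
        then have "Inv b' = Inv B"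
          using ce False B bq Bq c_arcs[of "ii i (s - 1)"] i by (intro compat_unique[of "c ! ii i (s - 1)"]) auto
        then show False using nB by simp
      qed
    qed
    define d :: "('v, 'a) overlap" where "d = \<lparr>ov_pos = int i, ov_word = (x, ls), ov_m = (head Q A, take s (drop k ls)),
      ov_A = A, ov_B = B, ov_C = (if k = 0 then None else Some (letter_arrow (ls ! (k - 1)))),
      ov_D = (if k + s = l then None else Some (letter_arrow (ls ! (k + s)))),
      ov_wL = drop (Suc (k + s)) ls, ov_wR = take (k - 1) ls\<rparr>"
    have len: "ov_len d = s" using ks length_ls by (simp add: ov_len_def d_def)
    have right_d: "ov_right d = take k ls"
    proof (cases "k = 0")
      case False
      then have "take k ls = take (k - 1) ls @ [ls ! (k - 1)]"
        using take_Suc_conv_app_nth[of "k - 1" ls] kl length_ls by simp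
      then show ?thesis using C False by (auto simp: ov_right_def d_def)
    qed (simp add: ov_right_def d_def)
    have left_d: "ov_left d = drop (k + s) ls"
    proof (cases "k + s = l")
      case False
      then have "drop (k + s) ls = ls ! (k + s) # drop (Suc (k + s)) ls"
        using Cons_nth_drop_Suc[of "k + s" ls] ks length_ls by simp
      then show ?thesis using D False ks by (auto simp: ov_left_def d_def)
    qed (use length_ls in \<open>simp add: ov_left_def d_def\<close>)
    have ix: "nat ((int i + int s') mod int n) = ii i s'" for s'
    proof (induction s')
      case 0
      then show ?case using i by simp
    next
      case (Suc s')
      then show ?case using succ_mod[of "int i + int s'"] by (simp add: algebra_simps)
    qed
    have ov: "is_overlap Q I c d"
      unfolding is_overlap_def len right_d left_d
    proof (intro conjI impI allI)
      have "nat ((int i - 1) mod int n) = pred i" using i by (simp add: pred_mod)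
      then show "biinf c (ov_pos d - 1) = Dir (ov_A d)" using A by (simp add: biinf_def d_def)
      show "biinf_segment c (ov_pos d) s = snd (ov_m d)"
        using run' ks length_ls by (intro nth_equalityI) (auto simp: biinf_segment_def biinf_def d_def ix)
      show "biinf c (ov_pos d + int s) = Inv (ov_B d)" using B by (simp add: biinf_def d_def ix)
      show "snd (ov_word d) = take k ls @ snd (ov_m d) @ drop (k + s) ls"
        by (simp add: d_def) (metis append_take_drop_id drop_drop add.commute)
      show "fst (ov_m d) = head Q (ov_A d)" by (simp add: d_def)
      show "fst (ov_m d) = word_end Q (fst (ov_word d), take k ls)" using vi lA by (simp add: d_def)
      show "ov_C d = None \<Longrightarrow> ov_wR d = []" by (auto simp: d_def split: if_splits)
      show "ov_D d = None \<Longrightarrow> ov_wL d = []" using length_ls by (auto simp: d_def split: if_splits)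
      assume "snd (ov_m d) = []"
      then have s: "s = 0" using len by (simp add: ov_len_def)
      then have r: "(\<forall>C. 0 < k \<longrightarrow> ls ! (k - 1) = Inv C \<longrightarrow> zero_comp Q I C A) \<and>
          (\<forall>D. k < l \<longrightarrow> ls ! k = Dir D \<longrightarrow> zero_comp Q I D B)" using right ns B by (auto simp: ma_def)
      show "zero_comp Q I C' (ov_A d)" if "ov_C d = Some C'" for C'
        using r that C by (auto simp: d_def split: if_splits)
      show "zero_comp Q I D' (ov_B d)" if "ov_D d = Some D'" for D'
        using r that D s kl by (auto simp: d_def split: if_splits)
    qed
    have dw: "ov_word d \<in> {w, word_inv Q w}" using orient by (simp add: d_def)
    have dm: "d \<in> overlaps Q I c w" using ov dw i by (simp add: overlaps_def d_def)
    interpret D: band_overlap Q I c t lam w d by unfold_locales (use ov dw in auto)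
    have fields: "ov_pos d = int i" "ov_word d = (x, ls)" by (simp_all add: d_def)
    have "D.ix 0 = i" using i unfolding D.ix_def fields by simp
    moreover have "D.place (length (ov_right d)) = place k"
      using kl length_ls unfolding right_d D.place_def place_def fields by simp
    ultimately have "D.overlap_coords = single (pred i) (Lv i (basis_vec (place k)))"
      using A by (auto simp: D.overlap_coords_def single_def Lv_def fun_eq_iff)
    then show ?thesis using W_overlap[OF dm] by (simp add: LW_def)
  qed
qed

text \<open>
  The common subword is followed backwards. Where it begins, the previous letter of the band is
  direct, which is the situation of the previous lemma, or inverse; then it acts as zero there,
  and the left half is zero.
\<close>
lemma right_matched:
  assumes "ostate i k" "k < l" "ls ! k = c ! i"
  shows "LW i (place k)"
  using assms
proof (induction k arbitrary: i rule: less_induct)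
  case (less k)
  have i: "i < n" using less.prems by (simp add: ostate_def)
  have cp: "compat (c ! pred i) (c ! i)" using compat_c[of "pred i"] i by simp
  show ?case
  proof (cases "0 < k \<and> ls ! (k - 1) = c ! pred i")
    case True
    then have st: "ostate (pred i) (k - 1)" using ostate_pred[of i "k - 1"] less.prems by simp
    have "LW (pred i) (place (k - 1))" using less.IH[of "k - 1" "pred i"] st True less.prems(2) by simp
    then have "RW (pred i) (place (k - 1))" using RW_LW[OF ostate_state[OF st]] by simp
    then show ?thesis using move[of "pred i" "k - 1"] True less.prems(2) i by simp
  next
    case False
    show ?thesis
    proof (cases "c ! pred i")
      case (Dir A)
      have "\<not> step ls (Dir A) k0 k" for k0
      proof
        assume "step ls (Dir A) k0 k"
        then consider "k = Suc k0" "ls ! k0 = Dir A" | "k0 = Suc k" "ls ! k = Inv A" by (auto simp: step_def)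
        then show False
          by cases (use False Dir cp less.prems(3) in \<open>auto simp: compat_def\<close>)
      qed
      then show ?thesis using left_end[OF less.prems(1) Dir] less.prems(2,3) by blast
    next
      case (Inv a)
      have "\<not> step ls (Dir a) k k'" for k'
      proof
        assume "step ls (Dir a) k k'"
        then consider "k' = Suc k" "ls ! k = Dir a" | "k = Suc k'" "ls ! k' = Inv a" by (auto simp: step_def)
        then show False
          by cases (use False Inv cp less.prems(3) in \<open>auto simp: compat_def\<close>)
      qed
      then have "Lv i (basis_vec (place k)) = (\<lambda>_. 0)"
        using arr_no_step[OF c_arcs'(2)[OF pred_less Inv]] less.prems(2) Inv by (simp add: Lv_def)
      then show ?thesis using W_zero by (simp add: LW_def single_def)
    qed
  qed
qed

lemma left_matched:
  assumes "ostate i (Suc k)" "ls ! k = c ! pred i" "k < l"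
  shows "LW i (place (Suc k))"
proof -
  have i: "i < n" using assms by (simp add: ostate_def)
  have st: "ostate (pred i) k" by (rule ostate_pred[OF assms(1,2)])
  have "RW (pred i) (place k)" using right_matched[OF st assms(3,2)] RW_LW[OF ostate_state[OF st]] by simp
  then show ?thesis using move[of "pred i" k] assms i by simp
qed

end

context span_set
begin

text \<open>
  If \<open>w\<close> and the band share a letter before or after the state, in one of the two readings of \<open>w\<close>,
  the two previous lemmas apply. If they share none and the previous letter of the band is
  inverse, the left half is zero. If it is a direct letter \<open>A\<close> and the next one an inverse letter
  \<open>B\<close>, the trivial word at this vertex is an overlap for at least one reading of \<open>w\<close>: if the third
  overlap condition failed for both, one arrow would compose to something nonzero with two others
  on the same side, against gentleness.
\<close>
lemma all_LW: "state i k \<Longrightarrow> LW i k"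
proof -
  assume st: "state i k"
  let ?w' = "word_inv Q w"
  interpret O1: span_orient Q I c t lam w W "fst w" "snd w" by unfold_locales simp
  interpret O2: span_orient Q I c t lam w W "fst ?w'" "snd ?w'" by unfold_locales simp
  have i: "i < n" and k: "k \<le> l" using st by (auto simp: state_def)
  have ls2: "snd ?w' = rev (map letter_inv (snd w))" by (simp add: word_inv_w)
  have k1: "O1.place j = j" for j by (simp add: O1.place_def)
  have k2: "O2.place j = l - j" if "j \<le> l" for j using that word_inv_eq_w by (auto simp: O2.place_def)
  have st1: "O1.ostate i k" using st by (auto simp: state_def O1.ostate_def)
  have st2: "O2.ostate i (l - k)" using st O2.vertex_place[of "l - k"] k2[of "l - k"] k
    by (auto simp: state_def O2.ostate_def)
  have to: "O2.place (l - k) = k" using k2[of "l - k"] k by simp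
  have inv_nth: "snd ?w' ! j = letter_inv (snd w ! (l - Suc j))" if "j < l" for j
    using that by (simp add: ls2 rev_nth)
  show "LW i k"
  proof (cases "\<exists>k'. step (snd w) (c ! i) k k'")
    case True
    then consider "k < l" "snd w ! k = c ! i" | "0 < k" "snd w ! (k - 1) = letter_inv (c ! i)"
      by (auto simp: step_def)
    then show ?thesis
    proof cases
      case 1
      then show ?thesis using O1.right_matched[OF st1] k1 by simp
    next
      case 2
      then have "l - k < l" "l - Suc (l - k) = k - 1" using k by auto
      then have "snd ?w' ! (l - k) = c ! i" using inv_nth[of "l - k"] 2 by simp
      then show ?thesis using O2.right_matched[OF st2] \<open>l - k < l\<close> to by simp
    qed
  next
    case nr: False
    show ?thesis
    proof (cases "\<exists>k'. step (snd w) (c ! pred i) k' k")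
      case True
      then consider "0 < k" "snd w ! (k - 1) = c ! pred i" | "k < l" "snd w ! k = letter_inv (c ! pred i)"
        by (auto simp: step_def)
      then show ?thesis
      proof cases
        case 1
        then show ?thesis using O1.left_matched[of i "k - 1"] st1 k1 k by simp
      next
        case 2
        then have e: "l - k = Suc (l - Suc k)" "l - Suc k < l" "l - Suc (l - Suc k) = k" by auto
        have "snd ?w' ! (l - Suc k) = c ! pred i" using inv_nth[OF e(2)] 2 e(3) by simp
        then show ?thesis using O2.left_matched[of i "l - Suc k"] st2 to e by simp
      qed
    next
      case nl: False
      show ?thesis
      proof (cases "c ! pred i")
        case (Inv a)
        have "\<not> step (snd w) (Dir a) k k'" for k' using nl Inv by (auto simp: step_def)
        then have "Lv i (basis_vec (O1.place k)) = (\<lambda>_. 0)"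
          using O1.arr_no_step[OF c_arcs'(2)[OF pred_less Inv] k] Inv by (simp add: Lv_def)
        then show ?thesis using W_zero by (simp add: LW_def single_def k1)
      next
        case A: (Dir A)
        have noA1: "\<not> step (snd w) (Dir A) k0 k" for k0 using nl A by auto
        have noA2: "\<not> step (snd ?w') (Dir A) k0 (l - k)" for k0
        proof
          assume s: "step (snd ?w') (Dir A) k0 (l - k)"
          then have "k0 \<le> l" using step_le[OF s] by (simp add: ls2)
          then show False using O2.step_place[of k0 "l - k" "Dir A"] s to noA1 by auto
        qed
        have nr2: "\<forall>k'. \<not> step (snd ?w') (c ! i) (l - k) k'"
        proof (intro allI notI)
          fix k' assume s: "step (snd ?w') (c ! i) (l - k) k'"
          then have "k' \<le> l" using step_le[OF s] by (simp add: ls2)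
          then show False using O2.step_place[of "l - k" k' "c ! i"] s to nr by auto
        qed
        define cond1 where "cond1 \<longleftrightarrow> (\<forall>B. c ! i = Inv B \<longrightarrow> (\<forall>C. 0 < k \<longrightarrow> snd w ! (k - 1) = Inv C \<longrightarrow> zero_comp Q I C A) \<and>
          (\<forall>D. k < l \<longrightarrow> snd w ! k = Dir D \<longrightarrow> zero_comp Q I D B))"
        define cond2 where "cond2 \<longleftrightarrow> (\<forall>B. c ! i = Inv B \<longrightarrow> (\<forall>C. k < l \<longrightarrow> snd w ! k = Dir C \<longrightarrow> zero_comp Q I C A) \<and>
          (\<forall>D. 0 < k \<longrightarrow> snd w ! (k - 1) = Inv D \<longrightarrow> zero_comp Q I D B))"
        have "cond1 \<or> cond2"
        proof (rule ccontr)
          assume n: "\<not> (cond1 \<or> cond2)"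
          then obtain B where B: "c ! i = Inv B" by (auto simp: cond1_def)
          have Aq: "A \<in> arcs Q" "head Q A = v i" using c_arcs'(1)[OF _ A] v_succ[of "pred i"] A i by auto
          have Bq: "B \<in> arcs Q" "head Q B = v i" "A \<noteq> B"
            using c_arcs'(2)[OF i B] compat_c[of "pred i"] A B i by (auto simp: compat_def v_def)
          have Cf: "C \<in> arcs Q \<and> tail Q C = v i" if "0 < k" "snd w ! (k - 1) = Inv C" for C
            using O1.arcs_ls[of "k - 1"] O1.vertex_before[OF k that(1)] that st k by (auto simp: state_def)
          have Df: "D \<in> arcs Q \<and> tail Q D = v i" if "k < l" "snd w ! k = Dir D" for D
            using O1.arcs_ls[of k] O1.vertex_after[OF that(1)] that st by (auto simp: state_def)
          have CD: "C \<noteq> D" if "0 < k" "snd w ! (k - 1) = Inv C" "k < l" "snd w ! k = Dir D" for C D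
            using O1.compat_ls[of "k - 1"] that by (auto simp: compat_def)
          have one: "zero_comp Q I E A \<or> zero_comp Q I E B" if "E \<in> arcs Q" "tail Q E = v i" for E
            using gentle_nonzero_right[of A B E] Aq Bq that by auto
          have two: "zero_comp Q I E F \<or> zero_comp Q I E' F"
            if "E \<in> arcs Q" "tail Q E = v i" "E' \<in> arcs Q" "tail Q E' = v i" "E \<noteq> E'" "F \<in> arcs Q" "head Q F = v i" for E E' F
            using gentle_nonzero_left[of E E' F] that by auto
          have n1: "(\<exists>C. 0 < k \<and> snd w ! (k - 1) = Inv C \<and> \<not> zero_comp Q I C A) \<or>
              (\<exists>D. k < l \<and> snd w ! k = Dir D \<and> \<not> zero_comp Q I D B)"
            using n B unfolding cond1_def by auto
          have n2: "(\<exists>D. k < l \<and> snd w ! k = Dir D \<and> \<not> zero_comp Q I D A) \<or>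
              (\<exists>C. 0 < k \<and> snd w ! (k - 1) = Inv C \<and> \<not> zero_comp Q I C B)"
            using n B unfolding cond2_def by auto
          from n1 n2 show False
          proof (elim disjE exE conjE)
            fix C D assume h: "0 < k" "snd w ! (k - 1) = Inv C" "\<not> zero_comp Q I C A" "k < l" "snd w ! k = Dir D" "\<not> zero_comp Q I D A"
            then show False using two[of C D A] Cf[OF h(1,2)] Df[OF h(4,5)] CD[OF h(1,2,4,5)] Aq by auto
          next
            fix C C' assume h: "0 < k" "snd w ! (k - 1) = Inv C" "\<not> zero_comp Q I C A" "snd w ! (k - 1) = Inv C'" "\<not> zero_comp Q I C' B"
            then show False using one[of C] Cf[OF h(1,2)] by auto
          next
            fix D D' assume h: "k < l" "snd w ! k = Dir D" "\<not> zero_comp Q I D B" "snd w ! k = Dir D'" "\<not> zero_comp Q I D' A"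
            then show False using one[of D] Df[OF h(1,2)] by auto
          next
            fix D C assume h: "k < l" "snd w ! k = Dir D" "\<not> zero_comp Q I D B" "0 < k" "snd w ! (k - 1) = Inv C" "\<not> zero_comp Q I C B"
            then show False using two[of C D B] Cf[OF h(4,5)] Df[OF h(1,2)] CD[OF h(4,5,1,2)] Bq by auto
          qed
        qed
        then show ?thesis
        proof
          assume cond1
          then show ?thesis using O1.left_end[OF st1 A noA1] nr k1 unfolding cond1_def by auto
        next
          assume c2: cond2
          have "\<forall>B. c ! i = Inv B \<longrightarrow> (\<forall>C. 0 < l - k \<longrightarrow> snd ?w' ! (l - k - 1) = Inv C \<longrightarrow> zero_comp Q I C A) \<and>
             (\<forall>D. l - k < l \<longrightarrow> snd ?w' ! (l - k) = Dir D \<longrightarrow> zero_comp Q I D B)"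
          proof (intro allI impI conjI)
            fix B C assume "c ! i = Inv B" and h: "0 < l - k" "snd ?w' ! (l - k - 1) = Inv C"
            have "l - Suc (l - k - 1) = k" "l - k - 1 < l" using h by auto
            then have "letter_inv (snd w ! k) = Inv C" using inv_nth[of "l - k - 1"] h by simp
            then have "snd w ! k = Dir C" by (simp add: letter_inv_eq_iff)
            then show "zero_comp Q I C A" using c2 h \<open>c ! i = Inv B\<close> unfolding cond2_def by auto
          next
            fix B D assume "c ! i = Inv B" and h: "l - k < l" "snd ?w' ! (l - k) = Dir D"
            have "l - Suc (l - k) = k - 1" "0 < k" using h k by auto
            then have "letter_inv (snd w ! (k - 1)) = Dir D" using inv_nth[of "l - k"] h by simp
            then have "snd w ! (k - 1) = Inv D" by (simp only: letter_inv_eq_iff)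
            then show "zero_comp Q I D B" using c2 \<open>0 < k\<close> \<open>c ! i = Inv B\<close> unfolding cond2_def by auto
          qed
          then show ?thesis using O2.left_end[OF st2 A noA2] nr2 to by auto
        qed
      qed
    qed
  qed
qed

lemma single_basis_W:
  assumes i: "i < n" and k: "k \<le> l"
    and a: "\<And>a. letter_arrow (c ! i) = a \<Longrightarrow> word_end Q (fst w, take k (snd w)) = head Q a"
  shows "single i (basis_vec k) \<in> W"
proof (cases "c ! i")
  case (Dir a)
  then have "state (succ i) k" using a i k v_succ[OF i] by (simp add: state_def)
  then have "LW (succ i) k" by (rule all_LW)
  moreover have "single i (\<lambda>j. - wt i * basis_vec k j) = (\<lambda>i' j. - wt i * single i (basis_vec k) i' j)"
    by (auto simp: single_def fun_eq_iff)
  ultimately show ?thesis using Dir i W_scale[of "- wt i"] by (simp add: LW_def Lv_def)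
next
  case (Inv a)
  then have st: "state i k" using a i k by (simp add: state_def v_def)
  then have "RW i k" using all_LW RW_LW by blast
  moreover have "single i (\<lambda>j. - basis_vec k j) = (\<lambda>i' j. - 1 * single i (basis_vec k) i' j)"
    by (auto simp: single_def fun_eq_iff)
  ultimately show ?thesis using Inv i W_scale[of "- 1"] by (simp add: RW_def Rv_def)
qed

lemma W_cong: "\<eta> \<in> W \<Longrightarrow> (\<And>i. i < n \<Longrightarrow> \<eta>' i = \<eta> i) \<Longrightarrow> \<eta>' \<in> W"
proof -
  assume \<eta>: "\<eta> \<in> W" and e: "\<And>i. i < n \<Longrightarrow> \<eta>' i = \<eta> i"
  have "boundary (\<lambda>i j. \<eta>' i j - \<eta> i j)"
    using boundary_zero e unfolding boundary_def by auto
  then have "(\<lambda>i j. \<eta>' i j - \<eta> i j) \<in> W" by (rule W_boundary) (simp add: e Y_carrier)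
  from W_comb[OF this \<eta>, of 1 1] show ?thesis by simp
qed

text \<open>
  The error of a letter lies at the end of the arrow of that letter, because the idempotent of
  that vertex fixes all other terms of the defining equation. So it is a combination of basis
  vectors at that vertex, each of which is, up to a scalar, a half of a state.
\<close>
lemma realised_W:
  assumes "realised \<eta>"
  shows "\<eta> \<in> W"
proof -
  have sum: "(\<lambda>i j. \<Sum>x\<in>X. f x i j) \<in> W" if "finite X" "\<And>x. x \<in> X \<Longrightarrow> f x \<in> W" for f :: "'z \<Rightarrow> nat \<Rightarrow> nat \<Rightarrow> 'k" and X
    using that
  proof (induction X rule: finite_induct)
    case (insert x X)
    then show ?case using W_comb[of "f x" "\<lambda>i j. \<Sum>x\<in>X. f x i j" 1 1] by simp
  qed (simp add: W_zero)
  have summand: "(\<lambda>i' j. \<eta> i k * single i (basis_vec k) i' j) \<in> W" if i: "i < n" and k: "k \<le> l" for i k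
  proof (cases "\<eta> i k = 0")
    case False
    obtain \<xi> e where "lift Y \<xi> e \<eta>" "\<xi> \<in> cls \<eta>" using realised_lift[OF assms] by blast
    then obtain E f g where l: "lift Y (E, f, g) e \<eta>" by (metis prod_cases3)
    then have ext: "is_extension R B Y (E, f, g)" by (simp add: lift.simps)
    then have mods: "left_module R E" "left_module R Y" and f: "f \<in> module_hom R Y E" "inj_on f (carrier Y)"
      by (auto simp: is_extension.simps)
    interpret E: left_module R E by fact
    define a where "a = letter_arrow (c ! i)"
    have aq: "a \<in> arcs Q" using c_arcs[OF i] by (simp add: a_def)
    have hc: "vtx (head Q a) \<in> carrier R" using vtx_closed head_verts aq by blast
    note li = liftD[OF l i] and ls = liftD(2)[OF l succ_less]
    have fc: "f (\<eta> i) \<in> carrier E" using module_hom_carrier[OF f(1) li(1)] .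
    have va: "vtx (head Q a) \<odot>\<^bsub>E\<^esub> (arr a \<odot>\<^bsub>E\<^esub> p) = arr a \<odot>\<^bsub>E\<^esub> p" if "p \<in> carrier E" for p
      using E.smult_assoc[OF hc arr_closed[OF aq] that] vtx_arr[OF aq head_verts[OF aq]] by simp
    have "f (vtx (head Q a) \<odot>\<^bsub>Y\<^esub> \<eta> i) = f (\<eta> i)"
    proof (cases "c ! i")
      case D: (Dir b)
      then have ab: "b = a" by (simp add: a_def)
      have hv: "head Q a = v (succ i)" using v_succ[OF i] D ab by simp
      have sc: "sc (wt i) \<odot>\<^bsub>E\<^esub> e (succ i) \<in> carrier E" using E.smult_closed[OF sc_closed ls] .
      have "vtx (head Q a) \<odot>\<^bsub>E\<^esub> (sc (wt i) \<odot>\<^bsub>E\<^esub> e (succ i)) = sc (wt i) \<odot>\<^bsub>E\<^esub> (vtx (head Q a) \<odot>\<^bsub>E\<^esub> e (succ i))"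
        using hc ls by (simp add: sc_central flip: E.smult_assoc)
      also have "\<dots> = sc (wt i) \<odot>\<^bsub>E\<^esub> e (succ i)" using liftD(4)[OF l succ_less, of i] hv by simp
      finally have "sc (wt i) \<odot>\<^bsub>E\<^esub> e (succ i) \<oplus>\<^bsub>E\<^esub> vtx (head Q a) \<odot>\<^bsub>E\<^esub> f (\<eta> i) = sc (wt i) \<odot>\<^bsub>E\<^esub> e (succ i) \<oplus>\<^bsub>E\<^esub> f (\<eta> i)"
        using va[OF li(2)] li(5)[OF D] E.smult_r_distr[OF hc sc fc] by (simp add: ab)
      then have "vtx (head Q a) \<odot>\<^bsub>E\<^esub> f (\<eta> i) = f (\<eta> i)"
        using E.M.add_left_cancelD[OF _ sc E.smult_closed[OF hc fc] fc] by blast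
      then show ?thesis using module_hom_smult[OF f(1) hc li(1)] by simp
    next
      case D: (Inv b)
      then have ab: "b = a" by (simp add: a_def)
      have hv: "head Q a = v i" using D ab by (simp add: v_def)
      have "e i \<oplus>\<^bsub>E\<^esub> vtx (head Q a) \<odot>\<^bsub>E\<^esub> f (\<eta> i) = e i \<oplus>\<^bsub>E\<^esub> f (\<eta> i)"
        using va[OF ls[of i]] li(6)[OF D] E.smult_r_distr[OF hc li(2) fc] li(4) hv ab by metis
      then have "vtx (head Q a) \<odot>\<^bsub>E\<^esub> f (\<eta> i) = f (\<eta> i)"
        using E.M.add_left_cancelD[OF _ li(2) E.smult_closed[OF hc fc] fc] by blast
      then show ?thesis using module_hom_smult[OF f(1) hc li(1)] by simp
    qed
    then have "vtx (head Q a) \<odot>\<^bsub>Y\<^esub> \<eta> i = \<eta> i"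
      using f(2) li(1) Y.smult_closed[OF hc li(1)] by (auto simp: inj_on_def)
    from fun_cong[OF this, of k] have "word_end Q (fst w, take k (snd w)) = head Q a"
      using False Y_vtx[OF head_verts[OF aq]] by (auto split: if_splits)
    then have "single i (basis_vec k) \<in> W" using single_basis_W[OF i k] by (simp add: a_def)
    then show ?thesis using W_scale[OF False] by simp
  qed (simp add: W_zero)
  have "(\<lambda>i' j. \<Sum>i<n. \<Sum>k\<le>l. \<eta> i k * single i (basis_vec k) i' j) \<in> W"
    by (intro sum) (use summand in auto)
  then show ?thesis
  proof (rule W_cong)
    fix i' assume i': "i' < n"
    show "\<eta> i' = (\<lambda>j. \<Sum>i<n. \<Sum>k\<le>l. \<eta> i k * single i (basis_vec k) i' j)"
    proof (rule ext)
      fix j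
      have "(\<Sum>i<n. \<Sum>k\<le>l. \<eta> i k * single i (basis_vec k) i' j) = (\<Sum>i<n. if i = i' then \<eta> i' j else 0)"
      proof (intro sum.cong refl)
        fix i assume "i \<in> {..<n}"
        have "(\<Sum>k\<le>l. \<eta> i' k * basis_vec k j) = (\<Sum>k\<le>l. if k = j then \<eta> i' j else 0)"
          by (intro sum.cong) auto
        also have "\<dots> = \<eta> i' j" using realised_carrier[OF assms i'] by (auto simp: Y_carrier)
        finally show "(\<Sum>k\<le>l. \<eta> i k * single i (basis_vec k) i' j) = (if i = i' then \<eta> i' j else 0)"
          by (auto simp: single_def)
      qed
      then show "\<eta> i' j = (\<Sum>i<n. \<Sum>k\<le>l. \<eta> i k * single i (basis_vec k) i' j)" using i' by simp
    qed
  qed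
qed

end

section \<open>Linear independence\<close>

context band_overlap
begin

sublocale orient: string_orient Q I c t lam w x ls
  using ow by unfold_locales (simp add: ov_word_eq)

lemma place_eq: "place = orient.place"
  by (simp add: fun_eq_iff place_def orient.place_def ov_word_eq)

text \<open>
  The letter of \<open>w\<close> before \<open>m\<close> is inverse, and the one after its first vertex is a letter of the
  band following \<open>A\<close> or the direct letter \<open>D\<close>.
\<close>
lemma no_A_step: "\<not> step ls (Dir (ov_A d)) k r"
proof
  assume "step ls (Dir (ov_A d)) k r"
  then consider "r = Suc k" "ls ! k = Dir (ov_A d)" | "r < l" "ls ! r = Inv (ov_A d)"
    by (auto simp: step_def length_ls)
  then show False
  proof cases
    case 1
    then show ?thesis using ls_right by auto
  next
    case 2
    show ?thesis
    proof (cases "M = 0")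
      case True
      then show ?thesis using ls_left 2 by auto
    next
      case False
      then have "c ! ix 0 = Inv (ov_A d)" using ls_m[of 0] 2 by simp
      then show ?thesis using compat_c[of "pred (ix 0)"] c_A by (simp add: compat_def)
    qed
  qed
qed

lemma pairing_overlap_coords_self: "pairing overlap_coords \<noteq> 0"
proof -
  have rl: "r \<le> l" using l_eq by simp
  have "place (r + s) = place r \<longleftrightarrow> s = 0" if "s \<le> M" for s
    using place_place[of r] place_place[of "r + s"] that l_eq by auto
  then have "graph_map (basis_vec (place r)) (ix 0) = (\<Sum>s\<le>M. if s = 0 then 1 else 0)"
    unfolding graph_map_basis[OF place_le[OF rl]] by (intro sum.cong refl) auto
  then have "pairing overlap_coords = - 1"
    unfolding overlap_coords_def using pairing_single[OF pred_less c_A place_le[OF rl]] by simp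
  then show ?thesis by simp
qed

lemma realised_overlap_coords: "realised overlap_coords" and overlap_coords_cls: "ov_ext Q c t lam w d \<in> cls overlap_coords"
  using overlap_lift unfolding realised_def cls_def ov_ext_eq by blast+

text \<open>For a split extension the errors would be a boundary, on which the pairing vanishes.\<close>
theorem overlap_nonsplit: "nonsplit_extension R B Y (ov_ext Q c t lam w d)"
  unfolding nonsplit_extension_def ov_ext_eq
proof (intro conjI overlap_is_extension notI)
  assume "split_extension R B (U, \<lambda>z. incl (reorient z), \<pi>)"
  then have "(U, \<lambda>z. incl (reorient z), \<pi>) \<in> cls (\<lambda>_ _. 0)"
    unfolding split_iff_lift_zero[OF overlap_is_extension] cls_def Y_zero by blast
  then have "boundary (\<lambda>i j. 0 - overlap_coords i j)"
    using mem_cls_iff[OF overlap_lift, of "\<lambda>_ _. 0"] by (simp add: Y_carrier)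
  then have "boundary (\<lambda>i j. - 1 * overlap_coords i j + 0 * overlap_coords i j)" by simp
  then show False using pairing_boundary pairing_comb[of "-1" overlap_coords 0 overlap_coords] pairing_overlap_coords_self by fastforce
qed

lemma parts_of_word:
  "ov_right d = take r ls" "snd (ov_m d) = take M (drop r ls)" "ov_left d = drop (r + M) ls"
  by (simp_all add: ls_split ov_len_def)

end

lemma ov_right_inject:
  assumes "ov_right d = ov_right d'" "ov_C d = None \<longrightarrow> ov_wR d = []" "ov_C d' = None \<longrightarrow> ov_wR d' = []"
  shows "ov_C d = ov_C d' \<and> ov_wR d = ov_wR d'"
  using assms by (cases "ov_C d"; cases "ov_C d'") (auto simp: ov_right_def)

lemma ov_left_inject:
  assumes "ov_left d = ov_left d'" "ov_D d = None \<longrightarrow> ov_wL d = []" "ov_D d' = None \<longrightarrow> ov_wL d' = []"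
  shows "ov_D d = ov_D d' \<and> ov_wL d = ov_wL d'"
  using assms by (cases "ov_D d"; cases "ov_D d'") (auto simp: ov_left_def)

context band_string
begin

lemma band_overlapI: "is_overlap Q I c d \<Longrightarrow> ov_word d \<in> {w, word_inv Q w} \<Longrightarrow> band_overlap Q I c t lam w d"
  by unfold_locales auto

text \<open>
  Of two overlaps with the same start, the shorter one would be followed in \<open>w\<close> by its direct
  letter \<open>D\<close>. As a part of the longer one it is followed there by the same letter as in the
  periodic word, which is its inverse letter \<open>B\<close>.
\<close>
lemma overlap_longest:
  assumes d: "band_overlap Q I c t lam w d" and d': "band_overlap Q I c t lam w d'"
    and word: "ov_word d = ov_word d'" and r: "length (ov_right d) = length (ov_right d')"
    and ix: "band_overlap.ix c d 0 = band_overlap.ix c d' 0"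
  shows "ov_len d \<le> ov_len d'"
proof (rule ccontr)
  assume "\<not> ov_len d \<le> ov_len d'"
  then have lt: "ov_len d' < ov_len d" by simp
  interpret D: band_overlap Q I c t lam w d by fact
  interpret D': band_overlap Q I c t lam w d' by fact
  have ls: "D.ls = D'.ls" using word by (simp add: D.ls_def D'.ls_def)
  have "D.ix s = D'.ix s" for s by (induction s) (simp_all add: ix D.ix_Suc D'.ix_Suc)
  then have "D.ls ! (length (ov_right d) + ov_len d') = Inv (ov_B d')" using D.ls_m[OF lt] D'.c_B by simp
  then show False using D'.ls_left lt D.l_eq r ls by auto
qed

lemma overlap_determined:
  assumes d: "band_overlap Q I c t lam w d" and d': "band_overlap Q I c t lam w d'"
    and word: "ov_word d = ov_word d'" and r: "length (ov_right d) = length (ov_right d')"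
    and pos: "ov_pos d = ov_pos d'"
  shows "d = d'"
proof -
  interpret D: band_overlap Q I c t lam w d by fact
  interpret D': band_overlap Q I c t lam w d' by fact
  have ix: "D.ix = D'.ix" by (simp add: fun_eq_iff D.ix_def D'.ix_def pos)
  have ls: "D.ls = D'.ls" using word by (simp add: D.ls_def D'.ls_def)
  have M: "ov_len d = ov_len d'"
    using overlap_longest[OF d d' word r] overlap_longest[OF d' d] word r ix by (simp add: antisym)
  have parts: "ov_right d = ov_right d'" "snd (ov_m d) = snd (ov_m d')" "ov_left d = ov_left d'"
    using D.parts_of_word D'.parts_of_word ls r M by simp_all
  have A: "ov_A d = ov_A d'" and B: "ov_B d = ov_B d'" using D.c_A D'.c_A D.c_B D'.c_B ix M by simp_all
  have "fst (ov_m d) = fst (ov_m d')" using D.ov D'.ov A by (simp add: is_overlap_def)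
  then have "ov_m d = ov_m d'" using parts by (simp add: prod_eq_iff)
  moreover have "ov_C d = ov_C d' \<and> ov_wR d = ov_wR d'"
    by (rule ov_right_inject[OF parts(1)]) (use D.ov D'.ov in \<open>simp_all add: is_overlap_def\<close>)
  moreover have "ov_D d = ov_D d' \<and> ov_wL d = ov_wL d'"
    by (rule ov_left_inject[OF parts(3)]) (use D.ov D'.ov in \<open>simp_all add: is_overlap_def\<close>)
  ultimately show ?thesis using word pos A B by (intro overlap.equality) auto
qed

text \<open>
  Overlaps with the two readings of \<open>w\<close> cannot start at the same place of \<open>w\<close> and of the band.
  Their common subwords would extend from this place in opposite directions along \<open>w\<close> but follow
  the same letters of the band; so they are both trivial, the arrow \<open>C\<close> of one is the arrow \<open>D\<close> of
  the other, and it would form zero relations with both \<open>A\<close> and \<open>B\<close>.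
\<close>
lemma overlap_reversed:
  assumes d: "band_overlap Q I c t lam w d" and d': "band_overlap Q I c t lam w d'"
    and rev: "snd (ov_word d') = rev (map letter_inv (snd (ov_word d)))"
    and r: "length (ov_right d) < l" "length (ov_right d') = l - length (ov_right d)"
    and ix: "band_overlap.ix c d 0 = band_overlap.ix c d' 0"
  shows False
proof -
  interpret D: band_overlap Q I c t lam w d by fact
  interpret D': band_overlap Q I c t lam w d' by fact
  let ?r = "length (ov_right d)" and ?r' = "length (ov_right d')"
  have inv: "D'.ls ! k = letter_inv (D.ls ! (l - Suc k))" if "k < l" for k
    using that D.length_ls by (simp add: D.ls_def D'.ls_def rev rev_nth)
  have r': "0 < ?r'" "l - Suc (?r' - 1) = ?r" "?r' - 1 < l" using r by auto
  obtain C where C: "D'.ls ! (?r' - 1) = Inv C" "ov_C d' = Some C" using D'.ls_right[OF r'(1)] by blast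
  have "letter_inv (D.ls ! ?r) = Inv C" using inv[OF r'(3)] r'(2) C by simp
  then have rC: "D.ls ! ?r = Dir C" by (simp only: letter_inv_eq_iff)
  have A: "ov_A d = ov_A d'" using D.c_A D'.c_A ix by simp
  have M'_end: "D'.ls ! ?r' = c ! D.ix 0" "?r' < l" if "0 < ov_len d'"
    using D'.ls_m[OF that] ix D'.l_eq that by simp_all
  show False
  proof (cases "ov_len d = 0")
    case False
    then have L: "c ! D.ix 0 = Dir C" using D.ls_m[of 0] rC by simp
    show False
    proof (cases "ov_len d' = 0")
      case True
      then show ?thesis using D'.c_B L ix by simp
    next
      case F: False
      then have "compat (D'.ls ! (?r' - 1)) (D'.ls ! Suc (?r' - 1))"
        using D'.ls_ok(1) M'_end(2) F r'(1) D'.length_ls unfolding word_ok_def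
        by (metis Suc_diff_1 neq0_conv)
      moreover have "Suc (?r' - 1) = ?r'" using r' by simp
      ultimately have "compat (Inv C) (Dir C)" using C(1) F M'_end(1) L by simp
      then show ?thesis by (simp add: compat_def)
    qed
  next
    case M: True
    then have D: "ov_D d = Some C" using D.ls_left r rC by auto
    have B: "c ! D.ix 0 = Inv (ov_B d)" using D.c_B M by simp
    show False
    proof (cases "ov_len d' = 0")
      case True
      have "zero_comp Q I C (ov_A d)" using D'.ov C True A by (simp add: is_overlap_def ov_len_def)
      moreover have "zero_comp Q I C (ov_B d)" using D.ov D M by (simp add: is_overlap_def ov_len_def)
      ultimately show ?thesis using gentle_zero_right D.A_neq_B[OF M] by blast
    next
      case False
      then have lr: "D'.ls ! ?r' = Inv (ov_B d)" "?r' < l" using M'_end B by auto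
      have e: "l - Suc ?r' = ?r - 1" "0 < ?r" using lr(2) r by auto
      have "letter_inv (D.ls ! (?r - 1)) = Inv (ov_B d)" using inv[OF lr(2)] lr(1) e by simp
      then show ?thesis using D.ls_right[OF e(2)] by auto
    qed
  qed
qed

text \<open>
  The pairing is nonzero only if the start of \<open>d'\<close>, as a place of \<open>w\<close> together with a place of the
  band, is also a place inside the overlap \<open>d\<close>. It cannot be a later place than the start of \<open>d\<close>,
  for then the letter \<open>A\<close> of \<open>d'\<close> would lead to it in \<open>w\<close>. So \<open>d\<close> and \<open>d'\<close> start at the same
  place, and then they agree.
\<close>
lemma pairing_overlap_coords_other:
  assumes d: "d \<in> overlaps Q I c w" and d': "d' \<in> overlaps Q I c w" and neq: "d \<noteq> d'"
  shows "band_overlap.pairing c t lam w d (band_overlap.overlap_coords c t lam w d') = 0"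
proof -
  have o: "band_overlap Q I c t lam w d" "band_overlap Q I c t lam w d'"
    using d d' band_overlapI unfolding overlaps_def by blast+
  interpret D: band_overlap Q I c t lam w d by (rule o(1))
  interpret D': band_overlap Q I c t lam w d' by (rule o(2))
  let ?r = "length (ov_right d)" and ?r' = "length (ov_right d')"
  have rl: "?r' \<le> l" using D'.l_eq by simp
  have "\<not> (D'.ix 0 = D.ix s \<and> D.place (?r + s) = D'.place ?r')" if s: "s \<le> ov_len d" for s
  proof
    assume h: "D'.ix 0 = D.ix s \<and> D.place (?r + s) = D'.place ?r'"
    have sl: "?r + s \<le> l" using s D.l_eq by simp
    show False
    proof (cases s)
      case (Suc s0)
      have "D.ls ! (?r + s0) = c ! pred (D'.ix 0)" using D.ls_m[of s0] s Suc h by (simp add: D.ix_Suc)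
      then have "step D.ls (Dir (ov_A d')) (?r + s0) (?r + s)"
        using D'.c_A Suc sl D.length_ls by (simp add: step_def)
      then have "step (snd w) (Dir (ov_A d')) (D.place (?r + s0)) (D.place (?r + s))"
        using D.orient.step_place[of "?r + s0" "?r + s"] Suc sl by (simp add: D.place_eq)
      moreover have "D.place (?r + s0) \<le> l" using D.place_le Suc sl by simp
      ultimately have "step D'.ls (Dir (ov_A d')) (D'.place (D.place (?r + s0))) ?r'"
        using D'.orient.step_place[of "D'.place (D.place (?r + s0))" ?r'] D'.place_place D'.place_le rl h by (simp add: D'.place_eq)
      then show False using D'.no_A_step by blast
    next
      case 0
      have kr: "D.place ?r = D'.place ?r'" and ix: "D.ix 0 = D'.ix 0" using h 0 by auto
      have pos: "ov_pos d = ov_pos d'" using ix d d' by (simp add: overlaps_def D.ix_def D'.ix_def nat_eq_iff2)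
      have words: "ov_word d \<in> {w, word_inv Q w}" "ov_word d' \<in> {w, word_inv Q w}" using D.ow D'.ow .
      show False
      proof (cases "ov_word d = ov_word d'")
        case True
        then have "D.place = D'.place" by (simp add: fun_eq_iff D.place_def D'.place_def)
        then have "?r = ?r'" using kr D.place_place[of ?r] D.place_place[of ?r'] rl sl 0 by simp
        then show ?thesis using overlap_determined[OF o True _ pos] neq by simp
      next
        case False
        have ww: "snd (word_inv Q w) = rev (map letter_inv (snd w))" by (simp add: word_inv_w)
        have "rev (map letter_inv (rev (map letter_inv (snd w)))) = snd w" by (simp add: rev_map o_def)
        then have rev: "snd (ov_word d') = rev (map letter_inv (snd (ov_word d)))"
          "snd (ov_word d) = rev (map letter_inv (snd (ov_word d')))"
          using words False ww by auto
        have l: "0 < l" using words False word_inv_eq_w by auto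
        have rr: "?r + ?r' = l"
          using kr words False rl sl 0 by (auto simp: D.place_def D'.place_def split: if_splits)
        show ?thesis
        proof (cases "?r < l")
          case True
          moreover have "?r' = l - ?r" using rr by linarith
          ultimately show ?thesis using overlap_reversed[OF o rev(1)] ix by blast
        next
          case False
          then have "?r' < l" "?r = l - ?r'" using rr l by linarith+
          then show ?thesis using overlap_reversed[OF o(2,1) rev(2)] ix by metis
        qed
      qed
    qed
  qed
  then have "D.graph_map (basis_vec (D'.place ?r')) (D'.ix 0) = 0"
    unfolding D.graph_map_basis[OF D'.place_le[OF rl]] by (intro sum.neutral) auto
  then show ?thesis
    unfolding D'.overlap_coords_def using D.pairing_single[OF pred_less D'.c_A D'.place_le[OF rl]] by simp
qed

theorem overlap_classes_basis:
  defines "C \<equiv> \<lambda>d. ext_equiv R B Y `` {ov_ext Q c t lam w d}"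
  shows "inj_on C (overlaps Q I c w)" "vectorspace.basis class_ring Ext (C ` overlaps Q I c w)"
proof -
  define h where "h d = band_overlap.overlap_coords c t lam w d" for d :: "('v, 'a) overlap"
  define \<psi> where "\<psi> d = band_overlap.pairing c t lam w d" for d :: "('v, 'a) overlap"
  have o: "band_overlap Q I c t lam w d" if "d \<in> overlaps Q I c w" for d
    using that band_overlapI unfolding overlaps_def by blast
  have C: "C d = cls (h d)" if d: "d \<in> overlaps Q I c w" for d
    using equiv_class_cls[OF band_overlap.overlap_coords_cls[OF o[OF d]]] by (simp add: C_def h_def)
  have span: "\<eta> \<in> W" if \<eta>: "realised \<eta>" and W: "\<And>d. d \<in> overlaps Q I c w \<Longrightarrow> h d \<in> W"
      "\<And>\<eta>. boundary \<eta> \<Longrightarrow> (\<And>i. i < n \<Longrightarrow> \<eta> i \<in> carrier Y) \<Longrightarrow> \<eta> \<in> W"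
      "\<And>\<eta> \<eta>' \<kappa> \<mu>. \<eta> \<in> W \<Longrightarrow> \<eta>' \<in> W \<Longrightarrow> (\<lambda>i j. \<kappa> * \<eta> i j + \<mu> * \<eta>' i j) \<in> W" for \<eta> W
  proof -
    interpret S: span_set Q I c t lam w W by unfold_locales (use W in \<open>auto simp: h_def\<close>)
    show ?thesis by (rule S.realised_W[OF \<eta>])
  qed
  have real: "realised (h d)" if "d \<in> overlaps Q I c w" for d
    unfolding h_def by (rule band_overlap.realised_overlap_coords[OF o[OF that]])
  have lin: "\<psi> d (\<lambda>i j. \<kappa> * \<eta> i j + \<mu> * \<eta>' i j) = \<kappa> * \<psi> d \<eta> + \<mu> * \<psi> d \<eta>'"
    if "d \<in> overlaps Q I c w" for d \<eta> \<eta>' \<kappa> \<mu>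
    unfolding \<psi>_def by (rule band_overlap.pairing_comb[OF o[OF that]])
  have bd: "\<psi> d \<eta> = 0" if "d \<in> overlaps Q I c w" "boundary \<eta>" for d \<eta>
    unfolding \<psi>_def by (rule band_overlap.pairing_boundary[OF o[OF that(1)] that(2)])
  have nz: "\<psi> d (h d) \<noteq> 0" if "d \<in> overlaps Q I c w" for d
    unfolding \<psi>_def h_def by (rule band_overlap.pairing_overlap_coords_self[OF o[OF that]])
  have ort: "\<psi> d (h d') = 0" if "d \<in> overlaps Q I c w" "d' \<in> overlaps Q I c w" "d \<noteq> d'" for d d'
    unfolding \<psi>_def h_def by (rule pairing_overlap_coords_other[OF that])
  have "inj_on (\<lambda>d. cls (h d)) (overlaps Q I c w)"
    by (rule Ext_basis_criterion(1)[of _ h \<psi>]; fact real lin bd nz ort span)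
  moreover have "vectorspace.basis class_ring Ext ((\<lambda>d. cls (h d)) ` overlaps Q I c w)"
    by (rule Ext_basis_criterion(2)[of _ h \<psi>]; fact real lin bd nz ort span)
  moreover have "C ` overlaps Q I c w = (\<lambda>d. cls (h d)) ` overlaps Q I c w" using C by (intro image_cong) auto
  moreover have "inj_on C (overlaps Q I c w) \<longleftrightarrow> inj_on (\<lambda>d. cls (h d)) (overlaps Q I c w)"
    using C by (intro inj_on_cong) auto
  ultimately show "inj_on C (overlaps Q I c w)" "vectorspace.basis class_ring Ext (C ` overlaps Q I c w)"
    by simp_all
qed

end

section \<open>The shape of the middle term\<close>

lemma biinf_segment_add:
  "biinf_segment c i (j + k) = biinf_segment c i j @ biinf_segment c (i + int j) k"
  by (intro nth_equalityI) (auto simp: biinf_segment_def nth_append algebra_simps)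

lemma biinf_segment_Suc: "biinf_segment c i (Suc k) = biinf c i # biinf_segment c (i + 1) k"
  using biinf_segment_add[of c i 1 k] by (simp add: biinf_segment_def)

lemma biinf_segment_cong:
  "i mod int (length c) = i' mod int (length c) \<Longrightarrow> biinf_segment c i k = biinf_segment c i' k"
  unfolding biinf_segment_def biinf_def by (intro map_cong refl arg_cong[where f = "\<lambda>p. c ! nat p"] mod_add_cong) auto

lemma rotate_biinf:
  assumes "c \<noteq> []"
  shows "rotate (nat (i mod int (length c))) c = biinf_segment c i (length c)"
proof (rule nth_equalityI)
  fix j assume j: "j < length (rotate (nat (i mod int (length c))) c)"
  have "int ((nat (i mod int (length c)) + j) mod length c) = (i mod int (length c) + int j) mod int (length c)"
    using assms by (simp add: zmod_int)
  also have "\<dots> = (i + int j) mod int (length c)" by (simp add: mod_add_left_eq)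
  finally have "(nat (i mod int (length c)) + j) mod length c = nat ((i + int j) mod int (length c))" by linarith
  then show "rotate (nat (i mod int (length c))) c ! j = biinf_segment c i (length c) ! j"
    using j by (simp add: nth_rotate biinf_segment_def biinf_def)
qed (simp add: biinf_segment_def)

lemma biinf_segment_power:
  "biinf_segment c i (k * length c) = list_power (biinf_segment c i (length c)) k"
proof (induction k arbitrary: i)
  case 0
  then show ?case by (simp add: biinf_segment_def list_power_def)
next
  case (Suc k)
  have "biinf_segment c (i + int (length c)) (length c) = biinf_segment c i (length c)"
    by (rule biinf_segment_cong) simp
  then show ?case using Suc[of "i + int (length c)"] by (simp add: biinf_segment_add list_power_def)
qed

context band_overlap
begin

lemma m_segment: "snd (ov_m d) = biinf_segment c (ov_pos d) M"
  using ov by (simp add: is_overlap_def)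

lemma letter_A: "biinf c (ov_pos d - 1) = Dir (ov_A d)" and letter_B: "biinf c (ov_pos d + int M) = Inv (ov_B d)"
  using ov by (auto simp: is_overlap_def)

text \<open>
  The length \<open>|m| = |c| - 1\<close> is impossible: the letters \<open>A\<close> and \<open>B\<^sup>-\<^sup>1\<close> next to \<open>m\<close> would be the
  same letter of \<open>c\<close>. So \<open>m\<close> and both of them fit into one period, and the rotation of \<open>c\<close> that
  starts with \<open>A\<close> has the required form with trivial \<open>c\<^sub>R\<close>.
\<close>
lemma middle_short:
  assumes "strict_sublist (snd (ov_m d)) (rotate k c)"
  shows "\<exists>r cL cR.
     rotate r c = cR @ [Dir (ov_A d)] @ snd (ov_m d) @ [Inv (ov_B d)] @ cL \<and>
     ov_middle c d = (x,
       ov_right d @ snd (ov_m d) @ [Inv (ov_B d)] @ cL @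
       cR @ [Dir (ov_A d)] @ snd (ov_m d) @ ov_left d)"
proof -
  obtain ps ss where ps: "rotate k c = ps @ snd (ov_m d) @ ss" "rotate k c \<noteq> snd (ov_m d)"
    using assms by (auto simp: strict_sublist_def sublist_def)
  have "length (rotate k c) = length ps + M + length ss" unfolding ps(1) by (simp add: ov_len_def)
  then have "n = length ps + M + length ss" by simp
  moreover have "ps \<noteq> [] \<or> ss \<noteq> []" using ps by auto
  ultimately have "M < n" by (auto simp flip: length_greater_0_conv)
  moreover have "M \<noteq> n - 1" using c_A c_B ix_n_pred by auto
  ultimately have len: "n = Suc (M + Suc (n - M - 2))" by linarith
  define cL where "cL = biinf_segment c (ov_pos d + int M + 1) (n - M - 2)"
  have "rotate (nat ((ov_pos d - 1) mod int n)) c = biinf_segment c (ov_pos d - 1) n"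
    by (rule rotate_biinf) (use n_pos in auto)
  also have "\<dots> = biinf_segment c (ov_pos d - 1) (Suc (M + Suc (n - M - 2)))"
    by (rule arg_cong[OF len])
  also have "\<dots> = [] @ [Dir (ov_A d)] @ snd (ov_m d) @ [Inv (ov_B d)] @ cL"
    by (simp add: biinf_segment_Suc biinf_segment_add letter_A letter_B cL_def m_segment del: add_Suc_right)
  finally have rot: "rotate (nat ((ov_pos d - 1) mod int n)) c = \<dots>" .
  have M: "biinf_segment c (ov_pos d + int n) M = snd (ov_m d)"
    unfolding m_segment by (rule biinf_segment_cong) simp
  have A: "biinf c (ov_pos d + int n - 1) = Dir (ov_A d)"
  proof -
    have "(ov_pos d + int n - 1) mod int n = (ov_pos d - 1) mod int n"
      using mod_add_self2[of "ov_pos d - 1" "int n"] by (simp add: algebra_simps)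
    then show ?thesis using letter_A by (simp add: biinf_def)
  qed
  have p: "ov_pos d + int M + 1 + int (n - M - 2) = ov_pos d + int n - 1" using len by linarith
  have "M + n = M + Suc ((n - M - 2) + Suc M)" using len by linarith
  then have "biinf_segment c (ov_pos d) (M + n) = biinf_segment c (ov_pos d) (M + Suc ((n - M - 2) + Suc M))"
    by (rule arg_cong)
  also have "\<dots> = biinf_segment c (ov_pos d) M @ biinf c (ov_pos d + int M) #
      biinf_segment c (ov_pos d + int M + 1) (n - M - 2) @
      biinf c (ov_pos d + int n - 1) # biinf_segment c (ov_pos d + int n - 1 + 1) M"
    unfolding biinf_segment_add biinf_segment_Suc p ..
  also have "\<dots> = snd (ov_m d) @ [Inv (ov_B d)] @ cL @ [] @ [Dir (ov_A d)] @ snd (ov_m d)"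
    using M by (simp add: A letter_B cL_def m_segment)
  finally have "biinf_segment c (ov_pos d) (M + n) =
      snd (ov_m d) @ [Inv (ov_B d)] @ cL @ [] @ [Dir (ov_A d)] @ snd (ov_m d)" .
  then have "ov_middle c d = (x, ov_right d @ snd (ov_m d) @ [Inv (ov_B d)] @ cL @
       [] @ [Dir (ov_A d)] @ snd (ov_m d) @ ov_left d)"
    by (simp add: ov_middle_def x_def)
  with rot show ?thesis by blast
qed

text \<open>
  Division of \<open>|m|\<close> by \<open>|c|\<close> with remainder; \<open>c\<^sub>2\<close> are the first \<open>|m| mod |c|\<close> letters of \<open>m\<close>, and
  \<open>c\<close> is rotated to start after them.
\<close>
lemma middle_long:
  assumes "sublist (rotate k c) (snd (ov_m d))"
  shows "\<exists>r c1 c2 l.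
     rotate r c = c1 @ c2 \<and> 1 \<le> l \<and> snd (ov_m d) = c2 @ list_power (c1 @ c2) l \<and>
     ov_middle c d = (x, ov_right d @ c2 @ list_power (c1 @ c2) (l + 1) @ ov_left d)"
proof -
  have "n \<le> M" using sublist_length_le[OF assms] by (simp add: ov_len_def)
  then have L: "1 \<le> M div n" using n_pos by (simp add: Suc_le_eq div_greater_zero_iff)
  define k where "k = M mod n"
  have M: "M = k + M div n * n" "M + n = k + (M div n + 1) * n" by (simp_all add: k_def)
  have kn: "n = (n - k) + k" using n_pos by (simp add: k_def less_imp_le)
  define c1 where "c1 = biinf_segment c (ov_pos d + int k) (n - k)"
  define c2 where "c2 = biinf_segment c (ov_pos d) k"
  have "biinf_segment c (ov_pos d + int n) k = c2" unfolding c2_def by (rule biinf_segment_cong) simp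
  moreover have "ov_pos d + int k + int (n - k) = ov_pos d + int n" using kn by linarith
  ultimately have P: "biinf_segment c (ov_pos d + int k) n = c1 @ c2"
    using biinf_segment_add[of c "ov_pos d + int k" "n - k" k] kn by (simp add: c1_def)
  have "rotate (nat ((ov_pos d + int k) mod int n)) c = c1 @ c2"
    unfolding P[symmetric] by (rule rotate_biinf) (use n_pos in auto)
  moreover have "snd (ov_m d) = c2 @ list_power (c1 @ c2) (M div n)"
    unfolding m_segment by (subst M(1)) (simp only: biinf_segment_add biinf_segment_power P c2_def)
  moreover have "biinf_segment c (ov_pos d) (M + n) = c2 @ list_power (c1 @ c2) (M div n + 1)"
    by (subst M(2)) (simp only: biinf_segment_add biinf_segment_power P c2_def)
  then have "ov_middle c d = (x, ov_right d @ c2 @ list_power (c1 @ c2) (M div n + 1) @ ov_left d)"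
    by (simp add: ov_middle_def x_def)
  ultimately show ?thesis using L by blast
qed

end

theorem theorem3:
  fixes Q :: "('v, 'a) pre_digraph"
    and I :: "(('v, 'a) path \<Rightarrow> 'k::alg_closed_field) set"
    and c :: "'a letter list" and t :: nat and lam :: 'k
    and w :: "('v, 'a) qword"
  assumes "gentle Q I"
    and "is_band Q I c"
    and "t < length c" and "\<exists>a. c ! t = Dir a"
    and "lam \<noteq> 0"
    and "is_string Q I w"
  shows
    "(\<forall>d. is_overlap Q I c d \<and> ov_word d = w \<and>
        (\<exists>r. strict_sublist (snd (ov_m d)) (rotate r c)) \<longrightarrow>
        (\<exists>r cL cR.
           rotate r c = cR @ [Dir (ov_A d)] @ snd (ov_m d) @ [Inv (ov_B d)] @ cL \<and>
           ov_middle c d = (fst w,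
             ov_right d @ snd (ov_m d) @ [Inv (ov_B d)] @ cL @
             cR @ [Dir (ov_A d)] @ snd (ov_m d) @ ov_left d)) \<and>
        is_string Q I (ov_middle c d) \<and>
        nonsplit_extension (bound_quiver_algebra Q I) (band_module Q c t lam) (string_module Q w)
          (ov_ext Q c t lam w d)) \<and>
     (\<forall>d. is_overlap Q I c d \<and> ov_word d = w \<and>
        (\<exists>r. sublist (rotate r c) (snd (ov_m d))) \<longrightarrow>
        (\<exists>r c1 c2 l.
           rotate r c = c1 @ c2 \<and> 1 \<le> l \<and>
           snd (ov_m d) = c2 @ list_power (c1 @ c2) l \<and>
           ov_middle c d = (fst w,
             ov_right d @ c2 @ list_power (c1 @ c2) (l + 1) @ ov_left d)) \<and>
        is_string Q I (ov_middle c d) \<and>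
        nonsplit_extension (bound_quiver_algebra Q I) (band_module Q c t lam) (string_module Q w)
          (ov_ext Q c t lam w d)) \<and>
     (let Ext = Ext1 (bound_quiver_algebra Q I) (scalar Q I)
            (band_module Q c t lam) (string_module Q w);
          cls = (\<lambda>d. ext_equiv (bound_quiver_algebra Q I)
            (band_module Q c t lam) (string_module Q w) `` {ov_ext Q c t lam w d})
      in vectorspace class_ring Ext \<and>
         inj_on cls (overlaps Q I c w) \<and>
         vectorspace.basis class_ring Ext (cls ` overlaps Q I c w))"
proof -
  interpret band_string Q I c t lam w
    using assms by unfold_locales
  have o: "band_overlap Q I c t lam w d" if "is_overlap Q I c d" "ov_word d = w" for d
    using that by (intro band_overlapI) auto
  have x: "band_overlap.x d = fst w" if "is_overlap Q I c d" "ov_word d = w" for d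
    using band_overlap.x_def[OF o[OF that]] that(2) by simp
  have string: "is_string Q I (ov_middle c d)"
    and nonsplit: "nonsplit_extension R (band_module Q c t lam) Y (ov_ext Q c t lam w d)"
    if d: "is_overlap Q I c d" "ov_word d = w" for d
    using band_overlap.middle_string[OF o[OF d]] band_overlap.overlap_nonsplit[OF o[OF d]] by (simp_all only: B_def)
  note short = band_overlap.middle_short[OF o] and long = band_overlap.middle_long[OF o]
  show ?thesis
    unfolding Let_def
  proof (intro conjI allI impI; (elim conjE exE)?)
    fix d r assume d: "is_overlap Q I c d" "ov_word d = w" and m: "strict_sublist (snd (ov_m d)) (rotate r c)"
    show "\<exists>r cL cR. rotate r c = cR @ [Dir (ov_A d)] @ snd (ov_m d) @ [Inv (ov_B d)] @ cL \<and>
        ov_middle c d = (fst w, ov_right d @ snd (ov_m d) @ [Inv (ov_B d)] @ cL @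
             cR @ [Dir (ov_A d)] @ snd (ov_m d) @ ov_left d)"
      using short[OF d m] unfolding x[OF d] .
  next
    fix d r assume d: "is_overlap Q I c d" "ov_word d = w" and m: "sublist (rotate r c) (snd (ov_m d))"
    show "\<exists>r c1 c2 l. rotate r c = c1 @ c2 \<and> 1 \<le> l \<and> snd (ov_m d) = c2 @ list_power (c1 @ c2) l \<and>
        ov_middle c d = (fst w, ov_right d @ c2 @ list_power (c1 @ c2) (l + 1) @ ov_left d)"
      using long[OF d m] unfolding x[OF d] .
  qed (use string nonsplit Ext_vectorspace overlap_classes_basis in \<open>simp_all only: B_def\<close>)
qed

end
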